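(* Consider the huge $l\times m\times n$ table problem with $t$ types, as defined in the context: given positive integers $l,m,t$, positive integers $n_1,\dots,n_t,n$ with $n_1+\cdots+n_t=n$ (all of $n_1,\dots,n_t,n$ encoded in binary), column-sum vectors $u^k\in\mathbb{Z}_+^m$ and row-sum vectors $v^k\in\mathbb{Z}_+^l$ for $k=1,\dots,t$, and vertical line sums $w\in\mathbb{Z}_+^{l\times m}$ (all encoded in binary), decide whether a feasible table exists, and find one (in compact representation) if yes. This problem, with $l$ a parameter and with $n$ variable and binary-encoded, is fixed-parameter tractable in each of the following two situations: 1. when $m$ is also a parameter and $t$ is variable and unary-encoded (so the parameters are $l,m$); 2. when $t$ is also a parameter and $m$ is variable and unary-encoded (so the parameters are $l,t$).
   Context: $\mathbb{Z}_+$ denotes the nonnegative integers. Huge table problem with $t$ types. A nonnegative integer $l\times m\times n$ table is regarded as a tuple $x=(x^1,\dots,x^n)$ of $n$ layers $x^h\in\mathbb{Z}_+^{l\times m}$. A layer $z\in\mathbb{Z}_+^{l\times m}$ is of type $k$ ($1\le k\le t$) if $\sum_{i=1}^l z_{i,j}=u^k_j$ for all $1\le j\le m$ and $\sum_{j=1}^m z_{i,j}=v^k_i$ for all $1\le i\le l$. The table $x$ is feasible if its first $n_1$ layers are of type $1$, its next $n_2$ layers are of type $2$, and so on, with the last $n_t$ layers of type $t$, and in addition $\sum_{h=1}^n x^h_{i,j}=w_{i,j}$ for all $1\le i\le l$, $1\le j\le m$. Compact representation. Since $n$ is encoded in binary, a feasible table is output in compact form: for each type $k$, a finite list of pairs $(\lambda,z)$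 where $z\in\mathbb{Z}_+^{l\times m}$ is a layer of type $k$ and $\lambda\in\mathbb{Z}_+$ is the binary-encoded number of the $n_k$ layers of type $k$ which are equal to $z$, the multiplicities $\lambda$ in the list for type $k$ summing to $n_k$. Fixed-parameter tractability. A parameterized problem with parameter $p$ (possibly a tuple of integers) and input $I$ is fixed-parameter tractable if it admits an algorithm running in time $O(f(p)\cdot\mathrm{size}(I)^{r})$ for some computable function $f(p)$ of $p$ that is independent of $I$ and some constant $r$ that is independent of $p$ and $I$, where $\mathrm{size}(I)$ is the encoding length of $I$. *)

theory Defs
  imports "HOL-Library.Log_Nat" "Jordan_Normal_Form.Matrix"
begin

section \<open>Random access machines with logarithmic cost\<close>

text \<open>
  The model of computation is the random access machine of Cook--Reckhow and
  Aho--Hopcroft--Ullman under the logarithmic cost criterion, with structured control flow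
  instead of jumps. The registers hold integers of arbitrary size; every operation is charged the
  bit lengths of all the numbers it touches, register addresses included. It is polynomially
  equivalent to the Turing machine.
\<close>

type_synonym memory = "int \<Rightarrow> int"

text \<open>The usual length function of the logarithmic cost criterion: the number of binary
  digits of the absolute value, where 0 has length 1.\<close>

definition bit_length :: "int \<Rightarrow> nat" where
  "bit_length z = max 1 (floorlog 2 (nat \<bar>z\<bar>))"

text \<open>\<open>Load e\<close> is the content of the register whose address is the value of \<open>e\<close>. Direct and
  indirect addressing are \<open>Load (Const a)\<close> and \<open>Load (Load (Const a))\<close>.\<close>

datatype expr =
    Const int
  | Load expr
  | Add expr expr
  | Sub expr expr
  | Mult expr expr
  | Div expr expr

fun val :: "expr \<Rightarrow> memory \<Rightarrow> int" where
  "val (Const c) s = c"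
| "val (Load e) s = s (val e s)"
| "val (Add a b) s = val a s + val b s"
| "val (Sub a b) s = val a s - val b s"
| "val (Mult a b) s = val a s * val b s"
| "val (Div a b) s = val a s div val b s"

fun cost :: "expr \<Rightarrow> memory \<Rightarrow> nat" where
  "cost (Const c) s = bit_length c"
| "cost (Load e) s = cost e s + bit_length (val e s) + bit_length (s (val e s))"
| "cost (Add a b) s = cost a s + cost b s + bit_length (val a s) + bit_length (val b s)"
| "cost (Sub a b) s = cost a s + cost b s + bit_length (val a s) + bit_length (val b s)"
| "cost (Mult a b) s = cost a s + cost b s + bit_length (val a s) + bit_length (val b s)"
| "cost (Div a b) s = cost a s + cost b s + bit_length (val a s) + bit_length (val b s)"

text \<open>\<open>Store a e\<close> writes the value of \<open>e\<close> into the register whose address is the value of \<open>a\<close>.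
  The tests of \<open>If\<close> and \<open>While\<close> ask whether the value of the expression is positive.\<close>

datatype program =
    Skip
  | Store expr expr
  | Seq program program
  | If expr program program
  | While expr program

text \<open>\<open>exec c s T s'\<close>: started with memory \<open>s\<close>, the program \<open>c\<close> halts with memory \<open>s'\<close> after
  running for time \<open>T\<close>.\<close>

inductive exec :: "program \<Rightarrow> memory \<Rightarrow> nat \<Rightarrow> memory \<Rightarrow> bool" where
  Skip: "exec Skip s 1 s"
| Store: "exec (Store a e) s
    (cost a s + cost e s + bit_length (val a s) + bit_length (val e s))
    (s(val a s := val e s))"
| Seq: "exec c\<^sub>1 s T\<^sub>1 s' \<Longrightarrow> exec c\<^sub>2 s' T\<^sub>2 s'' \<Longrightarrow> exec (Seq c\<^sub>1 c\<^sub>2) s (T\<^sub>1 + T\<^sub>2) s''"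
| If_True: "val e s > 0 \<Longrightarrow> exec c\<^sub>1 s T s' \<Longrightarrow> exec (If e c\<^sub>1 c\<^sub>2) s (cost e s + T) s'"
| If_False: "val e s \<le> 0 \<Longrightarrow> exec c\<^sub>2 s T s' \<Longrightarrow> exec (If e c\<^sub>1 c\<^sub>2) s (cost e s + T) s'"
| While_False: "val e s \<le> 0 \<Longrightarrow> exec (While e c) s (cost e s) s"
| While_True: "val e s > 0 \<Longrightarrow> exec c s T\<^sub>1 s' \<Longrightarrow> exec (While e c) s' T\<^sub>2 s'' \<Longrightarrow>
    exec (While e c) s (cost e s + T\<^sub>1 + T\<^sub>2) s''"

inductive_cases exec_SkipE: "exec Skip s T s'"
inductive_cases exec_StoreE: "exec (Store a e) s T s'"
inductive_cases exec_SeqE: "exec (Seq c\<^sub>1 c\<^sub>2) s T s'"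
inductive_cases exec_IfE: "exec (If e c\<^sub>1 c\<^sub>2) s T s'"
inductive_cases exec_WhileE: "exec (While e c) s T s'"

lemma exec_deterministic: "exec c s T s' \<Longrightarrow> exec c s U s'' \<Longrightarrow> U = T \<and> s'' = s'"
proof (induction arbitrary: U s'' rule: exec.induct)
  case (Skip s)
  then show ?case by (auto elim: exec_SkipE)
next
  case (Store a e s)
  then show ?case by (auto elim: exec_StoreE)
next
  case (Seq c\<^sub>1 s T\<^sub>1 s' c\<^sub>2 T\<^sub>2 s2)
  from Seq.prems obtain V\<^sub>1 V\<^sub>2 r where
    *: "U = V\<^sub>1 + V\<^sub>2" "exec c\<^sub>1 s V\<^sub>1 r" "exec c\<^sub>2 r V\<^sub>2 s''"
    by (rule exec_SeqE)
  have r: "V\<^sub>1 = T\<^sub>1 \<and> r = s'" by (rule Seq.IH(1)[OF *(2)])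
  have "V\<^sub>2 = T\<^sub>2 \<and> s'' = s2" by (rule Seq.IH(2)) (use *(3) r in simp)
  with * r show ?case by simp
next
  case (If_True e s c\<^sub>1 T s' c\<^sub>2)
  from If_True.prems obtain V where *: "U = cost e s + V" "exec c\<^sub>1 s V s''"
    by (rule exec_IfE) (use If_True.hyps in simp_all)
  with If_True.IH[OF *(2)] show ?case by simp
next
  case (If_False e s c\<^sub>2 T s' c\<^sub>1)
  from If_False.prems obtain V where *: "U = cost e s + V" "exec c\<^sub>2 s V s''"
    by (rule exec_IfE) (use If_False.hyps in simp_all)
  with If_False.IH[OF *(2)] show ?case by simp
next
  case (While_False e s c)
  from While_False.prems show ?case
    by (rule exec_WhileE) (use While_False.hyps in simp_all)
next
  case (While_True e s c T\<^sub>1 s' T\<^sub>2 s2)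
  from While_True.prems obtain V\<^sub>1 V\<^sub>2 r where
    *: "U = cost e s + V\<^sub>1 + V\<^sub>2" "exec c s V\<^sub>1 r" "exec (While e c) r V\<^sub>2 s''"
    by (rule exec_WhileE) (use While_True.hyps in simp_all)
  have r: "V\<^sub>1 = T\<^sub>1 \<and> r = s'" by (rule While_True.IH(1)[OF *(2)])
  have "V\<^sub>2 = T\<^sub>2 \<and> s'' = s2" by (rule While_True.IH(2)) (use *(3) r in simp)
  with * r show ?case by simp
qed

text \<open>Words of numbers are passed to and from a program with the length of the word in register 0
  and its letters in registers 1, 2, and so on; initially all other registers are 0.\<close>

definition input_memory :: "nat list \<Rightarrow> memory" where
  "input_memory xs = (\<lambda>a. if a = 0 then int (length xs)
     else if 1 \<le> a \<and> a \<le> int (length xs) then int (xs ! nat (a - 1)) else 0)"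

definition holds_output :: "memory \<Rightarrow> nat list \<Rightarrow> bool" where
  "holds_output s ys \<longleftrightarrow>
     s 0 = int (length ys) \<and> (\<forall>i<length ys. s (int i + 1) = int (ys ! i))"

definition encoding_length :: "nat list \<Rightarrow> nat" where
  "encoding_length xs = (\<Sum>x\<leftarrow>xs. bit_length (int x))"

text \<open>The time for reading off the output is included, so that registers the program has never
  written to cannot contribute to a long output for free.\<close>

definition computes :: "program \<Rightarrow> nat list \<Rightarrow> nat \<Rightarrow> nat list \<Rightarrow> bool" where
  "computes c xs T ys \<longleftrightarrow>
     (\<exists>T' s. exec c (input_memory xs) T' s \<and> holds_output s ys \<and> T = T' + encoding_length ys)"

definition computable :: "(nat list \<Rightarrow> nat) \<Rightarrow> bool" where
  "computable f \<longleftrightarrow> (\<exists>c. \<forall>p. \<exists>T. computes c p T [f p])"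


section \<open>Fixed-parameter tractability\<close>

text \<open>A parameterized problem is given by its set of instances, their encoding as words of
  binary-encoded numbers, their parameters, and the relation between instances and correct
  answers.\<close>

definition fixed_parameter_tractable ::
    "'i set \<Rightarrow> ('i \<Rightarrow> nat list) \<Rightarrow> ('i \<Rightarrow> nat list) \<Rightarrow> ('i \<Rightarrow> nat list \<Rightarrow> bool) \<Rightarrow> bool" where
  "fixed_parameter_tractable instances encode param correct \<longleftrightarrow>
     (\<exists>c f C r. computable f \<and>
       (\<forall>I\<in>instances. \<exists>T ys. computes c (encode I) T ys \<and> correct I ys \<and>
          T \<le> C * (f (param I) * encoding_length (encode I) ^ r)))"


section \<open>The huge table problem with types\<close>

text \<open>Rows, columns, layers and types are numbered from 0.\<close>

record huge_table =
  num_rows :: nat                   (* l *)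
  num_cols :: nat                   (* m *)
  num_types :: nat                  (* t *)
  type_counts :: "nat list"         (* n_1, ..., n_t *)
  num_layers :: nat                 (* n *)
  column_sums :: "nat vec list"     (* u^1, ..., u^t *)
  row_sums :: "nat vec list"        (* v^1, ..., v^t *)
  line_sums :: "nat mat"            (* w *)

definition huge_tables :: "huge_table set" where
  "huge_tables = {I.
     num_rows I \<ge> 1 \<and> num_cols I \<ge> 1 \<and> num_types I \<ge> 1 \<and> num_layers I \<ge> 1 \<and>
     length (type_counts I) = num_types I \<and> (\<forall>c\<in>set (type_counts I). c \<ge> 1) \<and>
     sum_list (type_counts I) = num_layers I \<and>
     length (column_sums I) = num_types I \<and> set (column_sums I) \<subseteq> carrier_vec (num_cols I) \<and>
     length (row_sums I) = num_types I \<and> set (row_sums I) \<subseteq> carrier_vec (num_rows I) \<and>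
     line_sums I \<in> carrier_mat (num_rows I) (num_cols I)}"

definition layer_of_type :: "huge_table \<Rightarrow> nat \<Rightarrow> nat mat \<Rightarrow> bool" where
  "layer_of_type I k z \<longleftrightarrow> z \<in> carrier_mat (num_rows I) (num_cols I) \<and>
     (\<forall>j<num_cols I. (\<Sum>i<num_rows I. z $$ (i, j)) = column_sums I ! k $ j) \<and>
     (\<forall>i<num_rows I. (\<Sum>j<num_cols I. z $$ (i, j)) = row_sums I ! k $ i)"

text \<open>The positions of the layers that have to be of type \<open>k\<close>.\<close>

definition block :: "huge_table \<Rightarrow> nat \<Rightarrow> nat set" where
  "block I k = {sum_list (take k (type_counts I)) ..< sum_list (take (Suc k) (type_counts I))}"

definition feasible :: "huge_table \<Rightarrow> nat mat list \<Rightarrow> bool" where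
  "feasible I x \<longleftrightarrow> length x = num_layers I \<and>
     (\<forall>k<num_types I. \<forall>h\<in>block I k. layer_of_type I k (x ! h)) \<and>
     (\<forall>i<num_rows I. \<forall>j<num_cols I. (\<Sum>h<num_layers I. x ! h $$ (i, j)) = line_sums I $$ (i, j))"

text \<open>Distinctness is part of the multiplicity \<open>q\<close> being the number of layers equal to \<open>z\<close>: without it, a layer
  listed twice could stand in for a layer that is missing from the list.\<close>

definition represents :: "huge_table \<Rightarrow> (nat \<times> nat mat) list list \<Rightarrow> nat mat list \<Rightarrow> bool" where
  "represents I L x \<longleftrightarrow> length L = num_types I \<and>
     (\<forall>k<num_types I. distinct (map snd (L ! k)) \<and>
        (\<forall>(q, z)\<in>set (L ! k). layer_of_type I k z \<and> q = card {h \<in> block I k. x ! h = z}) \<and>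
        (\<Sum>(q, z)\<leftarrow>L ! k. q) = type_counts I ! k)"


subsection \<open>Encodings\<close>

text \<open>\<open>unary k\<close> is the unary encoding of \<open>k\<close>, with an end marker; its encoding length is \<open>k + 1\<close>.
  A number that is a letter of the input word is binary-encoded.\<close>

definition unary :: "nat \<Rightarrow> nat list" where
  "unary k = replicate k 1 @ [0]"

definition encode_mat :: "nat mat \<Rightarrow> nat list" where
  "encode_mat A = concat (mat_to_list A)"

definition encode_data :: "huge_table \<Rightarrow> nat list" where
  "encode_data I = type_counts I @ [num_layers I] @
     concat (map list_of_vec (column_sums I)) @ concat (map list_of_vec (row_sums I)) @
     encode_mat (line_sums I)"

definition encode_unary_types :: "huge_table \<Rightarrow> nat list" where
  "encode_unary_types I = [num_rows I, num_cols I] @ unary (num_types I) @ encode_data I"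

definition encode_unary_cols :: "huge_table \<Rightarrow> nat list" where
  "encode_unary_cols I = [num_rows I, num_types I] @ unary (num_cols I) @ encode_data I"

definition encode_compact :: "(nat \<times> nat mat) list list \<Rightarrow> nat list" where
  "encode_compact L =
     concat (map (\<lambda>ps. length ps # concat (map (\<lambda>(q, z). q # encode_mat z) ps)) L)"

text \<open>The answer is 0 if there is no feasible table, and otherwise 1 followed by a compact
  representation of a feasible table.\<close>

definition solves :: "huge_table \<Rightarrow> nat list \<Rightarrow> bool" where
  "solves I ys \<longleftrightarrow>
     (if \<exists>x. feasible I x
      then \<exists>x L. feasible I x \<and> represents I L x \<and> ys = 1 # encode_compact L
      else ys = [0])"

end

theory Submission
  imports Defs "HOL-Library.While_Combinator"
begin

text \<open>
  There is a feasible table iff there are nonnegative tables \<open>X\<^sup>k\<close>, one per type, that sum to \<open>w\<close>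
  and have the margins \<open>n\<^sub>k v\<^sup>k\<close> and \<open>n\<^sub>k u\<^sup>k\<close>: rounding \<open>X\<^sup>k / n\<^sub>k\<close> by Gale's theorem gives a layer that
  can be subtracted with a large multiplicity, and \<open>l m + 1\<close> different layers exhaust \<open>X\<^sup>k\<close>.

  The tables \<open>X\<^sup>k\<close> form a three-way table with prescribed line sums in all directions. Two of its
  dimensions are parameters; along the third one, types or columns, it consists of \<open>p \<times> q\<close> slices. If
  the margins \<open>(r, c)\<close> and \<open>(r', c')\<close> of two slices are such that \<open>r(I) - c(J)\<close> and \<open>r'(I) - c'(J)\<close> never
  have opposite signs, then by Gale's theorem every table with the margins \<open>(r + r', c + c')\<close> is the
  sum of tables with the margins \<open>(r, c)\<close> and \<open>(r', c')\<close>. Slices with the same sign pattern can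
  therefore be merged, and the number of sign patterns is bounded in the parameters. What remains is a
  0/1 system of parameter size, which is solved for the binary digits of the unknowns, least
  significant digit first, with carries bounded in the parameters. Afterwards the slices are split off
  one after the other by solving such systems with two slices.

  The running time is accounted for by showing that the functions computable in fixed-parameter
  tractable time are closed under the operations the algorithm is composed of.
\<close>

section \<open>Running time in terms of a weight\<close>

text \<open>The obstacle to modular time bounds is that the logarithmic cost of a step depends on
  the lengths of the words it meets, and the run itself lengthens them. One number therefore bounds
  both the charge and the growth. Only multiplication could make lengths explode, so second factors
  are required to have bounded length. Merging by signs works because of an elementary fact: if
  \<open>x\<close> and \<open>y\<close> have the same sign, then \<open>x\<close> is at most 0 or at
  most \<open>x + y\<close>. A cut that can carry the sum of two demands of the same sign can thus
  carry each of them. For \<open>p \<times> q\<close> slices there are \<open>2 ^ (p + q)\<close>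
  pairs \<open>(I, J)\<close>, hence at most \<open>2 ^ 2 ^ (p + q)\<close> sign patterns. Each
  pattern becomes a block of a system whose search is again exponential in the number of equations,
  so the parameter dependence is an iterated exponential. The time bound must hold for instances
  without solutions as well. The loop invariants therefore separate what bounds the sizes, which
  survives a failed step, from what makes the result correct.\<close>

definition word_bound :: "nat \<Rightarrow> memory \<Rightarrow> bool" where
  "word_bound \<beta> s \<longleftrightarrow> (\<forall>a. bit_length (s a) \<le> \<beta>)"

text \<open>A run charged with \<open>n\<close> takes time at most \<open>n * (\<beta> + n)\<close> on words of at most \<open>\<beta>\<close> digits and
  lengthens them by at most \<open>n\<close> digits; these charges are additive under sequential composition.\<close>

definition brun :: "program \<Rightarrow> memory \<Rightarrow> nat \<Rightarrow> memory \<Rightarrow> bool" where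
  "brun c s n s' \<longleftrightarrow> (\<forall>\<beta>. word_bound \<beta> s \<longrightarrow>
     (\<exists>T. exec c s T s' \<and> T \<le> n * (\<beta> + n) \<and> word_bound (\<beta> + n) s'))"

text \<open>The asymmetry of the product is deliberate: the first factor may be as long as a word of
  the memory, while the second is charged with its actual length. A value then exceeds the word
  length of the memory by at most the weight.\<close>

fun weight :: "expr \<Rightarrow> memory \<Rightarrow> nat" where
  "weight (Const c) s = bit_length c"
| "weight (Load e) s = weight e s + 2"
| "weight (Add a b) s = weight a s + weight b s + 2"
| "weight (Sub a b) s = weight a s + weight b s + 2"
| "weight (Mult a b) s = weight a s + weight b s + bit_length (val b s) + 2"
| "weight (Div a b) s = weight a s + weight b s + 2"

section \<open>Lengths of sums, products and quotients\<close>

lemma bit_length_le_iff: "bit_length z \<le> k \<longleftrightarrow> 1 \<le> k \<and> \<bar>z\<bar> < 2 ^ k"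
proof -
  have *: "nat \<bar>z\<bar> < 2 ^ k \<longleftrightarrow> \<bar>z\<bar> < 2 ^ k"
    by (metis abs_ge_zero of_nat_less_numeral_power_cancel_iff nat_0_le)
  have "floorlog 2 (nat \<bar>z\<bar>) \<le> k \<longleftrightarrow> nat \<bar>z\<bar> < 2 ^ k"
    using floorlog_le_iff[of 2 "nat \<bar>z\<bar>" k] by simp
  then show ?thesis unfolding bit_length_def using * by auto
qed

lemma bit_length_pos [simp]: "Suc 0 \<le> bit_length z" "0 < bit_length z"
  by (auto simp: bit_length_def)

lemma bit_length_add: "bit_length (x + y) \<le> max (bit_length x) (bit_length y) + 1"
proof -
  let ?m = "max (bit_length x) (bit_length y)"
  have "\<bar>x\<bar> < 2 ^ ?m" "\<bar>y\<bar> < 2 ^ ?m"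
    using bit_length_le_iff[of x ?m] bit_length_le_iff[of y ?m] by auto
  then show ?thesis by (subst bit_length_le_iff) auto
qed

lemma bit_length_minus [simp]: "bit_length (- x) = bit_length x"
  by (simp add: bit_length_def)

lemma bit_length_diff: "bit_length (x - y) \<le> max (bit_length x) (bit_length y) + 1"
  using bit_length_add[of x "-y"] by simp

lemma bit_length_mult: "bit_length (x * y) \<le> bit_length x + bit_length y"
proof -
  have "\<bar>x\<bar> < 2 ^ bit_length x" "\<bar>y\<bar> < 2 ^ bit_length y"
    using bit_length_le_iff[of x "bit_length x"] bit_length_le_iff[of y "bit_length y"] by auto
  then have "\<bar>x\<bar> * \<bar>y\<bar> < 2 ^ bit_length x * 2 ^ bit_length y"
    by (intro mult_strict_mono') auto
  then show ?thesis
    by (subst bit_length_le_iff) (auto simp: power_add abs_mult add_pos_pos Suc_le_eq)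
qed

lemma abs_div_le: "\<bar>x div y\<bar> \<le> \<bar>x\<bar>" for x y :: int
proof (cases "y = 0")
  case False
  have "\<bar>x div y\<bar> \<le> \<bar>x\<bar>" if "y > 0" for x y :: int
  proof (cases "x \<ge> 0")
    case True
    then show ?thesis using that
      using zdiv_mono2[of x 1 y] pos_imp_zdiv_nonneg_iff[of y x] by simp
  next
    case False
    then have "x \<le> x div y"
      using that zdiv_mono2_neg[of x 1 y] by simp
    moreover have "x div y \<le> 0"
      using False that zdiv_mono1[of x 0 y] by simp
    ultimately show ?thesis by simp
  qed
  from this[of y x] this[of "-y" "-x"] False show ?thesis by force
qed simp

lemma bit_length_div: "bit_length (x div y) \<le> bit_length x"
proof -
  have "\<bar>x\<bar> < 2 ^ bit_length x" using bit_length_le_iff[of x "bit_length x"] by auto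
  then show ?thesis using abs_div_le[of x y] by (subst bit_length_le_iff) (simp add: Suc_le_eq)
qed

text \<open>A loaded word has at most \<open>\<beta>\<close> digits whatever its address, a sum or
  difference gains one digit, a quotient gains none, and a product gains the digits of the second
  factor, which its weight contains.\<close>

lemma bit_length_val:
  assumes "word_bound \<beta> s"
  shows "bit_length (val e s) \<le> \<beta> + weight e s"
proof (induction e)
  case (Load e)
  have "bit_length (s (val e s)) \<le> \<beta>" using assms by (simp add: word_bound_def)
  then show ?case by simp
next
  case (Add a b)
  then show ?case using bit_length_add[of "val a s" "val b s"] by simp
next
  case (Sub a b)
  then show ?case using bit_length_diff[of "val a s" "val b s"] by simp
next
  case (Mult a b)
  then show ?case using bit_length_mult[of "val a s" "val b s"] by simp
next
  case (Div a b)
  then show ?case using bit_length_div[of "val a s" "val b s"] by simp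
qed simp

text \<open>The summand 2 in the weights of the binary operations and of stores pays for the lengths
  of the two operands, each of which is at most \<open>\<beta> + n\<close>.\<close>

lemma add_weights:
  fixes w v \<beta> :: nat
  assumes "x \<le> w * (\<beta> + w)" "y \<le> v * (\<beta> + v)" "c \<le> \<beta> + w" "d \<le> \<beta> + v" "w + v + 2 \<le> n"
  shows "x + y + c + d \<le> n * (\<beta> + n)"
proof -
  have "x + y + c + d \<le> w * (\<beta> + n) + v * (\<beta> + n) + (\<beta> + n) + (\<beta> + n)"
    using assms order_trans[OF assms(1) mult_le_mono2[of "\<beta> + w" "\<beta> + n" w]]
      order_trans[OF assms(2) mult_le_mono2[of "\<beta> + v" "\<beta> + n" v]] by linarith
  also have "\<dots> = (w + v + 2) * (\<beta> + n)" by (simp add: algebra_simps)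
  also have "\<dots> \<le> n * (\<beta> + n)" by (rule mult_le_mono1[OF assms(5)])
  finally show ?thesis .
qed

lemma cost_le_weight:
  assumes "word_bound \<beta> s"
  shows "cost e s \<le> weight e s * (\<beta> + weight e s)"
proof (induction e)
  case (Const c)
  have "bit_length c * 1 \<le> bit_length c * (\<beta> + bit_length c)"
    by (intro mult_le_mono2) (use bit_length_pos(1)[of c] in linarith)
  then show ?case by simp
next
  case (Load e)
  have "bit_length (s (val e s)) \<le> \<beta> + 0" using assms by (simp add: word_bound_def)
  from add_weights[OF Load, of 0 0 _ _ "weight e s + 2", OF _ bit_length_val[OF assms, of e] this]
  show ?case by simp
next
  case (Add a b)
  show ?case unfolding cost.simps weight.simps
    by (rule add_weights[OF Add bit_length_val[OF assms, of a] bit_length_val[OF assms, of b]]) simp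
next
  case (Sub a b)
  show ?case unfolding cost.simps weight.simps
    by (rule add_weights[OF Sub bit_length_val[OF assms, of a] bit_length_val[OF assms, of b]]) simp
next
  case (Mult a b)
  show ?case unfolding cost.simps weight.simps
    by (rule add_weights[OF Mult bit_length_val[OF assms, of a] bit_length_val[OF assms, of b]]) simp
next
  case (Div a b)
  show ?case unfolding cost.simps weight.simps
    by (rule add_weights[OF Div bit_length_val[OF assms, of a] bit_length_val[OF assms, of b]]) simp
qed

text \<open>The second run starts on words that the first has lengthened to
  \<open>\<beta> + n\<close> digits, hence the form of its bound.\<close>

lemma add_quadratic:
  fixes T U n m :: nat
  assumes "T \<le> n * (\<beta> + n)" "U \<le> m * (\<beta> + n + m)"
  shows "T + U \<le> (n + m) * (\<beta> + (n + m))"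
proof -
  have "T + U \<le> n * (\<beta> + (n + m)) + m * (\<beta> + (n + m))"
    using assms order_trans[OF assms(1) mult_le_mono2[of "\<beta> + n" "\<beta> + (n + m)" n]]
    by (simp add: add.assoc)
  then show ?thesis by (simp add: algebra_simps)
qed

lemma word_bound_mono: "word_bound \<beta> s \<Longrightarrow> \<beta> \<le> \<gamma> \<Longrightarrow> word_bound \<gamma> s"
  unfolding word_bound_def using le_trans by blast

lemma brun_mono:
  assumes "brun c s n s'" "n \<le> m"
  shows "brun c s m s'"
  unfolding brun_def
proof (intro allI impI)
  fix \<beta> assume "word_bound \<beta> s"
  then obtain T where T: "exec c s T s'" "T \<le> n * (\<beta> + n)" "word_bound (\<beta> + n) s'"
    using assms(1) unfolding brun_def by blast
  have "n * (\<beta> + n) \<le> m * (\<beta> + m)" using assms(2) by (intro mult_le_mono) auto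
  with T show "\<exists>T. exec c s T s' \<and> T \<le> m * (\<beta> + m) \<and> word_bound (\<beta> + m) s'"
    using assms(2) word_bound_mono[OF T(3), of "\<beta> + m"] by auto
qed

section \<open>Charges of the program constructs\<close>

lemma brun_Store:
  assumes "s' = s(val a s := val e s)" "weight a s + weight e s + 2 \<le> n"
  shows "brun (Store a e) s n s'"
  unfolding brun_def
proof (intro allI impI)
  fix \<beta> assume \<beta>: "word_bound \<beta> s"
  let ?T = "cost a s + cost e s + bit_length (val a s) + bit_length (val e s)"
  have "?T \<le> n * (\<beta> + n)"
    using add_weights[OF cost_le_weight[OF \<beta>, of a] cost_le_weight[OF \<beta>, of e]
        bit_length_val[OF \<beta>, of a] bit_length_val[OF \<beta>, of e] assms(2)] .
  moreover have "word_bound (\<beta> + n) s'"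
    using \<beta> bit_length_val[OF \<beta>, of e] assms unfolding word_bound_def
    by (auto intro: le_trans trans_le_add1)
  ultimately show "\<exists>T. exec (Store a e) s T s' \<and> T \<le> n * (\<beta> + n) \<and> word_bound (\<beta> + n) s'"
    using exec.Store[of a e s] assms(1) by blast
qed

lemma brun_Seq:
  assumes "brun c s n s'" "brun d s' m s''"
  shows "brun (Seq c d) s (n + m) s''"
  unfolding brun_def
proof (intro allI impI)
  fix \<beta> assume "word_bound \<beta> s"
  then obtain T where T: "exec c s T s'" "T \<le> n * (\<beta> + n)" "word_bound (\<beta> + n) s'"
    using assms(1) unfolding brun_def by blast
  from T(3) obtain U where U: "exec d s' U s''" "U \<le> m * (\<beta> + n + m)"
    "word_bound (\<beta> + n + m) s''"
    using assms(2) unfolding brun_def by blast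
  show "\<exists>T. exec (Seq c d) s T s'' \<and> T \<le> (n + m) * (\<beta> + (n + m)) \<and>
      word_bound (\<beta> + (n + m)) s''"
  proof (intro exI conjI)
    show "exec (Seq c d) s (T + U) s''" by (rule exec.Seq[OF T(1) U(1)])
    show "word_bound (\<beta> + (n + m)) s''" using U(3) by (simp add: add.assoc)
  qed (rule add_quadratic[OF T(2) U(2)])
qed

lemma brun_If:
  assumes "val e s > 0 \<Longrightarrow> brun c s n s'" "val e s \<le> 0 \<Longrightarrow> brun d s n s'"
  shows "brun (If e c d) s (weight e s + n) s'"
  unfolding brun_def
proof (intro allI impI)
  fix \<beta> assume \<beta>: "word_bound \<beta> s"
  have "\<exists>T. exec (If e c d) s (cost e s + T) s' \<and> T \<le> n * (\<beta> + n) \<and> word_bound (\<beta> + n) s'"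
  proof (cases "val e s > 0")
    case True
    from assms(1)[OF this] \<beta> show ?thesis
      unfolding brun_def by (meson True exec.If_True)
  next
    case False
    then have *: "val e s \<le> 0" by simp
    from assms(2)[OF this] \<beta> show ?thesis
      unfolding brun_def by (meson * exec.If_False)
  qed
  then obtain T where T: "exec (If e c d) s (cost e s + T) s'" "T \<le> n * (\<beta> + n)"
    "word_bound (\<beta> + n) s'" by blast
  \<comment> \<open>Evaluating the test lengthens nothing; the bound is weakened only to fit
    \<open>add_quadratic\<close>.\<close>
  have "T \<le> n * (\<beta> + weight e s + n)"
    using T(2) by (rule order_trans) (intro mult_le_mono2, simp)
  from add_quadratic[OF cost_le_weight[OF \<beta>, of e] this]
  show "\<exists>T. exec (If e c d) s T s' \<and> T \<le> (weight e s + n) * (\<beta> + (weight e s + n)) \<and>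
     word_bound (\<beta> + (weight e s + n)) s'"
  proof (intro exI conjI)
    show "exec (If e c d) s (cost e s + T) s'" by (rule T(1))
    show "word_bound (\<beta> + (weight e s + n)) s'" by (rule word_bound_mono[OF T(3)]) simp
  qed
qed

lemma brun_While_False:
  assumes "val e s \<le> 0"
  shows "brun (While e c) s (weight e s) s"
  unfolding brun_def
proof (intro allI impI exI conjI)
  fix \<beta> assume \<beta>: "word_bound \<beta> s"
  show "exec (While e c) s (cost e s) s" by (rule exec.While_False[OF assms])
  show "cost e s \<le> weight e s * (\<beta> + weight e s)" by (rule cost_le_weight[OF \<beta>])
  show "word_bound (\<beta> + weight e s) s" by (rule word_bound_mono[OF \<beta>]) simp
qed

lemma brun_While_True:
  assumes "val e s > 0" "brun c s n s'" "brun (While e c) s' m s''"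
  shows "brun (While e c) s (weight e s + n + m) s''"
  unfolding brun_def
proof (intro allI impI)
  fix \<beta> assume \<beta>: "word_bound \<beta> s"
  let ?w = "weight e s"
  obtain T where T: "exec c s T s'" "T \<le> n * (\<beta> + n)" "word_bound (\<beta> + n) s'"
    using assms(2) \<beta> unfolding brun_def by blast
  from T(3) obtain U where U: "exec (While e c) s' U s''" "U \<le> m * (\<beta> + n + m)"
    "word_bound (\<beta> + n + m) s''"
    using assms(3) unfolding brun_def by blast
  have "T \<le> n * (\<beta> + ?w + n)"
    using T(2) by (rule order_trans) (intro mult_le_mono2, simp)
  from add_quadratic[OF cost_le_weight[OF \<beta>, of e] this]
  have 1: "cost e s + T \<le> (?w + n) * (\<beta> + (?w + n))" .
  have "U \<le> m * (\<beta> + (?w + n) + m)"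
    using U(2) by (rule order_trans) (intro mult_le_mono2, simp)
  from add_quadratic[OF 1 this]
  show "\<exists>T. exec (While e c) s T s'' \<and> T \<le> (?w + n + m) * (\<beta> + (?w + n + m)) \<and>
     word_bound (\<beta> + (?w + n + m)) s''"
  proof (intro exI conjI)
    show "exec (While e c) s (cost e s + T + U) s''" by (rule exec.While_True[OF assms(1) T(1) U(1)])
    show "word_bound (\<beta> + (?w + n + m)) s''" by (rule word_bound_mono[OF U(3)]) simp
  qed
qed


section \<open>Parameterized bounds\<close>

fun tower :: "nat \<Rightarrow> nat \<Rightarrow> nat" where
  "tower 0 a = a"
| "tower (Suc h) a = 2 ^ tower h a"

lemma tower_le_Suc: "tower h a \<le> tower (Suc h) a"
  by (simp add: less_imp_le)

lemma tower_mono_height: "h \<le> k \<Longrightarrow> tower h a \<le> tower k a"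
  by (rule lift_Suc_mono_le[of "\<lambda>h. tower h a"]) (rule tower_le_Suc)

lemma tower_mono: "a \<le> b \<Longrightarrow> tower h a \<le> tower h b"
  by (induction h) auto

text \<open>As \<open>a\<close> may be 0, a constant has to be absorbed by the height of the
  tower.\<close>

lemma le_tower: "n \<le> tower (Suc n) a"
proof (induction n)
  case (Suc n)
  then show ?case by (simp) (meson less_exp less_le_trans not_less_eq_eq not_less)
qed simp

lemma square_le_exp_exp: "(n::nat) * n \<le> 2 ^ 2 ^ n"
proof -
  have "n \<le> 2 ^ n" by (simp add: less_imp_le)
  then have "n * n \<le> 2 ^ n * 2 ^ n" by (intro mult_le_mono)
  also have "\<dots> = 2 ^ (2 * n)" by (simp add: mult_2 power_add)
  also have "\<dots> \<le> 2 ^ 2 ^ n"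
  proof (intro power_increasing)
    show "2 * n \<le> 2 ^ n"
    proof (induction n)
      case (Suc n) then show ?case by (cases n) auto
    qed simp
  qed simp
  finally show ?thesis .
qed

text \<open>The two extra levels absorb the squaring of \<open>tower (h + k) a\<close>.\<close>

lemma tower_mult_le: "tower h a * tower k a \<le> tower (h + k + 2) a"
proof -
  let ?m = "tower (h + k) a"
  have "tower h a * tower k a \<le> ?m * ?m"
    by (intro mult_le_mono tower_mono_height) auto
  also have "\<dots> \<le> 2 ^ 2 ^ ?m" by (rule square_le_exp_exp)
  finally show ?thesis by simp
qed

text \<open>Towers of fixed height keep the bounds closed under composition, where the parameter
  dependence of one function may enter the parameter of the next.\<close>

definition bnd :: "nat \<Rightarrow> nat \<Rightarrow> nat \<Rightarrow> nat" where
  "bnd N a b = tower N a * (b + 2) ^ N"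

lemma bnd_mono: "N \<le> M \<Longrightarrow> bnd N a b \<le> bnd M a b"
  unfolding bnd_def by (intro mult_le_mono tower_mono_height power_increasing) auto

lemma bnd_mult_le: "bnd N a b * bnd M a b \<le> bnd (N + M + 2) a b"
proof -
  have "bnd N a b * bnd M a b = (tower N a * tower M a) * (b + 2) ^ (N + M)"
    by (simp add: bnd_def power_add algebra_simps)
  also have "\<dots> \<le> tower (N + M + 2) a * (b + 2) ^ (N + M + 2)"
    by (intro mult_le_mono tower_mult_le power_increasing) auto
  finally show ?thesis by (simp add: bnd_def)
qed

text \<open>A sum of two numbers is at most their product once both are at least 2, which reduces
  sums of bounds to products. The base \<open>b + 2\<close> achieves this also for
  \<open>b = 0\<close>.\<close>

lemma two_le_bnd_Suc: "2 \<le> bnd (Suc N) a b"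
proof -
  have "1 * 2 ^ Suc 0 \<le> tower (Suc N) a * (b + 2) ^ Suc N"
    by (intro mult_le_mono order_trans[OF power_mono[of 2 "b + 2"] power_increasing]) auto
  then show ?thesis by (simp add: bnd_def)
qed

lemma bnd_add_le: "bnd N a b + bnd M a b \<le> bnd (N + M + 4) a b"
proof -
  have "bnd N a b + bnd M a b \<le> bnd (Suc N) a b + bnd (Suc M) a b"
    by (intro add_mono bnd_mono) auto
  also have "x + y \<le> x * y" if "2 \<le> x" "2 \<le> y" for x y :: nat
  proof -
    define i j where "i = x - 2" and "j = y - 2"
    then have "x = i + 2" "y = j + 2" using that by auto
    then show ?thesis by (simp add: algebra_simps)
  qed
  then have "bnd (Suc N) a b + bnd (Suc M) a b \<le> bnd (Suc N) a b * bnd (Suc M) a b"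
    using two_le_bnd_Suc by blast
  also have "\<dots> \<le> bnd (N + M + 4) a b"
    using bnd_mult_le[of "Suc N" a b "Suc M"] by (simp add: eval_nat_numeral)
  finally show ?thesis .
qed

lemma const_le_bnd: "n \<le> bnd (Suc n) a b"
proof -
  have "n * 1 \<le> tower (Suc n) a * (b + 2) ^ Suc n"
    by (intro mult_le_mono le_tower one_le_power) auto
  then show ?thesis by (simp add: bnd_def)
qed

text \<open>\<open>FB\<close> collects the quantities bounded like a fixed-parameter tractable
  running time, \<open>PB\<close> those bounded in the parameter alone; only the latter may become
  exponents. \<open>P a b x\<close> expresses that \<open>a\<close> and \<open>b\<close> are an
  admissible parameter and size for \<open>x\<close>, and the index \<open>N\<close> is uniform in
  all three.\<close>

definition FB :: "(nat \<Rightarrow> nat \<Rightarrow> 'x \<Rightarrow> bool) \<Rightarrow> ('x \<Rightarrow> nat) \<Rightarrow> bool" where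
  "FB P q \<longleftrightarrow> (\<exists>N. \<forall>a b x. P a b x \<longrightarrow> q x \<le> bnd N a b)"

definition PB :: "(nat \<Rightarrow> nat \<Rightarrow> 'x \<Rightarrow> bool) \<Rightarrow> ('x \<Rightarrow> nat) \<Rightarrow> bool" where
  "PB P q \<longleftrightarrow> (\<exists>N. \<forall>a b x. P a b x \<longrightarrow> q x \<le> tower N a)"

section \<open>Closure of bounded quantities under arithmetic\<close>

lemma FB_const: "FB P (\<lambda>x. n)"
  unfolding FB_def using const_le_bnd by blast

text \<open>With the pair \<open>(a, b)\<close> itself as argument, the closure rules of
  \<open>FB\<close> turn any polynomial expression in several \<open>bnd\<close>s into a single
  \<open>bnd K a b\<close>.\<close>

lemma FB_bnd: "FB (\<lambda>a b x. x = (a, b)) (\<lambda>x. bnd N (fst x) (snd x))"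
  unfolding FB_def by (intro exI[of _ N]) simp

lemma PB_const: "PB P (\<lambda>x. n)"
  unfolding PB_def using le_tower by blast

lemma FB_size: "(\<And>a b x. P a b x \<Longrightarrow> q x \<le> b) \<Longrightarrow> FB P q"
proof -
  have "b \<le> bnd 1 a b" for a b
  proof -
    have "1 * b \<le> tower 1 a * (b + 2) ^ 1" by (intro mult_le_mono) auto
    then show ?thesis by (simp add: bnd_def)
  qed
  then show "(\<And>a b x. P a b x \<Longrightarrow> q x \<le> b) \<Longrightarrow> FB P q"
    unfolding FB_def by (metis le_trans)
qed

lemma PB_param: "(\<And>a b x. P a b x \<Longrightarrow> q x \<le> a) \<Longrightarrow> PB P q"
  unfolding PB_def by (metis tower.simps(1))

lemma FB_of_PB: "PB P q \<Longrightarrow> FB P q"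
proof -
  assume "PB P q"
  then obtain N where N: "\<And>a b x. P a b x \<Longrightarrow> q x \<le> tower N a" unfolding PB_def by blast
  have "tower N a * 1 \<le> bnd N a b" for a b unfolding bnd_def by (intro mult_le_mono) auto
  with N show "FB P q" unfolding FB_def by (metis le_trans mult_1_right)
qed

lemma FB_mono:
  assumes "FB P q" "\<And>a b x. Q a b x \<Longrightarrow> P a b (g x) \<and> q' x \<le> q (g x)"
  shows "FB Q q'"
proof -
  obtain N where N: "\<And>a b x. P a b x \<Longrightarrow> q x \<le> bnd N a b" using assms(1) unfolding FB_def by blast
  have "q' x \<le> bnd N a b" if "Q a b x" for a b x
    using assms(2)[OF that] N[of a b "g x"] by simp
  then show ?thesis unfolding FB_def by (intro exI[of _ "N"] allI impI)
qed

lemma PB_mono: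
  assumes "PB P q" "\<And>a b x. Q a b x \<Longrightarrow> P a b (g x) \<and> q' x \<le> q (g x)"
  shows "PB Q q'"
proof -
  obtain N where N: "\<And>a b x. P a b x \<Longrightarrow> q x \<le> tower N a" using assms(1) unfolding PB_def by blast
  have "q' x \<le> tower N a" if "Q a b x" for a b x
    using assms(2)[OF that] N[of a b "g x"] by simp
  then show ?thesis unfolding PB_def by (intro exI[of _ "N"] allI impI)
qed

lemma FB_add:
  assumes "FB P p" "FB P q"
  shows "FB P (\<lambda>x. p x + q x)"
proof -
  obtain N M where N: "\<And>a b x. P a b x \<Longrightarrow> p x \<le> bnd N a b"
    and M: "\<And>a b x. P a b x \<Longrightarrow> q x \<le> bnd M a b" using assms unfolding FB_def by metis
  have "p x + q x \<le> bnd (N + M + 4) a b" if "P a b x" for a b x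
    by (rule order_trans[OF add_mono[OF N[OF that] M[OF that]] bnd_add_le])
  then show ?thesis unfolding FB_def by (intro exI[of _ "N + M + 4"] allI impI)
qed

lemma FB_mult:
  assumes "FB P p" "FB P q"
  shows "FB P (\<lambda>x. p x * q x)"
proof -
  obtain N M where N: "\<And>a b x. P a b x \<Longrightarrow> p x \<le> bnd N a b"
    and M: "\<And>a b x. P a b x \<Longrightarrow> q x \<le> bnd M a b" using assms unfolding FB_def by metis
  have "p x * q x \<le> bnd (N + M + 2) a b" if "P a b x" for a b x
    by (rule order_trans[OF mult_le_mono[OF N[OF that] M[OF that]] bnd_mult_le])
  then show ?thesis unfolding FB_def by (intro exI[of _ "N + M + 2"] allI impI)
qed

lemma FB_Suc: "FB P p \<Longrightarrow> FB P (\<lambda>x. Suc (p x))"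
  using FB_add[OF _ FB_const[of P 1]] by simp

lemma PB_mult:
  assumes "PB P p" "PB P q"
  shows "PB P (\<lambda>x. p x * q x)"
proof -
  obtain N M where N: "\<And>a b x. P a b x \<Longrightarrow> p x \<le> tower N a"
    and M: "\<And>a b x. P a b x \<Longrightarrow> q x \<le> tower M a" using assms unfolding PB_def by metis
  have "p x * q x \<le> tower (N + M + 2) a" if "P a b x" for a b x
    by (rule order_trans[OF mult_le_mono[OF N[OF that] M[OF that]] tower_mult_le])
  then show ?thesis unfolding PB_def by (intro exI[of _ "N + M + 2"] allI impI)
qed

lemma PB_exp2: "PB P p \<Longrightarrow> PB P (\<lambda>x. 2 ^ p x)"
proof -
  assume "PB P p"
  then obtain N where N: "\<And>a b x. P a b x \<Longrightarrow> p x \<le> tower N a" unfolding PB_def by blast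
  then have "\<forall>a b x. P a b x \<longrightarrow> 2 ^ p x \<le> tower (Suc N) a" by simp
  then show ?thesis unfolding PB_def by blast
qed

lemma PB_power: "PB P p \<Longrightarrow> PB P q \<Longrightarrow> PB P (\<lambda>x. p x ^ q x)"
proof -
  assume "PB P p" "PB P q"
  then have "PB P (\<lambda>x. 2 ^ (p x * q x))" by (intro PB_exp2 PB_mult)
  then show ?thesis
  proof (rule PB_mono[where g = "\<lambda>x. x"])
    fix a b x assume "P a b x"
    have "p x ^ q x \<le> (2 ^ p x) ^ q x" by (intro power_mono) (auto simp: less_imp_le)
    then show "P a b x \<and> p x ^ q x \<le> 2 ^ (p x * q x)" using \<open>P a b x\<close> by (simp add: power_mult)
  qed
qed

text \<open>Exponentials reduce the sum to a product:
  \<open>p + q \<le> 2 ^ (p + q) = 2 ^ p * 2 ^ q\<close>.\<close>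

lemma PB_add: "PB P p \<Longrightarrow> PB P q \<Longrightarrow> PB P (\<lambda>x. p x + q x)"
proof -
  assume "PB P p" "PB P q"
  then have "PB P (\<lambda>x. 2 ^ p x * 2 ^ q x)" by (intro PB_exp2 PB_mult)
  then show ?thesis
    by (rule PB_mono[where g = "\<lambda>x. x"]) (simp add: power_add[symmetric] less_imp_le)
qed


section \<open>Programs on immutable trees\<close>

text \<open>Odd negative addresses are registers, the even negative ones form a heap of pairs of words;
  register 0 holds the first free cell. The word 0 represents the empty list, and cell numbers are
  positive, so that a test for positivity recognizes nonempty lists.\<close>

datatype tree = Leaf int | Node tree tree

class enc =
  fixes enc :: "'a \<Rightarrow> tree"

instantiation int :: enc
begin
definition "enc (n::int) = Leaf n"
instance ..
end

instantiation nat :: enc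
begin
definition "enc (n::nat) = Leaf (int n)"
instance ..
end

instantiation bool :: enc
begin
definition "enc (b::bool) = Leaf (if b then 1 else 0)"
instance ..
end

instantiation prod :: (enc, enc) enc
begin
definition "enc (p::'a \<times> 'b) = Node (enc (fst p)) (enc (snd p))"
instance ..
end

instantiation list :: (enc) enc
begin
primrec enc_list :: "'a list \<Rightarrow> tree" where
  "enc_list [] = Leaf 0"
| "enc_list (x # xs) = Node (enc x) (enc_list xs)"
instance ..
end

section \<open>Registers, heap cells and the representation of trees\<close>

definition reg :: "nat \<Rightarrow> int" where "reg k = - (2 * int k + 1)"
text \<open>All addresses of registers and cells are negative, so that the input and output in the
  registers 0, 1, 2, ... are left alone. The constant is the second factor because the weight of a
  product contains the length of the second factor.\<close>

definition hd_addr :: "int \<Rightarrow> int" where "hd_addr w = w * (-4)"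
definition tl_addr :: "int \<Rightarrow> int" where "tl_addr w = w * (-4) - 2"

lemma addr_simps [simp]:
  "reg j = reg k \<longleftrightarrow> j = k" "hd_addr v = hd_addr w \<longleftrightarrow> v = w" "tl_addr v = tl_addr w \<longleftrightarrow> v = w"
  "reg k \<noteq> hd_addr w" "reg k \<noteq> tl_addr w" "hd_addr v \<noteq> tl_addr w"
  "hd_addr w \<noteq> reg k" "tl_addr w \<noteq> reg k" "tl_addr w \<noteq> hd_addr v"
  unfolding reg_def hd_addr_def tl_addr_def by presburger+

text \<open>The bound by \<open>s (reg 0)\<close> says that the cell has been allocated; later
  allocations write only at or above the free pointer, so they preserve every represented tree.
  Subtrees may share cells, so copying a tree amounts to copying one word.\<close>

fun rep :: "memory \<Rightarrow> int \<Rightarrow> tree \<Rightarrow> bool" where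
  "rep s w (Leaf n) \<longleftrightarrow> w = n"
| "rep s w (Node l r) \<longleftrightarrow> 0 < w \<and> w < s (reg 0) \<and> rep s (s (hd_addr w)) l \<and> rep s (s (tl_addr w)) r"

definition keeps :: "nat \<Rightarrow> memory \<Rightarrow> memory \<Rightarrow> bool" where
  "keeps k s s' \<longleftrightarrow> s (reg 0) \<le> s' (reg 0) \<and>
     (\<forall>w. 0 < w \<and> w < s (reg 0) \<longrightarrow> s' (hd_addr w) = s (hd_addr w) \<and> s' (tl_addr w) = s (tl_addr w)) \<and>
     (\<forall>j. 1 \<le> j \<and> j < k \<longrightarrow> s' (reg j) = s (reg j))"

lemma keeps_trans: "keeps k s s' \<Longrightarrow> keeps k s' s'' \<Longrightarrow> keeps k s s''"
  unfolding keeps_def by (auto intro: less_le_trans order_trans)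

lemma keeps_le: "keeps k s s' \<Longrightarrow> j \<le> k \<Longrightarrow> keeps j s s'"
  unfolding keeps_def by auto

lemma keeps_reg: "keeps k s s' \<Longrightarrow> 1 \<le> j \<Longrightarrow> j < k \<Longrightarrow> s' (reg j) = s (reg j)"
  unfolding keeps_def by auto

lemma keeps_upd: "1 \<le> k \<Longrightarrow> k \<le> j \<Longrightarrow> keeps k s (s(reg j := v))"
  unfolding keeps_def by auto

lemma rep_keeps: "keeps k s s' \<Longrightarrow> rep s w t \<Longrightarrow> rep s' w t"
  by (induction t arbitrary: w) (auto simp: keeps_def)

lemma rep_upd [simp]: "1 \<le> k \<Longrightarrow> rep (s(reg k := v)) w t = rep s w t"
  by (induction t arbitrary: w) auto

definition live :: "memory \<Rightarrow> bool" where "live s \<longleftrightarrow> 1 \<le> s (reg 0)"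

lemma live_keeps: "keeps k s s' \<Longrightarrow> live s \<Longrightarrow> live s'"
  unfolding live_def keeps_def by auto

lemma live_upd [simp]: "1 \<le> k \<Longrightarrow> live (s(reg k := v)) = live s"
  unfolding live_def by auto

text \<open>The argument is passed and the result returned in register \<open>k\<close>; the registers below \<open>k\<close>
  are preserved.\<close>

definition implements ::
    "program \<Rightarrow> nat \<Rightarrow> nat \<Rightarrow> (nat \<Rightarrow> nat \<Rightarrow> 'x::enc \<Rightarrow> bool) \<Rightarrow> ('x \<Rightarrow> 'y::enc) \<Rightarrow> bool" where
  "implements c k N P f \<longleftrightarrow> (\<forall>a b x s. P a b x \<longrightarrow> live s \<longrightarrow> rep s (s (reg k)) (enc x) \<longrightarrow>
     (\<exists>n s'. brun c s n s' \<and> n \<le> bnd N a b \<and> keeps k s s' \<and> rep s' (s' (reg k)) (enc (f x))))"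

text \<open>\<open>FC P f\<close>: one program computes \<open>f\<close> on all \<open>x\<close> with \<open>P a b x\<close> for some \<open>a\<close> and \<open>b\<close>,
  within fixed-parameter tractable time with respect to the parameter \<open>a\<close> and the size \<open>b\<close>.\<close>

definition FC :: "(nat \<Rightarrow> nat \<Rightarrow> 'x::enc \<Rightarrow> bool) \<Rightarrow> ('x \<Rightarrow> 'y::enc) \<Rightarrow> bool" where
  "FC P f \<longleftrightarrow> (\<exists>c. \<forall>k\<ge>1. \<exists>N. implements (c k) k N P f)"

lemma implementsD:
  assumes "implements c k N P f" "P a b x" "live s" "rep s (s (reg k)) (enc x)"
  obtains n s' where "brun c s n s'" "n \<le> bnd N a b" "keeps k s s'"
    "rep s' (s' (reg k)) (enc (f x))" "live s'"
  using assms live_keeps unfolding implements_def by metis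

lemma FC_mono:
  assumes "FC P f" "\<And>a b x. Q a b x \<Longrightarrow> P a b x"
  shows "FC Q f"
  using assms unfolding FC_def implements_def by metis

lemma FC_cong:
  assumes "FC P f" "\<And>a b x. P a b x \<Longrightarrow> f x = g x"
  shows "FC P g"
  using assms unfolding FC_def implements_def by metis

text \<open>A program sees only encodings. Functions with results of different types but equal
  encodings therefore share a program, which transfers results between \<open>int\<close>,
  \<open>nat\<close> and \<open>bool\<close>.\<close>

lemma FC_enc_cong:
  assumes "FC P f" "\<And>a b x. P a b x \<Longrightarrow> enc (f x) = enc (g x)"
  shows "FC P g"
  using assms unfolding FC_def implements_def by metis

section \<open>Closure under constants, composition, constructors and arithmetic\<close>

lemma FC_store:
  assumes "\<And>k. 1 \<le> k \<Longrightarrow> \<exists>N. \<forall>a b x s. P a b x \<longrightarrow> rep s (s (reg k)) (enc x) \<longrightarrow>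
    weight (e k) s \<le> bnd N a b \<and> rep s (val (e k) s) (enc (f x))"
  shows "FC P f"
  unfolding FC_def
proof (intro exI[of _ "\<lambda>k. Store (Const (reg k)) (e k)"] allI impI)
  fix k :: nat assume k: "1 \<le> k"
  then obtain N where N: "\<And>a b x s. P a b x \<Longrightarrow> rep s (s (reg k)) (enc x) \<Longrightarrow>
    weight (e k) s \<le> bnd N a b \<and> rep s (val (e k) s) (enc (f x))" using assms by meson
  \<comment> \<open>The address of register \<open>k\<close> is itself charged, so the index of the
    bound depends on \<open>k\<close>.\<close>
  let ?C = "bit_length (reg k) + 2"
  have "implements (Store (Const (reg k)) (e k)) k (Suc ?C + N + 4) P f"
    unfolding implements_def
  proof (intro allI impI exI conjI)
    fix a b x s assume *: "P a b x" "live s" "rep s (s (reg k)) (enc x)"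
    let ?s = "s(reg k := val (e k) s)"
    have "?C + weight (e k) s \<le> bnd (Suc ?C) a b + bnd N a b"
      using N[OF *(1,3)] const_le_bnd by (intro add_mono) auto
    then show "?C + weight (e k) s \<le> bnd (Suc ?C + N + 4) a b"
      by (rule order_trans[OF _ bnd_add_le])
    show "brun (Store (Const (reg k)) (e k)) s (?C + weight (e k) s) ?s"
      by (rule brun_Store) auto
    show "keeps k s ?s" using k by (rule keeps_upd) simp
    show "rep ?s (?s (reg k)) (enc (f x))" using N[OF *(1,3)] k by simp
  qed
  then show "\<exists>N. implements (Store (Const (reg k)) (e k)) k N P f" by blast
qed

lemma FC_id: "FC P (\<lambda>x. x)"
proof (rule FC_store)
  fix k :: nat
  show "\<exists>N. \<forall>a b x s. P a b x \<longrightarrow> rep s (s (reg k)) (enc x) \<longrightarrow>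
    weight (Load (Const (reg k))) s \<le> bnd N a b \<and> rep s (val (Load (Const (reg k))) s) (enc x)"
    by (intro exI[of _ "Suc (bit_length (reg k) + 2)"]) (simp add: const_le_bnd)
qed

lemma FC_const_int: "FC P (\<lambda>x. n :: int)"
proof (rule FC_store)
  show "\<exists>N. \<forall>a b x s. P a b x \<longrightarrow> rep s (s (reg k)) (enc x) \<longrightarrow>
    weight (Const n) s \<le> bnd N a b \<and> rep s (val (Const n) s) (enc n)" for k
    by (intro exI[of _ "Suc (bit_length n)"]) (simp add: const_le_bnd enc_int_def)
qed

lemma FC_const_nat: "FC P (\<lambda>x. n :: nat)"
  by (rule FC_enc_cong[OF FC_const_int[of P "int n"]]) (simp add: enc_int_def enc_nat_def)

lemma FC_const_bool: "FC P (\<lambda>x. c :: bool)"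
  by (rule FC_enc_cong[OF FC_const_int[of P "if c then 1 else 0"]]) (simp add: enc_int_def enc_bool_def)

lemma FC_Nil: "FC P (\<lambda>x. [])"
  by (rule FC_enc_cong[OF FC_const_int[of P 0]]) (simp add: enc_int_def)

lemma FC_comp:
  assumes "FC P f" "FC Q g" "\<And>a b x. P a b x \<Longrightarrow> Q a b (f x)"
  shows "FC P (\<lambda>x. g (f x))"
proof -
  obtain c where "\<forall>k\<ge>1. \<exists>N. implements (c k) k N P f" using assms(1) unfolding FC_def by blast
  note c = this[rule_format]
  obtain d where "\<forall>k\<ge>1. \<exists>N. implements (d k) k N Q g" using assms(2) unfolding FC_def by blast
  note d = this[rule_format]
  show ?thesis unfolding FC_def
  proof (intro exI[of _ "\<lambda>k. Seq (c k) (d k)"] allI impI)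
    fix k :: nat assume k: "1 \<le> k"
    obtain N M where N: "implements (c k) k N P f" and M: "implements (d k) k M Q g"
      using c[OF k] d[OF k] by blast
    have "implements (Seq (c k) (d k)) k (N + M + 4) P (\<lambda>x. g (f x))"
      unfolding implements_def
    proof (intro allI impI)
      fix a b x s assume *: "P a b x" "live s" "rep s (s (reg k)) (enc x)"
      from implementsD[OF N *] obtain n s' where 1: "brun (c k) s n s'" "n \<le> bnd N a b"
        "keeps k s s'" "rep s' (s' (reg k)) (enc (f x))" "live s'" .
      from implementsD[OF M assms(3)[OF *(1)] 1(5,4)] obtain m s'' where
        2: "brun (d k) s' m s''" "m \<le> bnd M a b"
        "keeps k s' s''" "rep s'' (s'' (reg k)) (enc (g (f x)))" "live s''" .
      show "\<exists>n s'. brun (Seq (c k) (d k)) s n s' \<and> n \<le> bnd (N + M + 4) a b \<and> keeps k s s' \<and>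
          rep s' (s' (reg k)) (enc (g (f x)))"
        by (intro exI conjI) (rule brun_Seq[OF 1(1) 2(1)] keeps_trans[OF 1(3) 2(3)] 2(4)
          order_trans[OF add_mono[OF 1(2) 2(2)] bnd_add_le])+
    qed
    then show "\<exists>N. implements (Seq (c k) (d k)) k N P (\<lambda>x. g (f x))" by blast
  qed
qed

definition copy :: "nat \<Rightarrow> program" where
  "copy k = Store (Const (reg (Suc k))) (Load (Const (reg k)))"

definition copy_weight :: "nat \<Rightarrow> nat" where
  "copy_weight k = bit_length (reg k) + bit_length (reg (Suc k)) + 4"

lemma brun_copy: "brun (copy k) s (copy_weight k) (s(reg (Suc k) := s (reg k)))"
  unfolding copy_def copy_weight_def by (rule brun_Store) auto

text \<open>Running \<open>c\<close> one register higher on a copy of the argument keeps the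
  argument in register \<open>k\<close> for a later use.\<close>

lemma implements_copy:
  assumes c: "implements c (Suc k) N P f" and k: "1 \<le> k"
    and *: "P a b x" "live s" "rep s (s (reg k)) (enc x)"
  obtains n s' where "brun (Seq (copy k) c) s n s'" "n \<le> bnd (Suc (copy_weight k) + N + 4) a b"
    "keeps (Suc k) s s'" "s' (reg k) = s (reg k)" "rep s' (s' (reg (Suc k))) (enc (f x))" "live s'"
proof -
  let ?s = "s(reg (Suc k) := s (reg k))"
  have "rep ?s (?s (reg (Suc k))) (enc x)" "live ?s" using * by auto
  from implementsD[OF c *(1) this(2,1)] obtain n s' where
    1: "brun c ?s n s'" "n \<le> bnd N a b" "keeps (Suc k) ?s s'"
    "rep s' (s' (reg (Suc k))) (enc (f x))" "live s'" .
  show thesis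
  proof (rule that)
    show "brun (Seq (copy k) c) s (copy_weight k + n) s'" by (rule brun_Seq[OF brun_copy 1(1)])
    show "copy_weight k + n \<le> bnd (Suc (copy_weight k) + N + 4) a b"
      by (rule order_trans[OF add_mono[OF const_le_bnd 1(2)] bnd_add_le])
    show "keeps (Suc k) s s'" by (rule keeps_trans[OF keeps_upd 1(3)]) auto
    show "s' (reg k) = s (reg k)" using keeps_reg[OF 1(3) k] by simp
  qed (use 1 in auto)
qed

definition cons_cell :: "nat \<Rightarrow> program" where
  "cons_cell k =
     Seq (Store (Mult (Load (Const (reg 0))) (Const (-4))) (Load (Const (reg (Suc k)))))
    (Seq (Store (Sub (Mult (Load (Const (reg 0))) (Const (-4))) (Const 2)) (Load (Const (reg (Suc (Suc k))))))
    (Seq (Store (Const (reg k)) (Load (Const (reg 0))))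
         (Store (Const (reg 0)) (Add (Load (Const (reg 0))) (Const 1)))))"

lemma brun_cons_cell:
  "\<exists>n. \<forall>s. 1 \<le> k \<longrightarrow> live s \<longrightarrow> (\<exists>s'. brun (cons_cell k) s n s' \<and> keeps k s s' \<and>
     s' = s(hd_addr (s (reg 0)) := s (reg (Suc k)), tl_addr (s (reg 0)) := s (reg (Suc (Suc k))),
            reg k := s (reg 0), reg 0 := s (reg 0) + 1))"
proof -
  \<comment> \<open>A single crude bound on the charge of each of the four stores.\<close>
  let ?W = "bit_length (reg 0) + bit_length (reg 0) + bit_length (reg k) + bit_length (reg (Suc k)) + bit_length (reg (Suc (Suc k))) +
    bit_length 4 + bit_length 4 + bit_length 2 + bit_length 1 + 20"
  have "\<exists>s'. brun (cons_cell k) s (?W + (?W + (?W + ?W))) s' \<and> keeps k s s' \<and>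
     s' = s(hd_addr (s (reg 0)) := s (reg (Suc k)), tl_addr (s (reg 0)) := s (reg (Suc (Suc k))),
            reg k := s (reg 0), reg 0 := s (reg 0) + 1)"
    (is "\<exists>s'. _ \<and> _ \<and> s' = ?s4") if k: "1 \<le> k" and s: "live s" for s
  proof (intro exI conjI)
    let ?s1 = "s(hd_addr (s (reg 0)) := s (reg (Suc k)))"
    let ?s2 = "?s1(tl_addr (s (reg 0)) := s (reg (Suc (Suc k))))"
    let ?s3 = "?s2(reg k := s (reg 0))"
    show "brun (cons_cell k) s (?W + (?W + (?W + ?W))) ?s4" unfolding cons_cell_def
    proof (intro brun_Seq)
      show "brun (Store (Mult (Load (Const (reg 0))) (Const (-4))) (Load (Const (reg (Suc k))))) s ?W ?s1"
        by (rule brun_Store) (auto simp: hd_addr_def)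
      show "brun (Store (Sub (Mult (Load (Const (reg 0))) (Const (-4))) (Const 2))
          (Load (Const (reg (Suc (Suc k)))))) ?s1 ?W ?s2"
        by (rule brun_Store) (auto simp: tl_addr_def)
      show "brun (Store (Const (reg k)) (Load (Const (reg 0)))) ?s2 ?W ?s3"
        by (rule brun_Store) auto
      show "brun (Store (Const (reg 0)) (Add (Load (Const (reg 0))) (Const 1))) ?s3 ?W ?s4"
        using k by (intro brun_Store) (auto simp: fun_eq_iff)
    qed
    show "keeps k s ?s4" using k unfolding keeps_def by auto
  qed simp
  then show ?thesis by blast
qed

lemma rep_cons_cell:
  assumes "live s" "1 \<le> k" "rep s (s (reg (Suc k))) l" "rep s (s (reg (Suc (Suc k)))) r" "keeps k s s'"
    and s': "s' = s(hd_addr (s (reg 0)) := s (reg (Suc k)), tl_addr (s (reg 0)) := s (reg (Suc (Suc k))),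
            reg k := s (reg 0), reg 0 := s (reg 0) + 1)"
  shows "rep s' (s' (reg k)) (Node l r)"
proof -
  have "rep s' (s (reg (Suc k))) l" "rep s' (s (reg (Suc (Suc k)))) r"
    using rep_keeps[OF assms(5)] assms by auto
  then show ?thesis using assms(1,2) unfolding live_def s' by simp
qed

text \<open>While the two components are computed, register \<open>k\<close> holds the argument, the
  next one the first component and the one after it the second. As only the encoding of
  \<open>h\<close> has to be a node, this covers both pairs and nonempty lists.\<close>

lemma FC_Node:
  assumes "FC P f" "FC P g" "\<And>x. enc (h x) = Node (enc (f x)) (enc (g x))"
  shows "FC P h"
proof -
  obtain c where "\<forall>k\<ge>1. \<exists>N. implements (c k) k N P f" using assms(1) unfolding FC_def by blast
  note c = this[rule_format]
  obtain d where "\<forall>k\<ge>1. \<exists>N. implements (d k) k N P g" using assms(2) unfolding FC_def by blast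
  note d = this[rule_format]
  let ?p = "\<lambda>k. Seq (Seq (copy k) (c (Suc k))) (Seq (Seq (Store (Const (reg (Suc (Suc k)))) (Load (Const (reg k))))
    (d (Suc (Suc k)))) (cons_cell k))"
  have "\<exists>N. implements (?p k) k N P h" if k: "1 \<le> k" for k
  proof -
    obtain N M where N: "implements (c (Suc k)) (Suc k) N P f"
      and M: "implements (d (Suc (Suc k))) (Suc (Suc k)) M P g"
      using c[of "Suc k"] d[of "Suc (Suc k)"] by auto
    obtain e where e: "\<And>s. live s \<Longrightarrow> \<exists>s'. brun (cons_cell k) s e s' \<and> keeps k s s' \<and>
     s' = s(hd_addr (s (reg 0)) := s (reg (Suc k)), tl_addr (s (reg 0)) := s (reg (Suc (Suc k))),
            reg k := s (reg 0), reg 0 := s (reg 0) + 1)"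
      using brun_cons_cell[of k] k by blast
    let ?w = "bit_length (reg (Suc (Suc k))) + bit_length (reg k) + 4"
    let ?B = "\<lambda>a b. bnd (Suc (copy_weight k) + N + 4) a b + ((?w + bnd M a b) + e)"
    have "FB (\<lambda>a b x. x = (a, b)) (\<lambda>(a, b). ?B a b)"
      unfolding split_beta by (intro FB_add FB_const FB_bnd)
    then obtain K where K: "\<And>a b. ?B a b \<le> bnd K a b" unfolding FB_def by fast
    have "implements (?p k) k K P h"
      unfolding implements_def
    proof (intro allI impI)
      fix a b x s assume *: "P a b x" "live s" "rep s (s (reg k)) (enc x)"
      from implements_copy[OF N k *] obtain n s1 where
        1: "brun (Seq (copy k) (c (Suc k))) s n s1" "n \<le> bnd (Suc (copy_weight k) + N + 4) a b"
        "keeps (Suc k) s s1" "s1 (reg k) = s (reg k)" "rep s1 (s1 (reg (Suc k))) (enc (f x))" "live s1" .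
      let ?s2 = "s1(reg (Suc (Suc k)) := s1 (reg k))"
      have 2: "brun (Store (Const (reg (Suc (Suc k)))) (Load (Const (reg k)))) s1 ?w ?s2"
        by (rule brun_Store) auto
      have k2: "keeps (Suc (Suc k)) s1 ?s2" by (rule keeps_upd) auto
      have "rep ?s2 (?s2 (reg (Suc (Suc k)))) (enc x)" "live ?s2"
        using * 1 rep_keeps[OF 1(3) *(3)] by auto
      from implementsD[OF M *(1) this(2,1)] obtain m s3 where
        3: "brun (d (Suc (Suc k))) ?s2 m s3" "m \<le> bnd M a b" "keeps (Suc (Suc k)) ?s2 s3"
        "rep s3 (s3 (reg (Suc (Suc k)))) (enc (g x))" "live s3" .
      have k3: "keeps (Suc (Suc k)) s1 s3" by (rule keeps_trans[OF k2 3(3)])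
      have r: "rep s3 (s3 (reg (Suc k))) (enc (f x))"
        using rep_keeps[OF k3 1(5)] keeps_reg[OF k3, of "Suc k"] by simp
      obtain s4 where 4: "brun (cons_cell k) s3 e s4" "keeps k s3 s4"
        "s4 = s3(hd_addr (s3 (reg 0)) := s3 (reg (Suc k)), tl_addr (s3 (reg 0)) := s3 (reg (Suc (Suc k))),
            reg k := s3 (reg 0), reg 0 := s3 (reg 0) + 1)" using e[OF 3(5)] by blast
      have "keeps k s s4"
        using keeps_trans[OF keeps_le[OF 1(3)] keeps_trans[OF keeps_le[OF k3] 4(2)]] by simp
      moreover have "rep s4 (s4 (reg k)) (enc (h x))"
        using rep_cons_cell[OF 3(5) k r 3(4) 4(2,3)] assms(3) by simp
      moreover have "brun (?p k) s (n + ((?w + m) + e)) s4"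
        by (intro brun_Seq) (rule 1 2 3 4)+
      moreover have "n + ((?w + m) + e) \<le> bnd K a b"
        using 1(2) 3(2) K[of a b] by linarith
      ultimately show "\<exists>n s'. brun (?p k) s n s' \<and> n \<le> bnd K a b \<and> keeps k s s' \<and>
          rep s' (s' (reg k)) (enc (h x))" by blast
    qed
    then show ?thesis by blast
  qed
  then show ?thesis unfolding FC_def by (intro exI[of _ ?p]) simp
qed

lemma FC_Pair: "FC P f \<Longrightarrow> FC P g \<Longrightarrow> FC P (\<lambda>x. (f x, g x))"
  by (rule FC_Node) (auto simp: enc_prod_def)

lemma FC_Cons: "FC P f \<Longrightarrow> FC P g \<Longrightarrow> FC P (\<lambda>x. f x # g x)"
  by (rule FC_Node) auto

lemma FC_apply1:
  assumes "\<And>k. \<exists>W. \<forall>a b x s. P a b x \<longrightarrow> rep s (s (reg k)) (enc x) \<longrightarrow>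
    weight (e (Load (Const (reg k)))) s \<le> W \<and> rep s (val (e (Load (Const (reg k)))) s) (enc (f x))"
  shows "FC P f"
proof (rule FC_store)
  fix k :: nat
  obtain W where "\<And>a b x s. P a b x \<Longrightarrow> rep s (s (reg k)) (enc x) \<Longrightarrow>
    weight (e (Load (Const (reg k)))) s \<le> W \<and> rep s (val (e (Load (Const (reg k)))) s) (enc (f x))"
    using assms by metis
  then show "\<exists>N. \<forall>a b x s. P a b x \<longrightarrow> rep s (s (reg k)) (enc x) \<longrightarrow>
    weight (e (Load (Const (reg k)))) s \<le> bnd N a b \<and> rep s (val (e (Load (Const (reg k)))) s) (enc (f x))"
    by (intro exI[of _ "Suc W"]) (metis const_le_bnd le_trans)
qed

definition Hd :: "expr \<Rightarrow> expr" where "Hd e = Load (Mult e (Const (-4)))"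
definition Tl :: "expr \<Rightarrow> expr" where "Tl e = Load (Sub (Mult e (Const (-4))) (Const 2))"

lemma Hd_Tl_simps [simp]:
  "val (Hd e) s = s (hd_addr (val e s))" "val (Tl e) s = s (tl_addr (val e s))"
  "weight (Hd e) s = weight e s + 2 * bit_length 4 + 4"
  "weight (Tl e) s = weight e s + 2 * bit_length 4 + bit_length 2 + 6"
  by (auto simp: Hd_def Tl_def hd_addr_def tl_addr_def)

lemma FC_fst: "FC P f \<Longrightarrow> FC P (\<lambda>x. fst (f x))"
  by (erule FC_comp[where g = fst and Q = "\<lambda>_ _ _. True"])
    (rule FC_apply1[where e = Hd], auto simp: enc_prod_def)

lemma FC_snd: "FC P f \<Longrightarrow> FC P (\<lambda>x. snd (f x))"
  by (erule FC_comp[where g = snd and Q = "\<lambda>_ _ _. True"])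
    (rule FC_apply1[where e = Tl], auto simp: enc_prod_def)

lemma FC_hd:
  assumes "FC P f" "\<And>a b x. P a b x \<Longrightarrow> f x \<noteq> []"
  shows "FC P (\<lambda>x. hd (f x))"
proof (rule FC_comp[where g = hd and Q = "\<lambda>_ _ x. x \<noteq> []"])
  show "FC (\<lambda>_ _ x. x \<noteq> []) (hd :: 'b list \<Rightarrow> 'b)"
    by (rule FC_apply1[where e = Hd]) (auto simp: neq_Nil_conv)
qed (use assms in auto)

lemma FC_tl:
  assumes "FC P f" "\<And>a b x. P a b x \<Longrightarrow> f x \<noteq> []"
  shows "FC P (\<lambda>x. tl (f x))"
proof (rule FC_comp[where g = tl and Q = "\<lambda>_ _ x. x \<noteq> []"])
  show "FC (\<lambda>_ _ x. x \<noteq> []) (tl :: 'b list \<Rightarrow> 'b list)"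
    by (rule FC_apply1[where e = Tl]) (auto simp: neq_Nil_conv)
qed (use assms in auto)

text \<open>One argument for all binary arithmetic: \<open>F\<close> is the operation on words,
  \<open>E\<close> the expression that performs it, \<open>w\<close> its surcharge in the weight,
  nonzero only for products, and \<open>P'\<close> the condition under which \<open>F\<close> on the
  words agrees with the operation on the values, as needed for subtraction of natural
  numbers.\<close>

lemma FC_apply2:
  assumes "FC P f" "FC P g"
    and "\<And>x. P' x \<Longrightarrow> enc (h x) = Leaf (F (u x) (v x))" "\<And>x. enc (f x) = Leaf (u x)" "\<And>x. enc (g x) = Leaf (v x)"
    and "\<And>d e s. val (E d e) s = F (val d s) (val e s)"
      "\<And>d e s. weight (E d e) s = weight d s + weight e s + w (val e s) + 2"
    and "FB P (\<lambda>x. w (v x))" and "\<And>a b x. P a b x \<Longrightarrow> P' x"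
  shows "FC P h"
proof -
  obtain N where N: "\<And>a b x. P a b x \<Longrightarrow> w (v x) \<le> bnd N a b" using assms(8) unfolding FB_def by metis
  have 1: "FC P (\<lambda>x. (f x, g x))" by (rule FC_Pair) fact+
  let ?Q = "\<lambda>a b p. \<exists>x y. enc (fst p) = Leaf x \<and> enc (snd p) = Leaf y \<and> w y \<le> bnd N a b"
  have "FC ?Q (\<lambda>p. F (case enc (fst p) of Leaf x \<Rightarrow> x) (case enc (snd p) of Leaf x \<Rightarrow> x))"
  proof (rule FC_store)
    fix k :: nat
    let ?R = "Load (Const (reg k))"
    let ?C = "weight (Hd ?R) (\<lambda>_. 0) + weight (Tl ?R) (\<lambda>_. 0) + 2"
    have "?C + x \<le> bnd (Suc ?C + N + 4) a b" if "x \<le> bnd N a b" for x a b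
      by (rule order_trans[OF _ bnd_add_le]) (intro add_mono const_le_bnd that)
    then show "\<exists>N. \<forall>a b p s. ?Q a b p \<longrightarrow> rep s (s (reg k)) (enc p) \<longrightarrow>
      weight (E (Hd ?R) (Tl ?R)) s \<le> bnd N a b \<and>
      rep s (val (E (Hd ?R) (Tl ?R)) s)
        (enc (F (case enc (fst p) of Leaf x \<Rightarrow> x) (case enc (snd p) of Leaf x \<Rightarrow> x)))"
      by (intro exI[of _ "Suc ?C + N + 4"])
        (auto simp: assms(6,7) enc_prod_def enc_int_def ac_simps)
  qed
  from FC_comp[OF 1 this] have "FC P (\<lambda>x. F (u x) (v x))"
    using N by (simp add: assms(4,5))
  then show ?thesis
    by (rule FC_enc_cong) (use assms(3,9) in \<open>auto simp: enc_int_def\<close>)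
qed

lemma FC_add_int: "FC P f \<Longrightarrow> FC P g \<Longrightarrow> FC P (\<lambda>x. f x + g x :: int)"
  by (erule (1) FC_apply2[where F = "(+)" and u = f and v = g and E = Add and w = "\<lambda>_. 0" and P' = "\<lambda>_. True"])
    (auto simp: enc_int_def intro: FB_const)

lemma FC_diff_int: "FC P f \<Longrightarrow> FC P g \<Longrightarrow> FC P (\<lambda>x. f x - g x :: int)"
  by (erule (1) FC_apply2[where F = "(-)" and u = f and v = g and E = Sub and w = "\<lambda>_. 0" and P' = "\<lambda>_. True"])
    (auto simp: enc_int_def intro: FB_const)

lemma FC_div_int: "FC P f \<Longrightarrow> FC P g \<Longrightarrow> FC P (\<lambda>x. f x div g x :: int)"
  by (erule (1) FC_apply2[where F = "(div)" and u = f and v = g and E = Div and w = "\<lambda>_. 0" and P' = "\<lambda>_. True"])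
    (auto simp: enc_int_def intro: FB_const)

lemma FC_mult_int: "FC P f \<Longrightarrow> FC P g \<Longrightarrow> FB P (\<lambda>x. bit_length (g x)) \<Longrightarrow> FC P (\<lambda>x. f x * g x :: int)"
  by (erule (1) FC_apply2[where F = "(*)" and u = f and v = g and E = Mult and w = bit_length and P' = "\<lambda>_. True"])
    (auto simp: enc_int_def)

text \<open>The remainder is computed as \<open>x - x div y * y\<close>, and the product in it is
  the reason for the bound on the length of the modulus.\<close>

lemma FC_mod_int: "FC P f \<Longrightarrow> FC P g \<Longrightarrow> FB P (\<lambda>x. bit_length (g x)) \<Longrightarrow> FC P (\<lambda>x. f x mod g x :: int)"
  unfolding minus_div_mult_eq_mod[symmetric]
  by (intro FC_diff_int FC_mult_int FC_div_int)

lemma FC_add_nat: "FC P f \<Longrightarrow> FC P g \<Longrightarrow> FC P (\<lambda>x. f x + g x :: nat)"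
  by (erule (1) FC_apply2[where F = "(+)" and u = "\<lambda>x. int (f x)" and v = "\<lambda>x. int (g x)" and E = Add
        and w = "\<lambda>_. 0" and P' = "\<lambda>_. True"])
    (auto simp: enc_nat_def intro: FB_const)

lemma FC_Suc: "FC P f \<Longrightarrow> FC P (\<lambda>x. Suc (f x))"
  using FC_add_nat[OF _ FC_const_nat[of P 1]] by simp

lemma FC_diff_nat:
  "FC P f \<Longrightarrow> FC P g \<Longrightarrow> (\<And>a b x. P a b x \<Longrightarrow> g x \<le> f x) \<Longrightarrow> FC P (\<lambda>x. f x - g x :: nat)"
  by (erule (1) FC_apply2[where F = "(-)" and u = "\<lambda>x. int (f x)" and v = "\<lambda>x. int (g x)" and E = Sub
        and w = "\<lambda>_. 0" and P' = "\<lambda>x. g x \<le> f x"])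
    (auto simp: enc_nat_def of_nat_diff intro: FB_const)

lemma bit_length_nat_le: "bit_length (int n) \<le> Suc n"
  by (subst bit_length_le_iff) (metis abs_of_nat le_add1 less_exp less_trans lessI of_nat_less_numeral_power_cancel_iff
      plus_1_eq_Suc power_strict_increasing_iff one_less_numeral_iff semiring_norm(76))

lemma FC_mult_nat:
  assumes "FC P f" "FC P g" "FB P g"
  shows "FC P (\<lambda>x. f x * g x :: nat)"
proof (rule FC_apply2[where F = "(*)" and u = "\<lambda>x. int (f x)" and v = "\<lambda>x. int (g x)" and E = Mult
        and w = bit_length and P' = "\<lambda>_. True", OF assms(1,2)])
  show "FB P (\<lambda>x. bit_length (int (g x)))"
    by (rule FB_mono[OF FB_Suc[OF assms(3)], where g = "\<lambda>x. x"]) (simp add: bit_length_nat_le)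
qed (auto simp: enc_nat_def)

lemma FC_of_nat: "FC P f \<Longrightarrow> FC P (\<lambda>x. int (f x))"
  by (erule FC_enc_cong) (simp add: enc_nat_def enc_int_def)

section \<open>Tests, conditionals and loops\<close>

lemma FB_binary: "\<exists>K. \<forall>a b. bnd N a b + bnd M a b + n \<le> bnd K a b"
proof -
  have "FB (\<lambda>a b x. x = (a, b)) (\<lambda>x. bnd N (fst x) (snd x) + bnd M (fst x) (snd x) + n)"
    by (intro FB_add FB_const FB_bnd)
  then show ?thesis unfolding FB_def by fastforce
qed

text \<open>Each branch may assume the outcome of the test, so partial operations such as
  \<open>hd\<close> can be guarded by a test for emptiness.\<close>

lemma FC_If:
  assumes "FC P t" "FC (\<lambda>a b x. P a b x \<and> t x) f" "FC (\<lambda>a b x. P a b x \<and> \<not> t x) g"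
  shows "FC P (\<lambda>x. if t x then f x else g x)"
proof -
  obtain e where "\<forall>k\<ge>1. \<exists>N. implements (e k) k N P t" using assms(1) unfolding FC_def by blast
  note e = this[rule_format]
  obtain c where "\<forall>k\<ge>1. \<exists>N. implements (c k) k N (\<lambda>a b x. P a b x \<and> t x) f" using assms(2) unfolding FC_def by blast
  note c = this[rule_format]
  obtain d where "\<forall>k\<ge>1. \<exists>N. implements (d k) k N (\<lambda>a b x. P a b x \<and> \<not> t x) g" using assms(3) unfolding FC_def by blast
  note d = this[rule_format]
  let ?e = "\<lambda>k. Load (Const (reg (Suc k)))"
  let ?p = "\<lambda>k. Seq (Seq (copy k) (e (Suc k))) (If (?e k) (c k) (d k))"
  show ?thesis unfolding FC_def
  proof (intro exI[of _ ?p] allI impI)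
    fix k :: nat assume k: "1 \<le> k"
    obtain N M L where N: "implements (e (Suc k)) (Suc k) N P t"
      and M: "implements (c k) k M (\<lambda>a b x. P a b x \<and> t x) f"
      and L: "implements (d k) k L (\<lambda>a b x. P a b x \<and> \<not> t x) g"
      using e[of "Suc k"] c[OF k] d[OF k] by auto
    let ?w = "bit_length (reg (Suc k)) + 2"
    obtain K where "\<forall>a b. bnd (Suc (copy_weight k) + N + 4) a b + bnd (M + L) a b + ?w \<le> bnd K a b" using FB_binary by blast
    note K = this[rule_format]
    have "implements (?p k) k K P (\<lambda>x. if t x then f x else g x)"
      unfolding implements_def
    proof (intro allI impI)
      fix a b x s assume *: "P a b x" "live s" "rep s (s (reg k)) (enc x)"
      from implements_copy[OF N k *] obtain n s1 where
        1: "brun (Seq (copy k) (e (Suc k))) s n s1" "n \<le> bnd (Suc (copy_weight k) + N + 4) a b"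
        "keeps (Suc k) s s1" "s1 (reg k) = s (reg k)" "rep s1 (s1 (reg (Suc k))) (enc (t x))" "live s1" .
      have r: "rep s1 (s1 (reg k)) (enc x)" using rep_keeps[OF 1(3) *(3)] 1(4) by simp
      have v: "val (?e k) s1 = (if t x then 1 else 0)" using 1(5) by (simp add: enc_bool_def)
      have "\<exists>m s2. (t x \<longrightarrow> brun (c k) s1 m s2) \<and> (\<not> t x \<longrightarrow> brun (d k) s1 m s2) \<and> m \<le> bnd (M + L) a b \<and>
          keeps k s1 s2 \<and> rep s2 (s2 (reg k)) (enc (if t x then f x else g x))"
      proof (cases "t x")
        case True
        then have "P a b x \<and> t x" using *(1) by simp
        from implementsD[OF M this 1(6) r] obtain m s2 where
          2: "brun (c k) s1 m s2" "m \<le> bnd M a b" "keeps k s1 s2" "rep s2 (s2 (reg k)) (enc (f x))" .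
        from 2(2) have "m \<le> bnd (M + L) a b" by (rule order_trans) (rule bnd_mono, simp)
        then show ?thesis using True 2 by auto
      next
        case False
        then have "P a b x \<and> \<not> t x" using *(1) by simp
        from implementsD[OF L this 1(6) r] obtain m s2 where
          2: "brun (d k) s1 m s2" "m \<le> bnd L a b" "keeps k s1 s2" "rep s2 (s2 (reg k)) (enc (g x))" .
        from 2(2) have "m \<le> bnd (M + L) a b" by (rule order_trans) (rule bnd_mono, simp)
        then show ?thesis using False 2 by auto
      qed
      then obtain m s2 where 2: "t x \<Longrightarrow> brun (c k) s1 m s2" "\<not> t x \<Longrightarrow> brun (d k) s1 m s2"
        "m \<le> bnd (M + L) a b" "keeps k s1 s2" "rep s2 (s2 (reg k)) (enc (if t x then f x else g x))"
        by blast
      have "brun (If (?e k) (c k) (d k)) s1 (weight (?e k) s1 + m) s2"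
        by (rule brun_If) (use v 2 in \<open>auto split: if_splits\<close>)
      from brun_Seq[OF 1(1) this] have "brun (?p k) s (n + (weight (?e k) s1 + m)) s2" .
      moreover have "n + (weight (?e k) s1 + m) \<le> bnd K a b"
        using 1(2) 2(3) K[of a b] by simp
      moreover have "keeps k s s2" using keeps_trans[OF keeps_le[OF 1(3)] 2(4)] by simp
      ultimately show "\<exists>n s'. brun (?p k) s n s' \<and> n \<le> bnd K a b \<and> keeps k s s' \<and>
          rep s' (s' (reg k)) (enc (if t x then f x else g x))" using 2(5) by blast
    qed
    then show "\<exists>N. implements (?p k) k N P (\<lambda>x. if t x then f x else g x)" by blast
  qed
qed

lemma FC_positive:
  assumes "\<And>a b x s w. P a b x \<Longrightarrow> rep s w (enc x) \<Longrightarrow> 0 < w \<longleftrightarrow> t x"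
  shows "FC P t"
  unfolding FC_def
proof (intro exI[of _ "\<lambda>k. If (Load (Const (reg k))) (Store (Const (reg k)) (Const 1))
    (Store (Const (reg k)) (Const 0))"] allI impI)
  fix k :: nat assume k: "1 \<le> k"
  let ?p = "\<lambda>k. If (Load (Const (reg k))) (Store (Const (reg k)) (Const 1)) (Store (Const (reg k)) (Const 0))"
  let ?w = "bit_length (reg k) + 2 + (bit_length (reg k) + bit_length 1 + bit_length 0 + 2)"
  have "implements (?p k) k (Suc ?w) P t"
    unfolding implements_def
  proof (intro allI impI exI conjI)
    fix a b x s assume *: "P a b x" "live s" "rep s (s (reg k)) (enc x)"
    let ?s = "s(reg k := if t x then 1 else 0)"
    have "brun (?p k) s (weight (Load (Const (reg k))) s + (bit_length (reg k) + bit_length 1 + bit_length 0 + 2)) ?s"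
      using assms[OF *(1,3)] by (intro brun_If brun_Store) auto
    then show "brun (?p k) s ?w ?s" by simp
    show "?w \<le> bnd (Suc ?w) a b" by (rule const_le_bnd)
    show "keeps k s ?s" using k by (rule keeps_upd) simp
    show "rep ?s (?s (reg k)) (enc (t x))" by (simp add: enc_bool_def)
  qed
  then show "\<exists>N. implements (?p k) k N P t" by blast
qed

lemma FC_pos_int: "FC P f \<Longrightarrow> FC P (\<lambda>x. 0 < (f x :: int))"
  by (erule FC_comp[where g = "\<lambda>x. 0 < x" and Q = "\<lambda>_ _ _. True"])
    (rule FC_positive, auto simp: enc_int_def)

lemma FC_not_Nil: "FC P f \<Longrightarrow> FC P (\<lambda>x. f x \<noteq> [])"
proof (erule FC_comp[where g = "\<lambda>x. x \<noteq> []" and Q = "\<lambda>_ _ _. True"])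
  have "rep s w (enc x) \<Longrightarrow> (0 < w) = (x \<noteq> [])" for s w and x :: "'b list"
    by (cases x) auto
  then show "FC (\<lambda>_ _ _. True) (\<lambda>x::'b list. x \<noteq> [])" by (rule FC_positive)
qed simp

lemma FC_less_int: "FC P f \<Longrightarrow> FC P g \<Longrightarrow> FC P (\<lambda>x. f x < (g x :: int))"
  using FC_pos_int[OF FC_diff_int, of P g f] by simp

lemma FC_Not: "FC P t \<Longrightarrow> FC P (\<lambda>x. \<not> t x)"
  by (drule FC_If[OF _ FC_const_bool[of _ False] FC_const_bool[of _ True]], erule FC_cong) simp

lemma FC_conj:
  assumes "FC P t" "FC P u"
  shows "FC P (\<lambda>x. t x \<and> u x)"
proof -
  have "FC (\<lambda>a b x. P a b x \<and> t x) u" using assms(2) by (rule FC_mono) simp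
  from FC_If[OF assms(1) this FC_const_bool[of _ False]] show ?thesis
    by (rule FC_cong) simp
qed

lemma FC_le_int: "FC P f \<Longrightarrow> FC P g \<Longrightarrow> FC P (\<lambda>x. f x \<le> (g x :: int))"
  using FC_Not[OF FC_less_int, of P g f] by (simp add: not_less)

lemma FC_eq_int: "FC P f \<Longrightarrow> FC P g \<Longrightarrow> FC P (\<lambda>x. f x = (g x :: int))"
  unfolding order_eq_iff by (intro FC_conj FC_le_int)

lemma FC_less_nat: "FC P f \<Longrightarrow> FC P g \<Longrightarrow> FC P (\<lambda>x. f x < (g x :: nat))"
  using FC_less_int[OF FC_of_nat FC_of_nat, of P f g] by simp

lemma FC_eq_nat: "FC P f \<Longrightarrow> FC P g \<Longrightarrow> FC P (\<lambda>x. f x = (g x :: nat))"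
  using FC_eq_int[OF FC_of_nat FC_of_nat, of P f g] by simp

text \<open>The invariant is preserved for the same \<open>a\<close> and \<open>b\<close>. Every
  iteration therefore obeys one and the same bound instead of bounds that accumulate, and the
  measure limits the number of iterations.\<close>

lemma FC_while:
  assumes "FC P t" "FC (\<lambda>a b x. P a b x \<and> t x) f" "FB P m"
    and inv: "\<And>a b x. P a b x \<Longrightarrow> t x \<Longrightarrow> P a b (f x) \<and> m (f x) < m x"
  shows "FC P (while t f)"
proof -
  obtain e where "\<forall>k\<ge>1. \<exists>N. implements (e k) k N P t" using assms(1) unfolding FC_def by blast
  note e = this[rule_format]
  obtain c where "\<forall>k\<ge>1. \<exists>N. implements (c k) k N (\<lambda>a b x. P a b x \<and> t x) f" using assms(2) unfolding FC_def by blast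
  note c = this[rule_format]
  obtain L where L: "\<And>a b x. P a b x \<Longrightarrow> m x \<le> bnd L a b" using assms(3) unfolding FB_def by metis
  let ?e = "\<lambda>k. Load (Const (reg (Suc k)))"
  let ?t = "\<lambda>k. Seq (copy k) (e (Suc k))"
  let ?w = "\<lambda>k. While (?e k) (Seq (c k) (?t k))"
  let ?p = "\<lambda>k. Seq (?t k) (?w k)"
  show ?thesis unfolding FC_def
  proof (intro exI[of _ ?p] allI impI)
    fix k :: nat assume k: "1 \<le> k"
    obtain N M where N: "implements (e (Suc k)) (Suc k) N P t"
      and M: "implements (c k) k M (\<lambda>a b x. P a b x \<and> t x) f"
      using e[of "Suc k"] c[OF k] by auto
    let ?W = "bit_length (reg (Suc k)) + 2"
    let ?N = "Suc (copy_weight k) + N + 4"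
    obtain K where "\<forall>a b. bnd ?N a b + bnd M a b + ?W \<le> bnd K a b" using FB_binary by blast
    note K = this[rule_format]
    \<comment> \<open>The 1 added to the measure pays for the last evaluation of the loop
      test.\<close>
    have loop: "\<exists>n s'. brun (?w k) s n s' \<and> n \<le> (m x + 1) * bnd K a b \<and> keeps k s s' \<and>
          rep s' (s' (reg k)) (enc (while t f x))"
      if "P a b x" "live s" "rep s (s (reg k)) (enc x)" "rep s (s (reg (Suc k))) (enc (t x))" for a b x s
      using that
    proof (induction "m x" arbitrary: x s rule: less_induct)
      case less
      show ?case
      proof (cases "t x")
        case False
        then have "s (reg (Suc k)) = 0" using less.prems by (simp add: enc_bool_def)
        then have "brun (?w k) s (weight (?e k) s) s" by (intro brun_While_False) simp
        moreover have "weight (?e k) s \<le> (m x + 1) * bnd K a b"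
          using K[of a b] by simp
        moreover have "while t f x = x" using False by (simp add: while_unfold)
        ultimately show ?thesis using less.prems
          by (intro exI[of _ "weight (?e k) s"] exI[of _ s]) (simp add: keeps_def)
      next
        case True
        have w: "while t f x = while t f (f x)" using True by (subst while_unfold) simp
        have v: "0 < val (?e k) s" using True less.prems by (simp add: enc_bool_def)
        have "P a b x \<and> t x" using True less.prems(1) by simp
        from implementsD[OF M this less.prems(2,3)] obtain n s1 where
          1: "brun (c k) s n s1" "n \<le> bnd M a b" "keeps k s s1" "rep s1 (s1 (reg k)) (enc (f x))" "live s1" .
        from inv[OF less.prems(1) True] have i: "P a b (f x)" "m (f x) < m x" by auto
        from implements_copy[OF N k i(1) 1(5,4)] obtain n' s2 where
          2: "brun (?t k) s1 n' s2" "n' \<le> bnd ?N a b" "keeps (Suc k) s1 s2" "s2 (reg k) = s1 (reg k)"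
          "rep s2 (s2 (reg (Suc k))) (enc (t (f x)))" "live s2" .
        have "rep s2 (s2 (reg k)) (enc (f x))" using rep_keeps[OF 2(3) 1(4)] 2(4) by simp
        from less.hyps[OF i(2,1) 2(6) this 2(5)] obtain n'' s3 where
          3: "brun (?w k) s2 n'' s3" "n'' \<le> (m (f x) + 1) * bnd K a b" "keeps k s2 s3"
          "rep s3 (s3 (reg k)) (enc (while t f (f x)))" by blast
        have "brun (?w k) s (weight (?e k) s + (n + n') + n'') s3"
          by (rule brun_While_True[OF v brun_Seq[OF 1(1) 2(1)] 3(1)])
        moreover have "weight (?e k) s + (n + n') + n'' \<le> (m x + 1) * bnd K a b"
        proof -
          have "weight (?e k) s + (n + n') \<le> bnd K a b" using K[of a b] 1(2) 2(2) by simp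
          moreover have "n'' \<le> m x * bnd K a b"
            using i(2) by (intro order_trans[OF 3(2)] mult_le_mono1) simp
          ultimately show ?thesis by simp
        qed
        moreover have "keeps k s s3"
          using keeps_trans[OF 1(3) keeps_trans[OF keeps_le[OF 2(3)] 3(3)]] by simp
        ultimately show ?thesis using 3(4) unfolding w by blast
      qed
    qed
    have "FB (\<lambda>a b x. x = (a, b)) (\<lambda>x. bnd ?N (fst x) (snd x) + (bnd L (fst x) (snd x) + 1) * bnd K (fst x) (snd x))"
      by (intro FB_add FB_mult FB_const FB_bnd)
    then obtain J where J: "\<And>a b. bnd ?N a b + (bnd L a b + 1) * bnd K a b \<le> bnd J a b"
      unfolding FB_def by fastforce
    have "implements (?p k) k J P (while t f)"
      unfolding implements_def
    proof (intro allI impI)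
      fix a b x s assume *: "P a b x" "live s" "rep s (s (reg k)) (enc x)"
      from implements_copy[OF N k *] obtain n s1 where
        1: "brun (?t k) s n s1" "n \<le> bnd ?N a b"
        "keeps (Suc k) s s1" "s1 (reg k) = s (reg k)" "rep s1 (s1 (reg (Suc k))) (enc (t x))" "live s1" .
      have r: "rep s1 (s1 (reg k)) (enc x)" using rep_keeps[OF 1(3) *(3)] 1(4) by simp
      obtain n' s2 where 2: "brun (?w k) s1 n' s2" "n' \<le> (m x + 1) * bnd K a b" "keeps k s1 s2"
          "rep s2 (s2 (reg k)) (enc (while t f x))" using loop[OF *(1) 1(6) r 1(5)] by blast
      have "(m x + 1) * bnd K a b \<le> (bnd L a b + 1) * bnd K a b"
        using L[OF *(1)] by (intro mult_le_mono1) simp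
      then have "n + n' \<le> bnd J a b" using 1(2) 2(2) J[of a b] by linarith
      then show "\<exists>n s'. brun (?p k) s n s' \<and> n \<le> bnd J a b \<and> keeps k s s' \<and>
          rep s' (s' (reg k)) (enc (while t f x))"
        using brun_Seq[OF 1(1) 2(1)] keeps_trans[OF keeps_le[OF 1(3)] 2(3)] 2(4) by auto
    qed
    then show "\<exists>N. implements (?p k) k N P (while t f)" by blast
  qed
qed


section \<open>List functions\<close>

text \<open>Functions of several variables are functions of nested pairs whose first component is
  the surrounding environment. With a projection for \<open>e\<close>, what was shown for the
  environment can be used inside the body of a \<open>map\<close> or \<open>fold\<close>.\<close>

lemma FC_env: "FC P f \<Longrightarrow> (\<And>a b z. Q a b z \<Longrightarrow> P a b (e z)) \<Longrightarrow> FC Q e \<Longrightarrow> FC Q (\<lambda>z. f (e z))"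
  by (rule FC_comp)

lemma FC_app3:
  assumes "FC Q (\<lambda>z. g (fst z) (fst (snd z)) (snd (snd z)))" "FC P u" "FC P v" "FC P w"
    "\<And>a b x. P a b x \<Longrightarrow> Q a b (u x, v x, w x)"
  shows "FC P (\<lambda>x. g (u x) (v x) (w x))"
  using FC_comp[OF FC_Pair[OF assms(2) FC_Pair[OF assms(3,4)]] assms(1,5)] by simp

lemma FB_env: "FB P f \<Longrightarrow> (\<And>a b z. Q a b z \<Longrightarrow> P a b (e z)) \<Longrightarrow> FB Q (\<lambda>z. f (e z))"
  by (erule FB_mono[where g = e]) simp

lemma PB_env: "PB P f \<Longrightarrow> (\<And>a b z. Q a b z \<Longrightarrow> P a b (e z)) \<Longrightarrow> PB Q (\<lambda>z. f (e z))"
  by (erule PB_mono[where g = e]) simp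

lemma FB_le: "FB P q \<Longrightarrow> (\<And>a b x. P a b x \<Longrightarrow> q' x \<le> q x) \<Longrightarrow> FB P q'"
  by (erule FB_mono[where g = "\<lambda>x. x"]) simp

lemma PB_le: "PB P q \<Longrightarrow> (\<And>a b x. P a b x \<Longrightarrow> q' x \<le> q x) \<Longrightarrow> PB P q'"
  by (erule PB_mono[where g = "\<lambda>x. x"]) simp

lemma FC_Let:
  assumes "FC P f" "FC (\<lambda>a b z. P a b (fst z) \<and> snd z = f (fst z)) (\<lambda>z. g (fst z) (snd z))"
  shows "FC P (\<lambda>x. let y = f x in g x y)"
  using FC_comp[OF FC_Pair[OF FC_id assms(1)] assms(2)] by simp

lemma FC_tl_total:
  assumes "FC P f"
  shows "FC P (\<lambda>x. tl (f x))"
proof -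
  have "FC P (\<lambda>x. if f x \<noteq> [] then tl (f x) else [])"
    by (intro FC_If FC_not_Nil FC_tl FC_Nil assms) (auto intro: FC_mono[OF assms])
  then show ?thesis by (rule FC_cong) auto
qed

text \<open>The loop state consists of the remaining list, the environment and the accumulator. The
  condition on \<open>Q\<close> concerns only accumulators reached after a prefix of the list; this
  is where a bound on the size of intermediate results enters.\<close>

lemma FC_fold:
  assumes xs: "FC P xs" and i: "FC P i" and len: "FB P (\<lambda>x. length (xs x))"
    and body: "FC Q (\<lambda>z. g (fst z) (fst (snd z)) (snd (snd z)))"
    and Q: "\<And>a b x ys y zs. P a b x \<Longrightarrow> xs x = ys @ y # zs \<Longrightarrow> Q a b (x, y, fold (g x) ys (i x))"
  shows "FC P (\<lambda>x. fold (g x) (xs x) (i x))"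
proof -
  define I where "I a b st \<longleftrightarrow> P a b (fst (snd st)) \<and>
    (\<exists>ys. xs (fst (snd st)) = ys @ fst st \<and> snd (snd st) = fold (g (fst (snd st))) ys (i (fst (snd st))))"
    for a b and st :: "'b list \<times> 'a \<times> 'c"
  let ?t = "\<lambda>st :: 'b list \<times> 'a \<times> 'c. fst st \<noteq> []"
  let ?f = "\<lambda>st. (tl (fst st), fst (snd st), g (fst (snd st)) (hd (fst st)) (snd (snd st)))"
  have step: "I a b (?f st)" if "I a b st" "?t st" for a b st
  proof -
    obtain x acc ys' where st: "st = (ys', x, acc)" by (metis prod.collapse)
    from that obtain y zs where ys': "ys' = y # zs" unfolding st by (cases ys') auto
    from that(1) obtain ys where "P a b x" "xs x = ys @ y # zs" "acc = fold (g x) ys (i x)"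
      unfolding I_def st ys' by auto
    then show ?thesis unfolding I_def st ys' by (intro conjI exI[of _ "ys @ [y]"]) auto
  qed
  have FCt: "FC I ?t" by (intro FC_not_Nil FC_fst FC_id)
  have FCf: "FC (\<lambda>a b st. I a b st \<and> ?t st) ?f"
  proof (intro FC_Pair)
    show "FC (\<lambda>a b st. I a b st \<and> ?t st) (\<lambda>st. tl (fst st))" by (intro FC_tl FC_fst FC_id) auto
    show "FC (\<lambda>a b st. I a b st \<and> ?t st) (\<lambda>st. fst (snd st))" by (intro FC_fst FC_snd FC_id)
    have "FC (\<lambda>a b st. I a b st \<and> ?t st) (\<lambda>st. (fst (snd st), hd (fst st), snd (snd st)))"
      by (intro FC_Pair FC_hd FC_fst FC_snd FC_id) auto
    from FC_comp[OF this body] show "FC (\<lambda>a b st. I a b st \<and> ?t st) (\<lambda>st. g (fst (snd st)) (hd (fst st)) (snd (snd st)))"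
    proof (simp, elim meta_mp)
      fix a b st assume "I a b st \<and> fst st \<noteq> []"
      then show "Q a b (fst (snd st), hd (fst st), snd (snd st))"
        unfolding I_def using Q by (cases "fst st") auto
    qed
  qed
  have FBm: "FB I (\<lambda>st. length (fst st))"
  proof (rule FB_mono[OF len])
    fix a b st assume "I a b st"
    then show "P a b (fst (snd st)) \<and> length (fst st) \<le> length (xs (fst (snd st)))"
      unfolding I_def by auto
  qed
  have w: "FC I (while ?t ?f)"
    by (rule FC_while[OF FCt FCf FBm]) (use step in auto)
  have "FC P (\<lambda>x. snd (snd (while ?t ?f (xs x, x, i x))))"
  proof (intro FC_snd)
    show "FC P (\<lambda>x. while ?t ?f (xs x, x, i x))"
      by (rule FC_comp[OF FC_Pair[OF xs FC_Pair[OF FC_id i]] w]) (auto simp: I_def)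
  qed
  moreover have "while ?t ?f (ys, x, c) = ([], x, fold (g x) ys c)" for ys x c
    by (induction ys arbitrary: c) (subst while_unfold; simp)+
  ultimately show ?thesis by simp
qed

lemma FC_rev:
  assumes "FC P xs" "FB P (\<lambda>x. length (xs x))"
  shows "FC P (\<lambda>x. rev (xs x))"
  unfolding rev_conv_fold
  by (rule FC_fold[OF assms(1) FC_Nil assms(2), where Q = "\<lambda>_ _ _. True"])
    (intro FC_Cons FC_fst FC_snd FC_id, simp)

lemma FC_map:
  assumes "FC P xs" "FB P (\<lambda>x. length (xs x))"
    "FC (\<lambda>a b z. P a b (fst z) \<and> snd z \<in> set (xs (fst z))) (\<lambda>z. g (fst z) (snd z))"
  shows "FC P (\<lambda>x. map (g x) (xs x))"
proof -
  let ?Q = "\<lambda>a b z. P a b (fst z) \<and> fst (snd z) \<in> set (xs (fst z))"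
  have "FC P (\<lambda>x. fold (\<lambda>y acc. g x y # acc) (xs x) [])"
  proof (rule FC_fold[OF assms(1) FC_Nil assms(2), where Q = ?Q])
    have "FC ?Q (\<lambda>z. g (fst (fst z, fst (snd z))) (snd (fst z, fst (snd z))))"
      by (rule FC_comp[OF _ assms(3)]) (auto intro!: FC_Pair FC_fst FC_snd FC_id)
    then show "FC ?Q (\<lambda>z. g (fst z) (fst (snd z)) # snd (snd z))"
      by (intro FC_Cons FC_snd FC_id) simp
  qed auto
  moreover have *: "fold (\<lambda>y acc. g x y # acc) ys acc = rev (map (g x) ys) @ acc" for x ys acc
    by (induction ys arbitrary: acc) auto
  ultimately have "FC P (\<lambda>x. rev (map (g x) (xs x)))" by simp
  from FC_rev[OF this] assms(2) show ?thesis by simp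
qed

lemma FC_filter:
  assumes "FC P xs" "FB P (\<lambda>x. length (xs x))"
    "FC (\<lambda>a b z. P a b (fst z) \<and> snd z \<in> set (xs (fst z))) (\<lambda>z. t (fst z) (snd z))"
  shows "FC P (\<lambda>x. filter (t x) (xs x))"
proof -
  let ?Q = "\<lambda>a b z. P a b (fst z) \<and> fst (snd z) \<in> set (xs (fst z))"
  have "FC P (\<lambda>x. fold (\<lambda>y acc. if t x y then y # acc else acc) (xs x) [])"
  proof (rule FC_fold[OF assms(1) FC_Nil assms(2), where Q = ?Q])
    have "FC ?Q (\<lambda>z. t (fst (fst z, fst (snd z))) (snd (fst z, fst (snd z))))"
      by (rule FC_comp[OF _ assms(3)]) (auto intro!: FC_Pair FC_fst FC_snd FC_id)
    then show "FC ?Q (\<lambda>z. if t (fst z) (fst (snd z)) then fst (snd z) # snd (snd z) else snd (snd z))"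
      by (intro FC_If FC_Cons FC_snd FC_fst FC_id) simp
  qed auto
  moreover have *: "fold (\<lambda>y acc. if t x y then y # acc else acc) ys acc = rev (filter (t x) ys) @ acc" for x ys acc
    by (induction ys arbitrary: acc) auto
  ultimately have "FC P (\<lambda>x. rev (filter (t x) (xs x)))" by simp
  from FC_rev[OF this] assms(2) show ?thesis by (simp add: FB_le[OF assms(2)])
qed

lemma FC_append:
  assumes "FC P f" "FC P g" "FB P (\<lambda>x. length (f x))"
  shows "FC P (\<lambda>x. f x @ g x)"
proof -
  have "FC P (\<lambda>x. fold (#) (rev (f x)) (g x))"
    by (rule FC_fold[OF FC_rev[OF assms(1,3)] assms(2), where Q = "\<lambda>_ _ _. True"])
      (simp_all add: assms(3) FC_Cons FC_fst FC_snd FC_id)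
  moreover have "fold (#) (rev xs) ys = xs @ ys" for xs ys :: "'b list"
    by (induction xs arbitrary: ys) auto
  ultimately show ?thesis by simp
qed

lemma FC_concat:
  assumes "FC P xs" "FB P (\<lambda>x. length (xs x))"
    "FB (\<lambda>a b z. P a b (fst z) \<and> snd z \<in> set (xs (fst z))) (\<lambda>z. length (snd z))"
  shows "FC P (\<lambda>x. concat (xs x))"
proof -
  let ?Q = "\<lambda>a b z. P a b (fst z) \<and> fst (snd z) \<in> set (xs (fst z))"
  have 1: "FC P (\<lambda>x. fold (\<lambda>ys acc. ys @ acc) (rev (xs x)) [])"
  proof (rule FC_fold[OF FC_rev[OF assms(1,2)] FC_Nil, where Q = ?Q])
    have "FB ?Q (\<lambda>z. length (snd (fst z, fst (snd z))))"
      by (rule FB_env[OF assms(3)]) simp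
    then show "FC ?Q (\<lambda>z. fst (snd z) @ snd (snd z))"
      by (intro FC_append FC_fst FC_snd FC_id) simp
    show "?Q a b (x, y, fold (\<lambda>ys acc. ys @ acc) ys [])" if "P a b x" "rev (xs x) = ys @ y # zs" for a b x y ys zs
    proof -
      have "y \<in> set (rev (xs x))" unfolding that(2) by simp
      then show ?thesis using that(1) by simp
    qed
  qed (use assms(2) in simp)
  have "fold (\<lambda>ys acc. ys @ acc) (rev yss) zs = concat yss @ zs" for yss and zs :: "'b list"
    by (induction yss arbitrary: zs) auto
  from 1[unfolded this] show ?thesis by simp
qed

lemma FC_length:
  assumes "FC P f" "FB P (\<lambda>x. length (f x))"
  shows "FC P (\<lambda>x. length (f x))"
proof -
  have "FC P (\<lambda>x. fold (\<lambda>_. Suc) (f x) 0)"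
    by (rule FC_fold[OF assms(1) FC_const_nat assms(2), where Q = "\<lambda>_ _ _. True"])
      (simp_all add: FC_Suc FC_fst FC_snd FC_id)
  moreover have "fold (\<lambda>_. Suc) xs n = n + length xs" for xs :: "'b list" and n
    by (induction xs arbitrary: n) auto
  ultimately show ?thesis by simp
qed

lemma FC_Ball:
  assumes "FC P xs" "FB P (\<lambda>x. length (xs x))"
    "FC (\<lambda>a b z. P a b (fst z) \<and> snd z \<in> set (xs (fst z))) (\<lambda>z. t (fst z) (snd z))"
  shows "FC P (\<lambda>x. \<forall>y\<in>set (xs x). t x y)"
proof -
  have "FC P (\<lambda>x. \<not> filter (\<lambda>y. \<not> t x y) (xs x) \<noteq> [])"
    by (intro FC_Not FC_not_Nil FC_filter assms)
  then show ?thesis by (simp add: filter_empty_conv)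
qed

lemma FC_Bex:
  assumes "FC P xs" "FB P (\<lambda>x. length (xs x))"
    "FC (\<lambda>a b z. P a b (fst z) \<and> snd z \<in> set (xs (fst z))) (\<lambda>z. t (fst z) (snd z))"
  shows "FC P (\<lambda>x. \<exists>y\<in>set (xs x). t x y)"
  using FC_Not[OF FC_Ball[OF assms(1,2) FC_Not[OF assms(3)]]] by simp

lemma FC_sum_list:
  assumes "FC P f" "FB P (\<lambda>x. length (f x))"
  shows "FC P (\<lambda>x. sum_list (f x) :: int)"
proof -
  have "FC P (\<lambda>x. fold (+) (f x) 0)"
    by (rule FC_fold[OF assms(1) FC_const_int assms(2), where Q = "\<lambda>_ _ _. True"])
      (simp_all add: FC_add_int FC_fst FC_snd FC_id)
  then show ?thesis by (simp add: fold_plus_sum_list_rev)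
qed

lemma FC_upt:
  assumes "FC P f" "FB P f"
  shows "FC P (\<lambda>x. [0..<f x])"
proof -
  let ?t = "\<lambda>st :: nat \<times> nat list. 0 < fst st"
  let ?f = "\<lambda>st. (fst st - 1, (fst st - 1) # snd st)"
  obtain N where N: "\<And>a b x. P a b x \<Longrightarrow> f x \<le> bnd N a b" using assms(2) unfolding FB_def by metis
  let ?I = "\<lambda>a b (st :: nat \<times> nat list). fst st \<le> bnd N a b"
  have "FC ?I (while ?t ?f)"
  proof (rule FC_while)
    show "FC ?I ?t" by (intro FC_less_nat FC_const_nat FC_fst FC_id)
    show "FC (\<lambda>a b st. ?I a b st \<and> ?t st) ?f"
      by (intro FC_Pair FC_Cons FC_diff_nat FC_const_nat FC_fst FC_snd FC_id) auto
    show "FB ?I fst" unfolding FB_def by (intro exI[of _ N]) simp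
  qed auto
  from FC_snd[OF FC_comp[OF FC_Pair[OF assms(1) FC_Nil] this]] N
  have "FC P (\<lambda>x. snd (while ?t ?f (f x, [])))" by simp
  moreover have "while ?t ?f (n, xs) = (0, [0..<n] @ xs)" for n xs
    by (induction n arbitrary: xs) (subst while_unfold; simp)+
  ultimately show ?thesis by simp
qed

lemma FC_zip:
  assumes "FC P f" "FC P g" "FB P (\<lambda>x. length (f x))"
  shows "FC P (\<lambda>x. zip (f x) (g x))"
proof -
  let ?h = "\<lambda>x st. if fst st \<noteq> [] then (tl (fst st), (x, hd (fst st)) # snd st) else st"
  have eq: "snd (fold ?h xs (ys, acc)) = rev (zip xs ys) @ acc" for xs ys acc
  proof (induction xs arbitrary: ys acc)
    case (Cons x xs)
    have "fold ?h xs ([], acc) = ([], acc)" by (induction xs) auto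
    with Cons show ?case by (cases ys) auto
  qed simp
  have 1: "FC P (\<lambda>x. rev (snd (fold ?h (f x) (g x, []))))"
  proof (rule FC_rev[OF FC_snd[OF FC_fold[OF assms(1) _ assms(3)]]])
    show "FC P (\<lambda>x. (g x, []))" by (intro FC_Pair assms FC_Nil)
    let ?Q = "\<lambda>_ _ _. True"
    show "FC ?Q (\<lambda>z. ?h (fst (snd z)) (snd (snd z)))"
      by (intro FC_If FC_Pair FC_not_Nil FC_tl FC_hd FC_Cons FC_fst FC_snd FC_id) auto
    show "FB P (\<lambda>x. length (snd (fold ?h (f x) (g x, []))))"
      unfolding eq by (rule FB_le[OF assms(3)]) simp
  qed simp
  then show ?thesis unfolding eq by simp
qed

lemma FC_eq_list:
  assumes "FC P f" "FC P g" "FB P (\<lambda>x. length (f x))" "FB P (\<lambda>x. length (g x))"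
    and eq: "FC (\<lambda>_ _ _. True) (\<lambda>p :: 'b::enc \<times> 'b. fst p = snd p)"
  shows "FC P (\<lambda>x. f x = (g x :: 'b list))"
proof -
  have e: "FC (\<lambda>a b z. P a b (fst z) \<and> snd z \<in> set (zip (f (fst z)) (g (fst z)))) (\<lambda>z. fst (snd z) = snd (snd z))"
    by (rule FC_comp[OF FC_snd[OF FC_id] eq]) simp
  have "FB P (\<lambda>x. length (zip (f x) (g x)))" by (rule FB_le[OF assms(3)]) simp
  from FC_conj[OF FC_eq_nat[OF FC_length[OF assms(1,3)] FC_length[OF assms(2,4)]]
      FC_Ball[OF FC_zip[OF assms(1-3)] this e]]
  show ?thesis
  proof (rule FC_cong)
    have "length xs = length ys \<and> (\<forall>p\<in>set (zip xs ys). fst p = snd p) \<longleftrightarrow> xs = ys" for xs ys :: "'b list"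
      by (metis zip_same fst_conv in_set_zip list_eq_iff_nth_eq snd_conv)
    then show "(length (f x) = length (g x) \<and> (\<forall>p\<in>set (zip (f x) (g x)). fst p = snd p)) = (f x = g x)" for x
      by blast
  qed
qed

lemma FC_eq_ints:
  assumes "FC P f" "FC P g" "FB P (\<lambda>x. length (f x))" "FB P (\<lambda>x. length (g x))"
  shows "FC P (\<lambda>x. f x = (g x :: int list))"
  by (intro FC_eq_list assms FC_eq_int FC_fst FC_snd FC_id)

lemma FC_drop:
  assumes "FC P n" "FB P n" "FC P xs"
  shows "FC P (\<lambda>x. drop (n x) (xs x))"
proof -
  have "FC P (\<lambda>x. fold (\<lambda>_. tl) [0..<n x] (xs x))"
    by (rule FC_fold[OF FC_upt[OF assms(1,2)] assms(3), where Q = "\<lambda>_ _ _. True"])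
      (simp_all add: assms FC_tl_total FC_snd FC_id)
  moreover have "fold (\<lambda>_. tl) [0..<n] ys = drop n ys" for n and ys :: "'b list"
    by (induction n) (auto simp: drop_Suc tl_drop)
  ultimately show ?thesis by simp
qed

lemma FC_n_lists:
  assumes "FC P n" "PB P n" "FC P xs" "PB P (\<lambda>x. length (xs x))"
  shows "FC P (\<lambda>x. List.n_lists (n x) (xs x))"
proof -
  let ?g = "\<lambda>x. \<lambda>_ acc. concat (map (\<lambda>ys. map (\<lambda>y. y # ys) (xs x)) acc)"
  let ?Q = "\<lambda>a b z. P a b (fst z) \<and> (\<exists>i\<le>n (fst z). snd (snd z) = List.n_lists i (xs (fst z)))"
  have *: "fold (?g x) [0..<k] [[]] = List.n_lists k (xs x)" for x k
    by (induction k) auto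
  have len: "PB ?Q (\<lambda>z. length (snd (snd z)))"
  proof (rule PB_mono)
    \<comment> \<open>The 1 covers an empty \<open>xs\<close>, where the intermediate list for
      \<open>i = 0\<close> has one element although the final list may have none.\<close>
    show "PB P (\<lambda>x. (length (xs x) + 1) ^ n x)" by (intro PB_power PB_add PB_const assms)
    fix a b z assume Q: "?Q a b z"
    then obtain i where i: "i \<le> n (fst z)" "snd (snd z) = List.n_lists i (xs (fst z))" by blast
    have "length (xs (fst z)) ^ i \<le> (length (xs (fst z)) + 1) ^ i" by (intro power_mono) auto
    also have "\<dots> \<le> (length (xs (fst z)) + 1) ^ n (fst z)" using i by (intro power_increasing) auto
    finally show "P a b (fst z) \<and> length (snd (snd z)) \<le> (length (xs (fst z)) + 1) ^ n (fst z)"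
      using Q i(2) by (simp add: length_n_lists)
  qed
  have "FC P (\<lambda>x. fold (?g x) [0..<n x] [[]])"
  proof (rule FC_fold[OF FC_upt[OF assms(1)], where Q = ?Q])
    show "FB P n" by (rule FB_of_PB[OF assms(2)])
    then show "FB P (\<lambda>x. length [0..<n x])" by simp
    show "FC P (\<lambda>x. [[]])" by (intro FC_Cons FC_Nil)
    show "FC ?Q (\<lambda>z. ?g (fst z) (fst (snd z)) (snd (snd z)))"
    proof (intro FC_concat FC_map FC_Cons FC_snd FC_fst FC_id)
      let ?Q1 = "\<lambda>a b z. ?Q a b (fst z) \<and> snd z \<in> set (snd (snd (fst z)))"
      show "FC ?Q1 (\<lambda>z. xs (fst (fst z)))"
        by (rule FC_env[OF assms(3)]) (auto intro!: FC_fst FC_id)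
      show "FB ?Q1 (\<lambda>z. length (xs (fst (fst z))))"
        by (rule FB_env[OF FB_of_PB[OF assms(4)]]) auto
      show "FB ?Q (\<lambda>z. length (map (\<lambda>ys. map (\<lambda>y. y # ys) (xs (fst z))) (snd (snd z))))"
        using FB_of_PB[OF len] by simp
      show "FB (\<lambda>a b z. ?Q a b (fst z) \<and> snd z \<in> set (map (\<lambda>ys. map (\<lambda>y. y # ys) (xs (fst (fst z)))) (snd (snd (fst z)))))
         (\<lambda>z. length (snd z))"
        by (rule FB_mono[OF FB_of_PB[OF assms(4)], where g = "\<lambda>z. fst (fst z)"]) auto
    qed (rule FB_of_PB[OF len])
    show "?Q a b (x, y, fold (?g x) ys [[]])" if "P a b x" "[0..<n x] = ys @ y # zs" for a b x ys y zs
    proof -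
      have "ys = take (length ys) [0..<n x]" "length ys < length [0..<n x]" using that(2) by auto
      then have "ys = [0..<length ys]" "length ys < n x" by (auto simp: take_upt)
      then show ?thesis using that(1) *[of x "length ys"] by (auto intro!: exI[of _ "length ys"])
    qed
  qed
  with * show ?thesis by simp
qed

text \<open>A digit count obtained by a loop, since lengths are not accessible to expressions; it is
  0 for numbers that are not positive.\<close>

definition halvings :: "int \<Rightarrow> nat" where
  "halvings n = snd (while (\<lambda>st. 0 < fst st) (\<lambda>st. (fst st div 2, Suc (snd st))) (n, 0))"

lemma halvings_while:
  "n < 2 ^ k \<Longrightarrow> \<exists>j\<le>k. n < 2 ^ j \<and> snd (while (\<lambda>st. 0 < fst st) (\<lambda>st. (fst st div 2, Suc (snd st))) (n::int, i)) = i + j"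
proof (induction k arbitrary: n i)
  case 0
  then show ?case by (subst while_unfold) auto
next
  case (Suc k)
  show ?case
  proof (cases "0 < n")
    case True
    have "n div 2 < 2 ^ k" using Suc.prems by (simp add: div_less_iff_less_mult)
    from Suc.IH[OF this, of "Suc i"] obtain j where j: "j \<le> k" "n div 2 < 2 ^ j"
      "snd (while (\<lambda>st. 0 < fst st) (\<lambda>st. (fst st div 2, Suc (snd st))) (n div 2, Suc i)) = Suc i + j" by blast
    have "n < 2 ^ Suc j" using j(2) by (simp add: div_less_iff_less_mult)
    moreover have "snd (while (\<lambda>st. 0 < fst st) (\<lambda>st. (fst st div 2, Suc (snd st))) (n, i)) = i + Suc j"
      using True j(3) by (subst while_unfold) simp
    ultimately show ?thesis using j(1) by (meson Suc_le_mono)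
  next
    case False
    then show ?thesis by (subst while_unfold) auto
  qed
qed

lemma less_halvings: "n < 2 ^ halvings n"
proof -
  have "n < 2 ^ bit_length n" using bit_length_le_iff[of n "bit_length n"] by auto
  from halvings_while[OF this, of 0] show ?thesis unfolding halvings_def by auto
qed

lemma halvings_le: "halvings n \<le> bit_length n"
proof -
  have "n < 2 ^ bit_length n" using bit_length_le_iff[of n "bit_length n"] by auto
  from halvings_while[OF this, of 0] show ?thesis unfolding halvings_def by auto
qed

lemma FC_halvings:
  assumes "FC P n" "FB P (\<lambda>x. bit_length (n x))"
  shows "FC P (\<lambda>x. halvings (n x))"
proof -
  let ?t = "\<lambda>st :: int \<times> nat. 0 < fst st"
  let ?f = "\<lambda>st :: int \<times> nat. (fst st div 2, Suc (snd st))"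
  obtain N where N: "\<And>a b x. P a b x \<Longrightarrow> bit_length (n x) \<le> bnd N a b" using assms(2) unfolding FB_def by metis
  let ?I = "\<lambda>a b (st :: int \<times> nat). bit_length (fst st) \<le> bnd N a b"
  have "FC ?I (while ?t ?f)"
  proof (rule FC_while)
    show "FC ?I ?t" by (intro FC_less_int FC_const_int FC_fst FC_id)
    show "FC (\<lambda>a b st. ?I a b st \<and> ?t st) ?f"
      by (intro FC_Pair FC_Suc FC_div_int FC_const_int FC_fst FC_snd FC_id)
    \<comment> \<open>As 0 and 1 both have length 1, the length alone would not drop in the last
      iteration.\<close>
    show "FB ?I (\<lambda>st. if 0 < fst st then bit_length (fst st) else 0)"
      unfolding FB_def by (intro exI[of _ N]) auto
    fix a b and st :: "int \<times> nat" assume I: "?I a b st" and t: "?t st"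
    have "bit_length (fst st div 2) < bit_length (fst st)" if "0 < fst st div 2"
    proof -
      obtain k where k: "bit_length (fst st) = Suc k" by (metis bit_length_pos(2) gr0_implies_Suc)
      then have lt: "\<bar>fst st\<bar> < 2 ^ Suc k" using bit_length_le_iff[of "fst st" "Suc k"] by auto
      have "k \<noteq> 0" using lt that by (intro notI) auto
      then have "bit_length (fst st div 2) \<le> k"
        using lt t that by (subst bit_length_le_iff) auto
      then show ?thesis using k by simp
    qed
    then show "?I a b (?f st) \<and> (if 0 < fst (?f st) then bit_length (fst (?f st)) else 0)
        < (if 0 < fst st then bit_length (fst st) else 0)"
      using I t bit_length_div[of "fst st" 2] by auto
  qed
  from FC_snd[OF FC_comp[OF FC_Pair[OF assms(1) FC_const_nat[of _ 0]] this]] N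
  show ?thesis unfolding halvings_def by simp
qed


section \<open>Input and output\<close>

definition Get :: "nat \<Rightarrow> expr" where "Get k = Load (Const (reg k))"

lemma Get_simps [simp]: "val (Get k) s = s (reg k)" "weight (Get k) s = bit_length (reg k) + 2"
  by (simp_all add: Get_def)

definition Put :: "nat \<Rightarrow> expr \<Rightarrow> program" where "Put k e = Store (Const (reg k)) e"

lemma brun_Put:
  "s' = s(reg k := val e s) \<Longrightarrow> bit_length (reg k) + weight e s + 2 \<le> n \<Longrightarrow> brun (Put k e) s n s'"
  unfolding Put_def by (rule brun_Store) auto

lemma addr_neg: "reg k < 0" "0 < w \<Longrightarrow> hd_addr w < 0" "0 < w \<Longrightarrow> tl_addr w < 0"
  by (auto simp: reg_def hd_addr_def tl_addr_def)

lemma addr_neq [simp]: "0 \<le> a \<Longrightarrow> a \<noteq> reg k" "0 \<le> a \<Longrightarrow> 0 < w \<Longrightarrow> a \<noteq> hd_addr w" "0 \<le> a \<Longrightarrow> 0 < w \<Longrightarrow> a \<noteq> tl_addr w"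
  using addr_neg(1)[of k] addr_neg(2,3)[of w] by auto

text \<open>The word is read from its last letter to its first, so that consing produces the list in
  the right order. The counter in register 4 is at the same time the address of the next
  letter.\<close>

definition read_list :: program where
  "read_list =
     Seq (Put 0 (Const 1)) (Seq (Put 1 (Const 0)) (Seq (Put 4 (Load (Const 0)))
     (While (Get 4)
       (Seq (Put 2 (Load (Get 4))) (Seq (Put 3 (Get 1)) (Seq (cons_cell 1)
         (Put 4 (Sub (Get 4) (Const 1)))))))))"

lemma brun_read_list:
  "\<exists>C. \<forall>xs. \<exists>s. brun read_list (input_memory xs) (C * (length xs + 1)) s \<and> live s \<and>
     rep s (s (reg 1)) (enc xs)"
proof -
  obtain e where e: "\<And>s. live s \<Longrightarrow> \<exists>s'. brun (cons_cell 1) s e s' \<and> keeps 1 s s' \<and>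
     s' = s(hd_addr (s (reg 0)) := s (reg (Suc 1)), tl_addr (s (reg 0)) := s (reg (Suc (Suc 1))),
            reg 1 := s (reg 0), reg 0 := s (reg 0) + 1)"
    using brun_cons_cell[of 1] by auto
  let ?W = "bit_length (reg 0) + bit_length (reg 1) + bit_length (reg 2) + bit_length (reg 3) +
    2 * bit_length (reg 4) + bit_length 0 + bit_length 1 + 20"
  let ?body = "Seq (Put 2 (Load (Get 4))) (Seq (Put 3 (Get 1)) (Seq (cons_cell 1) (Put 4 (Sub (Get 4) (Const 1)))))"
  let ?B = "?W + (?W + (e + ?W))"
  let ?K = "?W + ?B"
  have loop: "\<exists>s'. brun (While (Get 4) ?body) s (?K * (i + 1)) s' \<and> live s' \<and> rep s' (s' (reg 1)) (enc xs)"
    if "live s" "s (reg 4) = int i" "i \<le> length xs" "rep s (s (reg 1)) (enc (drop i xs))"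
      "\<forall>j<length xs. s (int j + 1) = int (xs ! j)" for s i and xs :: "nat list"
    using that
  proof (induction i arbitrary: s)
    case 0
    have "brun (While (Get 4) ?body) s (?K * (0 + 1)) s"
      by (rule brun_mono[OF brun_While_False]) (use 0 in auto)
    then show ?case using 0 by (intro exI[of _ s]) auto
  next
    case (Suc i)
    let ?s1 = "s(reg 2 := s (int (Suc i)))"
    let ?s2 = "?s1(reg 3 := s (reg 1))"
    have si: "s (int (Suc i)) = int (xs ! i)" using Suc.prems(3,5) by (auto simp: add.commute)
    obtain s3 where 3: "brun (cons_cell 1) ?s2 e s3" "keeps 1 ?s2 s3"
      "s3 = ?s2(hd_addr (?s2 (reg 0)) := ?s2 (reg (Suc 1)), tl_addr (?s2 (reg 0)) := ?s2 (reg (Suc (Suc 1))),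
            reg 1 := ?s2 (reg 0), reg 0 := ?s2 (reg 0) + 1)"
      using e[of ?s2] Suc.prems(1) by auto
    let ?s4 = "s3(reg 4 := s3 (reg 4) - 1)"
    have r4: "s3 (reg 4) = int (Suc i)" unfolding 3(3) using Suc.prems(2) by simp
    have body: "brun ?body s ?B ?s4"
    proof (intro brun_Seq)
      show "brun (Put 2 (Load (Get 4))) s ?W ?s1" by (rule brun_Put) (use Suc.prems(2) in auto)
      show "brun (Put 3 (Get 1)) ?s1 ?W ?s2" by (rule brun_Put) auto
      show "brun (cons_cell 1) ?s2 e s3" by (rule 3(1))
      show "brun (Put 4 (Sub (Get 4) (Const 1))) s3 ?W ?s4" by (rule brun_Put) auto
    qed
    have pos: "0 < s (reg 0)" using Suc.prems(1) by (simp add: live_def)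
    have "rep s3 (s3 (reg 1)) (Node (enc (xs ! i)) (enc (drop (Suc i) xs)))"
      by (rule rep_cons_cell[OF _ _ _ _ 3(2,3)]) (use Suc.prems(1,4) si in \<open>auto simp: enc_nat_def numeral_3_eq_3 numeral_2_eq_2\<close>)
    then have "rep s3 (s3 (reg 1)) (enc (drop i xs))"
      using Suc.prems(3) Cons_nth_drop_Suc[of i xs] by (metis Suc_le_lessD enc_list.simps(2))
    moreover have "live s3" using live_keeps[OF 3(2)] Suc.prems(1) by simp
    moreover have "\<forall>j<length xs. s3 (int j + 1) = int (xs ! j)"
      using Suc.prems(5) pos unfolding 3(3) by (auto simp: numeral_3_eq_3 numeral_2_eq_2)
    ultimately have "live ?s4" "?s4 (reg 4) = int i" "i \<le> length xs" "rep ?s4 (?s4 (reg 1)) (enc (drop i xs))"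
      "\<forall>j<length xs. ?s4 (int j + 1) = int (xs ! j)"
      using r4 Suc.prems(3) by auto
    from Suc.IH[OF this] obtain s' where s': "brun (While (Get 4) ?body) ?s4 (?K * (i + 1)) s'" "live s'"
      "rep s' (s' (reg 1)) (enc xs)" by blast
    have "brun (While (Get 4) ?body) s (weight (Get 4) s + ?B + ?K * (i + 1)) s'"
      by (rule brun_While_True[OF _ body s'(1)]) (use Suc.prems(2) in simp)
    then have "brun (While (Get 4) ?body) s (?K * (Suc i + 1)) s'"
      by (rule brun_mono) (simp add: algebra_simps)
    then show ?case using s' by blast
  qed
  have "\<exists>s. brun read_list (input_memory xs) ((4 * ?K) * (length xs + 1)) s \<and> live s \<and>
     rep s (s (reg 1)) (enc xs)" for xs :: "nat list"
  proof -
    let ?m = "input_memory xs"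
    let ?s = "?m(reg 0 := 1, reg 1 := 0, reg 4 := int (length xs))"
    have "\<exists>s'. brun (While (Get 4) ?body) ?s (?K * (length xs + 1)) s' \<and> live s' \<and> rep s' (s' (reg 1)) (enc xs)"
      by (rule loop) (auto simp: live_def input_memory_def)
    then obtain s' where s': "brun (While (Get 4) ?body) ?s (?K * (length xs + 1)) s'" "live s'"
      "rep s' (s' (reg 1)) (enc xs)" by blast
    have "brun read_list ?m (?W + (?W + (?W + ?K * (length xs + 1)))) s'"
      unfolding read_list_def
    proof (intro brun_Seq)
      show "brun (Put 0 (Const 1)) ?m ?W (?m(reg 0 := 1))" by (rule brun_Put) auto
      show "brun (Put 1 (Const 0)) (?m(reg 0 := 1)) ?W (?m(reg 0 := 1, reg 1 := 0))" by (rule brun_Put) auto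
      show "brun (Put 4 (Load (Const 0))) (?m(reg 0 := 1, reg 1 := 0)) ?W ?s"
        by (rule brun_Put) (auto simp: input_memory_def)
    qed (rule s'(1))
    then have "brun read_list ?m ((4 * ?K) * (length xs + 1)) s'"
      by (rule brun_mono) (simp add: algebra_simps)
    with s' show ?thesis by blast
  qed
  then show ?thesis by (intro exI[of _ "4 * ?K"]) blast
qed

definition write_list :: program where
  "write_list =
     Seq (Put 2 (Const 0)) (Seq
     (While (Get 1)
       (Seq (Put 2 (Add (Get 2) (Const 1))) (Seq (Store (Get 2) (Hd (Get 1))) (Put 1 (Tl (Get 1))))))
     (Store (Const 0) (Get 2)))"

text \<open>A represented tree depends only on the heap and on the free pointer, hence it survives
  the writing of letters at positive addresses.\<close>

lemma rep_agree:
  assumes "s' (reg 0) = s (reg 0)" "\<And>w. 0 < w \<Longrightarrow> s' (hd_addr w) = s (hd_addr w) \<and> s' (tl_addr w) = s (tl_addr w)"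
    "rep s w t"
  shows "rep s' w t"
  using assms(3) by (induction t arbitrary: w) (auto simp: assms)

lemma brun_write_list:
  "\<exists>C\<ge>1. \<forall>s ys. rep s (s (reg 1)) (enc ys) \<longrightarrow>
     (\<exists>s'. brun write_list s (C * (length ys + 1)) s' \<and> holds_output s' (ys :: nat list))"
proof -
  let ?W = "bit_length (reg 0) + 2 * bit_length (reg 1) + 2 * bit_length (reg 2) +
    bit_length 0 + bit_length 1 + 2 * bit_length 4 + bit_length 2 + 20"
  let ?body = "Seq (Put 2 (Add (Get 2) (Const 1))) (Seq (Store (Get 2) (Hd (Get 1))) (Put 1 (Tl (Get 1))))"
  let ?B = "?W + (?W + ?W)"
  let ?K = "?W + ?B"
  have loop: "\<exists>s'. brun (While (Get 1) ?body) s (?K * (length zs + 1)) s' \<and> s' (reg 2) = int (length ys + length zs) \<and>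
      (\<forall>j<length (ys @ zs). s' (int j + 1) = int ((ys @ zs) ! j))"
    if "rep s (s (reg 1)) (enc zs)" "s (reg 2) = int (length ys)"
      "\<forall>j<length ys. s (int j + 1) = int (ys ! j)" for s and ys zs :: "nat list"
    using that
  proof (induction zs arbitrary: s ys)
    case Nil
    have "brun (While (Get 1) ?body) s (?K * (0 + 1)) s"
      by (rule brun_mono[OF brun_While_False]) (use Nil in auto)
    then show ?case using Nil by (intro exI[of _ s]) auto
  next
    case (Cons z zs)
    let ?w = "s (reg 1)"
    let ?s1 = "s(reg 2 := int (Suc (length ys)))"
    let ?s2 = "?s1(int (Suc (length ys)) := s (hd_addr ?w))"
    let ?s3 = "?s2(reg 1 := s (tl_addr ?w))"
    have w: "0 < ?w" "s (hd_addr ?w) = int z" "rep s (s (tl_addr ?w)) (enc zs)"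
      using Cons.prems(1) by (auto simp: enc_nat_def)
    have nr: "int (Suc (length ys)) \<noteq> reg k" for k by (rule addr_neq) simp
    have nh: "int (Suc (length ys)) \<noteq> hd_addr v" and nt: "int (Suc (length ys)) \<noteq> tl_addr v" if "0 < v" for v
      by (rule addr_neq(2,3)[OF _ that], simp)+
    note neq = nr nh nt nr[symmetric] nh[symmetric] nt[symmetric]
    have body: "brun ?body s ?B ?s3"
    proof (intro brun_Seq)
      show "brun (Put 2 (Add (Get 2) (Const 1))) s ?W ?s1"
        by (rule brun_Put) (use Cons.prems(2) in auto)
      show "brun (Store (Get 2) (Hd (Get 1))) ?s1 ?W ?s2"
        by (rule brun_Store) auto
      show "brun (Put 1 (Tl (Get 1))) ?s2 ?W ?s3"
        by (rule brun_Put) (use w(1) in \<open>auto simp: neq simp del: of_nat_Suc\<close>)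
    qed
    have "rep ?s3 (s (tl_addr ?w)) (enc zs)"
      by (rule rep_agree[OF _ _ w(3)]) (auto simp: neq simp del: of_nat_Suc)
    then have "rep ?s3 (?s3 (reg 1)) (enc zs)" by (simp only: fun_upd_same)
    moreover have "?s3 (reg 2) = int (length (ys @ [z]))" by (simp add: neq del: of_nat_Suc)
    moreover have "\<forall>j<length (ys @ [z]). ?s3 (int j + 1) = int ((ys @ [z]) ! j)"
    proof (intro allI impI)
      fix j assume j: "j < length (ys @ [z])"
      have 1: "int j + 1 \<noteq> reg 1" "int j + 1 \<noteq> reg 2" by (rule addr_neq, simp)+
      have 2: "int j + 1 = int (Suc (length ys)) \<longleftrightarrow> j = length ys" by auto
      show "?s3 (int j + 1) = int ((ys @ [z]) ! j)"
        using 1 Cons.prems(3) j w(2) by (simp only: fun_upd_apply 2) (auto simp: nth_append)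
    qed
    ultimately obtain s' where s': "brun (While (Get 1) ?body) ?s3 (?K * (length zs + 1)) s'"
      "s' (reg 2) = int (length (ys @ [z]) + length zs)"
      "\<forall>j<length ((ys @ [z]) @ zs). s' (int j + 1) = int (((ys @ [z]) @ zs) ! j)"
      using Cons.IH[of ?s3 "ys @ [z]"] by blast
    have "brun (While (Get 1) ?body) s (weight (Get 1) s + ?B + ?K * (length zs + 1)) s'"
      by (rule brun_While_True[OF _ body s'(1)]) (use w in simp)
    then have "brun (While (Get 1) ?body) s (?K * (length (z # zs) + 1)) s'"
      by (rule brun_mono) (simp add: algebra_simps)
    then show ?case using s' by (intro exI[of _ s']) simp
  qed
  have "\<exists>s'. brun write_list s ((3 * ?K) * (length ys + 1)) s' \<and> holds_output s' ys"
    if "rep s (s (reg 1)) (enc ys)" for s and ys :: "nat list"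
  proof -
    let ?s = "s(reg 2 := 0)"
    have "rep ?s (?s (reg 1)) (enc ys)" "?s (reg 2) = int (length ([] :: nat list))" using that by auto
    from loop[OF this, unfolded append_Nil] obtain s' where
      s': "brun (While (Get 1) ?body) ?s (?K * (length ys + 1)) s'"
      "s' (reg 2) = int (length ys)" "\<forall>j<length ys. s' (int j + 1) = int (ys ! j)"
      unfolding list.size(3) add_0 by blast
    let ?s' = "s'(0 := int (length ys))"
    have "brun write_list s (?W + (?K * (length ys + 1) + ?W)) ?s'"
      unfolding write_list_def
      by (intro brun_Seq[OF brun_Put brun_Seq[OF s'(1) brun_Store]]) (use s'(2) in auto)
    then have "brun write_list s ((3 * ?K) * (length ys + 1)) ?s'"
      by (rule brun_mono) (simp add: algebra_simps)
    moreover have "holds_output ?s' ys" using s'(3) by (auto simp: holds_output_def)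
    ultimately show ?thesis by blast
  qed
  then show ?thesis by (intro exI[of _ "3 * ?K"]) auto
qed

lemma bit_length_le_encoding: "x \<in> set xs \<Longrightarrow> bit_length (int x) \<le> encoding_length xs"
  unfolding encoding_length_def by (rule member_le_sum_list) auto

lemma length_le_encoding: "length xs \<le> encoding_length xs"
proof (induction xs)
  case (Cons x xs)
  then show ?case using bit_length_pos(1)[of "int x"] by (simp add: encoding_length_def del: bit_length_pos)
qed simp

text \<open>The additional digit accounts for the length of the word in register 0 and, if the word
  is empty, for the length 1 of the number 0.\<close>

lemma word_bound_input: "word_bound (Suc (encoding_length xs)) (input_memory xs)"
proof -
  have "bit_length 0 = 1" by (simp add: bit_length_def floorlog_def)
  moreover have "bit_length (int (length xs)) \<le> Suc (encoding_length xs)"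
    using bit_length_nat_le[of "length xs"] length_le_encoding[of xs] by simp
  moreover have "bit_length (int (xs ! nat (a - 1))) \<le> Suc (encoding_length xs)" if "1 \<le> a" "a \<le> int (length xs)" for a
    using bit_length_le_encoding[of "xs ! nat (a - 1)" xs] that by (simp add: nth_mem le_SucI)
  ultimately show ?thesis unfolding word_bound_def input_memory_def by auto
qed

theorem FC_computes:
  fixes f :: "nat list \<Rightarrow> nat list"
  assumes "FC P f" "FB P encoding_length" "FB P (\<lambda>x. length (f x))"
  shows "\<exists>c N. \<forall>a b x. P a b x \<longrightarrow> (\<exists>T. computes c x T (f x) \<and> T \<le> bnd N a b)"
proof -
  obtain C1 where C1: "\<forall>xs. \<exists>s. brun read_list (input_memory xs) (C1 * (length xs + 1)) s \<and> live s \<and>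
     rep s (s (reg 1)) (enc xs)" using brun_read_list by blast
  obtain C2 where C2: "C2 \<ge> 1" "\<forall>s ys. rep s (s (reg 1)) (enc ys) \<longrightarrow>
     (\<exists>s'. brun write_list s (C2 * (length ys + 1)) s' \<and> holds_output s' (ys :: nat list))"
    using brun_write_list by blast
  obtain c where c: "\<forall>k\<ge>1. \<exists>N. implements (c k) k N P f" using assms(1) unfolding FC_def by blast
  obtain N where N: "implements (c 1) 1 N P f" using c by auto
  obtain L where L: "\<And>a b x. P a b x \<Longrightarrow> encoding_length x \<le> bnd L a b" using assms(2) unfolding FB_def by metis
  obtain M where M: "\<And>a b x. P a b x \<Longrightarrow> length (f x) \<le> bnd M a b" using assms(3) unfolding FB_def by metis
  let ?n = "\<lambda>a b. C1 * (bnd L a b + 1) + (bnd N a b + C2 * (bnd M a b + 1))"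
  \<comment> \<open>The factor 2 covers the run and the reading of the output.\<close>
  let ?T = "\<lambda>a b. 2 * (?n a b * (bnd L a b + 1 + ?n a b))"
  have "FB (\<lambda>a b x. x = (a, b)) (\<lambda>x. ?T (fst x) (snd x))"
    by (intro FB_add FB_mult FB_const FB_bnd)
  then obtain K where K: "\<And>a b. ?T a b \<le> bnd K a b" unfolding FB_def by fastforce
  let ?p = "Seq read_list (Seq (c 1) write_list)"
  have "\<exists>T. computes ?p x T (f x) \<and> T \<le> bnd K a b" if P: "P a b x" for a b x
  proof -
    obtain s1 where 1: "brun read_list (input_memory x) (C1 * (length x + 1)) s1" "live s1"
      "rep s1 (s1 (reg 1)) (enc x)" using C1 by blast
    from implementsD[OF N P 1(2,3)] obtain n s2 where 2: "brun (c 1) s1 n s2" "n \<le> bnd N a b"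
      "keeps 1 s1 s2" "rep s2 (s2 (reg 1)) (enc (f x))" "live s2" .
    obtain s3 where 3: "brun write_list s2 (C2 * (length (f x) + 1)) s3" "holds_output s3 (f x)"
      using C2(2) 2(4) by blast
    have "C1 * (length x + 1) \<le> C1 * (bnd L a b + 1)"
      using order_trans[OF length_le_encoding L[OF P]] by (intro mult_le_mono2) simp
    moreover have "C2 * (length (f x) + 1) \<le> C2 * (bnd M a b + 1)"
      using M[OF P] by (intro mult_le_mono2) simp
    ultimately have "C1 * (length x + 1) + (n + C2 * (length (f x) + 1)) \<le> ?n a b"
      using 2(2) by linarith
    from brun_mono[OF brun_Seq[OF 1(1) brun_Seq[OF 2(1) 3(1)]] this]
    have b: "brun ?p (input_memory x) (?n a b) s3" .
    have "word_bound (bnd L a b + 1) (input_memory x)"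
      by (rule word_bound_mono[OF word_bound_input]) (use L[OF P] in simp)
    with b obtain T where T: "exec ?p (input_memory x) T s3" "T \<le> ?n a b * (bnd L a b + 1 + ?n a b)"
      "word_bound (bnd L a b + 1 + ?n a b) s3" unfolding brun_def by blast
    \<comment> \<open>The letters of the output are words of the final memory, so the word bound at
      the end of the run limits their lengths.\<close>
    have "encoding_length (f x) \<le> length (f x) * (bnd L a b + 1 + ?n a b)"
    proof -
      have "bit_length (int y) \<le> bnd L a b + 1 + ?n a b" if y: "y \<in> set (f x)" for y
      proof -
        obtain i where "i < length (f x)" "y = f x ! i" using y by (auto simp: in_set_conv_nth)
        then have "int y = s3 (int i + 1)" using 3(2) by (simp add: holds_output_def)
        then show ?thesis using T(3) by (simp add: word_bound_def)
      qed
      then show ?thesis unfolding encoding_length_def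
        using sum_list_mono[of "f x" "\<lambda>y. bit_length (int y)" "\<lambda>_. bnd L a b + 1 + ?n a b"]
        by (simp add: sum_list_triv)
    qed
    also have "\<dots> \<le> ?n a b * (bnd L a b + 1 + ?n a b)"
    proof (rule mult_le_mono1)
      have "1 * length (f x) \<le> C2 * (bnd M a b + 1)" using C2(1) M[OF P] by (intro mult_le_mono) auto
      then show "length (f x) \<le> ?n a b" by simp
    qed
    finally have "T + encoding_length (f x) \<le> bnd K a b" using T(2) K[of a b] by linarith
    moreover have "computes ?p x (T + encoding_length (f x)) (f x)"
      unfolding computes_def using T(1) 3(2) by blast
    ultimately show ?thesis by blast
  qed
  then show ?thesis by blast
qed

section \<open>From computable functions to fixed-parameter tractability\<close>

lemma FC_tower: "FC (\<lambda>a b x. x \<le> a) (tower h)"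
proof (induction h)
  case 0
  show ?case by (simp add: FC_id)
next
  case (Suc h)
  let ?P = "\<lambda>a b x. x \<le> a"
  have PB: "PB ?P (tower h)" unfolding PB_def
    by (intro exI[of _ h]) (simp add: tower_mono)
  have "FC ?P (\<lambda>x. fold (\<lambda>_ n. n + n) [0..<tower h x] (1::nat))"
    by (rule FC_fold[OF FC_upt[OF Suc FB_of_PB[OF PB]] FC_const_nat, where Q = "\<lambda>_ _ _. True"])
      (simp_all add: FB_of_PB[OF PB] FC_add_nat FC_snd FC_id)
  moreover have "fold (\<lambda>_ n. n + n) [0..<k] (1::nat) = 2 ^ k" for k by (induction k) auto
  ultimately show ?case by simp
qed

lemma FC_sum_list_nat:
  assumes "FC P f" "FB P (\<lambda>x. length (f x))"
  shows "FC P (\<lambda>x. sum_list (f x) :: nat)"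
proof -
  have "FC P (\<lambda>x. fold (+) (f x) 0)"
    by (rule FC_fold[OF assms(1) FC_const_nat assms(2), where Q = "\<lambda>_ _ _. True"])
      (simp_all add: FC_add_nat FC_fst FC_snd FC_id)
  then show ?thesis by (simp add: fold_plus_sum_list_rev)
qed

text \<open>Computability of the parameter dependence is part of tractability. It comes from the
  same machinery: for a fixed word, its sum and its encoding length serve as \<open>a\<close> and
  \<open>b\<close>.\<close>

lemma computable_tower: "computable (\<lambda>p. tower h (sum_list p))"
proof -
  let ?P = "\<lambda>a b x. sum_list x \<le> a \<and> encoding_length x \<le> b"
  have "FC ?P (\<lambda>x. [tower h (sum_list x)])"
    by (intro FC_Cons FC_Nil FC_comp[OF FC_sum_list_nat FC_tower[of h]] FC_id FB_size)
      (auto intro: order_trans[OF length_le_encoding])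
  then have "\<exists>c N. \<forall>a b x. ?P a b x \<longrightarrow> (\<exists>T. computes c x T [tower h (sum_list x)] \<and> T \<le> bnd N a b)"
    by (rule FC_computes) (auto intro: FB_size FB_const)
  then obtain c where "\<And>a b x. ?P a b x \<Longrightarrow> \<exists>T. computes c x T [tower h (sum_list x)]" by blast
  then show ?thesis unfolding computable_def by blast
qed

text \<open>A tuple of parameters enters through its sum.\<close>

theorem fixed_parameter_tractable_FC:
  assumes "FC P f" "FB P encoding_length" "FB P (\<lambda>x. length (f x))"
    and "\<And>I. I \<in> S \<Longrightarrow> P (sum_list (param I)) (encoding_length (encode I)) (encode I)"
    and "\<And>I. I \<in> S \<Longrightarrow> correct I (f (encode I))" "\<And>I. I \<in> S \<Longrightarrow> encode I \<noteq> []"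
  shows "fixed_parameter_tractable S encode param correct"
proof -
  obtain c N where c: "\<forall>a b x. P a b x \<longrightarrow> (\<exists>T. computes c x T (f x) \<and> T \<le> bnd N a b)"
    using FC_computes[OF assms(1-3)] by blast
  \<comment> \<open>\<open>b + 2 \<le> 3 * b\<close> for \<open>b \<ge> 1\<close>, and nonempty
    encodings have positive length.\<close>
  have "bnd N a b \<le> 3 ^ N * (tower N a * b ^ N)" if "1 \<le> b" for a b
  proof -
    have "(b + 2) ^ N \<le> (3 * b) ^ N" using that by (intro power_mono) auto
    then show ?thesis by (simp add: bnd_def power_mult_distrib)
  qed
  moreover have "1 \<le> encoding_length (encode I)" if "I \<in> S" for I
    using length_le_encoding[of "encode I"] assms(6)[OF that] by (cases "encode I") auto
  ultimately have "\<forall>I\<in>S. \<exists>T ys. computes c (encode I) T ys \<and> correct I ys \<and>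
      T \<le> 3 ^ N * (tower N (sum_list (param I)) * encoding_length (encode I) ^ N)"
    using c assms(4,5) by (meson le_trans)
  then show ?thesis unfolding fixed_parameter_tractable_def
    by (intro exI[of _ c] exI[of _ "\<lambda>p. tower N (sum_list p)"] exI[of _ "3 ^ N"] exI[of _ N] conjI computable_tower)
qed


section \<open>Solving systems with few equations digit by digit\<close>

text \<open>The number with the binary digits \<open>g r\<close>, the most significant one at the
  head. This matches a history of choices that is extended at the head while digits are chosen from
  the least significant one upwards; the digits \<open>g r\<close> need not be 0 or 1.\<close>

primrec hsum :: "('r \<Rightarrow> int) \<Rightarrow> 'r list \<Rightarrow> int" where
  "hsum g [] = 0"
| "hsum g (r # h) = hsum g h + 2 ^ length h * g r"

lemma hsum_append: "hsum g (p @ s) = hsum g s + 2 ^ length s * hsum g p"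
  by (induction p) (auto simp: algebra_simps power_add)

lemma hsum_mult: "hsum (\<lambda>r. c * g r) h = c * hsum g h"
  by (induction h) (auto simp: algebra_simps)

lemma hsum_sum: "hsum (\<lambda>r. \<Sum>i\<in>A. f i r) h = (\<Sum>i\<in>A. hsum (f i) h)"
  by (induction h) (auto simp: sum.distrib sum_distrib_left)

lemma hsum_cong: "(\<And>r. r \<in> set h \<Longrightarrow> f r = g r) \<Longrightarrow> hsum f h = hsum g h"
  by (induction h) auto

lemma hsum_nonneg: "(\<And>r. r \<in> set h \<Longrightarrow> 0 \<le> f r) \<Longrightarrow> 0 \<le> hsum f h"
  by (induction h) auto

lemma hsum_eq_fold: "hsum g h = fold (\<lambda>r x. g r + 2 * x) h 0"
proof -
  have "fold (\<lambda>r x. g r + 2 * x) h y = hsum g h + 2 ^ length h * y" for y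
    by (induction h arbitrary: y) (auto simp: algebra_simps)
  then show ?thesis by simp
qed

lemma hsum_digits:
  assumes "0 \<le> x" "x < 2 ^ L"
  shows "hsum (\<lambda>i. x div 2 ^ i mod 2) (rev [0..<L]) = x"
proof -
  have "hsum (\<lambda>i. x div 2 ^ i mod 2) (rev [0..<k]) = x mod 2 ^ k" for k
  proof (induction k)
    case (Suc k)
    have "x mod 2 ^ Suc k = x mod 2 ^ k + 2 ^ k * (x div 2 ^ k mod 2)"
      using mod_mult2_eq'[of x "2 ^ k" 2] by (simp add: mult.commute)
    with Suc show ?case by simp
  qed simp
  then show ?thesis using assms by simp
qed

definition dedup :: "('a \<times> 'b) list \<Rightarrow> ('a \<times> 'b) list" where
  "dedup S = fold (\<lambda>e acc. if \<exists>e'\<in>set acc. fst e' = fst e then acc else e # acc) S []"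

lemma dedup_aux:
  "distinct (map fst acc) \<Longrightarrow>
   distinct (map fst (fold (\<lambda>e acc. if \<exists>e'\<in>set acc. fst e' = fst e then acc else e # acc) S acc)) \<and>
   set (fold (\<lambda>e acc. if \<exists>e'\<in>set acc. fst e' = fst e then acc else e # acc) S acc) \<subseteq> set acc \<union> set S \<and>
   fst ` set (fold (\<lambda>e acc. if \<exists>e'\<in>set acc. fst e' = fst e then acc else e # acc) S acc) = fst ` set acc \<union> fst ` set S"
proof (induction S arbitrary: acc)
  case (Cons e S)
  show ?case
  proof (cases "\<exists>e'\<in>set acc. fst e' = fst e")
    case True
    then have "fst e \<in> fst ` set acc" by (metis image_eqI)
    with Cons.IH[OF Cons.prems(1)] True show ?thesis by auto
  next
    case False
    then have "distinct (map fst (e # acc))" using Cons.prems(1) by auto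
    from Cons.IH[OF this] False show ?thesis by auto
  qed
qed simp

lemma distinct_dedup: "distinct (map fst (dedup S))"
  and dedup_subset: "set (dedup S) \<subseteq> set S"
  and fst_dedup: "fst ` set (dedup S) = fst ` set S"
  using dedup_aux[of "[]" S] unfolding dedup_def by auto

text \<open>A state is a residual right-hand side with the digits chosen so far, the last one first. States
  with equal residuals have the same continuations, so one of them suffices.\<close>

definition digit_step ::
    "('r \<Rightarrow> 'q \<Rightarrow> int) \<Rightarrow> 'q list \<Rightarrow> 'r list \<Rightarrow> (int list \<times> 'r list) list \<Rightarrow> (int list \<times> 'r list) list" where
  "digit_step g eqs cands S = dedup (concat (map (\<lambda>e.
     map (\<lambda>r. (map (\<lambda>p. (fst p - g r (snd p)) div 2) (zip (fst e) eqs), r # snd e))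
       (filter (\<lambda>r. \<forall>p\<in>set (zip (fst e) eqs). (fst p - g r (snd p)) mod 2 = 0) cands)) S))"

text \<open>As in all solvers below, the empty list reports that no solution was found.\<close>

definition digit_solve ::
    "('r \<Rightarrow> 'q \<Rightarrow> int) \<Rightarrow> 'q list \<Rightarrow> 'r list \<Rightarrow> int list \<Rightarrow> nat \<Rightarrow> 'r list list" where
  "digit_solve g eqs cands b L = map snd (filter (\<lambda>e. \<forall>x\<in>set (fst e). x = 0)
     (fold (\<lambda>_. digit_step g eqs cands) [0..<L] [(b, [])]))"

definition digit_states :: "('r \<Rightarrow> 'q \<Rightarrow> int) \<Rightarrow> 'q list \<Rightarrow> 'r list \<Rightarrow> int list \<Rightarrow> nat \<Rightarrow> (int list \<times> 'r list) list" where
  "digit_states g eqs cands b i = fold (\<lambda>_. digit_step g eqs cands) [0..<i] [(b, [])]"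

lemma digit_states_simps:
  "digit_states g eqs cands b 0 = [(b, [])]"
  "digit_states g eqs cands b (Suc i) = digit_step g eqs cands (digit_states g eqs cands b i)"
  by (simp_all add: digit_states_def)

lemma set_digit_step:
  "e' \<in> set (digit_step g eqs cands S) \<Longrightarrow> \<exists>e\<in>set S. \<exists>r\<in>set cands. snd e' = r # snd e \<and>
     fst e' = map (\<lambda>p. (fst p - g r (snd p)) div 2) (zip (fst e) eqs) \<and>
     (\<forall>p\<in>set (zip (fst e) eqs). (fst p - g r (snd p)) mod 2 = 0)"
  unfolding digit_step_def by (drule subsetD[OF dedup_subset]) force

lemma fst_digit_step:
  assumes "e \<in> set S" "r \<in> set cands" "\<forall>p\<in>set (zip (fst e) eqs). (fst p - g r (snd p)) mod 2 = 0"
  shows "map (\<lambda>p. (fst p - g r (snd p)) div 2) (zip (fst e) eqs) \<in> fst ` set (digit_step g eqs cands S)"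
  unfolding digit_step_def fst_dedup using assms by force

text \<open>The division by 2 is exact because only digits that leave an even residual pass the
  filter, so each step preserves the equation between the right-hand side, the digits chosen and the
  residual.\<close>

lemma digit_states_sound:
  assumes "length b = length eqs" "e \<in> set (digit_states g eqs cands b i)"
  shows "length (fst e) = length eqs \<and> set (snd e) \<subseteq> set cands \<and> length (snd e) = i \<and>
    (\<forall>j<length eqs. b ! j = hsum (\<lambda>r. g r (eqs ! j)) (snd e) + 2 ^ i * fst e ! j)"
  using assms(2)
proof (induction i arbitrary: e)
  case 0
  then show ?case using assms(1) by (auto simp: digit_states_simps)
next
  case (Suc i)
  from Suc.prems[unfolded digit_states_simps] obtain e0 r where
    e0: "e0 \<in> set (digit_states g eqs cands b i)" and r: "r \<in> set cands" "snd e = r # snd e0"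
    "fst e = map (\<lambda>p. (fst p - g r (snd p)) div 2) (zip (fst e0) eqs)"
    "\<forall>p\<in>set (zip (fst e0) eqs). (fst p - g r (snd p)) mod 2 = 0"
    by (blast dest: set_digit_step)
  note IH = Suc.IH[OF e0]
  have "b ! j = hsum (\<lambda>r. g r (eqs ! j)) (snd e) + 2 ^ Suc i * fst e ! j" if j: "j < length eqs" for j
  proof -
    let ?y = "fst e0 ! j - g r (eqs ! j)"
    have "(fst e0 ! j, eqs ! j) \<in> set (zip (fst e0) eqs)" using IH j by (auto simp: set_zip)
    then have "?y mod 2 = 0" using r(4) by force
    then have "2 * (?y div 2) = ?y" by (metis add.right_neutral mult_div_mod_eq)
    moreover have "fst e ! j = ?y div 2" using r(3) IH j by simp
    ultimately have "fst e0 ! j = g r (eqs ! j) + 2 * fst e ! j" by simp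
    moreover have "b ! j = hsum (\<lambda>r. g r (eqs ! j)) (snd e0) + 2 ^ i * fst e0 ! j" using IH j by blast
    ultimately have "b ! j = hsum (\<lambda>r. g r (eqs ! j)) (snd e0) + 2 ^ i * (g r (eqs ! j) + 2 * fst e ! j)" by simp
    then show ?thesis using r(2) IH by (simp add: algebra_simps)
  qed
  then show ?case using IH r by simp
qed

theorem digit_solve_sound:
  assumes "length b = length eqs" "h \<in> set (digit_solve g eqs cands b L)"
  shows "set h \<subseteq> set cands" "j < length eqs \<Longrightarrow> hsum (\<lambda>r. g r (eqs ! j)) h = b ! j"
proof -
  from assms(2) obtain e where e: "e \<in> set (digit_states g eqs cands b L)" "h = snd e" "\<forall>x\<in>set (fst e). x = 0"
    unfolding digit_solve_def digit_states_def by auto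
  note s = digit_states_sound[OF assms(1) e(1)]
  show "set h \<subseteq> set cands" using s e(2) by simp
  show "hsum (\<lambda>r. g r (eqs ! j)) h = b ! j" if "j < length eqs"
    using s that e(2,3) by (auto simp: nth_mem)
qed

text \<open>The history \<open>h\<close> itself may be lost when states with equal residuals are
  merged, but its residuals survive: after \<open>i\<close> digits the residual is the value of the
  remaining \<open>L - i\<close> most significant digits.\<close>

theorem digit_solve_complete:
  assumes "length b = length eqs" "length h = L" "set h \<subseteq> set cands"
    and "\<And>j. j < length eqs \<Longrightarrow> hsum (\<lambda>r. g r (eqs ! j)) h = b ! j"
  shows "digit_solve g eqs cands b L \<noteq> []"
proof -
  have "map (\<lambda>q. hsum (\<lambda>r. g r q) (take (L - i) h)) eqs \<in> fst ` set (digit_states g eqs cands b i)" if "i \<le> L" for i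
    using that
  proof (induction i)
    case 0
    have "map (\<lambda>q. hsum (\<lambda>r. g r q) h) eqs = b" using assms by (auto simp: list_eq_iff_nth_eq)
    then show ?case using assms(2) by (simp add: digit_states_simps)
  next
    case (Suc i)
    then obtain e where e: "e \<in> set (digit_states g eqs cands b i)"
      "fst e = map (\<lambda>q. hsum (\<lambda>r. g r q) (take (L - i) h)) eqs" by force
    let ?k = "L - Suc i" and ?r = "h ! (L - Suc i)"
    have k: "?k < length h" "L - i = Suc ?k" using Suc.prems assms(2) by auto
    then have t: "take (L - i) h = take ?k h @ [?r]" by (simp add: take_Suc_conv_app_nth)
    have z: "zip (fst e) eqs = map (\<lambda>q. (g ?r q + 2 * hsum (\<lambda>r. g r q) (take ?k h), q)) eqs"
      unfolding e(2) t by (simp add: hsum_append zip_map1 zip_same_conv_map)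
    have "?r \<in> set cands" using k assms(3) nth_mem by blast
    from fst_digit_step[OF e(1) this, of eqs g] show ?case
      unfolding z digit_states_simps by (simp add: comp_def)
  qed
  from this[of L] obtain e where e: "e \<in> set (digit_states g eqs cands b L)"
    "fst e = map (\<lambda>q. 0) eqs" by force
  then have "snd e \<in> set (digit_solve g eqs cands b L)"
    unfolding digit_solve_def digit_states_def by force
  then show ?thesis by auto
qed

text \<open>A residual is the initial right-hand side shifted by the number of digits, up to an error
  bounded by the coefficients.\<close>

lemma digit_states_length:
  assumes len: "length b = length eqs"
    and g: "\<And>r q. r \<in> set cands \<Longrightarrow> q \<in> set eqs \<Longrightarrow> 0 \<le> g r q \<and> g r q \<le> int \<gamma>"
  shows "length (digit_states g eqs cands b i) \<le> (\<gamma> + 1) ^ length eqs"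
proof -
  let ?S = "digit_states g eqs cands b i"
  let ?u = "\<lambda>i j. b ! j div 2 ^ i"
  \<comment> \<open>The width \<open>\<gamma>\<close> reproduces itself: subtracting at most
    \<open>\<gamma>\<close> from a number at least \<open>u - \<gamma>\<close> and halving gives at
    least \<open>u div 2 - \<gamma>\<close>.\<close>
  have box: "\<forall>j<length eqs. ?u i j - int \<gamma> \<le> fst e ! j \<and> fst e ! j \<le> ?u i j"
    if "e \<in> set (digit_states g eqs cands b i)" for e i
    using that
  proof (induction i arbitrary: e)
    case 0
    then show ?case by (simp add: digit_states_simps)
  next
    case (Suc i)
    from Suc.prems[unfolded digit_states_simps] obtain e0 r where
      e0: "e0 \<in> set (digit_states g eqs cands b i)" and r: "r \<in> set cands"
      "fst e = map (\<lambda>p. (fst p - g r (snd p)) div 2) (zip (fst e0) eqs)"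
      by (blast dest: set_digit_step)
    show ?case
    proof (intro allI impI)
      fix j assume j: "j < length eqs"
      have "fst e ! j = (fst e0 ! j - g r (eqs ! j)) div 2"
        using r(2) digit_states_sound[OF len e0] j by simp
      moreover have "?u (Suc i) j = ?u i j div 2" by (simp add: zdiv_zmult2_eq power_Suc2 del: power_Suc)
      moreover have "0 \<le> g r (eqs ! j) \<and> g r (eqs ! j) \<le> int \<gamma>" using g[OF r(1)] j by simp
      ultimately show "?u (Suc i) j - int \<gamma> \<le> fst e ! j \<and> fst e ! j \<le> ?u (Suc i) j"
        using Suc.IH[OF e0] j by fastforce
    qed
  qed
  let ?f = "\<lambda>xs. map (\<lambda>j. nat (?u i j - xs ! j)) [0..<length eqs]"
  have sub: "?f ` fst ` set ?S \<subseteq> {ys. set ys \<subseteq> {..\<gamma>} \<and> length ys = length eqs}"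
    using box by fastforce
  have inj: "inj_on ?f (fst ` set ?S)"
  proof (rule inj_onI)
    fix xs ys assume *: "xs \<in> fst ` set ?S" "ys \<in> fst ` set ?S" "?f xs = ?f ys"
    have l: "length xs = length eqs" "length ys = length eqs"
      using *(1,2) by (auto dest!: digit_states_sound[OF len])
    have "xs ! j = ys ! j" if j: "j < length eqs" for j
    proof -
      have "nat (?u i j - xs ! j) = nat (?u i j - ys ! j)" using *(3) j by simp
      moreover have "xs ! j \<le> ?u i j" "ys ! j \<le> ?u i j" using *(1,2) j by (auto dest!: box)
      ultimately show ?thesis by (simp add: eq_nat_nat_iff)
    qed
    then show "xs = ys" using l by (simp add: list_eq_iff_nth_eq)
  qed
  have "distinct (map fst ?S)"
    by (cases i) (auto simp: digit_states_simps digit_step_def distinct_dedup)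
  then have "length ?S = card (fst ` set ?S)" by (metis distinct_card length_map set_map)
  also have "\<dots> = card (?f ` fst ` set ?S)" using inj by (simp add: card_image)
  also have "\<dots> \<le> card {ys. set ys \<subseteq> {..\<gamma>} \<and> length ys = length eqs}"
    by (rule card_mono[OF finite_lists_length_eq sub]) simp
  finally show ?thesis by (simp add: card_lists_length_eq)
qed

section \<open>Running time of the digit search\<close>

lemma length_concat_le: "(\<And>ys. ys \<in> set yss \<Longrightarrow> length ys \<le> n) \<Longrightarrow> length (concat yss) \<le> length yss * n"
  by (induction yss) (auto simp: add_mono)

lemma FC_dedup:
  assumes "FC P S" "FB P (\<lambda>x. length (S x))"
    "FB (\<lambda>a b z. P a b (fst z) \<and> snd z \<in> set (S (fst z))) (\<lambda>z. length (fst (snd z)))"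
  shows "FC P (\<lambda>x. dedup (S x :: (int list \<times> 'r::enc) list))"
  unfolding dedup_def
proof (rule FC_fold[OF assms(1) FC_Nil assms(2)])
  let ?g = "\<lambda>e acc. if \<exists>e'\<in>set acc. fst e' = fst e then acc else e # acc"
  let ?Q = "\<lambda>a b z. P a b (fst z) \<and> fst (snd z) \<in> set (S (fst z)) \<and>
    length (snd (snd z)) \<le> length (S (fst z)) \<and> set (snd (snd z)) \<subseteq> set (S (fst z))"
  have len: "length (fold ?g ys acc) \<le> length ys + length acc" for ys acc
  proof (induction ys arbitrary: acc)
    case (Cons e ys)
    then show ?case using Cons[of "e # acc"] by (auto intro: le_SucI)
  qed simp
  show "?Q a b (x, y, fold ?g ys [])" if "P a b x" "S x = ys @ y # zs" for a b x ys y zs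
    using that len[of ys "[]"] dedup_aux[of "[]" ys] by auto
  have 1: "FB ?Q (\<lambda>z. length (snd (snd z)))"
    by (rule FB_mono[OF assms(2), where g = fst]) auto
  let ?Q' = "\<lambda>a b z. ?Q a b (fst z) \<and> snd z \<in> set (snd (snd (fst z)))"
  have 2: "FB ?Q' (\<lambda>z. length (fst (snd z)))"
    by (rule FB_mono[OF assms(3), where g = "\<lambda>z. (fst (fst z), snd z)"]) auto
  have 3: "FB ?Q' (\<lambda>z. length (fst (fst (snd (fst z)))))"
    by (rule FB_mono[OF assms(3), where g = "\<lambda>z. (fst (fst z), fst (snd (fst z)))"]) auto
  show "FC ?Q (\<lambda>z. ?g (fst (snd z)) (snd (snd z)))"
    by (intro FC_If FC_Bex FC_eq_ints FC_Cons FC_fst FC_snd FC_id 1 2 3)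
qed

lemma FC_digit_step:
  assumes S: "FC P S" "FB P (\<lambda>x. length (S x))"
      "\<And>a b x e. P a b x \<Longrightarrow> e \<in> set (S x) \<Longrightarrow> length (fst e) = length (eqs x)"
    and eqs: "FC P eqs" "FB P (\<lambda>x. length (eqs x))"
    and cands: "FC P cands" "FB P (\<lambda>x. length (cands x))"
    and g: "FC (\<lambda>a b z. P a b (fst z) \<and> fst (snd z) \<in> set (cands (fst z)) \<and> snd (snd z) \<in> set (eqs (fst z)))
      (\<lambda>z. g (fst z) (fst (snd z)) (snd (snd z)))"
  shows "FC P (\<lambda>x. digit_step (g x) (eqs x) (cands x) (S x))"
  unfolding digit_step_def
proof (rule FC_dedup)
  let ?P1 = "\<lambda>a b z. P a b (fst z) \<and> snd z \<in> set (S (fst z))"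
  let ?zip = "\<lambda>z. zip (fst (snd z)) (eqs (fst z))"
  have zip1: "FC ?P1 ?zip" "FB ?P1 (\<lambda>z. length (?zip z))"
  proof -
    have *: "FB ?P1 (\<lambda>z. length (fst (snd z)))" by (rule FB_mono[OF eqs(2), where g = fst]) (auto dest: S(3))
    then show "FC ?P1 ?zip" by (intro FC_zip FC_fst FC_snd FC_id FC_env[OF eqs(1)]) auto
    show "FB ?P1 (\<lambda>z. length (?zip z))" by (rule FB_le[OF *]) simp
  qed
  let ?t = "\<lambda>z r. \<forall>p\<in>set (?zip z). (fst p - g (fst z) r (snd p)) mod 2 = 0"
  let ?P2 = "\<lambda>a b z. ?P1 a b (fst z) \<and> snd z \<in> set (cands (fst (fst z)))"
  let ?P3 = "\<lambda>a b z. ?P2 a b (fst z) \<and> snd z \<in> set (?zip (fst (fst z)))"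
  have diff: "FC ?P3 (\<lambda>z. fst (snd z) - g (fst (fst (fst z))) (snd (fst z)) (snd (snd z)))"
  proof -
    have "FC ?P3 (\<lambda>z. g (fst (fst (fst z))) (snd (fst z)) (snd (snd z)))"
      by (rule FC_app3[OF g], (intro FC_fst FC_snd FC_id)+) (auto simp: set_zip)
    then show ?thesis by (intro FC_diff_int FC_fst FC_snd FC_id)
  qed
  have zip2: "FC ?P2 (\<lambda>z. ?zip (fst z))" by (rule FC_env[OF zip1(1)]) (auto intro: FC_fst FC_id)
  have zip2': "FB ?P2 (\<lambda>z. length (?zip (fst z)))" by (rule FB_env[OF zip1(2)]) auto
  have two: "FB ?P3 (\<lambda>z. bit_length 2)" by (rule FB_const)
  have t: "FC ?P2 (\<lambda>z. ?t (fst z) (snd z))"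
    by (intro FC_Ball zip2 zip2' FC_eq_int FC_mod_int diff FC_const_int two)
  have c1: "FC ?P1 (\<lambda>z. cands (fst z))" by (rule FC_env[OF cands(1)]) (auto intro: FC_fst FC_id)
  have c1': "FB ?P1 (\<lambda>z. length (cands (fst z)))" by (rule FB_env[OF cands(2)]) auto
  have f: "FC ?P1 (\<lambda>z. filter (?t z) (cands (fst z)))"
    by (intro FC_filter c1 c1' t)
  have f': "FB ?P1 (\<lambda>z. length (filter (?t z) (cands (fst z))))"
    by (rule FB_le[OF c1']) simp
  let ?P2' = "\<lambda>a b z. ?P1 a b (fst z) \<and> snd z \<in> set (filter (?t (fst z)) (cands (fst (fst z))))"
  have "FC ?P2 (\<lambda>z. (map (\<lambda>p. (fst p - g (fst (fst z)) (snd z) (snd p)) div 2) (?zip (fst z)), snd z # snd (snd (fst z))))"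
    by (intro FC_Pair FC_Cons FC_map zip2 zip2' FC_div_int diff FC_const_int FC_fst FC_snd FC_id)
  then have "FC ?P2' (\<lambda>z. (map (\<lambda>p. (fst p - g (fst (fst z)) (snd z) (snd p)) div 2) (?zip (fst z)), snd z # snd (snd (fst z))))"
    by (rule FC_mono) simp
  then have m: "FC ?P1 (\<lambda>z. map (\<lambda>r. (map (\<lambda>p. (fst p - g (fst z) r (snd p)) div 2) (?zip z), r # snd (snd z)))
      (filter (?t z) (cands (fst z))))"
    by (rule FC_map[OF f f'])
  have m': "FC P (\<lambda>x. map (\<lambda>e. map (\<lambda>r. (map (\<lambda>p. (fst p - g x r (snd p)) div 2) (zip (fst e) (eqs x)), r # snd e))
      (filter (\<lambda>r. \<forall>p\<in>set (zip (fst e) (eqs x)). (fst p - g x r (snd p)) mod 2 = 0) (cands x))) (S x))" (is "FC P ?M")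
    using FC_map[OF S(1,2) m] by simp
  have i: "FB (\<lambda>a b z. P a b (fst z) \<and> snd z \<in> set (?M (fst z))) (\<lambda>z. length (snd z))"
    by (rule FB_mono[OF cands(2), where g = fst]) (auto intro: le_trans[OF length_filter_le])
  show "FC P (\<lambda>x. concat (?M x))"
    by (rule FC_concat[OF m' _ i]) (use S(2) in simp)
  have cl: "length (concat (?M x)) \<le> length (S x) * length (cands x)" for x
    by (rule order_trans[OF length_concat_le[of _ "length (cands x)"]]) (auto intro: le_trans[OF length_filter_le])
  show "FB P (\<lambda>x. length (concat (?M x)))"
    by (rule FB_le[OF FB_mult[OF S(2) cands(2)] cl])
  show "FB (\<lambda>a b z. P a b (fst z) \<and> snd z \<in> set (concat (?M (fst z)))) (\<lambda>z. length (fst (snd z)))"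
    by (rule FB_mono[OF eqs(2), where g = fst]) auto
qed

text \<open>The number of states stays below \<open>(\<gamma> + 1) ^ length eqs\<close>, a bound in
  the parameters alone; the size of the numbers enters the number of iterations only through
  \<open>L\<close>.\<close>

lemma FC_digit_solve:
  assumes eqs: "FC P eqs" "PB P (\<lambda>x. length (eqs x))"
    and cands: "FC P cands" "PB P (\<lambda>x. length (cands x))"
    and L: "FC P L" "FB P L"
    and b: "FC P b" "\<And>a c x. P a c x \<Longrightarrow> length (b x) = length (eqs x)"
    and g: "FC (\<lambda>a b z. P a b (fst z) \<and> fst (snd z) \<in> set (cands (fst z)) \<and> snd (snd z) \<in> set (eqs (fst z)))
      (\<lambda>z. g (fst z) (fst (snd z)) (snd (snd z)))"
    and \<gamma>: "PB P \<gamma>" "\<And>a c x r q. P a c x \<Longrightarrow> r \<in> set (cands x) \<Longrightarrow> q \<in> set (eqs x) \<Longrightarrow>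
      0 \<le> g x r q \<and> g x r q \<le> int (\<gamma> x)"
  shows "FC P (\<lambda>x. digit_solve (g x) (eqs x) (cands x) (b x) (L x))"
proof -
  let ?st = "\<lambda>x. digit_states (g x) (eqs x) (cands x) (b x)"
  let ?Q = "\<lambda>a b z. P a b (fst z) \<and> (\<exists>i. snd (snd z) = ?st (fst z) i)"
  have bound: "PB P (\<lambda>x. (\<gamma> x + 1) ^ length (eqs x))"
    by (intro PB_power PB_add PB_const eqs \<gamma>)
  have dl: "length (?st x i) \<le> (\<gamma> x + 1) ^ length (eqs x)" if "P a c x" for a c x i
    by (rule digit_states_length[OF b(2)[OF that] \<gamma>(2)[OF that]])
  have len: "FB ?Q (\<lambda>z. length (snd (snd z)))"
    by (rule FB_mono[OF FB_of_PB[OF bound], where g = fst]) (use dl in auto)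
  let ?P2 = "\<lambda>a b z. ?Q a b (fst z) \<and> fst (snd z) \<in> set (cands (fst (fst z))) \<and> snd (snd z) \<in> set (eqs (fst (fst z)))"
  have 1: "FC P (\<lambda>x. fold (\<lambda>_. digit_step (g x) (eqs x) (cands x)) [0..<L x] [(b x, [])])"
  proof (rule FC_fold[OF FC_upt[OF L], where Q = ?Q])
    show "FC P (\<lambda>x. [(b x, [])])" by (intro FC_Cons FC_Pair b FC_Nil)
    show "FB P (\<lambda>x. length [0..<L x])" using L(2) by simp
    show "FC ?Q (\<lambda>z. digit_step (g (fst z)) (eqs (fst z)) (cands (fst z)) (snd (snd z)))"
    proof (rule FC_digit_step)
      show "FC ?Q (\<lambda>z. snd (snd z))" by (intro FC_snd FC_id)
      show "length (fst e) = length (eqs (fst z))" if "?Q a c z" "e \<in> set (snd (snd z))" for a c z e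
        using digit_states_sound[OF b(2)] that by fastforce
      show "FC ?Q (\<lambda>z. eqs (fst z))" by (rule FC_env[OF eqs(1)]) (auto intro: FC_fst FC_id)
      show "FC ?Q (\<lambda>z. cands (fst z))" by (rule FC_env[OF cands(1)]) (auto intro: FC_fst FC_id)
      show "FB ?Q (\<lambda>z. length (eqs (fst z)))" by (rule FB_env[OF FB_of_PB[OF eqs(2)]]) auto
      show "FB ?Q (\<lambda>z. length (cands (fst z)))" by (rule FB_env[OF FB_of_PB[OF cands(2)]]) auto
      show "FC ?P2 (\<lambda>z. g (fst (fst z)) (fst (snd z)) (snd (snd z)))"
        by (rule FC_app3[OF g]) (intro FC_fst FC_snd FC_id, simp)+
    qed (rule len)
    show "?Q a c (x, y, fold (\<lambda>_. digit_step (g x) (eqs x) (cands x)) ys [(b x, [])])"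
      if "P a c x" "[0..<L x] = ys @ y # zs" for a c x ys y zs
    proof -
      have "fold (\<lambda>_. digit_step (g x) (eqs x) (cands x)) ys [(b x, [])] = ?st x (length ys)"
        unfolding digit_states_def by (induction ys rule: rev_induct) auto
      then show ?thesis using that(1) by auto
    qed
  qed
  have l: "FB P (\<lambda>x. length (fold (\<lambda>_. digit_step (g x) (eqs x) (cands x)) [0..<L x] [(b x, [])]))"
    by (rule FB_le[OF FB_of_PB[OF bound]], fold digit_states_def) (use dl in auto)
  let ?P3 = "\<lambda>a c z. P a c (fst z) \<and>
    snd z \<in> set (fold (\<lambda>_. digit_step (g (fst z)) (eqs (fst z)) (cands (fst z))) [0..<L (fst z)] [(b (fst z), [])])"
  have 3: "FB ?P3 (\<lambda>z. length (fst (snd z)))"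
    by (rule FB_mono[OF FB_of_PB[OF eqs(2)], where g = fst])
      (use digit_states_sound[OF b(2)] in \<open>fastforce simp: digit_states_def\<close>)
  show ?thesis unfolding digit_solve_def
    by (intro FC_map FC_filter 1 l FC_Ball FC_fst FC_snd FC_id 3 FC_eq_int FC_const_int FB_le[OF l length_filter_le])
qed


section \<open>Block systems with few equations\<close>

text \<open>The default makes indexing total, so that no side condition on the index arises in the
  running time rules.\<close>

definition nth_or :: "'a \<Rightarrow> 'a list \<Rightarrow> nat \<Rightarrow> 'a" where
  "nth_or d xs i = (if drop i xs \<noteq> [] then hd (drop i xs) else d)"

lemma nth_or_nth [simp]: "i < length xs \<Longrightarrow> nth_or d xs i = xs ! i"
  by (simp add: nth_or_def hd_drop_conv_nth)

lemma FC_nth_or: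
  assumes "FC P d" "FC P xs" "FC P i" "FB P i"
  shows "FC P (\<lambda>x. nth_or (d x) (xs x) (i x))"
proof -
  have dr: "FC P (\<lambda>x. drop (i x) (xs x))" by (intro FC_drop assms)
  show ?thesis unfolding nth_or_def
    by (intro FC_If FC_not_Nil FC_hd dr FC_mono[OF dr] FC_mono[OF assms(1)]) auto
qed

text \<open>The coefficients come second in the pairs because \<open>FC_mult_int\<close> asks for
  short second factors; the entries of \<open>z\<close> may be long.\<close>

definition dot :: "int list \<Rightarrow> int list \<Rightarrow> int" where
  "dot c z = sum_list (map (\<lambda>p. fst p * snd p) (zip z c))"

lemma dot_eq_sum: "length c = d \<Longrightarrow> length z = d \<Longrightarrow> dot c z = (\<Sum>v<d. c ! v * z ! v)"
  unfolding dot_def by (simp add: sum_list_sum_nth atLeast0LessThan mult.commute)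

lemma FC_dot:
  assumes "FC P c" "FC P z" "FB P (\<lambda>x. length (z x))"
    "FB (\<lambda>a b y. P a b (fst y) \<and> snd y \<in> set (c (fst y))) (\<lambda>y. bit_length (snd y))"
  shows "FC P (\<lambda>x. dot (c x) (z x))"
proof -
  have len: "FB P (\<lambda>x. length (zip (z x) (c x)))" by (rule FB_le[OF assms(3)]) simp
  have "FB (\<lambda>a b y. P a b (fst y) \<and> snd y \<in> set (zip (z (fst y)) (c (fst y)))) (\<lambda>y. bit_length (snd (snd y)))"
    by (rule FB_mono[OF assms(4), where g = "\<lambda>y. (fst y, snd (snd y))"]) (auto simp: set_zip)
  with len show ?thesis unfolding dot_def
    by (intro FC_sum_list FC_map FC_zip assms(1-3) FC_mult_int FC_fst FC_snd FC_id) simp_all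
qed

definition apply_rows :: "int list list \<Rightarrow> int list \<Rightarrow> int list" where
  "apply_rows B z = map (\<lambda>c. dot c z) B"

definition nonneg :: "nat \<Rightarrow> int list \<Rightarrow> bool" where
  "nonneg d z \<longleftrightarrow> length z = d \<and> (\<forall>v<d. 0 \<le> z ! v)"

definition vector_sum :: "nat \<Rightarrow> int list list \<Rightarrow> int list" where
  "vector_sum d zs = map (\<lambda>v. sum_list (map (\<lambda>z. nth_or 0 z v) zs)) [0..<d]"

lemma length_vector_sum [simp]: "length (vector_sum d zs) = d"
  by (simp add: vector_sum_def)

lemma nth_vector_sum:
  assumes "v < d" "\<And>z. z \<in> set zs \<Longrightarrow> length z = d"
  shows "vector_sum d zs ! v = (\<Sum>c<length zs. zs ! c ! v)"
proof -
  have "map (\<lambda>z. nth_or 0 z v) zs = map (\<lambda>z. z ! v) zs" using assms by (auto intro: map_cong)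
  moreover have "vector_sum d zs ! v = sum_list (map (\<lambda>z. nth_or 0 z v) zs)" using assms(1) by (simp add: vector_sum_def)
  ultimately have "vector_sum d zs ! v = sum_list (map (\<lambda>z. z ! v) zs)" by (simp only:)
  also have "\<dots> = (\<Sum>c<length zs. zs ! c ! v)" by (simp add: sum_list_sum_nth atLeast0LessThan)
  finally show ?thesis .
qed

lemma FC_vector_sum:
  assumes "FC P d" "FB P d" "FC P zs" "FB P (\<lambda>x. length (zs x))"
  shows "FC P (\<lambda>x. vector_sum (d x) (zs x))"
proof -
  let ?Q = "\<lambda>a b y. P a b (fst y) \<and> snd y \<in> set [0..<d (fst y)]"
  have zs: "FC ?Q (\<lambda>y. zs (fst y))" by (rule FC_env[OF assms(3)]) (auto intro: FC_fst FC_id)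
  have zs': "FB ?Q (\<lambda>y. length (zs (fst y)))" by (rule FB_env[OF assms(4)]) simp
  have v: "FB (\<lambda>a b y. ?Q a b (fst y) \<and> snd y \<in> set (zs (fst (fst y)))) (\<lambda>y. snd (fst y))"
    by (rule FB_mono[OF assms(2), where g = "\<lambda>y. fst (fst y)"]) auto
  have d: "FB P (\<lambda>x. length [0..<d x])" using assms(2) by simp
  have m: "FB ?Q (\<lambda>y. length (map (\<lambda>z. nth_or 0 z (snd y)) (zs (fst y))))" using zs' by simp
  show ?thesis unfolding vector_sum_def
    by (intro FC_map FC_upt assms d FC_sum_list m zs zs' FC_nth_or v FC_const_int FC_fst FC_snd FC_id)
qed

text \<open>Labels of the equations: \<open>(k, j)\<close> is row \<open>j\<close> of block
  \<open>k\<close>, and the first component \<open>K\<close> marks the linking equations, one for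
  each coordinate \<open>v\<close>. The system has the shape of an n-fold integer program with the
  identity in the linking rows.\<close>

definition block_eqs :: "nat \<Rightarrow> nat \<Rightarrow> nat \<Rightarrow> (nat \<times> nat) list" where
  "block_eqs K M d = concat (map (\<lambda>k. map (\<lambda>j. (k, j)) [0..<M]) [0..<K]) @ map (\<lambda>v. (K, v)) [0..<d]"

lemma set_block_eqs: "set (block_eqs K M d) = {..<K} \<times> {..<M} \<union> {K} \<times> {..<d}"
  unfolding block_eqs_def by auto

lemma length_block_eqs: "length (block_eqs K M d) = K * M + d"
  by (simp add: block_eqs_def length_concat comp_def sum_list_triv)

definition block_val :: "int list list \<Rightarrow> nat \<Rightarrow> int list list \<Rightarrow> nat \<times> nat \<Rightarrow> int" where
  "block_val B K r q = (if fst q < K then dot (nth_or [] B (snd q)) (nth_or [] r (fst q))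
     else sum_list (map (\<lambda>z. nth_or 0 z (snd q)) r))"

definition block_rhs :: "nat \<Rightarrow> int list list \<Rightarrow> int list \<Rightarrow> nat \<times> nat \<Rightarrow> int" where
  "block_rhs K \<beta>s W q = (if fst q < K then nth_or 0 (nth_or [] \<beta>s (fst q)) (snd q) else nth_or 0 W (snd q))"

text \<open>One candidate assigns a binary digit to all unknowns of all blocks at the same
  time.\<close>

definition block_digits :: "nat \<Rightarrow> nat \<Rightarrow> int list list list" where
  "block_digits K d = List.n_lists K (List.n_lists d [0, 1])"

text \<open>Each unknown is at most a coordinate of \<open>W\<close>, hence at most
  \<open>sum_list W\<close>, which fixes the number of digits.\<close>

definition block_solve :: "nat \<Rightarrow> int list list \<Rightarrow> int list list \<Rightarrow> int list \<Rightarrow> int list list list" where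
  "block_solve d B \<beta>s W = map (\<lambda>h. map (\<lambda>k. map (\<lambda>v. fold (\<lambda>r x. nth_or 0 (nth_or [] r k) v + 2 * x) h 0) [0..<d]) [0..<length \<beta>s])
     (digit_solve (block_val B (length \<beta>s)) (block_eqs (length \<beta>s) (length B) d) (block_digits (length \<beta>s) d)
       (map (block_rhs (length \<beta>s) \<beta>s W) (block_eqs (length \<beta>s) (length B) d)) (halvings (sum_list W)))"

definition solution :: "nat \<Rightarrow> int list list \<Rightarrow> int list list \<Rightarrow> int list \<Rightarrow> int list list \<Rightarrow> bool" where
  "solution d B \<beta>s W zs \<longleftrightarrow> map (apply_rows B) zs = \<beta>s \<and> (\<forall>z\<in>set zs. nonneg d z) \<and> vector_sum d zs = W"

definition well_formed :: "nat \<Rightarrow> int list list \<Rightarrow> bool" where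
  "well_formed d B \<longleftrightarrow> (\<forall>c\<in>set B. length c = d \<and> set c \<subseteq> {0, 1})"

lemma apply_rows_nth:
  assumes "well_formed d B" "length z = d" "j < length B"
  shows "apply_rows B z ! j = (\<Sum>v<d. B ! j ! v * z ! v)"
  using assms unfolding apply_rows_def well_formed_def by (simp add: dot_eq_sum)

lemma length_apply_rows [simp]: "length (apply_rows B z) = length B"
  by (simp add: apply_rows_def)

lemma apply_rows_vector_sum:
  assumes B: "well_formed d B" and zs: "\<And>z. z \<in> set zs \<Longrightarrow> length z = d"
  shows "apply_rows B (vector_sum d zs) = vector_sum (length B) (map (apply_rows B) zs)"
proof (rule nth_equalityI)
  fix j assume "j < length (apply_rows B (vector_sum d zs))"
  then have j: "j < length B" by simp
  have "apply_rows B (vector_sum d zs) ! j = (\<Sum>v<d. B ! j ! v * (\<Sum>c<length zs. zs ! c ! v))"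
    using zs by (simp add: apply_rows_nth[OF B _ j] nth_vector_sum)
  also have "\<dots> = (\<Sum>c<length zs. \<Sum>v<d. B ! j ! v * zs ! c ! v)"
    unfolding sum_distrib_left by (rule sum.swap)
  also have "\<dots> = vector_sum (length B) (map (apply_rows B) zs) ! j"
    using zs j by (subst nth_vector_sum) (auto simp: apply_rows_nth[OF B] intro!: sum.cong)
  finally show "apply_rows B (vector_sum d zs) ! j = vector_sum (length B) (map (apply_rows B) zs) ! j" .
qed simp

lemma block_digitsD:
  assumes "r \<in> set (block_digits K d)"
  shows "length r = K" "k < K \<Longrightarrow> length (r ! k) = d" "k < K \<Longrightarrow> v < d \<Longrightarrow> r ! k ! v \<in> {0, 1}"
proof -
  have r: "length r = K" "set r \<subseteq> {ys. length ys = d \<and> set ys \<subseteq> {0, 1}}"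
    using assms by (auto simp: block_digits_def set_n_lists)
  show "length r = K" by (rule r)
  have "length (r ! k) = d \<and> set (r ! k) \<subseteq> {0, 1}" if "k < K" for k
    using subsetD[OF r(2) nth_mem, of k] r(1) that by simp
  then show "k < K \<Longrightarrow> length (r ! k) = d" "k < K \<Longrightarrow> v < d \<Longrightarrow> r ! k ! v \<in> {0, 1}"
    using nth_mem by blast+
qed

lemma block_val_row:
  assumes "well_formed d B" "length r = K" "length (r ! k) = d" "k < K" "j < length B"
  shows "block_val B K r (k, j) = (\<Sum>v<d. B ! j ! v * r ! k ! v)"
  using assms by (simp add: block_val_def dot_eq_sum well_formed_def)

lemma block_val_line:
  assumes "length r = K" "\<And>k. k < K \<Longrightarrow> length (r ! k) = d" "v < d"
  shows "block_val B K r (K, v) = (\<Sum>k<K. r ! k ! v)"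
  using assms by (simp add: block_val_def sum_list_sum_nth atLeast0LessThan)

theorem block_solve_sound:
  assumes B: "well_formed d B" and \<beta>: "\<forall>\<beta>\<in>set \<beta>s. length \<beta> = length B" and W: "length W = d"
    and zs: "zs \<in> set (block_solve d B \<beta>s W)"
  shows "solution d B \<beta>s W zs"
proof -
  let ?K = "length \<beta>s"
  let ?eqs = "block_eqs ?K (length B) d"
  obtain h where h: "h \<in> set (digit_solve (block_val B ?K) ?eqs (block_digits ?K d)
       (map (block_rhs ?K \<beta>s W) ?eqs) (halvings (sum_list W)))"
    and zs_def: "zs = map (\<lambda>k. map (\<lambda>v. fold (\<lambda>r x. nth_or 0 (nth_or [] r k) v + 2 * x) h 0) [0..<d]) [0..<?K]"
    using zs unfolding block_solve_def by auto
  note s = digit_solve_sound[OF length_map h]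
  have digits: "length r = ?K" "k < ?K \<Longrightarrow> length (r ! k) = d" "k < ?K \<Longrightarrow> v < d \<Longrightarrow> r ! k ! v \<in> {0, 1}"
    if "r \<in> set h" for r k v using block_digitsD[OF subsetD[OF s(1) that]] by auto
  have eq: "hsum (\<lambda>r. block_val B ?K r q) h = block_rhs ?K \<beta>s W q" if "q \<in> set ?eqs" for q
    using that s(2) by (auto simp: in_set_conv_nth)
  have z: "zs ! k ! v = hsum (\<lambda>r. r ! k ! v) h" if "k < ?K" "v < d" for k v
  proof -
    have "zs ! k ! v = hsum (\<lambda>r. nth_or 0 (nth_or [] r k) v) h"
      using that by (simp add: zs_def hsum_eq_fold)
    also have "\<dots> = hsum (\<lambda>r. r ! k ! v) h"
      by (rule hsum_cong) (use that digits in simp)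
    finally show ?thesis .
  qed
  have len: "length zs = ?K" "\<And>k. k < ?K \<Longrightarrow> length (zs ! k) = d" by (simp_all add: zs_def)
  have lenz: "length z = d" if "z \<in> set zs" for z
    using that len by (metis in_set_conv_nth)
  have "map (apply_rows B) zs = \<beta>s"
  proof (rule nth_equalityI)
    fix k assume "k < length (map (apply_rows B) zs)"
    then have k: "k < ?K" using len by simp
    have "apply_rows B (zs ! k) = \<beta>s ! k"
    proof (rule nth_equalityI)
      show l: "length (apply_rows B (zs ! k)) = length (\<beta>s ! k)" using \<beta> k by simp
      fix j assume "j < length (apply_rows B (zs ! k))"
      then have j: "j < length B" by simp
      have "apply_rows B (zs ! k) ! j = (\<Sum>v<d. B ! j ! v * hsum (\<lambda>r. r ! k ! v) h)"
        using apply_rows_nth[OF B len(2)[OF k] j] z[OF k] by simp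
      \<comment> \<open>By linearity, an equation between numbers is the weighted sum of its
        instances at the single digits.\<close>
      also have "\<dots> = hsum (\<lambda>r. \<Sum>v<d. B ! j ! v * r ! k ! v) h"
        by (simp add: hsum_sum hsum_mult)
      also have "\<dots> = hsum (\<lambda>r. block_val B ?K r (k, j)) h"
        by (rule hsum_cong) (use k j digits in \<open>simp add: block_val_row[OF B]\<close>)
      also have "\<dots> = block_rhs ?K \<beta>s W (k, j)" by (rule eq) (use k j in \<open>simp add: set_block_eqs\<close>)
      also have "\<dots> = \<beta>s ! k ! j" using k j \<beta> by (simp add: block_rhs_def)
      finally show "apply_rows B (zs ! k) ! j = \<beta>s ! k ! j" .
    qed
    then show "map (apply_rows B) zs ! k = \<beta>s ! k" using k len by simp
  qed (simp add: len)
  moreover have "\<forall>z\<in>set zs. nonneg d z"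
  proof
    fix z assume "z \<in> set zs"
    then obtain k where k: "k < ?K" "z = zs ! k" using len by (metis in_set_conv_nth)
    show "nonneg d z" unfolding nonneg_def k(2)
      using len k(1) z digits by (auto intro!: hsum_nonneg) (metis digits(3) insertE order_refl singletonD zero_le_one)
  qed
  moreover have "vector_sum d zs = W"
  proof (rule nth_equalityI)
    fix v assume "v < length (vector_sum d zs)"
    then have v: "v < d" by simp
    have "vector_sum d zs ! v = (\<Sum>k<?K. hsum (\<lambda>r. r ! k ! v) h)"
      using lenz len z v by (simp add: nth_vector_sum)
    also have "\<dots> = hsum (\<lambda>r. block_val B ?K r (?K, v)) h"
      unfolding hsum_sum[symmetric] by (rule hsum_cong) (use v digits block_val_line in metis)
    also have "\<dots> = block_rhs ?K \<beta>s W (?K, v)" by (rule eq) (use v in \<open>simp add: set_block_eqs\<close>)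
    also have "\<dots> = W ! v" using v W by (simp add: block_rhs_def)
    finally show "vector_sum d zs ! v = W ! v" .
  qed (simp add: W)
  ultimately show ?thesis by (simp add: solution_def)
qed

lemma hsum_map: "hsum f (map \<phi> xs) = hsum (\<lambda>i. f (\<phi> i)) xs"
  by (induction xs) auto

lemma solution_le:
  assumes "solution d B \<beta>s W zs" "z \<in> set zs" "v < d"
  shows "0 \<le> z ! v" "z ! v \<le> W ! v"
proof -
  have nn: "\<And>z. z \<in> set zs \<Longrightarrow> nonneg d z" and W: "W = vector_sum d zs" using assms(1) by (auto simp: solution_def)
  then show "0 \<le> z ! v" using assms by (auto simp: nonneg_def)
  obtain c where c: "c < length zs" "z = zs ! c" using assms(2) by (metis in_set_conv_nth)
  have "zs ! c ! v \<le> (\<Sum>c<length zs. zs ! c ! v)"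
    by (rule member_le_sum) (use c nn assms(3) in \<open>auto simp: nonneg_def\<close>)
  then show "z ! v \<le> W ! v" unfolding W c(2) using nn assms(3) by (subst nth_vector_sum) (auto simp: nonneg_def)
qed

lemma nth_le_sum_list:
  assumes "\<And>v. v < length W \<Longrightarrow> (0::int) \<le> W ! v" "v < length W"
  shows "W ! v \<le> sum_list W"
proof -
  have "W ! v \<le> (\<Sum>v<length W. W ! v)" by (rule member_le_sum) (use assms in auto)
  then show ?thesis by (simp add: sum_list_sum_nth atLeast0LessThan)
qed

theorem block_solve_complete:
  assumes B: "well_formed d B" and zs: "solution d B \<beta>s W zs"
  shows "block_solve d B \<beta>s W \<noteq> []"
proof -
  let ?K = "length \<beta>s"
  let ?eqs = "block_eqs ?K (length B) d"
  let ?L = "halvings (sum_list W)"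
  \<comment> \<open>The digits in position \<open>i\<close> of all unknowns; the positions are
    reversed to have the most significant one at the head.\<close>
  let ?r = "\<lambda>i. map (map (\<lambda>x. x div 2 ^ i mod 2)) zs"
  let ?h = "map ?r (rev [0..<?L])"
  have nn: "\<And>z. z \<in> set zs \<Longrightarrow> nonneg d z" and W: "W = vector_sum d zs" and \<beta>: "\<beta>s = map (apply_rows B) zs"
    using zs by (auto simp: solution_def)
  have len: "length zs = ?K" "\<And>k. k < ?K \<Longrightarrow> length (zs ! k) = d" "length W = d"
    using nn by (auto simp: \<beta> W nonneg_def)
  have W0: "0 \<le> W ! v" if "v < d" for v
    using that nn unfolding W by (subst nth_vector_sum) (auto simp: nonneg_def intro!: sum_nonneg)
  have x: "0 \<le> zs ! k ! v" "zs ! k ! v < 2 ^ ?L" if "k < ?K" "v < d" for k v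
  proof -
    have "zs ! k \<in> set zs" using that len by simp
    note * = solution_le[OF zs this that(2)]
    show "0 \<le> zs ! k ! v" by (rule *)
    have "zs ! k ! v \<le> sum_list W" using *(2) nth_le_sum_list[of W v] W0 len(3) that(2) by auto
    then show "zs ! k ! v < 2 ^ ?L" using less_halvings[of "sum_list W"] by linarith
  qed
  have dig: "hsum (\<lambda>i. zs ! k ! v div 2 ^ i mod 2) (rev [0..<?L]) = zs ! k ! v" if "k < ?K" "v < d" for k v
    by (rule hsum_digits[OF x[OF that]])
  have val: "hsum (\<lambda>r. block_val B ?K r q) ?h = block_rhs ?K \<beta>s W q" if q: "q \<in> set ?eqs" for q
  proof -
    obtain k j where kj: "q = (k, j)" "k < ?K \<and> j < length B \<or> k = ?K \<and> j < d"
      using q by (auto simp: set_block_eqs)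
    show ?thesis
    proof (cases "k < ?K")
      case True
      then have j: "j < length B" using kj(2) by auto
      have "hsum (\<lambda>r. block_val B ?K r q) ?h = hsum (\<lambda>i. \<Sum>v<d. B ! j ! v * (zs ! k ! v div 2 ^ i mod 2)) (rev [0..<?L])"
        unfolding hsum_map kj(1) using True j len
        by (intro hsum_cong) (subst block_val_row[OF B], auto intro!: sum.cong)
      also have "\<dots> = (\<Sum>v<d. B ! j ! v * zs ! k ! v)"
      proof (subst hsum_sum, rule sum.cong[OF refl])
        fix v assume "v \<in> {..<d}"
        then have v: "v < d" by simp
        show "hsum (\<lambda>i. B ! j ! v * (zs ! k ! v div 2 ^ i mod 2)) (rev [0..<?L]) = B ! j ! v * zs ! k ! v"
          by (subst hsum_mult, subst dig[OF True v], rule refl)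
      qed
      also have "\<dots> = block_rhs ?K \<beta>s W q"
      proof -
        have "\<beta>s ! k = apply_rows B (zs ! k)" using True len(1) by (metis \<beta> nth_map)
        then show ?thesis
          using True j apply_rows_nth[OF B len(2)[OF True] j] by (simp add: kj(1) block_rhs_def)
      qed
      finally show ?thesis .
    next
      case False
      then have k: "k = ?K" and j: "j < d" using kj(2) by auto
      have "hsum (\<lambda>r. block_val B ?K r q) ?h = hsum (\<lambda>i. \<Sum>c<?K. zs ! c ! j div 2 ^ i mod 2) (rev [0..<?L])"
        unfolding hsum_map kj(1) k using j len
        by (intro hsum_cong) (subst block_val_line[where d = d], auto intro!: sum.cong)
      also have "\<dots> = (\<Sum>c<?K. zs ! c ! j)"
      proof (subst hsum_sum, rule sum.cong[OF refl])
        fix c assume "c \<in> {..<?K}"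
        then have c: "c < ?K" by simp
        show "hsum (\<lambda>i. zs ! c ! j div 2 ^ i mod 2) (rev [0..<?L]) = zs ! c ! j"
          by (rule dig[OF c j])
      qed
      also have "\<dots> = W ! j" unfolding W using j nn len(1)
        by (subst nth_vector_sum) (auto simp: nonneg_def)
      also have "\<dots> = block_rhs ?K \<beta>s W q" using j len by (simp add: kj(1) k block_rhs_def)
      finally show ?thesis .
    qed
  qed
  have "digit_solve (block_val B ?K) ?eqs (block_digits ?K d) (map (block_rhs ?K \<beta>s W) ?eqs) ?L \<noteq> []"
  proof (rule digit_solve_complete)
    show "set ?h \<subseteq> set (block_digits ?K d)"
      using len nn by (auto simp: block_digits_def set_n_lists nonneg_def)
    show "hsum (\<lambda>r. block_val B ?K r (?eqs ! j)) ?h = map (block_rhs ?K \<beta>s W) ?eqs ! j" if "j < length ?eqs" for j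
      using val[of "?eqs ! j"] that by simp
  qed simp_all
  then show ?thesis by (simp add: block_solve_def)
qed

section \<open>Running time of the block solver\<close>

lemma length_digit_solve:
  assumes "length b = length eqs"
    "\<And>r q. r \<in> set cands \<Longrightarrow> q \<in> set eqs \<Longrightarrow> 0 \<le> g r q \<and> g r q \<le> int \<gamma>"
  shows "length (digit_solve g eqs cands b L) \<le> (\<gamma> + 1) ^ length eqs"
  unfolding digit_solve_def digit_states_def[symmetric] length_map
  by (rule order_trans[OF length_filter_le digit_states_length]) (use assms in auto)

lemma digit_solve_length_history:
  "length b = length eqs \<Longrightarrow> h \<in> set (digit_solve g eqs cands b L) \<Longrightarrow> length h = L"
  unfolding digit_solve_def digit_states_def[symmetric] by (auto dest: digit_states_sound)

text \<open>This is the coefficient bound \<open>\<gamma>\<close> of the digit search: a row of a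
  block has \<open>d\<close> terms and a linking equation has \<open>K\<close> terms, all of them 0
  or 1.\<close>

lemma block_val_bounds:
  assumes "well_formed d B" "r \<in> set (block_digits K d)" "q \<in> set (block_eqs K (length B) d)"
  shows "0 \<le> block_val B K r q \<and> block_val B K r q \<le> int (d + K)"
proof -
  note r = block_digitsD[OF assms(2)]
  obtain k j where kj: "q = (k, j)" "k < K \<and> j < length B \<or> k = K \<and> j < d"
    using assms(3) by (auto simp: set_block_eqs)
  show ?thesis
  proof (cases "k < K")
    case True
    then have j: "j < length B" using kj(2) by auto
    have t: "0 \<le> B ! j ! v * r ! k ! v \<and> B ! j ! v * r ! k ! v \<le> 1" if "v < d" for v
    proof -
      have "length (B ! j) = d" "set (B ! j) \<subseteq> {0, 1}" using assms(1) j by (auto simp: well_formed_def)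
      then have "B ! j ! v \<in> {0, 1}" using that by (metis nth_mem subsetD)
      then show ?thesis using r(3)[OF True that] by auto
    qed
    have "(\<Sum>v<d. B ! j ! v * r ! k ! v) \<le> (\<Sum>v<d. 1)" by (rule sum_mono) (use t in auto)
    then show ?thesis using t j True r
      by (auto simp: kj(1) block_val_row[OF assms(1)] intro!: sum_nonneg)
  next
    case False
    then have k: "k = K" "j < d" using kj(2) by auto
    have t: "0 \<le> r ! c ! j \<and> r ! c ! j \<le> 1" if "c < K" for c using r(3)[OF that k(2)] by auto
    have "(\<Sum>c<K. r ! c ! j) \<le> (\<Sum>c<K. 1)" by (rule sum_mono) (use t in auto)
    then show ?thesis using t r k
      by (auto simp: kj(1) block_val_line[where d = d] intro!: sum_nonneg)
  qed
qed

lemma FC_digit_value: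
  assumes "FC P h" "FB P (\<lambda>x. length (h x))" "FC P k" "FB P k" "FC P v" "FB P v"
  shows "FC P (\<lambda>x. fold (\<lambda>r y. nth_or 0 (nth_or [] r (k x)) (v x) + 2 * y) (h x) (0::int))"
proof (rule FC_fold[OF assms(1) FC_const_int assms(2)])
  let ?Q = "\<lambda>a b z. P a b (fst z)"
  have k: "FC ?Q (\<lambda>z. k (fst z))" "FC ?Q (\<lambda>z. v (fst z))"
    by (rule FC_env[OF assms(3)] FC_env[OF assms(5)]; auto intro: FC_fst FC_id)+
  have k': "FB ?Q (\<lambda>z. k (fst z))" "FB ?Q (\<lambda>z. v (fst z))"
    by (rule FB_env[OF assms(4)] FB_env[OF assms(6)]; simp)+
  show "FC ?Q (\<lambda>z. nth_or (0::int) (nth_or [] (fst (snd z)) (k (fst z))) (v (fst z)) + 2 * snd (snd z))"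
    \<comment> \<open>Doubling becomes an addition, since a product would demand a length bound on
      the accumulator.\<close>
    unfolding mult_2
    by (intro FC_add_int FC_nth_or FC_const_int FC_Nil k k' FC_fst FC_snd FC_id)
qed simp

lemma FC_block_eqs:
  assumes "FC P K" "FB P K" "FC P M" "FB P M" "FC P d" "FB P d"
  shows "FC P (\<lambda>x. block_eqs (K x) (M x) (d x))"
proof -
  let ?Q = "\<lambda>a b z. P a b (fst z) \<and> snd z \<in> set [0..<K (fst z)]"
  let ?Q' = "\<lambda>a b z. P a b (fst z) \<and> snd z \<in> set [0..<d (fst z)]"
  have M: "FC ?Q (\<lambda>z. M (fst z))" by (rule FC_env[OF assms(3)]) (auto intro!: FC_fst FC_id)
  have M': "FB ?Q (\<lambda>z. M (fst z))" by (rule FB_env[OF assms(4)]) simp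
  have K: "FC ?Q' (\<lambda>z. K (fst z))" by (rule FC_env[OF assms(1)]) (auto intro!: FC_fst FC_id)
  have c: "FC P (\<lambda>x. map (\<lambda>k. map (\<lambda>j. (k, j)) [0..<M x]) [0..<K x])"
    by (intro FC_map FC_upt assms M M' FC_Pair FC_fst FC_snd FC_id) (use assms M' in simp_all)
  have c': "FB (\<lambda>a b z. P a b (fst z) \<and> snd z \<in> set (map (\<lambda>k. map (\<lambda>j. (k, j)) [0..<M (fst z)]) [0..<K (fst z)])) (\<lambda>z. length (snd z))"
    by (rule FB_mono[OF assms(4), where g = fst]) auto
  have c2: "FC P (\<lambda>x. concat (map (\<lambda>k. map (\<lambda>j. (k, j)) [0..<M x]) [0..<K x]))"
    by (rule FC_concat[OF c _ c']) (use assms in simp)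
  have c3: "FB P (\<lambda>x. length (concat (map (\<lambda>k. map (\<lambda>j. (k, j)) [0..<M x]) [0..<K x])))"
    using FB_mult[OF assms(2,4)] by (simp add: length_concat comp_def sum_list_triv)
  show ?thesis unfolding block_eqs_def
    by (intro FC_append c2 c3 FC_map FC_upt assms K FC_Pair FC_snd FC_id) (use assms in simp)
qed

text \<open>There are \<open>2 ^ (d * K)\<close> digit candidates for \<open>K\<close> blocks of
  \<open>d\<close> unknowns, so the number of blocks must be bounded in the parameters here; this is
  what the merging of slices achieves.\<close>

lemma FC_block_solve:
  assumes d: "FC P d" "PB P d" and B: "FC P B" "PB P (\<lambda>x. length (B x))"
      "\<And>a b x. P a b x \<Longrightarrow> well_formed (d x) (B x)"
    and \<beta>s: "FC P \<beta>s" "PB P (\<lambda>x. length (\<beta>s x))"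
    and W: "FC P W" "FB P (\<lambda>x. length (W x))" "FB P (\<lambda>x. bit_length (sum_list (W x)))"
  shows "FC P (\<lambda>x. block_solve (d x) (B x) (\<beta>s x) (W x))"
    and "FB P (\<lambda>x. length (block_solve (d x) (B x) (\<beta>s x) (W x)))"
proof -
  let ?K = "\<lambda>x. length (\<beta>s x)"
  let ?M = "\<lambda>x. length (B x)"
  let ?eqs = "\<lambda>x. block_eqs (?K x) (?M x) (d x)"
  let ?cands = "\<lambda>x. block_digits (?K x) (d x)"
  let ?L = "\<lambda>x. halvings (sum_list (W x))"
  let ?b = "\<lambda>x. map (block_rhs (?K x) (\<beta>s x) (W x)) (?eqs x)"
  let ?sols = "\<lambda>x. digit_solve (block_val (B x) (?K x)) (?eqs x) (?cands x) (?b x) (?L x)"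
  have K: "FC P ?K" by (intro FC_length \<beta>s FB_of_PB[OF \<beta>s(2)])
  have M: "FC P ?M" by (intro FC_length B FB_of_PB[OF B(2)])
  have eqs: "FC P ?eqs"
    by (intro FC_block_eqs K M d FB_of_PB[OF \<beta>s(2)] FB_of_PB[OF B(2)] FB_of_PB[OF d(2)])
  have eqs': "PB P (\<lambda>x. length (?eqs x))" unfolding length_block_eqs by (intro PB_add PB_mult \<beta>s B d)
  have two: "FC P (\<lambda>x. [0, 1 :: int])" by (intro FC_Cons FC_Nil FC_const_int)
  have two': "PB P (\<lambda>x. length (List.n_lists (d x) [0, 1 :: int]))"
    using PB_exp2[OF d(2)] by (simp add: length_n_lists numeral_2_eq_2)
  have cands: "FC P ?cands" unfolding block_digits_def
    by (intro FC_n_lists K \<beta>s d two two') (simp add: PB_const)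
  have cands': "PB P (\<lambda>x. length (?cands x))" unfolding block_digits_def length_n_lists[of _ "List.n_lists _ _"]
    by (intro PB_power two' \<beta>s)
  have L: "FC P ?L" by (intro FC_halvings FC_sum_list W)
  have L': "FB P ?L" by (rule FB_le[OF W(3) halvings_le])
  have b: "FC P ?b"
  proof (rule FC_map[OF eqs FB_of_PB[OF eqs']])
    let ?Q = "\<lambda>a b z. P a b (fst z) \<and> snd z \<in> set (?eqs (fst z))"
    have e: "FC ?Q (\<lambda>z. \<beta>s (fst z))" "FC ?Q (\<lambda>z. W (fst z))" "FC ?Q (\<lambda>z. ?K (fst z))"
      by (rule FC_env[OF \<beta>s(1)] FC_env[OF W(1)] FC_env[OF K]; auto intro: FC_fst FC_id)+
    have i: "FB ?Q (\<lambda>z. fst (snd z))"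
      by (rule FB_mono[OF FB_of_PB[OF \<beta>s(2)], where g = fst]) (auto simp: set_block_eqs)
    have j: "FB ?Q (\<lambda>z. snd (snd z))"
      by (rule FB_mono[OF FB_add[OF FB_of_PB[OF B(2)] FB_of_PB[OF d(2)]], where g = fst]) (auto simp: set_block_eqs)
    have 1: "FC ?Q (\<lambda>z. nth_or 0 (nth_or [] (\<beta>s (fst z)) (fst (snd z))) (snd (snd z)))"
      by (intro FC_nth_or FC_const_int FC_Nil e i j FC_fst FC_snd FC_id)
    have 2: "FC ?Q (\<lambda>z. nth_or 0 (W (fst z)) (snd (snd z)))"
      by (intro FC_nth_or FC_const_int FC_Nil e i j FC_fst FC_snd FC_id)
    show "FC ?Q (\<lambda>z. block_rhs (?K (fst z)) (\<beta>s (fst z)) (W (fst z)) (snd z))"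
      unfolding block_rhs_def
      by (intro FC_If FC_less_nat e FC_fst FC_snd FC_id FC_mono[OF 1] FC_mono[OF 2]) auto
  qed
  have g: "FC (\<lambda>a b z. P a b (fst z) \<and> fst (snd z) \<in> set (?cands (fst z)) \<and> snd (snd z) \<in> set (?eqs (fst z)))
      (\<lambda>z. block_val (B (fst z)) (?K (fst z)) (fst (snd z)) (snd (snd z)))"
    unfolding block_val_def
  proof (rule FC_If)
    let ?Q = "\<lambda>a b z. P a b (fst z) \<and> fst (snd z) \<in> set (?cands (fst z)) \<and> snd (snd z) \<in> set (?eqs (fst z))"
    have e: "FC ?Q (\<lambda>z. B (fst z))" "FC ?Q (\<lambda>z. ?K (fst z))"
      by (rule FC_env[OF B(1)] FC_env[OF K]; auto intro: FC_fst FC_id)+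
    have i: "FB ?Q (\<lambda>z. fst (snd (snd z)))"
      by (rule FB_mono[OF FB_of_PB[OF \<beta>s(2)], where g = fst]) (auto simp: set_block_eqs)
    have j: "FB ?Q (\<lambda>z. snd (snd (snd z)))"
      by (rule FB_mono[OF FB_add[OF FB_of_PB[OF B(2)] FB_of_PB[OF d(2)]], where g = fst]) (auto simp: set_block_eqs)
    show "FC ?Q (\<lambda>z. fst (snd (snd z)) < ?K (fst z))" by (intro FC_less_nat e FC_fst FC_snd FC_id)
    let ?Q1 = "\<lambda>a b z. ?Q a b z \<and> fst (snd (snd z)) < ?K (fst z)"
    have c: "FC ?Q (\<lambda>z. nth_or [] (B (fst z)) (snd (snd (snd z))))"
      by (intro FC_nth_or FC_Nil e j FC_fst FC_snd FC_id)
    have z: "FC ?Q (\<lambda>z. nth_or [] (fst (snd z)) (fst (snd (snd z))))"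
      by (intro FC_nth_or FC_Nil i FC_fst FC_snd FC_id)
    show "FC ?Q1 (\<lambda>z. dot (nth_or [] (B (fst z)) (snd (snd (snd z)))) (nth_or [] (fst (snd z)) (fst (snd (snd z)))))"
    proof (rule FC_dot)
      show "FB ?Q1 (\<lambda>z. length (nth_or [] (fst (snd z)) (fst (snd (snd z)))))"
        by (rule FB_mono[OF FB_of_PB[OF d(2)], where g = fst]) (auto simp: block_digitsD)
      have "bit_length (snd y) \<le> 1"
        if "?Q1 a b (fst y) \<and> snd y \<in> set (nth_or [] (B (fst (fst y))) (snd (snd (snd (fst y)))))" for a b y
      proof -
        have "snd (snd (snd (fst y))) < length (B (fst (fst y)))" using that by (auto simp: set_block_eqs)
        then have "snd y \<in> {0, 1}" using that B(3)[of a b "fst (fst y)"] by (auto simp: well_formed_def)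
        then show ?thesis by (auto simp: bit_length_le_iff)
      qed
      then show "FB (\<lambda>a b y. ?Q1 a b (fst y) \<and> snd y \<in> set (nth_or [] (B (fst (fst y))) (snd (snd (snd (fst y))))))
          (\<lambda>y. bit_length (snd y))"
        by (rule FB_le[OF FB_const[of _ 1]])
    qed (rule FC_mono[OF c] FC_mono[OF z], blast)+
    let ?Q2 = "\<lambda>a b z. ?Q a b z \<and> \<not> fst (snd (snd z)) < ?K (fst z)"
    have j': "FB (\<lambda>a b z. ?Q2 a b (fst z) \<and> snd z \<in> set (fst (snd (fst z)))) (\<lambda>z. snd (snd (snd (fst z))))"
      by (rule FB_mono[OF j, where g = fst]) auto
    have l: "FB ?Q2 (\<lambda>z. length (fst (snd z)))"
      by (rule FB_mono[OF FB_of_PB[OF \<beta>s(2)], where g = fst]) (auto simp: block_digitsD)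
    show "FC ?Q2 (\<lambda>z. sum_list (map (\<lambda>y. nth_or 0 y (snd (snd (snd z)))) (fst (snd z))))"
      by (intro FC_sum_list FC_map FC_nth_or FC_const_int j' l FC_fst FC_snd FC_id) (use l in simp)
  qed
  have \<gamma>: "PB P (\<lambda>x. d x + ?K x)" by (intro PB_add d \<beta>s)
  have val: "0 \<le> block_val (B x) (?K x) r q \<and> block_val (B x) (?K x) r q \<le> int (d x + ?K x)"
    if "P a c x" "r \<in> set (?cands x)" "q \<in> set (?eqs x)" for a c x r q
    by (rule block_val_bounds[OF B(3)[OF that(1)] that(2,3)])
  have sols: "FC P ?sols"
    by (rule FC_digit_solve[OF eqs eqs' cands cands' L L' b _ g \<gamma>]) (use val in simp_all)
  have sols': "FB P (\<lambda>x. length (?sols x))"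
  proof (rule FB_le[OF FB_of_PB[OF PB_power[OF PB_add[OF \<gamma> PB_const[of _ 1]] eqs']]])
    fix a c x assume P: "P a c x"
    show "length (?sols x) \<le> (d x + ?K x + 1) ^ length (?eqs x)"
      by (rule length_digit_solve) (use val[OF P] in auto)
  qed
  show "FB P (\<lambda>x. length (block_solve (d x) (B x) (\<beta>s x) (W x)))"
    unfolding block_solve_def using sols' by simp
  let ?Q1 = "\<lambda>a b z. P a b (fst z) \<and> snd z \<in> set (?sols (fst z))"
  let ?Q2 = "\<lambda>a b z. ?Q1 a b (fst z) \<and> snd z \<in> set [0..<?K (fst (fst z))]"
  let ?Q3 = "\<lambda>a b z. ?Q2 a b (fst z) \<and> snd z \<in> set [0..<d (fst (fst (fst z)))]"
  have h: "FB ?Q3 (\<lambda>z. length (snd (fst (fst z))))"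
  proof (rule FB_mono[OF L', where g = "\<lambda>z. fst (fst (fst z))"])
    fix a b z assume Q: "?Q3 a b z"
    then have "snd (fst (fst z)) \<in> set (?sols (fst (fst (fst z))))" by blast
    from digit_solve_length_history[OF length_map this] Q
    show "P a b (fst (fst (fst z))) \<and> length (snd (fst (fst z))) \<le> ?L (fst (fst (fst z)))" by simp
  qed
  have k: "FB ?Q3 (\<lambda>z. snd (fst z))"
    by (rule FB_mono[OF FB_of_PB[OF \<beta>s(2)], where g = "\<lambda>z. fst (fst (fst z))"]) (simp only: set_upt, simp)
  have v: "FB ?Q3 snd"
    by (rule FB_mono[OF FB_of_PB[OF d(2)], where g = "\<lambda>z. fst (fst (fst z))"]) (simp only: set_upt, simp)
  have K1: "FC ?Q1 (\<lambda>z. ?K (fst z))" by (rule FC_env[OF K]) (auto intro!: FC_fst FC_id)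
  have K1': "FB ?Q1 (\<lambda>z. ?K (fst z))" by (rule FB_env[OF FB_of_PB[OF \<beta>s(2)]]) simp
  have d2: "FC ?Q2 (\<lambda>z. d (fst (fst z)))" by (rule FC_env[OF d(1)], simp) (intro FC_fst FC_id)
  have d2': "FB ?Q2 (\<lambda>z. d (fst (fst z)))" by (rule FB_env[OF FB_of_PB[OF d(2)]]) simp
  have "FC ?Q3 (\<lambda>z. fold (\<lambda>r x. nth_or 0 (nth_or [] r (snd (fst z))) (snd z) + 2 * x) (snd (fst (fst z))) 0)"
    by (intro FC_digit_value h k v FC_fst FC_snd FC_id)
  then show "FC P (\<lambda>x. block_solve (d x) (B x) (\<beta>s x) (W x))"
    unfolding block_solve_def
    by (intro FC_map FC_upt sols sols' K1 K1' d2 d2') (use K1' d2' in simp_all)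
qed


section \<open>Merging right-hand sides with equal sign patterns\<close>

text \<open>Zero is counted with the positive values, which is harmless because splitting requires
  only weakly equal signs.\<close>

definition signature :: "int list list \<Rightarrow> int list \<Rightarrow> int list" where
  "signature masks \<beta> = map (\<lambda>mk. if 0 \<le> dot mk \<beta> then 1 else 0) masks"

definition sign_classes :: "int list list \<Rightarrow> int list list \<Rightarrow> int list list" where
  "sign_classes masks \<beta>s = map fst (dedup (map (\<lambda>\<beta>. (signature masks \<beta>, \<beta>)) \<beta>s))"

definition class_sum :: "nat \<Rightarrow> int list list \<Rightarrow> int list list \<Rightarrow> int list \<Rightarrow> int list" where
  "class_sum M masks \<beta>s \<sigma> = vector_sum M (filter (\<lambda>\<beta>. signature masks \<beta> = \<sigma>) \<beta>s)"

definition lookup :: "(int list \<times> int list) list \<Rightarrow> int list \<Rightarrow> int list" where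
  "lookup A \<sigma> = snd (nth_or ([], []) (filter (\<lambda>p. fst p = \<sigma>) A) 0)"

text \<open>A failed step leaves the state as it is. Failure is recognized in the end by an output
  that is shorter than the number of slices.\<close>

definition split_result ::
    "int list list list \<Rightarrow> int list \<Rightarrow> (int list \<times> int list) list \<times> int list list \<Rightarrow> (int list \<times> int list) list \<times> int list list" where
  "split_result sols \<sigma> st = (if sols \<noteq> []
     then (map (\<lambda>p. (fst p, if fst p = \<sigma> then nth_or [] (hd sols) 1 else snd p)) (fst st), nth_or [] (hd sols) 0 # snd st)
     else st)"

text \<open>Slice \<open>i\<close> is split off from the table found for its sign class; the second block collects the
  later slices of that class.\<close>

definition split_solve :: "nat \<Rightarrow> int list list \<Rightarrow> int list list \<Rightarrow> int list list \<Rightarrow> nat \<Rightarrow> (int list \<times> int list) list \<Rightarrow> int list list list" where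
  "split_solve d B masks \<beta>s i A = block_solve d B
     [nth_or [] \<beta>s i, class_sum (length B) masks (drop (Suc i) \<beta>s) (signature masks (nth_or [] \<beta>s i))]
     (lookup A (signature masks (nth_or [] \<beta>s i)))"

definition split_step where
  "split_step d B masks \<beta>s i st =
     split_result (split_solve d B masks \<beta>s i (fst st)) (signature masks (nth_or [] \<beta>s i)) st"

definition split_all where
  "split_all d B masks \<beta>s A n = fold (split_step d B masks \<beta>s) [0..<n] (A, [])"

definition class_solve where
  "class_solve d B masks \<beta>s W = block_solve d B (map (class_sum (length B) masks \<beta>s) (sign_classes masks \<beta>s)) W"

definition split_tables :: "nat \<Rightarrow> int list list \<Rightarrow> int list list \<Rightarrow> int list list \<Rightarrow> int list list \<Rightarrow> int list list list" where
  "split_tables d B masks \<beta>s Zs =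
     (let out = snd (split_all d B masks \<beta>s (zip (sign_classes masks \<beta>s) Zs) (length \<beta>s))
      in if length out = length \<beta>s then [rev out] else [])"

definition solve_tables :: "nat \<Rightarrow> int list list \<Rightarrow> int list list \<Rightarrow> int list list \<Rightarrow> int list \<Rightarrow> int list list list" where
  "solve_tables d B masks \<beta>s W =
     (if class_solve d B masks \<beta>s W \<noteq> [] then split_tables d B masks \<beta>s (hd (class_solve d B masks \<beta>s W)) else [])"

section \<open>Correctness of merging and splitting\<close>

lemma sign_classes: "distinct (sign_classes masks \<beta>s)" "set (sign_classes masks \<beta>s) = signature masks ` set \<beta>s"
  using distinct_dedup[of "map (\<lambda>\<beta>. (signature masks \<beta>, \<beta>)) \<beta>s"] fst_dedup[of "map (\<lambda>\<beta>. (signature masks \<beta>, \<beta>)) \<beta>s"]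
  by (simp_all add: sign_classes_def image_image)

lemma length_sign_classes: "length (sign_classes masks \<beta>s) \<le> 2 ^ length masks"
proof -
  have "length (sign_classes masks \<beta>s) = card (signature masks ` set \<beta>s)"
    by (metis sign_classes distinct_card)
  also have "\<dots> \<le> card {ys. set ys \<subseteq> {0, 1 :: int} \<and> length ys = length masks}"
    by (rule card_mono[OF finite_lists_length_eq]) (auto simp: signature_def)
  finally show ?thesis by (simp add: card_lists_length_eq numeral_2_eq_2)
qed

lemma lookup_Cons [simp]: "lookup (p # A) \<sigma> = (if fst p = \<sigma> then snd p else lookup A \<sigma>)"
  by (simp add: lookup_def)

lemma lookup_Nil [simp]: "lookup [] \<sigma> = []"
  by (simp add: lookup_def nth_or_def)

lemma lookup_update:
  "lookup (map (\<lambda>p. (fst p, if fst p = \<sigma> then Z else snd p)) A) \<tau> = (if \<tau> = \<sigma> \<and> \<sigma> \<in> fst ` set A then Z else lookup A \<tau>)"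
proof (induction A)
  case (Cons p A)
  then show ?case by (cases "\<tau> = \<sigma>"; cases "fst p = \<tau>"; simp)
qed simp

lemma lookup_zip:
  "distinct ks \<Longrightarrow> length ks = length Zs \<Longrightarrow> i < length ks \<Longrightarrow> lookup (zip ks Zs) (ks ! i) = Zs ! i"
proof (induction ks Zs arbitrary: i rule: list_induct2')
  case (4 k ks Z Zs)
  then show ?case by (cases i) auto
qed auto

lemma sum_list_by_class:
  assumes "finite S" "\<And>z. z \<in> set zs \<Longrightarrow> k z \<in> S"
  shows "(\<Sum>\<sigma>\<in>S. sum_list (map f (filter (\<lambda>z. k z = \<sigma>) zs))) = (sum_list (map f zs) :: int)"
  using assms(2)
proof (induction zs)
  case (Cons z zs)
  have "(\<Sum>\<sigma>\<in>S. sum_list (map f (filter (\<lambda>z. k z = \<sigma>) (z # zs)))) =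
      (\<Sum>\<sigma>\<in>S. (if k z = \<sigma> then f z else 0) + sum_list (map f (filter (\<lambda>z. k z = \<sigma>) zs)))"
    by (rule sum.cong) auto
  also have "\<dots> = f z + sum_list (map f zs)"
    using Cons assms(1) by (simp add: sum.distrib)
  finally show ?case by simp
qed simp

lemma nth_vector_sum':
  assumes "v < d" "\<And>z. z \<in> set zs \<Longrightarrow> length z = d"
  shows "vector_sum d zs ! v = sum_list (map (\<lambda>z. z ! v) zs)"
  by (subst nth_vector_sum[OF assms]) (auto simp: sum_list_sum_nth atLeast0LessThan)

lemma nonneg_vector_sum: "(\<And>z. z \<in> set zs \<Longrightarrow> nonneg d z) \<Longrightarrow> nonneg d (vector_sum d zs)"
  unfolding nonneg_def by (auto simp: nth_vector_sum' intro!: sum_list_nonneg)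

lemma dot_vector_sum:
  assumes "length mk = M" "\<And>\<beta>. \<beta> \<in> set \<beta>s \<Longrightarrow> length \<beta> = M"
  shows "dot mk (vector_sum M \<beta>s) = sum_list (map (dot mk) \<beta>s)"
proof -
  have "dot mk (vector_sum M \<beta>s) = (\<Sum>v<M. mk ! v * (\<Sum>c<length \<beta>s. \<beta>s ! c ! v))"
    using assms by (simp add: dot_eq_sum nth_vector_sum)
  also have "\<dots> = (\<Sum>c<length \<beta>s. \<Sum>v<M. mk ! v * \<beta>s ! c ! v)"
    unfolding sum_distrib_left by (rule sum.swap)
  also have "\<dots> = sum_list (map (dot mk) \<beta>s)"
    using assms by (simp add: sum_list_sum_nth atLeast0LessThan dot_eq_sum)
  finally show ?thesis .
qed

text \<open>When all slices of a class have been split off, the right-hand side left for the class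
  is 0; pointedness then makes the table left for it vanish, so that the slices alone sum to
  \<open>W\<close>.\<close>

definition pointed :: "nat \<Rightarrow> int list list \<Rightarrow> bool" where
  "pointed d B \<longleftrightarrow> (\<forall>z. nonneg d z \<longrightarrow> apply_rows B z = replicate (length B) 0 \<longrightarrow> z = replicate d 0)"

text \<open>\<open>z1\<close> and \<open>z2\<close> only witness that the two right-hand sides are
  attainable. The table \<open>z\<close> need not be their sum: it has the right margins, and the
  two parts found must be parts of \<open>z\<close>.\<close>

definition splitting :: "nat \<Rightarrow> int list list \<Rightarrow> int list list \<Rightarrow> bool" where
  "splitting d B masks \<longleftrightarrow> (\<forall>z z1 z2. nonneg d z \<longrightarrow> nonneg d z1 \<longrightarrow> nonneg d z2 \<longrightarrow>
     apply_rows B z = vector_sum (length B) [apply_rows B z1, apply_rows B z2] \<longrightarrow>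
     (\<forall>mk\<in>set masks. 0 \<le> dot mk (apply_rows B z1) \<and> 0 \<le> dot mk (apply_rows B z2) \<or>
       dot mk (apply_rows B z1) \<le> 0 \<and> dot mk (apply_rows B z2) \<le> 0) \<longrightarrow>
     (\<exists>ys. solution d B [apply_rows B z1, apply_rows B z2] z ys))"

text \<open>The first part, with the bound by \<open>W\<close>, holds whether or not steps have
  failed and serves the running time. The exact equations are claimed only if the output has one
  table for every slice so far, that is, if no step has failed.\<close>

definition split_invariant :: "nat \<Rightarrow> int list list \<Rightarrow> int list list \<Rightarrow> int list list \<Rightarrow> int list \<Rightarrow> nat \<Rightarrow> (int list \<times> int list) list \<times> int list list \<Rightarrow> bool" where
  "split_invariant d B masks \<beta>s W i st \<longleftrightarrow> map fst (fst st) = (sign_classes masks \<beta>s) \<and> length (snd st) \<le> i \<and>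
     (\<forall>\<sigma>\<in>set (sign_classes masks \<beta>s). nonneg d (lookup (fst st) \<sigma>) \<and> (\<forall>v<d. lookup (fst st) \<sigma> ! v \<le> W ! v)) \<and>
     (length (snd st) = i \<longrightarrow>
       (\<forall>\<sigma>\<in>set (sign_classes masks \<beta>s). apply_rows B (lookup (fst st) \<sigma>) = class_sum (length B) masks (drop i \<beta>s) \<sigma>) \<and>
       map (apply_rows B) (rev (snd st)) = take i \<beta>s \<and> (\<forall>z\<in>set (snd st). nonneg d z) \<and>
       (\<forall>v<d. (\<Sum>\<sigma>\<in>set (sign_classes masks \<beta>s). lookup (fst st) \<sigma> ! v) + sum_list (map (\<lambda>z. z ! v) (snd st)) = W ! v))"

context
  fixes d :: nat and B masks \<beta>s :: "int list list" and W :: "int list"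
  assumes B: "well_formed d B" and W: "length W = d" and \<beta>: "\<forall>\<beta>\<in>set \<beta>s. length \<beta> = length B"
begin

abbreviation (input) "keys \<equiv> sign_classes masks \<beta>s"
abbreviation (input) "csum i \<equiv> class_sum (length B) masks (drop i \<beta>s)"

lemma split_invariant_init:
  assumes "Zs \<in> set (class_solve d B masks \<beta>s W)"
  shows "split_invariant d B masks \<beta>s W 0 (zip keys Zs, [])" "length Zs = length keys"
proof -
  have sol: "solution d B (map (csum 0) keys) W Zs"
    using block_solve_sound[OF B _ W] assms by (auto simp: class_solve_def class_sum_def)
  have "map (apply_rows B) Zs = map (csum 0) keys" using sol by (simp add: solution_def)
  then have len: "length keys = length Zs" by (metis length_map)
  have lk: "lookup (zip keys Zs) (keys ! i) = Zs ! i" if "i < length keys" for i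
    by (rule lookup_zip[OF sign_classes(1) len that])
  have nn: "\<And>z. z \<in> set Zs \<Longrightarrow> nonneg d z" and WZ: "W = vector_sum d Zs" using sol by (auto simp: solution_def)
  have 1: "nonneg d (lookup (zip keys Zs) \<sigma>) \<and> (\<forall>v<d. lookup (zip keys Zs) \<sigma> ! v \<le> W ! v) \<and>
      apply_rows B (lookup (zip keys Zs) \<sigma>) = csum 0 \<sigma>" if \<sigma>: "\<sigma> \<in> set keys" for \<sigma>
  proof -
    obtain i where i: "i < length keys" "\<sigma> = keys ! i" using \<sigma> by (auto simp: in_set_conv_nth)
    have Zi: "Zs ! i \<in> set Zs" using i len by simp
    have "apply_rows B (Zs ! i) = csum 0 (keys ! i)"
      using arg_cong[OF \<open>map (apply_rows B) Zs = map (csum 0) keys\<close>, of "\<lambda>l. l ! i"] i len by simp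
    then show ?thesis using nn[OF Zi] solution_le(2)[OF sol Zi] lk[OF i(1)] i(2) by simp
  qed
  have "(\<Sum>\<sigma>\<in>set keys. lookup (zip keys Zs) \<sigma> ! v) = W ! v" if v: "v < d" for v
  proof -
    have "(\<Sum>\<sigma>\<in>set keys. lookup (zip keys Zs) \<sigma> ! v) = sum_list (map (\<lambda>\<sigma>. lookup (zip keys Zs) \<sigma> ! v) keys)"
      by (rule sum_list_distinct_conv_sum_set[OF sign_classes(1), symmetric])
    also have "map (\<lambda>\<sigma>. lookup (zip keys Zs) \<sigma> ! v) keys = map (\<lambda>z. z ! v) Zs"
      by (rule nth_equalityI) (use len lk in auto)
    also have "sum_list \<dots> = W ! v" unfolding WZ by (subst nth_vector_sum'[OF v]) (use nn in \<open>auto simp: nonneg_def\<close>)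
    finally show ?thesis .
  qed
  with 1 len show "split_invariant d B masks \<beta>s W 0 (zip keys Zs, [])" unfolding split_invariant_def by simp
  show "length Zs = length keys" using len by simp
qed

lemma class_sum_drop:
  assumes "i < length \<beta>s"
  shows "csum i (signature masks (\<beta>s ! i)) =
      vector_sum (length B) [\<beta>s ! i, csum (Suc i) (signature masks (\<beta>s ! i))]"
    "\<sigma> \<noteq> signature masks (\<beta>s ! i) \<Longrightarrow> csum i \<sigma> = csum (Suc i) \<sigma>"
proof -
  have dr: "drop i \<beta>s = \<beta>s ! i # drop (Suc i) \<beta>s" by (rule Cons_nth_drop_Suc[OF assms, symmetric])
  show "\<sigma> \<noteq> signature masks (\<beta>s ! i) \<Longrightarrow> csum i \<sigma> = csum (Suc i) \<sigma>" by (simp add: dr class_sum_def)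
  have len: "length \<beta> = length B" if "\<beta> \<in> set (\<beta>s ! i # drop (Suc i) \<beta>s)" for \<beta>
    using that \<beta> assms by (auto dest: in_set_dropD)
  show "csum i (signature masks (\<beta>s ! i)) =
      vector_sum (length B) [\<beta>s ! i, csum (Suc i) (signature masks (\<beta>s ! i))]"
  proof (rule nth_equalityI)
    let ?F = "filter (\<lambda>\<beta>. signature masks \<beta> = signature masks (\<beta>s ! i)) (drop (Suc i) \<beta>s)"
    fix v assume "v < length (csum i (signature masks (\<beta>s ! i)))"
    then have v: "v < length B" by (simp add: class_sum_def)
    have "csum i (signature masks (\<beta>s ! i)) ! v = sum_list (map (\<lambda>\<beta>. \<beta> ! v) (\<beta>s ! i # ?F))"
      unfolding class_sum_def dr using len by (subst nth_vector_sum'[OF v]) auto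
    moreover have "vector_sum (length B) ?F ! v = sum_list (map (\<lambda>\<beta>. \<beta> ! v) ?F)"
      using len by (subst nth_vector_sum'[OF v]) auto
    moreover have "vector_sum (length B) [\<beta>s ! i, vector_sum (length B) ?F] ! v = \<beta>s ! i ! v + vector_sum (length B) ?F ! v"
      using len by (subst nth_vector_sum'[OF v]) auto
    ultimately show "csum i (signature masks (\<beta>s ! i)) ! v =
        vector_sum (length B) [\<beta>s ! i, csum (Suc i) (signature masks (\<beta>s ! i))] ! v"
      by (simp add: class_sum_def)
  qed (simp add: class_sum_def)
qed

lemma split_invariant_step:
  assumes inv: "split_invariant d B masks \<beta>s W i st" and i: "i < length \<beta>s"
  shows "split_invariant d B masks \<beta>s W (Suc i) (split_step d B masks \<beta>s i st)"
proof -
  let ?\<sigma> = "signature masks (\<beta>s ! i)"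
  let ?sols = "split_solve d B masks \<beta>s i (fst st)"
  have \<sigma>: "?\<sigma> \<in> set keys" using i by (simp add: sign_classes(2))
  have S: "set keys = fst ` set (fst st)" using inv by (metis split_invariant_def set_map)
  show ?thesis
  proof (cases "?sols = []")
    case True
    then have "split_step d B masks \<beta>s i st = st" by (simp add: split_step_def split_result_def)
    \<comment> \<open>The output has at most \<open>i\<close> entries, so the exact part of the
      invariant holds vacuously at \<open>Suc i\<close>.\<close>
    then show ?thesis using inv unfolding split_invariant_def by auto
  next
    case False
    let ?ys = "hd ?sols"
    let ?Z = "lookup (fst st) ?\<sigma>"
    have Z: "nonneg d ?Z" "\<forall>v<d. ?Z ! v \<le> W ! v" using inv \<sigma> unfolding split_invariant_def by auto
    have "?ys \<in> set ?sols" using False by simp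
    then have sol: "solution d B [\<beta>s ! i, csum (Suc i) ?\<sigma>] ?Z ?ys"
      using block_solve_sound[OF B _ , of "[\<beta>s ! i, csum (Suc i) ?\<sigma>]" ?Z ?ys] Z \<beta> i
      unfolding split_solve_def by (simp add: class_sum_def nonneg_def)
    then obtain y1 y2 where ys: "?ys = [y1, y2]" "apply_rows B y1 = \<beta>s ! i" "apply_rows B y2 = csum (Suc i) ?\<sigma>"
      by (auto simp: solution_def map_eq_Cons_conv)
    have nn: "nonneg d y1" "nonneg d y2" using sol by (auto simp: solution_def ys)
    have y2: "\<forall>v<d. y2 ! v \<le> ?Z ! v" using solution_le(2)[OF sol] by (simp add: ys)
    have sum: "y1 ! v + y2 ! v = ?Z ! v" if "v < d" for v
    proof -
      have "vector_sum d [y1, y2] = ?Z" using sol by (simp add: solution_def ys)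
      from this[symmetric] show ?thesis using nn that by (subst \<open>?Z = _\<close>, subst nth_vector_sum') (auto simp: nonneg_def)
    qed
    let ?st = "split_step d B masks \<beta>s i st"
    have st: "fst ?st = map (\<lambda>p. (fst p, if fst p = ?\<sigma> then y2 else snd p)) (fst st)" "snd ?st = y1 # snd st"
      using False i by (simp_all add: split_step_def split_result_def ys)
    have lk: "lookup (fst ?st) \<tau> = (if \<tau> = ?\<sigma> then y2 else lookup (fst st) \<tau>)" for \<tau>
      unfolding st lookup_update using \<sigma> S by auto
    have nn': "\<forall>\<tau>\<in>set keys. nonneg d (lookup (fst ?st) \<tau>) \<and> (\<forall>v<d. lookup (fst ?st) \<tau> ! v \<le> W ! v)"
      using inv nn(2) y2 Z(2) unfolding lk split_invariant_def by (auto intro: order_trans)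
    have full: "(\<forall>\<tau>\<in>set keys. apply_rows B (lookup (fst ?st) \<tau>) = csum (Suc i) \<tau>) \<and>
       map (apply_rows B) (rev (snd ?st)) = take (Suc i) \<beta>s \<and> (\<forall>z\<in>set (snd ?st). nonneg d z) \<and>
       (\<forall>v<d. (\<Sum>\<tau>\<in>set keys. lookup (fst ?st) \<tau> ! v) + sum_list (map (\<lambda>z. z ! v) (snd ?st)) = W ! v)"
      if "length (snd ?st) = Suc i"
    proof -
      have l: "length (snd st) = i" using that by (simp add: st)
      note I = inv[unfolded split_invariant_def]
      have "apply_rows B (lookup (fst ?st) \<tau>) = csum (Suc i) \<tau>" if "\<tau> \<in> set keys" for \<tau>
        using I l that ys(3) class_sum_drop(2)[OF i, of \<tau>] unfolding lk by auto
      moreover have "map (apply_rows B) (rev (snd ?st)) = take (Suc i) \<beta>s"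
        using I l ys(2) i by (simp add: st take_Suc_conv_app_nth)
      moreover have "\<forall>z\<in>set (snd ?st). nonneg d z" using I l nn by (simp add: st)
      moreover have "(\<Sum>\<tau>\<in>set keys. lookup (fst ?st) \<tau> ! v) + sum_list (map (\<lambda>z. z ! v) (snd ?st)) = W ! v" if v: "v < d" for v
      proof -
        have "(\<Sum>\<tau>\<in>set keys. lookup (fst ?st) \<tau> ! v) = y2 ! v + (\<Sum>\<tau>\<in>set keys - {?\<sigma>}. lookup (fst st) \<tau> ! v)"
          unfolding lk using \<sigma> by (simp add: sum.remove)
        moreover have "(\<Sum>\<tau>\<in>set keys. lookup (fst st) \<tau> ! v) = ?Z ! v + (\<Sum>\<tau>\<in>set keys - {?\<sigma>}. lookup (fst st) \<tau> ! v)"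
          using \<sigma> by (simp add: sum.remove)
        moreover have "(\<Sum>\<tau>\<in>set keys. lookup (fst st) \<tau> ! v) + sum_list (map (\<lambda>z. z ! v) (snd st)) = W ! v"
          using I l v by blast
        ultimately show ?thesis using sum[OF v] by (simp add: st)
      qed
      ultimately show ?thesis by blast
    qed
    have "map fst (fst ?st) = keys" using inv by (simp add: st split_invariant_def comp_def)
    moreover have "length (snd ?st) \<le> Suc i" using inv by (simp add: st split_invariant_def)
    ultimately show ?thesis unfolding split_invariant_def using nn' full by blast
  qed
qed

lemma split_all_Suc: "split_all d B masks \<beta>s A (Suc i) = split_step d B masks \<beta>s i (split_all d B masks \<beta>s A i)"
  by (simp add: split_all_def)

lemma split_invariant_all:
  assumes "Zs \<in> set (class_solve d B masks \<beta>s W)" "i \<le> length \<beta>s"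
  shows "split_invariant d B masks \<beta>s W i (split_all d B masks \<beta>s (zip keys Zs) i)"
  using assms(2)
proof (induction i)
  case 0
  then show ?case using split_invariant_init[OF assms(1)] by (simp add: split_all_def)
next
  case (Suc i)
  then show ?case using split_invariant_step by (simp add: split_all_Suc)
qed

theorem solve_tables_sound:
  assumes p: "pointed d B" and zs: "zs \<in> set (solve_tables d B masks \<beta>s W)"
  shows "solution d B \<beta>s W zs"
proof -
  let ?Zs = "hd (class_solve d B masks \<beta>s W)"
  let ?st = "split_all d B masks \<beta>s (zip keys ?Zs) (length \<beta>s)"
  have "class_solve d B masks \<beta>s W \<noteq> []" using zs by (auto simp: solve_tables_def)
  then have "?Zs \<in> set (class_solve d B masks \<beta>s W)" by simp
  from split_invariant_all[OF this order_refl]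
  have inv: "split_invariant d B masks \<beta>s W (length \<beta>s) ?st" .
  have out: "length (snd ?st) = length \<beta>s" "zs = rev (snd ?st)"
    using zs by (auto simp: solve_tables_def split_tables_def Let_def split: if_splits)
  note I = inv[unfolded split_invariant_def]
  have "lookup (fst ?st) \<sigma> ! v = 0" if "\<sigma> \<in> set keys" "v < d" for \<sigma> v
  proof -
    have "apply_rows B (lookup (fst ?st) \<sigma>) = csum (length \<beta>s) \<sigma>" "nonneg d (lookup (fst ?st) \<sigma>)"
      using I out that by blast+
    moreover have "csum (length \<beta>s) \<sigma> = replicate (length B) 0"
      by (simp add: class_sum_def vector_sum_def map_replicate_const)
    ultimately have "lookup (fst ?st) \<sigma> = replicate d 0" using p unfolding pointed_def by metis
    then show ?thesis using that(2) by simp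
  qed
  then have "(\<Sum>\<sigma>\<in>set keys. lookup (fst ?st) \<sigma> ! v) = 0" if "v < d" for v
    using that by (intro sum.neutral) blast
  then have s: "sum_list (map (\<lambda>z. z ! v) (snd ?st)) = W ! v" if "v < d" for v
    using I out that by force
  have nn: "\<forall>z\<in>set (snd ?st). nonneg d z" and m: "map (apply_rows B) (rev (snd ?st)) = take (length \<beta>s) \<beta>s"
    using I out by blast+
  have "vector_sum d zs = W"
  proof (rule nth_equalityI)
    fix v assume "v < length (vector_sum d zs)"
    then have v: "v < d" by simp
    have "vector_sum d zs ! v = sum_list (map (\<lambda>z. z ! v) zs)"
      using nn by (intro nth_vector_sum'[OF v]) (simp add: out(2) nonneg_def)
    also have "\<dots> = sum_list (map (\<lambda>z. z ! v) (snd ?st))"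
      unfolding out(2) by (metis rev_map sum_list_rev)
    also have "\<dots> = W ! v" by (rule s[OF v])
    finally show "vector_sum d zs ! v = W ! v" .
  qed (simp add: W)
  then show ?thesis using nn m by (simp add: solution_def out)
qed

text \<open>The sums of a solution over the classes show that the merged system is solvable. The
  tables the solver returns may be unrelated to that solution, but the existence of a split depends
  on their margins only: slice \<open>i\<close> of the solution and the sum of the later slices of
  its class witness the two right-hand sides.\<close>

theorem solve_tables_complete:
  assumes sp: "splitting d B masks" and masks: "\<forall>mk\<in>set masks. length mk = length B"
    and zs: "solution d B \<beta>s W zs"
  shows "solve_tables d B masks \<beta>s W \<noteq> []"
proof -
  have \<beta>s: "\<beta>s = map (apply_rows B) zs" and nn: "\<And>z. z \<in> set zs \<Longrightarrow> nonneg d z" and Wz: "W = vector_sum d zs"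
    using zs by (auto simp: solution_def)
  have len: "\<And>z. z \<in> set zs \<Longrightarrow> length z = d" using nn by (simp add: nonneg_def)
  let ?part = "\<lambda>i \<sigma>. vector_sum d (filter (\<lambda>z. signature masks (apply_rows B z) = \<sigma>) (drop i zs))"
  have part: "apply_rows B (?part i \<sigma>) = csum i \<sigma>" "nonneg d (?part i \<sigma>)" for i \<sigma>
  proof -
    show "apply_rows B (?part i \<sigma>) = csum i \<sigma>"
      unfolding class_sum_def \<beta>s drop_map filter_map comp_def
      by (rule apply_rows_vector_sum[OF B]) (auto dest: in_set_dropD simp: len)
    show "nonneg d (?part i \<sigma>)" by (rule nonneg_vector_sum) (auto dest: in_set_dropD simp: nn)
  qed
  have "solution d B (map (csum 0) keys) W (map (?part 0) keys)"
    unfolding solution_def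
  proof (intro conjI)
    show "map (apply_rows B) (map (?part 0) keys) = map (csum 0) keys"
      unfolding map_map comp_def part(1) by (rule refl)
    show "\<forall>z\<in>set (map (?part 0) keys). nonneg d z" unfolding set_map using part(2) by blast
    show "vector_sum d (map (?part 0) keys) = W"
    proof (rule nth_equalityI)
      fix v assume "v < length (vector_sum d (map (?part 0) keys))"
      then have v: "v < d" by simp
      have "vector_sum d (map (?part 0) keys) ! v = sum_list (map (\<lambda>\<sigma>. ?part 0 \<sigma> ! v) keys)"
        using v by (subst nth_vector_sum') (auto simp: comp_def)
      also have "\<dots> = (\<Sum>\<sigma>\<in>set keys. ?part 0 \<sigma> ! v)"
        by (rule sum_list_distinct_conv_sum_set[OF sign_classes(1)])
      also have "\<dots> = (\<Sum>\<sigma>\<in>set keys. sum_list (map (\<lambda>z. z ! v) (filter (\<lambda>z. signature masks (apply_rows B z) = \<sigma>) zs)))"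
        unfolding drop_0 using len by (intro sum.cong refl nth_vector_sum'[OF v]) simp
      also have "\<dots> = sum_list (map (\<lambda>z. z ! v) zs)"
        by (rule sum_list_by_class) (auto simp: sign_classes(2) \<beta>s)
      also have "\<dots> = W ! v" unfolding Wz using v len by (simp add: nth_vector_sum')
      finally show "vector_sum d (map (?part 0) keys) ! v = W ! v" .
    qed (simp add: W)
  qed
  from block_solve_complete[OF B this] have ne: "class_solve d B masks \<beta>s W \<noteq> []"
    by (simp add: class_solve_def)
  let ?Zs = "hd (class_solve d B masks \<beta>s W)"
  let ?st = "split_all d B masks \<beta>s (zip keys ?Zs)"
  have Zs: "?Zs \<in> set (class_solve d B masks \<beta>s W)" using ne by simp
  have "length (snd (?st i)) = i" if "i \<le> length \<beta>s" for i
    using that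
  proof (induction i)
    case (Suc i)
    then have i: "i < length \<beta>s" and l: "length (snd (?st i)) = i" by auto
    have inv: "split_invariant d B masks \<beta>s W i (?st i)" by (rule split_invariant_all[OF Zs]) (use i in simp)
    let ?\<sigma> = "signature masks (\<beta>s ! i)"
    let ?Z = "lookup (fst (?st i)) ?\<sigma>"
    have \<sigma>: "?\<sigma> \<in> set keys" using i by (simp add: sign_classes(2))
    have Z: "nonneg d ?Z" "apply_rows B ?Z = csum i ?\<sigma>"
      using inv l \<sigma> unfolding split_invariant_def by blast+
    let ?z = "zs ! i"
    have iz: "i < length zs" "apply_rows B ?z = \<beta>s ! i" using i by (simp_all add: \<beta>s)
    have "\<exists>ys. solution d B [apply_rows B ?z, apply_rows B (?part (Suc i) ?\<sigma>)] ?Z ys"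
    proof (rule sp[unfolded splitting_def, rule_format])
      show "nonneg d ?Z" by (rule Z)
      show "nonneg d ?z" using iz nn by simp
      show "nonneg d (?part (Suc i) ?\<sigma>)" by (rule part)
      show "apply_rows B ?Z = vector_sum (length B) [apply_rows B ?z, apply_rows B (?part (Suc i) ?\<sigma>)]"
        unfolding Z(2) iz(2) part(1) by (rule class_sum_drop(1)[OF i])
      fix mk assume mk: "mk \<in> set masks"
      then obtain q where q: "q < length masks" "mk = masks ! q" using mk by (auto simp: in_set_conv_nth)
      have *: "0 \<le> dot mk \<gamma> \<longleftrightarrow> 0 \<le> dot mk (\<beta>s ! i)" if "signature masks \<gamma> = ?\<sigma>" for \<gamma>
      proof -
        have "signature masks \<gamma> ! q = ?\<sigma> ! q" using that by simp
        then show ?thesis using q by (simp add: signature_def split: if_splits)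
      qed
      \<comment> \<open>The rest of the class is a sum of right-hand sides with the sign of slice
        \<open>i\<close>, so it inherits that sign.\<close>
      have "dot mk (apply_rows B (?part (Suc i) ?\<sigma>)) =
          sum_list (map (dot mk) (filter (\<lambda>\<gamma>. signature masks \<gamma> = ?\<sigma>) (drop (Suc i) \<beta>s)))"
        unfolding part(1) class_sum_def using masks mk \<beta>
        by (intro dot_vector_sum) (auto dest: in_set_dropD)
      moreover have "0 \<le> \<dots>" if "0 \<le> dot mk (\<beta>s ! i)"
        by (rule sum_list_nonneg) (use * that in auto)
      moreover have "sum_list (map (dot mk) (filter (\<lambda>\<gamma>. signature masks \<gamma> = ?\<sigma>) (drop (Suc i) \<beta>s))) \<le> 0" if "\<not> 0 \<le> dot mk (\<beta>s ! i)"
      proof (rule sum_list_nonpos)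
        fix y assume "y \<in> set (map (dot mk) (filter (\<lambda>\<gamma>. signature masks \<gamma> = ?\<sigma>) (drop (Suc i) \<beta>s)))"
        then obtain \<gamma> where "y = dot mk \<gamma>" "signature masks \<gamma> = ?\<sigma>" by auto
        then show "y \<le> 0" using *[of \<gamma>] that by linarith
      qed
      ultimately show "0 \<le> dot mk (apply_rows B ?z) \<and> 0 \<le> dot mk (apply_rows B (?part (Suc i) ?\<sigma>)) \<or>
          dot mk (apply_rows B ?z) \<le> 0 \<and> dot mk (apply_rows B (?part (Suc i) ?\<sigma>)) \<le> 0"
        unfolding iz(2) by linarith
    qed
    then obtain ys where "solution d B [\<beta>s ! i, csum (Suc i) ?\<sigma>] ?Z ys" unfolding iz(2) part(1) by blast
    from block_solve_complete[OF B this] have "split_solve d B masks \<beta>s i (fst (?st i)) \<noteq> []"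
      using i by (simp add: split_solve_def)
    then show ?case using l by (simp add: split_all_Suc split_step_def split_result_def)
  qed (simp add: split_all_def)
  then have "length (snd (?st (length \<beta>s))) = length \<beta>s" by simp
  then show ?thesis using ne by (simp add: solve_tables_def split_tables_def Let_def)
qed

end

section \<open>Running time of merging and splitting\<close>

lemma length_signature [simp]: "length (signature masks \<beta>) = length masks"
  by (simp add: signature_def)

text \<open>Entries of one digit, which provides the length bound that \<open>FC_dot\<close> asks
  for.\<close>

definition sign_masks :: "int list list \<Rightarrow> bool" where
  "sign_masks masks \<longleftrightarrow> (\<forall>mk\<in>set masks. \<forall>c\<in>set mk. \<bar>c\<bar> \<le> 1)"

lemma FC_signature:
  assumes m: "FC P masks" "FB P (\<lambda>x. length (masks x))" "\<And>a b x. P a b x \<Longrightarrow> sign_masks (masks x)"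
    and \<beta>: "FC P \<beta>" "FB P (\<lambda>x. length (\<beta> x))"
  shows "FC P (\<lambda>x. signature (masks x) (\<beta> x))"
  unfolding signature_def
proof (rule FC_map[OF m(1,2)])
  let ?Q = "\<lambda>a b z. P a b (fst z) \<and> snd z \<in> set (masks (fst z))"
  have "FC ?Q (\<lambda>z. dot (snd z) (\<beta> (fst z)))"
  proof (rule FC_dot)
    show "FC ?Q (\<lambda>z. \<beta> (fst z))" by (rule FC_env[OF \<beta>(1)], blast) (intro FC_fst FC_id)
    show "FB ?Q (\<lambda>z. length (\<beta> (fst z)))" by (rule FB_env[OF \<beta>(2)]) simp
    show "FB (\<lambda>a b y. ?Q a b (fst y) \<and> snd y \<in> set (snd (fst y))) (\<lambda>y. bit_length (snd y))"
      by (rule FB_le[OF FB_const[of _ 1]]) (use m(3) in \<open>fastforce simp: bit_length_le_iff sign_masks_def\<close>)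
  qed (intro FC_snd FC_id)
  then show "FC ?Q (\<lambda>z. if 0 \<le> dot (snd z) (\<beta> (fst z)) then 1 else 0 :: int)"
    by (intro FC_If FC_le_int FC_const_int)
qed

lemma FC_sign_classes:
  assumes m: "FC P masks" "FB P (\<lambda>x. length (masks x))" "\<And>a b x. P a b x \<Longrightarrow> sign_masks (masks x)"
    and \<beta>s: "FC P \<beta>s" "FB P (\<lambda>x. length (\<beta>s x))"
      "FB (\<lambda>a b z. P a b (fst z) \<and> snd z \<in> set (\<beta>s (fst z))) (\<lambda>z. length (snd z))"
  shows "FC P (\<lambda>x. sign_classes (masks x) (\<beta>s x))"
proof -
  let ?Q = "\<lambda>a b z. P a b (fst z) \<and> snd z \<in> set (\<beta>s (fst z))"
  have s: "FC ?Q (\<lambda>z. signature (masks (fst z)) (snd z))"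
  proof (rule FC_signature)
    show "FC ?Q (\<lambda>z. masks (fst z))" by (rule FC_env[OF m(1)], blast) (intro FC_fst FC_id)
    show "FB ?Q (\<lambda>z. length (masks (fst z)))" by (rule FB_env[OF m(2)]) simp
  qed (use m(3) \<beta>s(3) in \<open>auto intro: FC_snd FC_id\<close>)
  have d: "FC P (\<lambda>x. dedup (map (\<lambda>\<beta>. (signature (masks x) \<beta>, \<beta>)) (\<beta>s x)))"
  proof (rule FC_dedup)
    show "FC P (\<lambda>x. map (\<lambda>\<beta>. (signature (masks x) \<beta>, \<beta>)) (\<beta>s x))"
      by (intro FC_map \<beta>s FC_Pair s FC_snd FC_id)
    show "FB P (\<lambda>x. length (map (\<lambda>\<beta>. (signature (masks x) \<beta>, \<beta>)) (\<beta>s x)))" using \<beta>s(2) by simp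
    show "FB (\<lambda>a b z. P a b (fst z) \<and> snd z \<in> set (map (\<lambda>\<beta>. (signature (masks (fst z)) \<beta>, \<beta>)) (\<beta>s (fst z))))
        (\<lambda>z. length (fst (snd z)))"
      by (rule FB_mono[OF m(2), where g = fst]) auto
  qed
  have l: "length (dedup (map (\<lambda>\<beta>. (signature masks \<beta>, \<beta>)) \<beta>s)) \<le> 2 ^ length masks" for masks \<beta>s
    using length_sign_classes[of masks \<beta>s] by (simp add: sign_classes_def)
  have l': "length (dedup S) \<le> length S" for S :: "(int list \<times> int list) list"
  proof -
    have "length (dedup S) = card (fst ` set (dedup S))"
      using distinct_dedup[of S] by (metis distinct_card length_map set_map)
    also have "\<dots> \<le> card (set S)" unfolding fst_dedup by (rule card_image_le) simp
    finally show ?thesis using card_length[of S] by simp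
  qed
  have "FB P (\<lambda>x. length (dedup (map (\<lambda>\<beta>. (signature (masks x) \<beta>, \<beta>)) (\<beta>s x))))"
    by (rule FB_le[OF \<beta>s(2)]) (rule order_trans[OF l'], simp)
  with d show ?thesis unfolding sign_classes_def by (intro FC_map FC_fst FC_snd FC_id)
qed

lemma FC_class_sum:
  assumes M: "FC P M" "FB P M"
    and m: "FC P masks" "FB P (\<lambda>x. length (masks x))" "\<And>a b x. P a b x \<Longrightarrow> sign_masks (masks x)"
    and \<beta>s: "FC P \<beta>s" "FB P (\<lambda>x. length (\<beta>s x))"
      "FB (\<lambda>a b z. P a b (fst z) \<and> snd z \<in> set (\<beta>s (fst z))) (\<lambda>z. length (snd z))"
    and \<sigma>: "FC P \<sigma>" "FB P (\<lambda>x. length (\<sigma> x))"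
  shows "FC P (\<lambda>x. class_sum (M x) (masks x) (\<beta>s x) (\<sigma> x))"
proof -
  let ?Q = "\<lambda>a b z. P a b (fst z) \<and> snd z \<in> set (\<beta>s (fst z))"
  have m': "FB ?Q (\<lambda>z. length (masks (fst z)))" by (rule FB_env[OF m(2)]) simp
  have s: "FC ?Q (\<lambda>z. signature (masks (fst z)) (snd z))"
  proof (rule FC_signature)
    show "FC ?Q (\<lambda>z. masks (fst z))" by (rule FC_env[OF m(1)], blast) (intro FC_fst FC_id)
  qed (use m(3) m' \<beta>s(3) in \<open>auto intro: FC_snd FC_id\<close>)
  have s': "FB ?Q (\<lambda>z. length (signature (masks (fst z)) (snd z)))" using m' by simp
  have \<sigma>1: "FC ?Q (\<lambda>z. \<sigma> (fst z))" by (rule FC_env[OF \<sigma>(1)], blast) (intro FC_fst FC_id)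
  have \<sigma>2: "FB ?Q (\<lambda>z. length (\<sigma> (fst z)))" by (rule FB_env[OF \<sigma>(2)]) simp
  show ?thesis unfolding class_sum_def
    by (intro FC_vector_sum M FC_filter \<beta>s FC_eq_ints s s' \<sigma>1 \<sigma>2 FB_le[OF \<beta>s(2) length_filter_le])
qed

lemma sum_list_mono_nth:
  fixes xs ys :: "int list"
  assumes "length xs = d" "length ys = d" "\<And>v. v < d \<Longrightarrow> xs ! v \<le> ys ! v"
  shows "sum_list xs \<le> sum_list ys"
  using assms by (simp add: sum_list_sum_nth, intro sum_mono) simp

lemma bit_length_mono: "0 \<le> x \<Longrightarrow> x \<le> y \<Longrightarrow> bit_length x \<le> bit_length y"
  unfolding bit_length_def by (intro max.mono floorlog_mono order_refl) simp

text \<open>The number of slices is bounded with respect to parameter and size only. It determines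
  the length of the loop and of the class sums, whereas every system solved has at most as many
  blocks as there are sign patterns, or just two.\<close>

lemma FC_solve_tables:
  assumes d: "FC P d" "PB P d" and B: "FC P B" "PB P (\<lambda>x. length (B x))"
      "\<And>a b x. P a b x \<Longrightarrow> well_formed (d x) (B x)"
    and m: "FC P masks" "PB P (\<lambda>x. length (masks x))" "\<And>a b x. P a b x \<Longrightarrow> sign_masks (masks x)"
    and \<beta>s: "FC P \<beta>s" "FB P (\<lambda>x. length (\<beta>s x))"
      "\<And>a b x. P a b x \<Longrightarrow> \<forall>\<beta>\<in>set (\<beta>s x). length \<beta> = length (B x)"
    and W: "FC P W" "\<And>a b x. P a b x \<Longrightarrow> length (W x) = d x" "FB P (\<lambda>x. bit_length (sum_list (W x)))"
  shows "FC P (\<lambda>x. solve_tables (d x) (B x) (masks x) (\<beta>s x) (W x))"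
proof -
  let ?M = "\<lambda>x. length (B x)"
  let ?keys = "\<lambda>x. sign_classes (masks x) (\<beta>s x)"
  let ?cs = "\<lambda>x. class_solve (d x) (B x) (masks x) (\<beta>s x) (W x)"
  have M: "FC P ?M" by (intro FC_length B FB_of_PB[OF B(2)])
  note dFB = FB_of_PB[OF d(2)] and MFB = FB_of_PB[OF B(2)] and mFB = FB_of_PB[OF m(2)]
  have \<beta>l: "FB (\<lambda>a b z. P a b (fst z) \<and> snd z \<in> set (\<beta>s (fst z))) (\<lambda>z. length (snd z))"
    by (rule FB_mono[OF MFB, where g = fst]) (use \<beta>s(3) in auto)
  have keys: "FC P ?keys" by (intro FC_sign_classes m mFB \<beta>s \<beta>l)
  have keysPB: "PB P (\<lambda>x. length (?keys x))"
    by (rule PB_le[OF PB_exp2[OF m(2)] length_sign_classes])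
  have keyl: "FB (\<lambda>a b z. P a b (fst z) \<and> snd z \<in> set (?keys (fst z))) (\<lambda>z. length (snd z))"
    by (rule FB_mono[OF mFB, where g = fst]) (auto simp: sign_classes(2))
  have WFB: "FB P (\<lambda>x. length (W x))" by (rule FB_le[OF dFB]) (simp add: W(2))
  have sums: "FC P (\<lambda>x. map (class_sum (?M x) (masks x) (\<beta>s x)) (?keys x))"
  proof (rule FC_map[OF keys FB_of_PB[OF keysPB]])
    let ?Q = "\<lambda>a b z. P a b (fst z) \<and> snd z \<in> set (?keys (fst z))"
    have e: "FC ?Q (\<lambda>z. ?M (fst z))" "FC ?Q (\<lambda>z. masks (fst z))" "FC ?Q (\<lambda>z. \<beta>s (fst z))"
      by (rule FC_env[OF M] FC_env[OF m(1)] FC_env[OF \<beta>s(1)], blast, intro FC_fst FC_id)+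
    have f: "FB ?Q (\<lambda>z. ?M (fst z))" "FB ?Q (\<lambda>z. length (masks (fst z)))" "FB ?Q (\<lambda>z. length (\<beta>s (fst z)))"
      by (rule FB_env[OF MFB] FB_env[OF mFB] FB_env[OF \<beta>s(2)], simp)+
    have g: "FB (\<lambda>a b z. ?Q a b (fst z) \<and> snd z \<in> set (\<beta>s (fst (fst z)))) (\<lambda>z. length (snd z))"
      by (rule FB_mono[OF \<beta>l, where g = "\<lambda>z. (fst (fst z), snd z)"]) simp
    show "FC ?Q (\<lambda>z. class_sum (?M (fst z)) (masks (fst z)) (\<beta>s (fst z)) (snd z))"
      by (intro FC_class_sum e f g keyl FC_snd FC_id) (use m(3) in blast)
  qed
  have cs: "FC P ?cs" "FB P (\<lambda>x. length (?cs x))"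
    unfolding class_solve_def
    by (rule FC_block_solve[OF d B sums _ W(1) WFB W(3)], assumption, simp add: keysPB)+
  let ?P1 = "\<lambda>a b x. P a b x \<and> ?cs x \<noteq> []"
  let ?Zs = "\<lambda>x. hd (?cs x)"
  let ?A = "\<lambda>x. zip (?keys x) (?Zs x)"
  let ?all = "\<lambda>x. split_all (d x) (B x) (masks x) (\<beta>s x) (?A x)"
  have inv: "split_invariant (d x) (B x) (masks x) (\<beta>s x) (W x) i (?all x i)" if "?P1 a b x" "i \<le> length (\<beta>s x)" for a b x i
  proof (rule split_invariant_all)
    have P: "P a b x" using that by simp
    show "well_formed (d x) (B x)" "length (W x) = d x" "\<forall>\<beta>\<in>set (\<beta>s x). length \<beta> = length (B x)"
      using B(3)[OF P] W(2)[OF P] \<beta>s(3)[OF P] by auto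
    show "?Zs x \<in> set (?cs x)" "i \<le> length (\<beta>s x)" using that by auto
  qed
  have A: "FC ?P1 ?A"
    by (intro FC_zip FC_hd FC_mono[OF keys] FC_mono[OF cs(1)] FB_mono[OF FB_of_PB[OF keysPB], where g = "\<lambda>x. x"]) auto
  let ?Q = "\<lambda>a b z. ?P1 a b (fst z) \<and> fst (snd z) < length (\<beta>s (fst z)) \<and> snd (snd z) = ?all (fst z) (fst (snd z))"
  let ?\<beta> = "\<lambda>z. nth_or [] (\<beta>s (fst z)) (fst (snd z))"
  let ?\<sigma> = "\<lambda>z. signature (masks (fst z)) (?\<beta> z)"
  have qi: "FB ?Q (\<lambda>z. fst (snd z))" by (rule FB_mono[OF \<beta>s(2), where g = fst]) auto
  have qd: "FC ?Q (\<lambda>z. d (fst z))" "FC ?Q (\<lambda>z. B (fst z))" "FC ?Q (\<lambda>z. masks (fst z))" "FC ?Q (\<lambda>z. \<beta>s (fst z))"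
      "FC ?Q (\<lambda>z. ?M (fst z))"
    by (rule FC_env[OF d(1)] FC_env[OF B(1)] FC_env[OF m(1)] FC_env[OF \<beta>s(1)] FC_env[OF M], blast, intro FC_fst FC_id)+
  have qb: "PB ?Q (\<lambda>z. d (fst z))" "PB ?Q (\<lambda>z. ?M (fst z))" "PB ?Q (\<lambda>z. length (masks (fst z)))"
    by (rule PB_env[OF d(2)] PB_env[OF B(2)] PB_env[OF m(2)], simp)+
  have qm: "FB ?Q (\<lambda>z. length (masks (fst z)))" "FB ?Q (\<lambda>z. ?M (fst z))" by (rule FB_of_PB[OF qb(3)] FB_of_PB[OF qb(2)])+
  have qs: "\<And>a b z. ?Q a b z \<Longrightarrow> sign_masks (masks (fst z))" using m(3) by blast
  have q\<beta>: "FC ?Q ?\<beta>" by (intro FC_nth_or FC_Nil qd qi FC_fst FC_snd FC_id)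
  have q\<beta>': "FB ?Q (\<lambda>z. length (?\<beta> z))"
    by (rule FB_le[OF qm(2)]) (use \<beta>s(3) nth_mem in fastforce)
  have q\<sigma>: "FC ?Q ?\<sigma>" by (rule FC_signature[OF qd(3) qm(1) qs q\<beta> q\<beta>'])
  have q\<sigma>': "FB ?Q (\<lambda>z. length (?\<sigma> z))" using qm(1) by simp
  have qdrop: "FC ?Q (\<lambda>z. drop (Suc (fst (snd z))) (\<beta>s (fst z)))"
    by (intro FC_drop FC_Suc FB_Suc qi qd FC_fst FC_snd FC_id)
  have qdrop': "FB ?Q (\<lambda>z. length (drop (Suc (fst (snd z))) (\<beta>s (fst z))))"
    by (rule FB_mono[OF \<beta>s(2), where g = fst]) simp
  have qdrop'': "FB (\<lambda>a b z. ?Q a b (fst z) \<and> snd z \<in> set (drop (Suc (fst (snd (fst z)))) (\<beta>s (fst (fst z))))) (\<lambda>z. length (snd z))"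
    by (rule FB_mono[OF \<beta>l, where g = "\<lambda>z. (fst (fst z), snd z)"]) (auto dest: in_set_dropD)
  have qrest: "FC ?Q (\<lambda>z. class_sum (?M (fst z)) (masks (fst z)) (drop (Suc (fst (snd z))) (\<beta>s (fst z))) (?\<sigma> z))"
    by (rule FC_class_sum[OF qd(5) qm(2) qd(3) qm(1) qs qdrop qdrop' qdrop'' q\<sigma> q\<sigma>'])
  have keysA: "map fst (fst (snd (snd z))) = ?keys (fst z)" if "?Q a b z" for a b z
    using inv[of a b "fst z" "fst (snd z)"] that unfolding split_invariant_def by auto
  have qA: "FB ?Q (\<lambda>z. length (fst (snd (snd z))))"
    by (rule FB_mono[OF FB_of_PB[OF keysPB], where g = fst]) (metis keysA length_map order_refl)
  have qAl: "FB (\<lambda>a b z. ?Q a b (fst z) \<and> snd z \<in> set (fst (snd (snd (fst z))))) (\<lambda>z. length (fst (snd z)))"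
  proof (rule FB_mono[OF mFB, where g = "\<lambda>z. fst (fst z)"])
    fix a b z assume z: "?Q a b (fst z) \<and> snd z \<in> set (fst (snd (snd (fst z))))"
    then have "?Q a b (fst z)" by blast
    moreover have "fst (snd z) \<in> set (map fst (fst (snd (snd (fst z)))))" unfolding set_map using z by blast
    ultimately have "fst (snd z) \<in> set (?keys (fst (fst z)))" using keysA by metis
    then show "P a b (fst (fst z)) \<and> length (fst (snd z)) \<le> length (masks (fst (fst z)))"
      using z by (auto simp: sign_classes(2))
  qed
  let ?Z = "\<lambda>z. lookup (fst (snd (snd z))) (?\<sigma> z)"
  have qZ: "FC ?Q ?Z"
  proof -
    let ?R = "\<lambda>a b z. ?Q a b (fst z) \<and> snd z \<in> set (fst (snd (snd (fst z))))"
    have r1: "FC ?R (\<lambda>z. ?\<sigma> (fst z))" by (rule FC_env[OF q\<sigma>], blast) (intro FC_fst FC_id)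
    have r2: "FB ?R (\<lambda>z. length (?\<sigma> (fst z)))" by (rule FB_env[OF q\<sigma>']) blast
    show ?thesis unfolding lookup_def
      by (intro FC_snd FC_nth_or FC_Pair FC_Nil FC_filter FC_eq_ints r1 r2 qA qAl FC_const_nat FB_const FC_fst FC_id)
  qed
  \<comment> \<open>The part of the invariant that survives failed steps keeps the number of digits
    in every later system below that of the first.\<close>
  have Zinv: "nonneg (d (fst z)) (?Z z) \<and> sum_list (?Z z) \<le> sum_list (W (fst z))" if z: "?Q a b z" for a b z
  proof -
    have k: "?\<sigma> z \<in> set (?keys (fst z))" using z by (auto simp: sign_classes(2))
    have "split_invariant (d (fst z)) (B (fst z)) (masks (fst z)) (\<beta>s (fst z)) (W (fst z)) (fst (snd z)) (snd (snd z))"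
      using inv[of a b "fst z" "fst (snd z)"] z by auto
    then have 1: "nonneg (d (fst z)) (?Z z)" "\<forall>v<d (fst z). ?Z z ! v \<le> W (fst z) ! v"
      using k unfolding split_invariant_def by blast+
    moreover have "sum_list (?Z z) \<le> sum_list (W (fst z))"
      by (rule sum_list_mono_nth[of _ "d (fst z)"]) (use 1 W(2) z in \<open>auto simp: nonneg_def\<close>)
    ultimately show ?thesis by simp
  qed
  have qZ': "FB ?Q (\<lambda>z. length (?Z z))"
    by (rule FB_mono[OF dFB, where g = fst]) (use Zinv in \<open>auto simp: nonneg_def\<close>)
  have qZ'': "FB ?Q (\<lambda>z. bit_length (sum_list (?Z z)))"
  proof (rule FB_mono[OF W(3), where g = fst])
    fix a b z assume z: "?Q a b z"
    have "0 \<le> sum_list (?Z z)" using Zinv[OF z] by (auto simp: nonneg_def sum_list_sum_nth intro!: sum_nonneg)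
    then show "P a b (fst z) \<and> bit_length (sum_list (?Z z)) \<le> bit_length (sum_list (W (fst z)))"
      using Zinv[OF z] z by (auto intro: bit_length_mono)
  qed
  have qsol: "FC ?Q (\<lambda>z. split_solve (d (fst z)) (B (fst z)) (masks (fst z)) (\<beta>s (fst z)) (fst (snd z)) (fst (snd (snd z))))"
    unfolding split_solve_def
  proof (rule FC_block_solve(1)[OF qd(1) qb(1) qd(2) qb(2)])
    show "well_formed (d (fst z)) (B (fst z))" if "?Q a b z" for a b z using that B(3) by blast
    show "FC ?Q (\<lambda>z. [?\<beta> z, class_sum (?M (fst z)) (masks (fst z)) (drop (Suc (fst (snd z))) (\<beta>s (fst z))) (?\<sigma> z)])"
      by (intro FC_Cons FC_Nil q\<beta> qrest)
  qed (rule qZ qZ' qZ'' | simp add: PB_const)+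
  let ?S = "\<lambda>z. split_solve (d (fst z)) (B (fst z)) (masks (fst z)) (\<beta>s (fst z)) (fst (snd z)) (fst (snd (snd z)))"
  have step: "FC ?Q (\<lambda>z. split_step (d (fst z)) (B (fst z)) (masks (fst z)) (\<beta>s (fst z)) (fst (snd z)) (snd (snd z)))"
  proof -
    let ?Q' = "\<lambda>a b z. ?Q a b z \<and> ?S z \<noteq> []"
    let ?R = "\<lambda>a b z. ?Q' a b (fst z) \<and> snd z \<in> set (fst (snd (snd (fst z))))"
    have r1: "FC ?R (\<lambda>z. ?\<sigma> (fst z))" by (rule FC_env[OF q\<sigma>], blast) (intro FC_fst FC_id)
    have r2: "FB ?R (\<lambda>z. length (?\<sigma> (fst z)))" by (rule FB_env[OF q\<sigma>']) blast
    have r3: "FB ?R (\<lambda>z. length (fst (snd z)))" by (rule FB_mono[OF qAl, where g = "\<lambda>z. z"]) (blast intro: order_refl)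
    have h: "FC ?Q' (\<lambda>z. hd (?S z))" by (intro FC_hd FC_mono[OF qsol]) auto
    have r4: "FC ?R (\<lambda>z. hd (?S (fst z)))" by (rule FC_env[OF h], blast) (intro FC_fst FC_id)
    have r5: "FB ?Q' (\<lambda>z. length (fst (snd (snd z))))" by (rule FB_mono[OF qA, where g = "\<lambda>z. z"]) (blast intro: order_refl)
    let ?if = "\<lambda>z. if fst (snd z) = ?\<sigma> (fst z) then nth_or [] (hd (?S (fst z))) 1 else snd (snd z)"
    have r6: "FC ?R ?if"
      by (rule FC_If[OF FC_eq_ints[OF _ r1 r3 r2]];
        (rule FC_mono[OF FC_nth_or[OF FC_Nil r4 FC_const_nat FB_const]], blast)?; (intro FC_fst FC_snd FC_id)?)
    have r7: "FC ?Q' (\<lambda>z. map (\<lambda>p. (fst p, if fst p = ?\<sigma> z then nth_or [] (hd (?S z)) 1 else snd p)) (fst (snd (snd z))))"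
      by (intro FC_map r5 FC_Pair r6 FC_fst FC_snd FC_id)
    have r8: "FC ?Q' (\<lambda>z. nth_or [] (hd (?S z)) 0 # snd (snd (snd z)))"
      by (intro FC_Cons FC_nth_or FC_Nil h FC_const_nat FB_const FC_snd FC_id)
    show ?thesis unfolding split_step_def split_result_def
      by (rule FC_If[OF FC_not_Nil[OF qsol] FC_Pair[OF r7 r8]]) (intro FC_snd FC_id)
  qed
  have len1: "FC ?P1 (\<lambda>x. length (\<beta>s x))" "FB ?P1 (\<lambda>x. length (\<beta>s x))"
    by (rule FC_mono[OF FC_length[OF \<beta>s(1,2)]], blast, rule FB_mono[OF \<beta>s(2), where g = "\<lambda>x. x"], simp)
  have all: "FC ?P1 (\<lambda>x. ?all x (length (\<beta>s x)))"
    unfolding split_all_def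
  proof (rule FC_fold[OF FC_upt[OF len1] FC_Pair[OF A FC_Nil] _ step])
    show "FB ?P1 (\<lambda>x. length [0..<length (\<beta>s x)])" using len1(2) by simp
    fix a b x ys y zs assume x: "?P1 a b x" "[0..<length (\<beta>s x)] = ys @ y # zs"
    then have "ys = take (length ys) [0..<length (\<beta>s x)]" "length ys < length [0..<length (\<beta>s x)]" by auto
    then have ys: "ys = [0..<length ys]" "length ys < length (\<beta>s x)" by (auto simp: take_upt)
    have "y = [0..<length (\<beta>s x)] ! length ys" using x(2) by simp
    then have "y = length ys" using ys(2) by simp
    then show "?Q a b (x, y, fold (split_step (d x) (B x) (masks x) (\<beta>s x)) ys (?A x, []))"
      using x(1) ys by (simp add: split_all_def)
  qed
  have out: "FC ?P1 (\<lambda>x. snd (?all x (length (\<beta>s x))))" by (intro FC_snd all)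
  have out': "FB ?P1 (\<lambda>x. length (snd (?all x (length (\<beta>s x)))))"
    by (rule FB_le[OF len1(2)]) (use inv in \<open>auto simp: split_invariant_def\<close>)
  have "FC ?P1 (\<lambda>x. split_tables (d x) (B x) (masks x) (\<beta>s x) (?Zs x))"
  proof -
    let ?o = "\<lambda>x. snd (?all x (length (\<beta>s x)))"
    have "FC ?P1 (\<lambda>x. if length (?o x) = length (\<beta>s x) then [rev (?o x)] else [])"
      by (rule FC_If[OF FC_eq_nat[OF FC_length[OF out out'] len1(1)] FC_mono[OF FC_Cons[OF FC_rev[OF out out'] FC_Nil]] FC_Nil]) blast
    then show ?thesis by (simp add: split_tables_def Let_def)
  qed
  then show ?thesis unfolding solve_tables_def
    by (rule FC_If[OF FC_not_Nil[OF cs(1)]]) (rule FC_Nil)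
qed


section \<open>Transportation tables\<close>

text \<open>Gale's condition for a table below \<open>z\<close> with given margins. One unit of a positive entry is
  either removed or put into the table; by submodularity of the cut function one of the two
  preserves all cut conditions.\<close>

lemma gale:
  fixes z :: "'a \<Rightarrow> 'b \<Rightarrow> int"
  assumes fin: "finite A" "finite B"
    and "\<And>i j. 0 \<le> z i j" and "sum R A = sum C B"
    and "\<And>I K. I \<subseteq> A \<Longrightarrow> K \<subseteq> B \<Longrightarrow> sum R I - sum C K \<le> (\<Sum>i\<in>I. \<Sum>j\<in>B - K. z i j)"
  shows "\<exists>y. (\<forall>i j. 0 \<le> y i j \<and> y i j \<le> z i j) \<and> (\<forall>i\<in>A. (\<Sum>j\<in>B. y i j) = R i) \<and>
    (\<forall>j\<in>B. (\<Sum>i\<in>A. y i j) = C j)"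
  using assms(3-)
proof (induction "nat (\<Sum>i\<in>A. \<Sum>j\<in>B. z i j)" arbitrary: z R C rule: less_induct)
  case less
  note z0 = less.prems(1) and RC = less.prems(2) and cut = less.prems(3)
  have cutsum: "(\<Sum>i\<in>I. \<Sum>j\<in>B - K. z i j) = (\<Sum>i\<in>A. \<Sum>j\<in>B. z i j * of_bool (i \<in> I \<and> j \<notin> K))"
    if "I \<subseteq> A" for I K and z :: "'a \<Rightarrow> 'b \<Rightarrow> int"
  proof -
    have "(\<Sum>j\<in>B - K. z i j) = (\<Sum>j\<in>B. z i j * of_bool (j \<notin> K))" for i
      using fin by (intro sum.mono_neutral_cong_left) auto
    then have "(\<Sum>i\<in>I. \<Sum>j\<in>B - K. z i j) = (\<Sum>i\<in>I. \<Sum>j\<in>B. z i j * of_bool (j \<notin> K))" by simp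
    also have "\<dots> = (\<Sum>i\<in>A. \<Sum>j\<in>B. z i j * of_bool (i \<in> I \<and> j \<notin> K))"
      using fin that by (intro sum.mono_neutral_cong_left) auto
    finally show ?thesis .
  qed
  show ?case
  proof (cases "\<exists>a\<in>A. \<exists>b\<in>B. 0 < z a b")
    case False
    then have z: "z i j = 0" if "i \<in> A" "j \<in> B" for i j using z0[of i j] that by force
    have c: "sum R I \<le> sum C K" if "I \<subseteq> A" "K \<subseteq> B" for I K
    proof -
      have "(\<Sum>i\<in>I. \<Sum>j\<in>B - K. z i j) = 0" using that z by (intro sum.neutral) auto
      then show ?thesis using cut[OF that] by simp
    qed
    \<comment> \<open>The cut of \<open>{i}\<close> and \<open>{}\<close> gives
      \<open>R i \<le> 0\<close>; the cut of the complement of \<open>i\<close> and all columns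
      gives the converse, by equality of the totals.\<close>
    have "R i = 0" if "i \<in> A" for i
      using c[of "{i}" "{}"] c[of "A - {i}" B] that fin RC by (simp add: sum_diff1 split: if_splits)
    moreover have "C j = 0" if "j \<in> B" for j
      using c[of "{}" "{j}"] c[of A "B - {j}"] that fin RC by (simp add: sum_diff1 split: if_splits)
    ultimately show ?thesis using z0 by (intro exI[of _ "\<lambda>_ _. 0"]) simp
  next
    case True
    then obtain a b where ab: "a \<in> A" "b \<in> B" "0 < z a b" by blast
    let ?z = "\<lambda>i j. z i j - of_bool (i = a \<and> j = b)"
    have unit: "(\<Sum>i\<in>A. \<Sum>j\<in>B. of_bool (i = a \<and> j = b) * f i j) = (f a b :: int)" for f
    proof -
      have "(\<Sum>j\<in>B. of_bool (i = a \<and> j = b) * f i j) = (if i = a then f a b else 0)" for i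
      proof -
        have "(\<Sum>j\<in>B. of_bool (i = a \<and> j = b) * f i j) = (\<Sum>j\<in>B. if j = b then (if i = a then f a b else 0) else 0)"
          by (rule sum.cong) auto
        then show ?thesis using fin ab by simp
      qed
      then show ?thesis using fin ab by simp
    qed
    have z1: "0 \<le> ?z i j" for i j using z0[of i j] ab by auto
    have "(\<Sum>i\<in>A. \<Sum>j\<in>B. ?z i j) = (\<Sum>i\<in>A. \<Sum>j\<in>B. z i j) - 1"
      using unit[of "\<lambda>_ _. 1"] by (simp add: sum_subtractf)
    moreover have "0 \<le> (\<Sum>i\<in>A. \<Sum>j\<in>B. ?z i j)" using z1 by (intro sum_nonneg) auto
    ultimately have dec: "nat (\<Sum>i\<in>A. \<Sum>j\<in>B. ?z i j) < nat (\<Sum>i\<in>A. \<Sum>j\<in>B. z i j)" by linarith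
    have cutz: "(\<Sum>i\<in>I. \<Sum>j\<in>B - K. ?z i j) = (\<Sum>i\<in>I. \<Sum>j\<in>B - K. z i j) - of_bool (a \<in> I \<and> b \<notin> K)"
      if "I \<subseteq> A" for I K
      unfolding cutsum[OF that] left_diff_distrib sum_subtractf unit by simp
    show ?thesis
    proof (cases "\<forall>I K. I \<subseteq> A \<longrightarrow> K \<subseteq> B \<longrightarrow> sum R I - sum C K \<le> (\<Sum>i\<in>I. \<Sum>j\<in>B - K. ?z i j)")
      case True
      then obtain y where y: "\<forall>i j. 0 \<le> y i j \<and> y i j \<le> ?z i j" "\<forall>i\<in>A. (\<Sum>j\<in>B. y i j) = R i"
        "\<forall>j\<in>B. (\<Sum>i\<in>A. y i j) = C j"
        using less.hyps[OF dec z1 RC] by blast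
      have "y i j \<le> z i j" for i j using y(1)[rule_format, of i j] by (cases "i = a \<and> j = b") auto
      then show ?thesis using y by blast
    next
      case False
      \<comment> \<open>Removing the unit violates some cut; that cut is crossed by the entry at
        \<open>(a, b)\<close> and is tight for \<open>z\<close>.\<close>
      then obtain I K where IK: "I \<subseteq> A" "K \<subseteq> B" "sum R I - sum C K > (\<Sum>i\<in>I. \<Sum>j\<in>B - K. ?z i j)"
        by (auto simp: not_le)
      then have tight: "a \<in> I" "b \<notin> K" "(\<Sum>i\<in>I. \<Sum>j\<in>B - K. z i j) = sum R I - sum C K"
        using cut[OF IK(1,2)] unfolding cutz[OF IK(1)] by (cases "a \<in> I \<and> b \<notin> K"; auto)+
      let ?R = "\<lambda>i. R i - of_bool (i = a)" and ?C = "\<lambda>j. C j - of_bool (j = b)"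
      have RI: "sum ?R I' = sum R I' - of_bool (a \<in> I')" if "I' \<subseteq> A" for I'
        using finite_subset[OF that fin(1)] by (simp add: sum_subtractf of_bool_def)
      have CK: "sum ?C K' = sum C K' - of_bool (b \<in> K')" if "K' \<subseteq> B" for K'
        using finite_subset[OF that fin(2)] by (simp add: sum_subtractf of_bool_def)
      have cut1: "sum ?R I' - sum ?C K' \<le> (\<Sum>i\<in>I'. \<Sum>j\<in>B - K'. ?z i j)" if IK': "I' \<subseteq> A" "K' \<subseteq> B" for I' K'
      proof (rule ccontr)
        assume "\<not> ?thesis"
        then have v: "a \<notin> I'" "b \<in> K'" "(\<Sum>i\<in>I'. \<Sum>j\<in>B - K'. z i j) = sum R I' - sum C K'"
          using cut[OF IK'] unfolding cutz[OF IK'(1)] RI[OF IK'(1)] CK[OF IK'(2)]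
          by (cases "a \<in> I'"; cases "b \<in> K'"; auto)+
        have fins: "finite I" "finite I'" "finite K" "finite K'"
          using IK IK' fin by (auto intro: finite_subset)
        \<comment> \<open>The entry at \<open>(a, b)\<close> crosses the cut of \<open>I\<close> and
          \<open>K\<close> but neither the union nor the intersection of the two cuts. Submodularity
          is therefore strict, which two tight cuts do not allow.\<close>
        have "(\<Sum>i\<in>A. \<Sum>j\<in>B. z i j * of_bool (i \<in> I \<union> I' \<and> j \<notin> K \<union> K')) +
            (\<Sum>i\<in>A. \<Sum>j\<in>B. z i j * of_bool (i \<in> I \<inter> I' \<and> j \<notin> K \<inter> K')) +
            (\<Sum>i\<in>A. \<Sum>j\<in>B. of_bool (i = a \<and> j = b) * z i j)
          \<le> (\<Sum>i\<in>A. \<Sum>j\<in>B. z i j * of_bool (i \<in> I \<and> j \<notin> K)) + (\<Sum>i\<in>A. \<Sum>j\<in>B. z i j * of_bool (i \<in> I' \<and> j \<notin> K'))"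
          unfolding sum.distrib[symmetric] using z0 tight(1,2) v(1,2) by (intro sum_mono) auto
        then have "(\<Sum>i\<in>I \<union> I'. \<Sum>j\<in>B - (K \<union> K'). z i j) + (\<Sum>i\<in>I \<inter> I'. \<Sum>j\<in>B - (K \<inter> K'). z i j) + z a b
          \<le> (\<Sum>i\<in>I. \<Sum>j\<in>B - K. z i j) + (\<Sum>i\<in>I'. \<Sum>j\<in>B - K'. z i j)"
          unfolding unit using IK IK' by (subst (1 2 3 4) cutsum) auto
        moreover have "sum R (I \<union> I') - sum C (K \<union> K') \<le> (\<Sum>i\<in>I \<union> I'. \<Sum>j\<in>B - (K \<union> K'). z i j)"
          using IK IK' by (intro cut) auto
        moreover have "sum R (I \<inter> I') - sum C (K \<inter> K') \<le> (\<Sum>i\<in>I \<inter> I'. \<Sum>j\<in>B - (K \<inter> K'). z i j)"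
          using IK IK' by (intro cut) auto
        moreover have "sum R (I \<union> I') + sum R (I \<inter> I') = sum R I + sum R I'"
          "sum C (K \<union> K') + sum C (K \<inter> K') = sum C K + sum C K'"
          using fins by (simp_all add: sum.union_inter)
        ultimately show False using tight(3) v(3) ab(3) by linarith
      qed
      have "sum ?R A = sum ?C B" using RI[of A] CK[of B] RC ab by simp
      from less.hyps[OF dec z1 this cut1] obtain y where
        y: "\<forall>i j. 0 \<le> y i j \<and> y i j \<le> ?z i j" "\<forall>i\<in>A. (\<Sum>j\<in>B. y i j) = ?R i"
        "\<forall>j\<in>B. (\<Sum>i\<in>A. y i j) = ?C j" by blast
      let ?y = "\<lambda>i j. y i j + of_bool (i = a \<and> j = b)"
      have "0 \<le> ?y i j \<and> ?y i j \<le> z i j" for i j using y(1)[rule_format, of i j] by simp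
      moreover have "(\<Sum>j\<in>B. ?y i j) = R i" if "i \<in> A" for i
        using y(2) that fin ab by (cases "i = a") (auto simp: sum.distrib)
      moreover have "(\<Sum>i\<in>A. ?y i j) = C j" if "j \<in> B" for j
        using y(3) that fin ab by (cases "j = b") (auto simp: sum.distrib)
      ultimately show ?thesis by (intro exI[of _ ?y]) blast
    qed
  qed
qed

section \<open>Tables stored row by row and their margins\<close>

lemma sum_grid: "(\<Sum>v<p * q. f v) = (\<Sum>i<p. \<Sum>j<q. f (i * q + j))" for f :: "nat \<Rightarrow> int"
proof -
  have "sum f {i * q..<i * q + q} = (\<Sum>j<q. f (i * q + j))" for i
    using sum.shift_bounds_nat_ivl[of f 0 "i * q" q] by (simp add: atLeast0LessThan add.commute)
  then show ?thesis by (simp add: sum.nat_group[symmetric])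
qed

lemma grid_less: "i < p \<Longrightarrow> j < q \<Longrightarrow> i * q + j < p * (q :: nat)"
  by (metis add.commute add_less_cancel_left mult.commute mult_le_mono2 mult_Suc_right less_le_trans Suc_leI)

lemma grid_div_mod: "v < p * q \<Longrightarrow> v div q < p \<and> v mod q < q \<and> v div q * q + v mod q = (v :: nat)"
  by (metis div_less_iff_less_mult div_mult_mod_eq gr_zeroI mod_less_divisor mult_0_right not_less_zero)

text \<open>The incidence matrix of the complete bipartite graph: \<open>p\<close> rows for the row
  sums, followed by \<open>q\<close> rows for the column sums.\<close>

definition transport :: "nat \<Rightarrow> nat \<Rightarrow> int list list" where
  "transport p q = map (\<lambda>i. map (\<lambda>v. if v div q = i then 1 else 0) [0..<p * q]) [0..<p] @
     map (\<lambda>j. map (\<lambda>v. if v mod q = j then 1 else 0) [0..<p * q]) [0..<q]"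

lemma length_transport [simp]: "length (transport p q) = p + q"
  by (simp add: transport_def)

lemma well_formed_transport: "well_formed (p * q) (transport p q)"
  by (auto simp: well_formed_def transport_def)

lemma apply_transport:
  assumes "length z = p * q"
  shows "apply_rows (transport p q) z =
    map (\<lambda>i. \<Sum>j<q. z ! (i * q + j)) [0..<p] @ map (\<lambda>j. \<Sum>i<p. z ! (i * q + j)) [0..<q]"
proof (rule nth_equalityI)
  fix k assume "k < length (apply_rows (transport p q) z)"
  then have k: "k < p + q" by simp
  have e: "apply_rows (transport p q) z ! k = (\<Sum>i<p. \<Sum>j<q. transport p q ! k ! (i * q + j) * z ! (i * q + j))"
    using k by (simp add: apply_rows_nth[OF well_formed_transport assms] sum_grid)
  show "apply_rows (transport p q) z ! k =
    (map (\<lambda>i. \<Sum>j<q. z ! (i * q + j)) [0..<p] @ map (\<lambda>j. \<Sum>i<p. z ! (i * q + j)) [0..<q]) ! k"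
  proof (cases "k < p")
    case True
    have "(\<Sum>j<q. transport p q ! k ! (i * q + j) * z ! (i * q + j)) = (if i = k then \<Sum>j<q. z ! (i * q + j) else 0)" if "i < p" for i
      using that True by (auto simp: transport_def nth_append grid_less intro!: sum.neutral sum.cong)
    then show ?thesis unfolding e using True by (simp add: nth_append)
  next
    case False
    have "(\<Sum>j<q. transport p q ! k ! (i * q + j) * z ! (i * q + j)) = z ! (i * q + (k - p))" if i: "i < p" for i
    proof -
      have "(\<Sum>j<q. transport p q ! k ! (i * q + j) * z ! (i * q + j)) = (\<Sum>j<q. if j = k - p then z ! (i * q + j) else 0)"
        using i False k by (intro sum.cong) (auto simp: transport_def nth_append grid_less)
      then show ?thesis using False k by (simp add: less_diff_conv2)
    qed
    then show ?thesis unfolding e using False k by (simp add: nth_append)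
  qed
qed simp

lemma apply_transport_eq_iff:
  assumes "length z = p * q"
  shows "apply_rows (transport p q) z = map R [0..<p] @ map C [0..<q] \<longleftrightarrow>
    (\<forall>i<p. (\<Sum>j<q. z ! (i * q + j)) = R i) \<and> (\<forall>j<q. (\<Sum>i<p. z ! (i * q + j)) = C j)"
  unfolding apply_transport[OF assms] by (auto simp: map_eq_conv)

text \<open>One mask for each expression \<open>r(I) - c(J)\<close> in the cut conditions of Gale's theorem.\<close>

definition transport_masks :: "nat \<Rightarrow> nat \<Rightarrow> int list list" where
  "transport_masks p q = concat (map (\<lambda>I. map (\<lambda>J. I @ J) (List.n_lists q [0, - 1])) (List.n_lists p [0, 1]))"

lemma set_transport_masks:
  "mk \<in> set (transport_masks p q) \<longleftrightarrow>
    (\<exists>I J. mk = I @ J \<and> length I = p \<and> set I \<subseteq> {0, 1} \<and> length J = q \<and> set J \<subseteq> {0, - 1})"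
  unfolding transport_masks_def by (auto simp: set_n_lists)

lemma length_transport_masks: "length (transport_masks p q) = 2 ^ (p + q)"
  by (simp add: transport_masks_def length_concat comp_def sum_list_triv length_n_lists power_add numeral_2_eq_2)

lemma sign_masks_transport: "sign_masks (transport_masks p q)"
  unfolding sign_masks_def
proof (intro ballI)
  fix mk c assume "mk \<in> set (transport_masks p q)" and c: "c \<in> set mk"
  then obtain I J where "mk = I @ J" "set I \<subseteq> {0, 1}" "set J \<subseteq> {0, - 1}"
    unfolding set_transport_masks by blast
  then have "c \<in> {0, 1} \<union> {0, - 1}" using c by auto
  then show "\<bar>c\<bar> \<le> 1" by auto
qed

lemma transport_masks_length: "\<forall>mk\<in>set (transport_masks p q). length mk = length (transport p q)"
  by (auto simp: set_transport_masks)

lemma pointed_transport: "pointed (p * q) (transport p q)"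
  unfolding pointed_def
proof (intro allI impI)
  fix z assume z: "nonneg (p * q) z" and "apply_rows (transport p q) z = replicate (length (transport p q)) 0"
  then have "apply_rows (transport p q) z = map (\<lambda>_. 0) [0..<p] @ map (\<lambda>_. 0) [0..<q]"
    by (simp add: map_replicate_const replicate_add)
  then have rows: "(\<Sum>j<q. z ! (i * q + j)) = 0" if "i < p" for i
    using z that by (subst (asm) apply_transport_eq_iff) (auto simp: nonneg_def)
  have "z ! v = 0" if v: "v < p * q" for v
  proof -
    note g = grid_div_mod[OF v]
    have "\<forall>j\<in>{..<q}. z ! (v div q * q + j) = 0"
      using rows[of "v div q"] g z by (subst sum_nonneg_eq_0_iff[symmetric]) (auto simp: nonneg_def grid_less)
    then show ?thesis using g by force
  qed
  then show "z = replicate (p * q) 0" using z by (auto simp: nonneg_def list_eq_iff_nth_eq)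
qed

text \<open>What \<open>z\<close> has in the rows \<open>I\<close> outside the columns
  \<open>K\<close> is nonnegative and at least the sum of the differences \<open>r(I) - c(K)\<close>
  for \<open>z1\<close> and \<open>z2\<close>. As these two have the same sign, it is at least the
  one for \<open>z1\<close>, which is Gale's condition. The resulting table below \<open>z\<close>
  has the margins of \<open>z1\<close>, and its complement in \<open>z\<close> has those of
  \<open>z2\<close>.\<close>

lemma splitting_transport: "splitting (p * q) (transport p q) (transport_masks p q)"
  unfolding splitting_def
proof (intro allI impI)
  let ?B = "transport p q"
  fix z z1 z2
  assume z: "nonneg (p * q) z" "nonneg (p * q) z1" "nonneg (p * q) z2"
    and eq: "apply_rows ?B z = vector_sum (length ?B) [apply_rows ?B z1, apply_rows ?B z2]"
    and masks: "\<forall>mk\<in>set (transport_masks p q). 0 \<le> dot mk (apply_rows ?B z1) \<and> 0 \<le> dot mk (apply_rows ?B z2) \<or>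
       dot mk (apply_rows ?B z1) \<le> 0 \<and> dot mk (apply_rows ?B z2) \<le> 0"
  let ?R = "\<lambda>z i. \<Sum>j<q. z ! (i * q + j)" and ?C = "\<lambda>z j. \<Sum>i<p. z ! (i * q + j)"
  have len: "length z = p * q" "length z1 = p * q" "length z2 = p * q" using z by (auto simp: nonneg_def)
  have row: "apply_rows ?B z ! i = ?R z i" "apply_rows ?B z1 ! i = ?R z1 i" "apply_rows ?B z2 ! i = ?R z2 i" if "i < p" for i
    using that len by (simp_all add: apply_transport nth_append)
  have col: "apply_rows ?B z ! (p + j) = ?C z j" "apply_rows ?B z1 ! (p + j) = ?C z1 j" "apply_rows ?B z2 ! (p + j) = ?C z2 j" if "j < q" for j
    using that len by (simp_all add: apply_transport nth_append)
  have vs: "apply_rows ?B z ! k = apply_rows ?B z1 ! k + apply_rows ?B z2 ! k" if "k < p + q" for k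
    unfolding eq using that by (subst nth_vector_sum') auto
  have R: "?R z i = ?R z1 i + ?R z2 i" if "i < p" for i using vs[of i] row that by simp
  have C: "?C z j = ?C z1 j + ?C z2 j" if "j < q" for j using vs[of "p + j"] col that by simp
  have diff: "0 \<le> sum (?R z1) I - sum (?C z1) K \<and> 0 \<le> sum (?R z2) I - sum (?C z2) K \<or>
      sum (?R z1) I - sum (?C z1) K \<le> 0 \<and> sum (?R z2) I - sum (?C z2) K \<le> 0" if IK: "I \<subseteq> {..<p}" "K \<subseteq> {..<q}" for I K
  proof -
    let ?mk = "map (\<lambda>i. of_bool (i \<in> I)) [0..<p] @ map (\<lambda>j. - of_bool (j \<in> K)) [0..<q] :: int list"
    have "dot ?mk (apply_rows ?B y) = sum (?R y) I - sum (?C y) K" if y: "length y = p * q" for y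
    proof -
      have "dot ?mk (apply_rows ?B y) = (\<Sum>v<p + q. ?mk ! v * apply_rows ?B y ! v)" by (rule dot_eq_sum) auto
      also have "\<dots> = (\<Sum>v<p. ?mk ! v * apply_rows ?B y ! v) + (\<Sum>j<q. ?mk ! (p + j) * apply_rows ?B y ! (p + j))"
        using sum.atLeastLessThan_concat[of 0 p "p + q" "\<lambda>v. ?mk ! v * apply_rows ?B y ! v"]
          sum.shift_bounds_nat_ivl[of "\<lambda>v. ?mk ! v * apply_rows ?B y ! v" 0 p q]
        by (simp add: atLeast0LessThan add.commute)
      also have "(\<Sum>v<p. ?mk ! v * apply_rows ?B y ! v) = (\<Sum>i<p. of_bool (i \<in> I) * ?R y i)"
        using y by (intro sum.cong) (auto simp: apply_transport nth_append)
      also have "\<dots> = sum (?R y) I"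
        using IK by (intro sum.mono_neutral_cong_right) auto
      also have "(\<Sum>j<q. ?mk ! (p + j) * apply_rows ?B y ! (p + j)) = (\<Sum>j<q. - (of_bool (j \<in> K) * ?C y j))"
        using y by (intro sum.cong) (auto simp: apply_transport nth_append)
      also have "\<dots> = - (\<Sum>j<q. of_bool (j \<in> K) * ?C y j)" by (rule sum_negf)
      also have "(\<Sum>j<q. of_bool (j \<in> K) * ?C y j) = sum (?C y) K"
        using IK by (intro sum.mono_neutral_cong_right) auto
      finally show ?thesis by simp
    qed
    moreover have "?mk \<in> set (transport_masks p q)" unfolding set_transport_masks
      by (intro exI[of _ "map (\<lambda>i. of_bool (i \<in> I)) [0..<p]"] exI[of _ "map (\<lambda>j. - of_bool (j \<in> K)) [0..<q]"]) auto
    ultimately show ?thesis using masks len by metis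
  qed
  \<comment> \<open>Extended by 0, because \<open>gale\<close> asks for nonnegativity at all index
    pairs.\<close>
  let ?z = "\<lambda>i j. if i < p \<and> j < q then z ! (i * q + j) else 0"
  have "\<exists>y. (\<forall>i j. 0 \<le> y i j \<and> y i j \<le> ?z i j) \<and> (\<forall>i\<in>{..<p}. (\<Sum>j\<in>{..<q}. y i j) = ?R z1 i) \<and>
    (\<forall>j\<in>{..<q}. (\<Sum>i\<in>{..<p}. y i j) = ?C z1 j)"
  proof (rule gale)
    show "0 \<le> ?z i j" for i j using z(1) by (auto simp: nonneg_def grid_less)
    show "sum (?R z1) {..<p} = sum (?C z1) {..<q}" by (rule sum.swap)
    fix I K assume IK: "I \<subseteq> {..<p}" "K \<subseteq> {..<q}"
    have nn: "0 \<le> (\<Sum>i\<in>I. \<Sum>j\<in>{..<q} - K. ?z i j)"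
      using z(1) by (intro sum_nonneg) (auto simp: nonneg_def grid_less)
    have "sum (?R z) I = (\<Sum>i\<in>I. (\<Sum>j\<in>{..<q} - K. ?z i j) + (\<Sum>j\<in>K. ?z i j))"
    proof (rule sum.cong[OF refl])
      fix i assume i: "i \<in> I"
      have "?R z i = (\<Sum>j<q. ?z i j)" using i IK by (intro sum.cong) auto
      also have "\<dots> = (\<Sum>j\<in>{..<q} - K. ?z i j) + (\<Sum>j\<in>K. ?z i j)"
        using IK by (intro sum.subset_diff) auto
      finally show "?R z i = (\<Sum>j\<in>{..<q} - K. ?z i j) + (\<Sum>j\<in>K. ?z i j)" .
    qed
    then have 1: "sum (?R z) I = (\<Sum>i\<in>I. \<Sum>j\<in>{..<q} - K. ?z i j) + (\<Sum>i\<in>I. \<Sum>j\<in>K. ?z i j)"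
      by (simp add: sum.distrib)
    have "(\<Sum>i\<in>I. \<Sum>j\<in>K. ?z i j) = (\<Sum>j\<in>K. \<Sum>i\<in>I. ?z i j)" by (rule sum.swap)
    also have "\<dots> \<le> (\<Sum>j\<in>K. ?C z j)"
    proof (rule sum_mono)
      fix j assume j: "j \<in> K"
      have "(\<Sum>i\<in>I. ?z i j) \<le> (\<Sum>i<p. ?z i j)"
        using IK z(1) by (intro sum_mono2) (auto simp: nonneg_def grid_less)
      also have "\<dots> = ?C z j" using j IK by (intro sum.cong) auto
      finally show "(\<Sum>i\<in>I. ?z i j) \<le> ?C z j" .
    qed
    finally have 2: "sum (?R z) I - sum (?C z) K \<le> (\<Sum>i\<in>I. \<Sum>j\<in>{..<q} - K. ?z i j)" using 1 by linarith
    have "sum (?R z) I = (\<Sum>k\<in>I. ?R z1 k + ?R z2 k)"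
      by (rule sum.cong[OF refl]) (use IK R in blast)
    then have RI: "sum (?R z) I = sum (?R z1) I + sum (?R z2) I" by (simp only: sum.distrib)
    have "sum (?C z) K = (\<Sum>k\<in>K. ?C z1 k + ?C z2 k)"
      by (rule sum.cong[OF refl]) (use IK C in blast)
    then have CK: "sum (?C z) K = sum (?C z1) K + sum (?C z2) K" by (simp only: sum.distrib)
    show "sum (?R z1) I - sum (?C z1) K \<le> (\<Sum>i\<in>I. \<Sum>j\<in>{..<q} - K. ?z i j)"
      using diff[OF IK] 2 nn RI CK by linarith
  qed auto
  then obtain y where "(\<forall>i j. 0 \<le> y i j \<and> y i j \<le> ?z i j) \<and> (\<forall>i\<in>{..<p}. (\<Sum>j\<in>{..<q}. y i j) = ?R z1 i) \<and>
    (\<forall>j\<in>{..<q}. (\<Sum>i\<in>{..<p}. y i j) = ?C z1 j)" by (rule exE)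
  then have y: "\<And>i j. 0 \<le> y i j \<and> y i j \<le> ?z i j" "\<And>i. i < p \<Longrightarrow> (\<Sum>j<q. y i j) = ?R z1 i"
    "\<And>j. j < q \<Longrightarrow> (\<Sum>i<p. y i j) = ?C z1 j" by blast+
  let ?y = "map (\<lambda>v. y (v div q) (v mod q)) [0..<p * q]"
  let ?y' = "map (\<lambda>v. z ! v - y (v div q) (v mod q)) [0..<p * q]"
  have ij: "?y ! (i * q + j) = y i j" "?y' ! (i * q + j) = z ! (i * q + j) - y i j" if "i < p" "j < q" for i j
    using grid_less[OF that] that by (simp_all add: div_mult_self3)
  have yz: "y (v div q) (v mod q) \<le> z ! v" if "v < p * q" for v
    using y(1)[of "v div q" "v mod q"] grid_div_mod[OF that] by (simp split: if_splits)
  have "apply_rows ?B ?y = apply_rows ?B z1"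
    using len y(2,3) ij by (simp add: apply_transport)
  moreover have "apply_rows ?B ?y' = apply_rows ?B z2"
    using len y(2,3) ij R C by (simp add: apply_transport sum_subtractf)
  moreover have "vector_sum (p * q) [?y, ?y'] = z"
  proof (rule nth_equalityI)
    fix v assume "v < length (vector_sum (p * q) [?y, ?y'])"
    then have v: "v < p * q" by simp
    show "vector_sum (p * q) [?y, ?y'] ! v = z ! v" by (subst nth_vector_sum'[OF v]) (use v in auto)
  qed (simp add: len)
  moreover have "nonneg (p * q) ?y" "nonneg (p * q) ?y'" using y(1) yz by (auto simp: nonneg_def)
  ultimately have "solution (p * q) ?B [apply_rows ?B z1, apply_rows ?B z2] z [?y, ?y']"
    by (simp add: solution_def)
  then show "\<exists>ys. solution (p * q) ?B [apply_rows ?B z1, apply_rows ?B z2] z ys" by blast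
qed

lemma FC_div_nat: "FC P f \<Longrightarrow> FC P g \<Longrightarrow> FC P (\<lambda>x. f x div g x :: nat)"
  by (rule FC_enc_cong[OF FC_div_int[OF FC_of_nat FC_of_nat]])
    (auto simp: enc_nat_def enc_int_def zdiv_int)

lemma FC_mod_nat: "FC P f \<Longrightarrow> FC P g \<Longrightarrow> FB P g \<Longrightarrow> FC P (\<lambda>x. f x mod g x :: nat)"
  by (rule FC_enc_cong[OF FC_mod_int[OF FC_of_nat FC_of_nat FB_le[OF FB_Suc bit_length_nat_le]]])
    (auto simp: enc_nat_def enc_int_def zmod_int)

text \<open>The line-sum problem for tables of \<open>p\<close> rows, \<open>q\<close> columns and
  one slice for each element of \<open>\<beta>s\<close>; \<open>W\<close> contains the sums across
  the slices. The number of slices is the dimension that may be large.\<close>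

definition three_way :: "nat \<Rightarrow> nat \<Rightarrow> int list list \<Rightarrow> int list \<Rightarrow> int list list list" where
  "three_way p q \<beta>s W = solve_tables (p * q) (transport p q) (transport_masks p q) \<beta>s W"

lemma three_way_sound:
  assumes zs: "zs \<in> set (three_way p q (map (\<lambda>c. map (R c) [0..<p] @ map (C c) [0..<q]) [0..<N]) W)"
    and W: "length W = p * q"
  shows "length zs = N" "\<And>c. c < N \<Longrightarrow> nonneg (p * q) (zs ! c)"
    "\<And>c i. c < N \<Longrightarrow> i < p \<Longrightarrow> (\<Sum>j<q. zs ! c ! (i * q + j)) = R c i"
    "\<And>c j. c < N \<Longrightarrow> j < q \<Longrightarrow> (\<Sum>i<p. zs ! c ! (i * q + j)) = C c j"
    "\<And>v. v < p * q \<Longrightarrow> (\<Sum>c<N. zs ! c ! v) = W ! v"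
proof -
  have sol: "solution (p * q) (transport p q) (map (\<lambda>c. map (R c) [0..<p] @ map (C c) [0..<q]) [0..<N]) W zs"
    by (rule solve_tables_sound[OF well_formed_transport W _ pointed_transport zs[unfolded three_way_def]]) auto
  have "map (apply_rows (transport p q)) zs = map (\<lambda>c. map (R c) [0..<p] @ map (C c) [0..<q]) [0..<N]"
    using sol by (simp add: solution_def)
  from arg_cong[OF this, of length] have len: "length zs = N" by simp
  show "length zs = N" by (rule len)
  show nn: "nonneg (p * q) (zs ! c)" if "c < N" for c using sol that len unfolding solution_def by auto
  have row: "apply_rows (transport p q) (zs ! c) = map (R c) [0..<p] @ map (C c) [0..<q]" if "c < N" for c
  proof -
    have "map (apply_rows (transport p q)) zs ! c = map (\<lambda>c. map (R c) [0..<p] @ map (C c) [0..<q]) [0..<N] ! c"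
      using sol unfolding solution_def by simp
    then show ?thesis using that len by simp
  qed
  have rc: "(\<forall>i<p. (\<Sum>j<q. zs ! c ! (i * q + j)) = R c i) \<and> (\<forall>j<q. (\<Sum>i<p. zs ! c ! (i * q + j)) = C c j)" if "c < N" for c
  proof -
    have "length (zs ! c) = p * q" using nn[OF that] by (simp add: nonneg_def)
    from apply_transport_eq_iff[OF this] row[OF that] show ?thesis by blast
  qed
  show "(\<Sum>j<q. zs ! c ! (i * q + j)) = R c i" if "c < N" "i < p" for c i using rc that by blast
  show "(\<Sum>i<p. zs ! c ! (i * q + j)) = C c j" if "c < N" "j < q" for c j using rc that by blast
  show "(\<Sum>c<N. zs ! c ! v) = W ! v" if v: "v < p * q" for v
  proof -
    have "vector_sum (p * q) zs ! v = (\<Sum>c<length zs. zs ! c ! v)"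
      by (rule nth_vector_sum[OF v]) (use sol in \<open>auto simp: solution_def nonneg_def\<close>)
    then show ?thesis using sol len by (simp add: solution_def)
  qed
qed

lemma three_way_complete:
  assumes x: "\<And>c i j. c < N \<Longrightarrow> i < p \<Longrightarrow> j < q \<Longrightarrow> 0 \<le> x c i j"
    and R: "\<And>c i. c < N \<Longrightarrow> i < p \<Longrightarrow> (\<Sum>j<q. x c i j) = R c i"
    and C: "\<And>c j. c < N \<Longrightarrow> j < q \<Longrightarrow> (\<Sum>i<p. x c i j) = C c j"
    and W: "length W = p * q" "\<And>i j. i < p \<Longrightarrow> j < q \<Longrightarrow> (\<Sum>c<N. x c i j) = W ! (i * q + j)"
  shows "three_way p q (map (\<lambda>c. map (R c) [0..<p] @ map (C c) [0..<q]) [0..<N]) W \<noteq> []"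
proof -
  let ?z = "\<lambda>c. map (\<lambda>v. x c (v div q) (v mod q)) [0..<p * q]"
  have ij: "?z c ! (i * q + j) = x c i j" if "i < p" "j < q" for c i j
    using grid_less[OF that] that by (simp add: div_mult_self3)
  have nn: "nonneg (p * q) (?z c)" if "c < N" for c
    using x[OF that] by (auto simp: nonneg_def dest!: grid_div_mod)
  have ap: "apply_rows (transport p q) (?z c) = map (R c) [0..<p] @ map (C c) [0..<q]" if "c < N" for c
    using R[OF that] C[OF that] ij by (subst apply_transport_eq_iff) auto
  have "solution (p * q) (transport p q) (map (\<lambda>c. map (R c) [0..<p] @ map (C c) [0..<q]) [0..<N]) W (map ?z [0..<N])"
    unfolding solution_def
  proof (intro conjI)
    show "map (apply_rows (transport p q)) (map ?z [0..<N]) = map (\<lambda>c. map (R c) [0..<p] @ map (C c) [0..<q]) [0..<N]"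
      using ap by simp
    show "\<forall>z\<in>set (map ?z [0..<N]). nonneg (p * q) z" using nn by simp
    show "vector_sum (p * q) (map ?z [0..<N]) = W"
    proof (rule nth_equalityI)
      fix v assume "v < length (vector_sum (p * q) (map ?z [0..<N]))"
      then have v: "v < p * q" by simp
      have "vector_sum (p * q) (map ?z [0..<N]) ! v = (\<Sum>c<N. x c (v div q) (v mod q))"
        using v by (subst nth_vector_sum[OF v]) auto
      also have "\<dots> = W ! v" using W(2)[of "v div q" "v mod q"] grid_div_mod[OF v] by simp
      finally show "vector_sum (p * q) (map ?z [0..<N]) ! v = W ! v" .
    qed (simp add: W)
  qed
  then show ?thesis unfolding three_way_def
    by (intro solve_tables_complete[OF well_formed_transport W(1) _ splitting_transport transport_masks_length]) auto
qed

lemma FC_transport: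
  assumes "FC P p" "FB P p" "FC P q" "FB P q"
  shows "FC P (\<lambda>x. transport (p x) (q x))"
proof -
  have pq: "FB P (\<lambda>x. p x * q x)" by (intro FB_mult assms)
  let ?Q = "\<lambda>r a b z. P a b (fst z) \<and> snd z \<in> set [0..<r (fst z)]"
  let ?T = "\<lambda>r a b z. ?Q r a b (fst z) \<and> snd z \<in> set [0..<p (fst (fst z)) * q (fst (fst z))]"
  have e: "FC (?Q r) (\<lambda>z. p (fst z))" "FC (?Q r) (\<lambda>z. q (fst z))" "FB (?Q r) (\<lambda>z. p (fst z) * q (fst z))" "FB (?Q r) (\<lambda>z. q (fst z))" for r
    by (rule FC_env[OF assms(1)] FC_env[OF assms(3)] FB_env[OF pq] FB_env[OF assms(4)], blast, (intro FC_fst FC_id)?)+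
  have f: "FC (?T r) (\<lambda>z. q (fst (fst z)))" "FB (?T r) (\<lambda>z. q (fst (fst z)))" for r
    by (rule FC_env[OF assms(3)] FB_env[OF assms(4)], blast, (intro FC_fst FC_id)?)+
  have g: "FB (?Q r) (\<lambda>z. length [0..<p (fst z) * q (fst z)])" for r using e(3)[of r] by simp
  have i: "FC (?Q r) (\<lambda>z. [0..<p (fst z) * q (fst z)])" for r
    by (intro FC_upt FC_mult_nat e)
  have 1: "FC P (\<lambda>x. map (\<lambda>i. map (\<lambda>v. if v div q x = i then 1 else 0 :: int) [0..<p x * q x]) [0..<p x])"
    by (intro FC_map FC_upt assms i g FC_If FC_eq_nat FC_div_nat f FC_const_int FC_fst FC_snd FC_id) (use assms in simp)
  have 2: "FC P (\<lambda>x. map (\<lambda>i. map (\<lambda>v. if v mod q x = i then 1 else 0 :: int) [0..<p x * q x]) [0..<q x])"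
    by (intro FC_map FC_upt assms i g FC_If FC_eq_nat FC_mod_nat f FC_const_int FC_fst FC_snd FC_id) (use assms in simp)
  show ?thesis unfolding transport_def by (intro FC_append 1 2) (use assms in simp)
qed

lemma FC_transport_masks:
  assumes "FC P p" "PB P p" "FC P q" "PB P q"
  shows "FC P (\<lambda>x. transport_masks (p x) (q x))"
proof -
  have c: "FC P (\<lambda>x. List.n_lists (p x) [0, 1 :: int])" "FC P (\<lambda>x. List.n_lists (q x) [0, - 1 :: int])"
    by (intro FC_n_lists assms FC_Cons FC_Nil FC_const_int, simp add: PB_const)+
  have l: "FB P (\<lambda>x. length (List.n_lists (p x) [0, 1 :: int]))" "FB P (\<lambda>x. length (List.n_lists (q x) [0, - 1 :: int]))"
    using FB_of_PB[OF PB_exp2[OF assms(2)]] FB_of_PB[OF PB_exp2[OF assms(4)]]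
    by (simp_all add: length_n_lists numeral_2_eq_2)
  let ?Q = "\<lambda>a b z. P a b (fst z) \<and> snd z \<in> set (List.n_lists (p (fst z)) [0, 1 :: int])"
  have e: "FC ?Q (\<lambda>z. List.n_lists (q (fst z)) [0, - 1 :: int])" "FB ?Q (\<lambda>z. length (List.n_lists (q (fst z)) [0, - 1 :: int]))"
    by (rule FC_env[OF c(2)] FB_env[OF l(2)], blast, (intro FC_fst FC_id)?)+
  have f: "FB (\<lambda>a b z. ?Q a b (fst z) \<and> snd z \<in> set (List.n_lists (q (fst (fst z))) [0, - 1 :: int])) (\<lambda>z. length (snd (fst z)))"
    by (rule FB_mono[OF FB_of_PB[OF assms(2)], where g = "\<lambda>z. fst (fst z)"]) (auto simp: set_n_lists)
  have "FC P (\<lambda>x. map (\<lambda>I. map (\<lambda>J. I @ J) (List.n_lists (q x) [0, - 1 :: int])) (List.n_lists (p x) [0, 1]))"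
    by (intro FC_map c l e FC_append f FC_fst FC_snd FC_id)
  then show ?thesis unfolding transport_masks_def
  proof (rule FC_concat)
    show "FB P (\<lambda>x. length (map (\<lambda>I. map (\<lambda>J. I @ J) (List.n_lists (q x) [0, - 1 :: int])) (List.n_lists (p x) [0, 1])))"
      using l(1) by simp
    show "FB (\<lambda>a b z. P a b (fst z) \<and> snd z \<in> set (map (\<lambda>I. map (\<lambda>J. I @ J) (List.n_lists (q (fst z)) [0, - 1 :: int])) (List.n_lists (p (fst z)) [0, 1])))
        (\<lambda>z. length (snd z))"
      by (rule FB_mono[OF l(2), where g = fst]) auto
  qed
qed

lemma FC_three_way:
  assumes p: "FC P p" "PB P p" and q: "FC P q" "PB P q"
    and \<beta>s: "FC P \<beta>s" "FB P (\<lambda>x. length (\<beta>s x))"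
      "\<And>a b x. P a b x \<Longrightarrow> \<forall>\<beta>\<in>set (\<beta>s x). length \<beta> = p x + q x"
    and W: "FC P W" "\<And>a b x. P a b x \<Longrightarrow> length (W x) = p x * q x" "FB P (\<lambda>x. bit_length (sum_list (W x)))"
  shows "FC P (\<lambda>x. three_way (p x) (q x) (\<beta>s x) (W x))"
  unfolding three_way_def
proof (rule FC_solve_tables)
  show "FC P (\<lambda>x. p x * q x)" by (intro FC_mult_nat p q FB_of_PB[OF q(2)])
  show "PB P (\<lambda>x. p x * q x)" by (intro PB_mult p q)
  show "FC P (\<lambda>x. transport (p x) (q x))" by (intro FC_transport p q FB_of_PB[OF p(2)] FB_of_PB[OF q(2)])
  show "PB P (\<lambda>x. length (transport (p x) (q x)))" unfolding length_transport by (intro PB_add p q)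
  show "FC P (\<lambda>x. transport_masks (p x) (q x))" by (intro FC_transport_masks p q)
  show "PB P (\<lambda>x. length (transport_masks (p x) (q x)))" unfolding length_transport_masks by (intro PB_exp2 PB_add p q)
qed (use \<beta>s W in \<open>auto simp: well_formed_transport sign_masks_transport\<close>)


section \<open>Decomposing a table into layers\<close>

definition row_sum :: "nat \<Rightarrow> int list \<Rightarrow> nat \<Rightarrow> int" where
  "row_sum m A i = sum_list (map (\<lambda>j. nth_or 0 A (i * m + j)) [0..<m])"

definition col_sum :: "nat \<Rightarrow> nat \<Rightarrow> int list \<Rightarrow> nat \<Rightarrow> int" where
  "col_sum l m A j = sum_list (map (\<lambda>i. nth_or 0 A (i * m + j)) [0..<l])"

lemma row_sum: "length A = l * m \<Longrightarrow> i < l \<Longrightarrow> row_sum m A i = (\<Sum>j<m. A ! (i * m + j))"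
  by (simp add: row_sum_def grid_less sum_list_sum_nth atLeast0LessThan)

lemma col_sum: "length A = l * m \<Longrightarrow> j < m \<Longrightarrow> col_sum l m A j = (\<Sum>i<l. A ! (i * m + j))"
  by (simp add: col_sum_def grid_less sum_list_sum_nth atLeast0LessThan)

definition positive_part :: "int list \<Rightarrow> int list" where
  "positive_part S = map (\<lambda>s. if 0 < s then 1 else 0) S"

text \<open>A 0/1 matrix with support in the positive entries of \<open>S\<close> and the margins of \<open>S\<close> divided by
  \<open>n\<close>; its columns, together with the columns of its complement, are the layers of a
  three-way table.\<close>

definition rounding_solutions :: "nat \<Rightarrow> nat \<Rightarrow> int \<Rightarrow> int list \<Rightarrow> int list list list" where
  "rounding_solutions l m n S = three_way l 2
     (map (\<lambda>j. map (\<lambda>i. nth_or 0 (positive_part S) (i * m + j)) [0..<l] @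
        map (\<lambda>e. if e = 0 then col_sum l m S j div n else col_sum l m (positive_part S) j - col_sum l m S j div n) [0..<2]) [0..<m])
     (map (\<lambda>v. if v mod 2 = 0 then row_sum m S (v div 2) div n
        else row_sum m (positive_part S) (v div 2) - row_sum m S (v div 2) div n) [0..<l * 2])"

definition rounding :: "nat \<Rightarrow> nat \<Rightarrow> int \<Rightarrow> int list \<Rightarrow> int list list" where
  "rounding l m n S = (if rounding_solutions l m n S \<noteq> []
     then [map (\<lambda>v. nth_or 0 (nth_or [] (hd (rounding_solutions l m n S)) (v mod m)) (v div m * 2)) [0..<l * m]] else [])"

text \<open>\<open>S / n\<close> is a fractional table with the margins \<open>r\<close> and
  \<open>c\<close> below the indicator of the support of \<open>S\<close>. It satisfies Gale's cut
  conditions, and multiplying them by \<open>n\<close> keeps the computation in the integers; hence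
  an integral table below the indicator exists, and the three-way solver finds one.\<close>

lemma rounding:
  assumes n: "0 < n" and S: "length S = l * m" "\<And>v. v < l * m \<Longrightarrow> 0 \<le> S ! v \<and> S ! v < n"
    and r: "\<And>i. i < l \<Longrightarrow> (\<Sum>j<m. S ! (i * m + j)) = n * r i"
    and c: "\<And>j. j < m \<Longrightarrow> (\<Sum>i<l. S ! (i * m + j)) = n * c j"
  obtains D where "rounding l m n S = [D]" "length D = l * m"
    "\<And>v. v < l * m \<Longrightarrow> D ! v = 0 \<or> D ! v = 1 \<and> 0 < S ! v"
    "\<And>i. i < l \<Longrightarrow> (\<Sum>j<m. D ! (i * m + j)) = r i"
    "\<And>j. j < m \<Longrightarrow> (\<Sum>i<l. D ! (i * m + j)) = c j"
proof -
  let ?K = "positive_part S"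
  let ?k = "\<lambda>i j. if i < l \<and> j < m then ?K ! (i * m + j) else 0"
  let ?s = "\<lambda>i j. if i < l \<and> j < m then S ! (i * m + j) else 0"
  have lenK: "length ?K = l * m" using S by (simp add: positive_part_def)
  have K: "?K ! v = (if 0 < S ! v then 1 else 0)" if "v < l * m" for v using that S by (simp add: positive_part_def)
  have k01: "0 \<le> ?k i j" "?s i j \<le> n * ?k i j" "0 \<le> ?s i j" for i j
    using S(2)[of "i * m + j"] K[of "i * m + j"] grid_less[of i l j m] n by auto
  have rs: "(\<Sum>j<m. ?s i j) = n * r i" if "i < l" for i using r[OF that] that by simp
  have cs: "(\<Sum>i<l. ?s i j) = n * c j" if "j < m" for j using c[OF that] that by simp
  have "\<exists>y. (\<forall>i j. 0 \<le> y i j \<and> y i j \<le> ?k i j) \<and> (\<forall>i\<in>{..<l}. (\<Sum>j\<in>{..<m}. y i j) = r i) \<and>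
    (\<forall>j\<in>{..<m}. (\<Sum>i\<in>{..<l}. y i j) = c j)"
  proof (rule gale)
    have "n * sum r {..<l} = (\<Sum>i<l. \<Sum>j<m. ?s i j)" using rs by (simp add: sum_distrib_left)
    also have "\<dots> = (\<Sum>j<m. \<Sum>i<l. ?s i j)" by (rule sum.swap)
    also have "\<dots> = n * sum c {..<m}" using cs by (simp add: sum_distrib_left)
    finally show "sum r {..<l} = sum c {..<m}" using n by simp
    fix I J assume IJ: "I \<subseteq> {..<l}" "J \<subseteq> {..<m}"
    have "n * sum r I = (\<Sum>i\<in>I. \<Sum>j<m. ?s i j)"
      unfolding sum_distrib_left by (rule sum.cong[OF refl]) (use rs IJ in auto)
    also have "\<dots> = (\<Sum>i\<in>I. (\<Sum>j\<in>{..<m} - J. ?s i j) + (\<Sum>j\<in>J. ?s i j))"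
      by (rule sum.cong[OF refl], rule sum.subset_diff) (use IJ in auto)
    also have "\<dots> = (\<Sum>i\<in>I. \<Sum>j\<in>{..<m} - J. ?s i j) + (\<Sum>i\<in>I. \<Sum>j\<in>J. ?s i j)" by (rule sum.distrib)
    also have "(\<Sum>i\<in>I. \<Sum>j\<in>J. ?s i j) = (\<Sum>j\<in>J. \<Sum>i\<in>I. ?s i j)" by (rule sum.swap)
    also have "\<dots> \<le> (\<Sum>j\<in>J. \<Sum>i<l. ?s i j)"
      by (rule sum_mono, rule sum_mono2[OF _ _ k01(3)]) (use IJ in auto)
    also have "\<dots> = n * sum c J"
      unfolding sum_distrib_left by (rule sum.cong[OF refl]) (use cs IJ in auto)
    also have "(\<Sum>i\<in>I. \<Sum>j\<in>{..<m} - J. ?s i j) \<le> (\<Sum>i\<in>I. \<Sum>j\<in>{..<m} - J. n * ?k i j)"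
      by (intro sum_mono k01)
    also have "\<dots> = n * (\<Sum>i\<in>I. \<Sum>j\<in>{..<m} - J. ?k i j)" by (simp only: sum_distrib_left)
    finally have "n * (sum r I - sum c J) \<le> n * (\<Sum>i\<in>I. \<Sum>j\<in>{..<m} - J. ?k i j)"
      by (simp add: right_diff_distrib)
    then show "sum r I - sum c J \<le> (\<Sum>i\<in>I. \<Sum>j\<in>{..<m} - J. ?k i j)" using n by simp
  qed (use k01 in auto)
  then obtain y where "(\<forall>i j. 0 \<le> y i j \<and> y i j \<le> ?k i j) \<and> (\<forall>i\<in>{..<l}. (\<Sum>j\<in>{..<m}. y i j) = r i) \<and>
    (\<forall>j\<in>{..<m}. (\<Sum>i\<in>{..<l}. y i j) = c j)" by (rule exE)
  then have y: "\<And>i j. 0 \<le> y i j \<and> y i j \<le> ?k i j" "\<And>i. i < l \<Longrightarrow> (\<Sum>j<m. y i j) = r i"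
    "\<And>j. j < m \<Longrightarrow> (\<Sum>i<l. y i j) = c j" by blast+
  let ?R = "\<lambda>j i. nth_or 0 ?K (i * m + j)"
  let ?C = "\<lambda>j (e :: nat). if e = 0 then col_sum l m S j div n else col_sum l m ?K j - col_sum l m S j div n"
  let ?W = "map (\<lambda>v. if v mod 2 = 0 then row_sum m S (v div 2) div n
        else row_sum m ?K (v div 2) - row_sum m S (v div 2) div n) [0..<l * 2]"
  have R: "?R j i = ?k i j" if "i < l" "j < m" for i j using that grid_less[of i l j m] lenK by simp
  have C: "?C j e = (if e = 0 then c j else (\<Sum>i<l. ?k i j) - c j)" if "j < m" for j e
    using that c[OF that] n col_sum[OF S(1) that] col_sum[OF lenK that] by simp
  have W: "?W ! (i * 2 + e) = (if e = 0 then r i else (\<Sum>j<m. ?k i j) - r i)" if "i < l" "e < 2" for i e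
  proof -
    have "(i * 2 + e) mod 2 = e" "(i * 2 + e) div 2 = i" using that by auto
    then show ?thesis
      using that grid_less[OF that] r[OF that(1)] n row_sum[OF S(1) that(1)] row_sum[OF lenK that(1)] by simp
  qed
  have sum2: "(\<Sum>e<2. f e) = f 0 + f (1::nat)" for f :: "nat \<Rightarrow> int" by (simp add: numeral_2_eq_2)
  have e2: "e < 2 \<longleftrightarrow> e = 0 \<or> e = 1" for e :: nat by auto
  have sols_def: "rounding_solutions l m n S = three_way l 2 (map (\<lambda>j. map (?R j) [0..<l] @ map (?C j) [0..<2]) [0..<m]) ?W"
    by (simp only: rounding_solutions_def)
  have ne: "rounding_solutions l m n S \<noteq> []" unfolding sols_def
  proof (rule three_way_complete[where x = "\<lambda>j i e. if e = 0 then y i j else ?k i j - y i j"])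
    show "0 \<le> (if e = 0 then y i j else ?k i j - y i j)" for e :: nat and i j using y(1)[of i j] by simp
    show "(\<Sum>e<2::nat. if e = 0 then y i j else ?k i j - y i j) = ?R j i" if "j < m" "i < l" for i j
      unfolding R[OF that(2,1)] sum2 by simp
    show "(\<Sum>i<l. if e = 0 then y i j else ?k i j - y i j) = ?C j e" if "j < m" "e < 2" for j e
      unfolding C[OF that(1)] using y(3)[OF that(1)] by (cases "e = 0") (simp_all only: if_True if_False simp_thms sum_subtractf)
    show "(\<Sum>j<m. if e = 0 then y i j else ?k i j - y i j) = ?W ! (i * 2 + e)" if "i < l" "e < 2" for i e
      unfolding W[OF that] using y(2)[OF that(1)] by (cases "e = 0") (simp_all only: if_True if_False simp_thms sum_subtractf)
  qed simp
  let ?zs = "hd (rounding_solutions l m n S)"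
  have "?zs \<in> set (rounding_solutions l m n S)" using ne by simp
  note zs = three_way_sound[OF this[unfolded sols_def], folded sols_def]
  have zl: "length ?zs = m" by (rule zs) simp
  have znn: "nonneg (l * 2) (?zs ! j)" if "j < m" for j by (rule zs) (use that in simp_all)
  let ?D = "map (\<lambda>v. nth_or 0 (nth_or [] ?zs (v mod m)) (v div m * 2)) [0..<l * m]"
  have D: "?D ! (i * m + j) = ?zs ! j ! (i * 2 + 0)" if "i < l" "j < m" for i j
    using that grid_less[OF that] zl znn[OF that(2)] by (simp add: nonneg_def div_mult_self3)
  have pair: "?zs ! j ! (i * 2 + 0) + ?zs ! j ! (i * 2 + 1) = ?k i j" if "i < l" "j < m" for i j
    using zs(3)[of j i] that R[OF that] unfolding sum2 by simp
  show thesis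
  proof (rule that)
    show "rounding l m n S = [?D]" using ne by (simp add: rounding_def)
    show "length ?D = l * m" by simp
    show "?D ! v = 0 \<or> ?D ! v = 1 \<and> 0 < S ! v" if v: "v < l * m" for v
    proof -
      let ?i = "v div m" and ?j = "v mod m"
      have ij: "?i < l" "?j < m" "?i * m + ?j = v" using grid_div_mod[OF v] by auto
      have "?i * 2 + 0 < l * 2" "?i * 2 + 1 < l * 2" using ij by auto
      then have "0 \<le> ?zs ! ?j ! (?i * 2 + 0)" "0 \<le> ?zs ! ?j ! (?i * 2 + 1)"
        using znn[OF ij(2)] unfolding nonneg_def by blast+
      then have "0 \<le> ?D ! v" "?D ! v \<le> ?k ?i ?j" using pair[OF ij(1,2)] D[OF ij(1,2)] unfolding ij(3) by linarith+
      then show ?thesis using ij K[OF v] by (auto split: if_splits)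
    qed
    show "(\<Sum>j<m. ?D ! (i * m + j)) = r i" if i: "i < l" for i
    proof -
      have "(\<Sum>j<m. ?D ! (i * m + j)) = (\<Sum>j<m. ?zs ! j ! (i * 2 + 0))"
        by (rule sum.cong[OF refl], rule D[OF i]) simp
      also have "\<dots> = ?W ! (i * 2 + 0)" by (rule zs(5)) (use i in simp_all)
      also have "\<dots> = r i" by (subst W[OF i]) simp_all
      finally show ?thesis .
    qed
    show "(\<Sum>i<l. ?D ! (i * m + j)) = c j" if j: "j < m" for j
    proof -
      have "(\<Sum>i<l. ?D ! (i * m + j)) = (\<Sum>i<l. ?zs ! j ! (i * 2 + 0))"
        by (rule sum.cong[OF refl], rule D[OF _ j]) simp
      also have "\<dots> = ?C j 0" by (rule zs(4)) (use j in simp_all)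
      also have "\<dots> = c j" by (subst C[OF j]) simp
      finally show ?thesis .
    qed
  qed
qed

section \<open>Splitting off layers with maximal multiplicity\<close>

definition residues :: "int \<Rightarrow> int list \<Rightarrow> int list" where
  "residues n X = map (\<lambda>x. x mod n) X"

definition dec_layer :: "int \<Rightarrow> int list \<Rightarrow> int list \<Rightarrow> int list" where
  "dec_layer n X D = map (\<lambda>p. fst p div n + snd p) (zip X D)"

definition dec_mult :: "int \<Rightarrow> int list \<Rightarrow> int list \<Rightarrow> int" where
  "dec_mult n X D = fold (\<lambda>p k. if (if snd p = 1 then fst p else n - fst p) < k then (if snd p = 1 then fst p else n - fst p) else k)
     (zip (residues n X) D) n"

definition dec_rest :: "int \<Rightarrow> int list \<Rightarrow> int list \<Rightarrow> int list" where
  "dec_rest n X D = map (\<lambda>p. fst p - snd p * dec_mult n X D) (zip X (dec_layer n X D))"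

text \<open>\<open>dec_mult\<close> is the largest multiplicity that leaves every entry of the rest between the floor and the
  ceiling of \<open>X / n\<close>, times the number of remaining layers.\<close>

primrec dec :: "nat \<Rightarrow> nat \<Rightarrow> nat \<Rightarrow> int \<Rightarrow> int list \<Rightarrow> (int \<times> int list) list" where
  "dec l m 0 n X = []"
| "dec l m (Suc f) n X = (if 0 < n \<and> rounding l m n (residues n X) \<noteq> []
     then let D = hd (rounding l m n (residues n X))
       in (dec_mult n X D, dec_layer n X D) # dec l m f (n - dec_mult n X D) (dec_rest n X D)
     else [])"

definition has_margins :: "nat \<Rightarrow> nat \<Rightarrow> (nat \<Rightarrow> int) \<Rightarrow> (nat \<Rightarrow> int) \<Rightarrow> int list \<Rightarrow> bool" where
  "has_margins l m r c X \<longleftrightarrow> nonneg (l * m) X \<and> (\<forall>i<l. (\<Sum>j<m. X ! (i * m + j)) = r i) \<and>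
     (\<forall>j<m. (\<Sum>i<l. X ! (i * m + j)) = c j)"

lemma fold_min:
  fixes f :: "'a \<Rightarrow> int"
  defines "M xs n \<equiv> fold (\<lambda>p k. if f p < k then f p else k) xs n"
  shows "M xs n \<le> n" "\<forall>p\<in>set xs. M xs n \<le> f p" "M xs n = n \<or> (\<exists>p\<in>set xs. M xs n = f p)"
proof -
  have "M xs n \<le> n \<and> (\<forall>p\<in>set xs. M xs n \<le> f p) \<and> (M xs n = n \<or> (\<exists>p\<in>set xs. M xs n = f p))"
    unfolding M_def
  proof (induction xs arbitrary: n)
    case (Cons p xs)
    let ?n = "if f p < n then f p else n"
    have "?n \<le> n" "?n \<le> f p" "?n = n \<or> ?n = f p" by auto
    then show ?case using Cons[of ?n] by (simp only: fold_Cons o_apply list.set ball_simps bex_simps) linarith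
  qed simp
  then show "M xs n \<le> n" "\<forall>p\<in>set xs. M xs n \<le> f p" "M xs n = n \<or> (\<exists>p\<in>set xs. M xs n = f p)" by auto
qed

text \<open>The bounds \<open>A\<close> and \<open>B\<close> are arbitrary multiples of the number
  of layers, so they can be carried through all later steps. The last two conclusions measure
  progress: divisible entries stay divisible, and unless nothing remains, a further entry becomes
  divisible with a quotient \<open>w\<close> that the layer just split off does not have.\<close>

lemma dec_step:
  assumes n: "0 < n" and X: "has_margins l m (\<lambda>i. n * r i) (\<lambda>j. n * c j) X"
  obtains D where "rounding l m n (residues n X) = [D]" "1 \<le> dec_mult n X D" "dec_mult n X D \<le> n"
    "has_margins l m r c (dec_layer n X D)"
    "has_margins l m (\<lambda>i. (n - dec_mult n X D) * r i) (\<lambda>j. (n - dec_mult n X D) * c j) (dec_rest n X D)"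
    "\<And>v. v < l * m \<Longrightarrow> X ! v = dec_mult n X D * dec_layer n X D ! v + dec_rest n X D ! v"
    "\<And>v A B. v < l * m \<Longrightarrow> A * n \<le> X ! v \<Longrightarrow> X ! v \<le> B * n \<Longrightarrow> A \<le> dec_layer n X D ! v \<and> dec_layer n X D ! v \<le> B \<and>
       A * (n - dec_mult n X D) \<le> dec_rest n X D ! v \<and> dec_rest n X D ! v \<le> B * (n - dec_mult n X D)"
    "\<And>v. v < l * m \<Longrightarrow> X ! v mod n = 0 \<Longrightarrow> dec_rest n X D ! v mod (n - dec_mult n X D) = 0"
    "dec_mult n X D = n \<or> (\<exists>v w. v < l * m \<and> X ! v mod n \<noteq> 0 \<and> dec_rest n X D ! v = w * (n - dec_mult n X D) \<and> dec_layer n X D ! v \<noteq> w)"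
proof -
  let ?S = "residues n X"
  have lenX: "length X = l * m" and X0: "\<And>v. v < l * m \<Longrightarrow> 0 \<le> X ! v" using X by (auto simp: has_margins_def nonneg_def)
  have lenS: "length ?S = l * m" using lenX by (simp add: residues_def)
  have S: "?S ! v = X ! v mod n" if "v < l * m" for v using that lenX by (simp add: residues_def)
  have S0: "0 \<le> ?S ! v \<and> ?S ! v < n" if "v < l * m" for v using n that by (simp add: S)
  have XS: "n * (X ! v div n) + ?S ! v = X ! v" if "v < l * m" for v using S[OF that] by simp
  let ?r = "\<lambda>i. r i - (\<Sum>j<m. X ! (i * m + j) div n)" and ?c = "\<lambda>j. c j - (\<Sum>i<l. X ! (i * m + j) div n)"
  have rs: "(\<Sum>j<m. ?S ! (i * m + j)) = n * ?r i" if i: "i < l" for i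
  proof -
    have "(\<Sum>j<m. ?S ! (i * m + j)) = (\<Sum>j<m. X ! (i * m + j) - n * (X ! (i * m + j) div n))"
      proof (rule sum.cong[OF refl])
      fix j assume "j \<in> {..<m}"
      then show "?S ! (i * m + j) = X ! (i * m + j) - n * (X ! (i * m + j) div n)"
        using XS[OF grid_less[OF i, of j m]] by simp
    qed
    also have "\<dots> = (\<Sum>j<m. X ! (i * m + j)) - n * (\<Sum>j<m. X ! (i * m + j) div n)"
      by (simp add: sum_subtractf sum_distrib_left)
    finally show ?thesis using X i by (simp add: has_margins_def right_diff_distrib)
  qed
  have cs: "(\<Sum>i<l. ?S ! (i * m + j)) = n * ?c j" if j: "j < m" for j
  proof -
    have "(\<Sum>i<l. ?S ! (i * m + j)) = (\<Sum>i<l. X ! (i * m + j) - n * (X ! (i * m + j) div n))"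
      proof (rule sum.cong[OF refl])
      fix i assume "i \<in> {..<l}"
      then show "?S ! (i * m + j) = X ! (i * m + j) - n * (X ! (i * m + j) div n)"
        using XS[OF grid_less[OF _ j, of i l]] by simp
    qed
    also have "\<dots> = (\<Sum>i<l. X ! (i * m + j)) - n * (\<Sum>i<l. X ! (i * m + j) div n)"
      by (simp add: sum_subtractf sum_distrib_left)
    finally show ?thesis using X j by (simp add: has_margins_def right_diff_distrib)
  qed
  obtain D where D: "rounding l m n ?S = [D]" "length D = l * m"
    "\<And>v. v < l * m \<Longrightarrow> D ! v = 0 \<or> D ! v = 1 \<and> 0 < ?S ! v"
    "\<And>i. i < l \<Longrightarrow> (\<Sum>j<m. D ! (i * m + j)) = ?r i"
    "\<And>j. j < m \<Longrightarrow> (\<Sum>i<l. D ! (i * m + j)) = ?c j"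
    by (rule rounding[OF n lenS S0 rs cs], assumption, assumption, assumption) (rule that; blast)
  let ?k = "dec_mult n X D" and ?z = "dec_layer n X D" and ?Y = "dec_rest n X D"
  let ?f = "\<lambda>p. if snd p = 1 then fst p else n - fst p"
  have set: "p \<in> set (zip ?S D) \<longleftrightarrow> (\<exists>v<l * m. p = (?S ! v, D ! v))" for p
    using lenS D(2) by (auto simp: set_zip)
  note min = fold_min[where f = ?f and xs = "zip ?S D" and n = n, folded dec_mult_def]
  have kv: "?k \<le> (if D ! v = 1 then ?S ! v else n - ?S ! v)" if "v < l * m" for v
  proof -
    have "(?S ! v, D ! v) \<in> set (zip ?S D)" using that unfolding set by blast
    from bspec[OF min(2) this] show ?thesis by (simp only: fst_conv snd_conv)
  qed
  have fpos: "1 \<le> (if D ! v = 1 then ?S ! v else n - ?S ! v)" if "v < l * m" for v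
    using D(3)[OF that] S0[OF that] by auto
  have kv': "?k = n \<or> (\<exists>v<l * m. ?k = (if D ! v = 1 then ?S ! v else n - ?S ! v))"
    using min(3) unfolding Bex_def set by (elim disjE exE conjE) auto
  have k1: "1 \<le> ?k" using kv' n fpos by (elim disjE exE conjE) auto
  have kn: "?k \<le> n" by (rule min(1))
  have z: "?z ! v = X ! v div n + D ! v" if "v < l * m" for v using that lenX D(2) by (simp add: dec_layer_def)
  have lenz: "length ?z = l * m" using lenX D(2) by (simp add: dec_layer_def)
  have Y: "?Y ! v = X ! v - ?z ! v * ?k" if "v < l * m" for v using that lenX lenz by (simp add: dec_rest_def)
  have lenY: "length ?Y = l * m" using lenX lenz by (simp add: dec_rest_def)
  have YS: "?Y ! v = (n - ?k) * (X ! v div n) + (?S ! v - D ! v * ?k)" if "v < l * m" for v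
    using XS[OF that] unfolding Y[OF that] z[OF that] by (simp add: algebra_simps)
  \<comment> \<open>Where the layer is rounded up the multiplicity is at most the residue, and where
    it is rounded down it is at most \<open>n\<close> minus the residue; in both cases the residue
    that remains lies between 0 and the number of remaining layers.\<close>
  have SD: "0 \<le> ?S ! v - D ! v * ?k \<and> ?S ! v - D ! v * ?k \<le> n - ?k \<and> (?S ! v = 0 \<longrightarrow> D ! v = 0)" if "v < l * m" for v
    using kv[OF that] D(3)[OF that] S0[OF that] by auto
  show thesis
  proof (rule that[OF D(1) k1 kn])
    have z0: "0 \<le> ?z ! v" if "v < l * m" for v
      using z[OF that] D(3)[OF that] X0[OF that] n pos_imp_zdiv_nonneg_iff[OF n, of "X ! v"] by auto
    have zr: "(\<Sum>j<m. ?z ! (i * m + j)) = r i" if i: "i < l" for i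
    proof -
      have "(\<Sum>j<m. ?z ! (i * m + j)) = (\<Sum>j<m. X ! (i * m + j) div n + D ! (i * m + j))"
        by (rule sum.cong[OF refl]) (rule z, rule grid_less[OF i], simp)
      then show ?thesis using D(4)[OF i] by (simp add: sum.distrib)
    qed
    have zc: "(\<Sum>i<l. ?z ! (i * m + j)) = c j" if j: "j < m" for j
    proof -
      have "(\<Sum>i<l. ?z ! (i * m + j)) = (\<Sum>i<l. X ! (i * m + j) div n + D ! (i * m + j))"
        by (rule sum.cong[OF refl]) (rule z, rule grid_less[OF _ j], simp)
      then show ?thesis using D(5)[OF j] by (simp add: sum.distrib)
    qed
    show "has_margins l m r c ?z" using z0 zr zc lenz by (simp add: has_margins_def nonneg_def)
    have Y0: "0 \<le> ?Y ! v" if "v < l * m" for v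
      using YS[OF that] SD[OF that] kn X0[OF that] pos_imp_zdiv_nonneg_iff[OF n, of "X ! v"] by simp
    have Yr: "(\<Sum>j<m. ?Y ! (i * m + j)) = (n - ?k) * r i" if i: "i < l" for i
    proof -
      have "(\<Sum>j<m. ?Y ! (i * m + j)) = (\<Sum>j<m. X ! (i * m + j) - ?z ! (i * m + j) * ?k)"
        by (rule sum.cong[OF refl]) (rule Y, rule grid_less[OF i], simp)
      also have "\<dots> = n * r i - (\<Sum>j<m. ?z ! (i * m + j)) * ?k"
        using X i by (simp add: has_margins_def sum_subtractf sum_distrib_right)
      finally show ?thesis using zr[OF i] by (simp add: algebra_simps)
    qed
    have Yc: "(\<Sum>i<l. ?Y ! (i * m + j)) = (n - ?k) * c j" if j: "j < m" for j
    proof -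
      have "(\<Sum>i<l. ?Y ! (i * m + j)) = (\<Sum>i<l. X ! (i * m + j) - ?z ! (i * m + j) * ?k)"
        by (rule sum.cong[OF refl]) (rule Y, rule grid_less[OF _ j], simp)
      also have "\<dots> = n * c j - (\<Sum>i<l. ?z ! (i * m + j)) * ?k"
        using X j by (simp add: has_margins_def sum_subtractf sum_distrib_right)
      finally show ?thesis using zc[OF j] by (simp add: algebra_simps)
    qed
    show "has_margins l m (\<lambda>i. (n - ?k) * r i) (\<lambda>j. (n - ?k) * c j) ?Y"
      using Y0 Yr Yc lenY by (simp add: has_margins_def nonneg_def)
    show "X ! v = ?k * ?z ! v + ?Y ! v" if "v < l * m" for v using Y[OF that] by simp
    show "A \<le> ?z ! v \<and> ?z ! v \<le> B \<and> A * (n - ?k) \<le> ?Y ! v \<and> ?Y ! v \<le> B * (n - ?k)"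
      if v: "v < l * m" and A: "A * n \<le> X ! v" and B: "X ! v \<le> B * n" for v A B
    proof -
      let ?Q = "X ! v div n"
      have AQ: "A \<le> ?Q" using A n using zdiv_mono1[OF A n] by simp
      have nk: "0 \<le> n - ?k" using kn by simp
      have "A * (n - ?k) \<le> ?Q * (n - ?k)" using AQ nk by (rule mult_right_mono)
      then have 1: "A * (n - ?k) \<le> ?Y ! v" using YS[OF v] SD[OF v] by (simp add: mult.commute)
      show ?thesis
      proof (cases "?S ! v = 0")
        case True
        then have "n * ?Q \<le> n * B" using B XS[OF v] mult.commute[of n B] by linarith
        then have QB: "?Q \<le> B" using n by simp
        have "?z ! v = ?Q" "?Y ! v = ?Q * (n - ?k)" using True SD[OF v] z[OF v] YS[OF v] by (simp_all add: mult.commute)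
        then show ?thesis using AQ QB nk by (simp add: mult_right_mono)
      next
        case False
        then have "0 < ?S ! v" using S0[OF v] by linarith
        then have "n * ?Q < n * B" using B XS[OF v] mult.commute[of n B] by linarith
        then have QB: "?Q + 1 \<le> B" using n by simp
        have "?Y ! v \<le> (?Q + 1) * (n - ?k)" using YS[OF v] SD[OF v] by (simp add: algebra_simps)
        also have "\<dots> \<le> B * (n - ?k)" using QB nk by (rule mult_right_mono)
        finally show ?thesis using 1 AQ QB z[OF v] D(3)[OF v] by auto
      qed
    qed
    show "?Y ! v mod (n - ?k) = 0" if "v < l * m" "X ! v mod n = 0" for v
      using YS[OF that(1)] SD[OF that(1)] S[OF that(1)] that(2) by simp
    show "?k = n \<or> (\<exists>v w. v < l * m \<and> X ! v mod n \<noteq> 0 \<and> ?Y ! v = w * (n - ?k) \<and> ?z ! v \<noteq> w)"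
    proof (cases "?k = n")
      case False
      then obtain v where v: "v < l * m" "?k = (if D ! v = 1 then ?S ! v else n - ?S ! v)"
        using kv' by auto
      show ?thesis
      proof (cases "D ! v = 1")
        case True
        then have "?Y ! v = (X ! v div n) * (n - ?k)" "?z ! v \<noteq> X ! v div n" "X ! v mod n \<noteq> 0"
          using v YS[OF v(1)] z[OF v(1)] D(3)[OF v(1)] S[OF v(1)] by (simp_all add: mult.commute)
        then show ?thesis using v by blast
      next
        case F: False
        then have s: "?S ! v = n - ?k" using v by simp
        have d: "D ! v = 0" using F D(3)[OF v(1)] by blast
        have "?Y ! v = (n - ?k) * (X ! v div n) + (n - ?k)" using YS[OF v(1)] unfolding s d by simp
        then have "?Y ! v = (X ! v div n + 1) * (n - ?k)" by (simp only: distrib_right mult_1 mult.commute[of "n - ?k"])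
        moreover have "?z ! v \<noteq> X ! v div n + 1" using z[OF v(1)] d by simp
        moreover have "X ! v mod n \<noteq> 0" using S[OF v(1)] s False by simp
        ultimately show ?thesis using v by blast
      qed
    qed simp
  qed
qed

text \<open>Each step makes a further entry of the rest divisible by the number of remaining layers. That
  entry is the same in all later layers and differs in the layer just split off, so the layers are
  distinct and at most \<open>l * m + 1\<close> in number.\<close>

theorem dec_correct:
  assumes "0 \<le> n" "has_margins l m (\<lambda>i. n * r i) (\<lambda>j. n * c j) X" "card {v. v < l * m \<and> X ! v mod n \<noteq> 0} < f"
  shows "(\<forall>p\<in>set (dec l m f n X). 1 \<le> fst p \<and> has_margins l m r c (snd p)) \<and>
    sum_list (map fst (dec l m f n X)) = n \<and>
    (\<forall>v<l * m. sum_list (map (\<lambda>p. fst p * snd p ! v) (dec l m f n X)) = X ! v) \<and>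
    distinct (map snd (dec l m f n X)) \<and>
    (\<forall>v A B. v < l * m \<longrightarrow> A * n \<le> X ! v \<longrightarrow> X ! v \<le> B * n \<longrightarrow> (\<forall>p\<in>set (dec l m f n X). A \<le> snd p ! v \<and> snd p ! v \<le> B))"
  using assms
proof (induction f arbitrary: n X)
  case (Suc f)
  show ?case
  proof (cases "n = 0")
    case True
    have "X ! v = 0" if v: "v < l * m" for v
    proof -
      note g = grid_div_mod[OF v]
      have "(\<Sum>j<m. X ! (v div m * m + j)) = 0" using Suc.prems(2) g True by (simp add: has_margins_def)
      then have "\<forall>j\<in>{..<m}. X ! (v div m * m + j) = 0"
        using g Suc.prems(2) by (subst sum_nonneg_eq_0_iff[symmetric]) (auto simp: has_margins_def nonneg_def grid_less)
      then show ?thesis using g by force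
    qed
    then show ?thesis using True by simp
  next
    case False
    then have n: "0 < n" using Suc.prems(1) by simp
    show ?thesis
    proof (rule dec_step[OF n Suc.prems(2)], goal_cases)
    case (1 D)
    note D = 1
    let ?k = "dec_mult n X D" and ?z = "dec_layer n X D" and ?Y = "dec_rest n X D"
    have dec: "dec l m (Suc f) n X = (?k, ?z) # dec l m f (n - ?k) ?Y" using n D(1) by simp
    show ?thesis
    proof (cases "?k = n")
      case True
      have "has_margins l m (\<lambda>i. 0) (\<lambda>j. 0) ?Y" using D(5) True by simp
      have Y: "?Y ! v = 0" if "v < l * m" for v
      proof -
        \<comment> \<open>Any upper bound would do for \<open>B\<close>, as it is multiplied by the
          number 0 of remaining layers.\<close>
        have "X ! v \<le> X ! v * n" "0 \<le> X ! v" using that Suc.prems(2) n by (auto simp: has_margins_def nonneg_def mult_le_cancel_left1)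
        then show ?thesis using D(7)[OF that, of 0 "X ! v"] True by simp
      qed
      have "dec l m f 0 ?Y = []" by (cases f) simp_all
      then show ?thesis unfolding dec using True D(2,4,6,7) Y by simp
    next
      case False
      then obtain v w where v: "v < l * m" "X ! v mod n \<noteq> 0" "?Y ! v = w * (n - ?k)" "?z ! v \<noteq> w"
        using D(9) by (elim disjE exE conjE) (erule (1) notE, rule that)
      have "{v. v < l * m \<and> ?Y ! v mod (n - ?k) \<noteq> 0} \<subset> {v. v < l * m \<and> X ! v mod n \<noteq> 0}"
      proof (rule psubsetI)
        show "{v. v < l * m \<and> ?Y ! v mod (n - ?k) \<noteq> 0} \<subseteq> {v. v < l * m \<and> X ! v mod n \<noteq> 0}"
          by (rule Collect_mono, rule impI, elim conjE, intro conjI notI, assumption, drule (1) D(8), erule (1) notE)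
        have "?Y ! v mod (n - ?k) = 0" unfolding v(3) by simp
        then have "v \<notin> {v. v < l * m \<and> ?Y ! v mod (n - ?k) \<noteq> 0}" by (simp only: mem_Collect_eq simp_thms)
        moreover have "v \<in> {v. v < l * m \<and> X ! v mod n \<noteq> 0}" using v(1,2) by (simp only: mem_Collect_eq simp_thms)
        ultimately show "{v. v < l * m \<and> ?Y ! v mod (n - ?k) \<noteq> 0} \<noteq> {v. v < l * m \<and> X ! v mod n \<noteq> 0}"
          by (intro notI) (simp only: not_True_eq_False)
      qed
      then have "card {v. v < l * m \<and> ?Y ! v mod (n - ?k) \<noteq> 0} < card {v. v < l * m \<and> X ! v mod n \<noteq> 0}"
        by (intro psubset_card_mono) auto
      then have card: "card {v. v < l * m \<and> ?Y ! v mod (n - ?k) \<noteq> 0} < f" using Suc.prems(3) by simp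
      have "0 \<le> n - ?k" using D(3) by simp
      note IH = Suc.IH[OF this D(5) card]
      note IH1 = IH[THEN conjunct1] and IH2 = IH[THEN conjunct2, THEN conjunct1]
        and IH3 = IH[THEN conjunct2, THEN conjunct2, THEN conjunct1, rule_format]
        and IH4 = IH[THEN conjunct2, THEN conjunct2, THEN conjunct2, THEN conjunct1]
        and IH5 = IH[THEN conjunct2, THEN conjunct2, THEN conjunct2, THEN conjunct2, rule_format]
      \<comment> \<open>Taking \<open>w\<close> for both bounds pins the entry to \<open>w\<close>
        in every later layer.\<close>
      have w: "snd p ! v = w" if "p \<in> set (dec l m f (n - ?k) ?Y)" for p
        using IH5[OF v(1) _ _ that, of w w] v(3) by simp
      have "?z \<notin> snd ` set (dec l m f (n - ?k) ?Y)"
      proof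
        assume "?z \<in> snd ` set (dec l m f (n - ?k) ?Y)"
        then obtain p where "?z = snd p" "p \<in> set (dec l m f (n - ?k) ?Y)" by (rule imageE)
        with w[of p] v(4) show False by simp
      qed
      then have dist: "distinct (map snd (dec l m (Suc f) n X))" unfolding dec using IH4 by simp
      have bd: "A \<le> snd p ! u \<and> snd p ! u \<le> B"
        if u: "u < l * m" "A * n \<le> X ! u" "X ! u \<le> B * n" and p: "p \<in> set (dec l m (Suc f) n X)" for u A B p
      proof (cases "p = (?k, ?z)")
        case True
        then show ?thesis using D(7)[OF u] by simp
      next
        case False
        then have "p \<in> set (dec l m f (n - ?k) ?Y)" using p unfolding dec by simp
        then show ?thesis using D(7)[OF u] IH5[OF u(1), of A B p] by simp
      qed
      have s1: "sum_list (map fst (dec l m (Suc f) n X)) = n" unfolding dec using IH2 by simp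
      have s2: "\<forall>v<l * m. sum_list (map (\<lambda>p. fst p * snd p ! v) (dec l m (Suc f) n X)) = X ! v"
      proof (intro allI impI)
        fix v assume v: "v < l * m"
        show "sum_list (map (\<lambda>p. fst p * snd p ! v) (dec l m (Suc f) n X)) = X ! v"
          unfolding dec list.map sum_list.Cons fst_conv snd_conv IH3[OF v] D(6)[OF v, symmetric] by (rule refl)
      qed
      have s3: "\<forall>p\<in>set (dec l m (Suc f) n X). 1 \<le> fst p \<and> has_margins l m r c (snd p)"
        unfolding dec using IH1 D(2,4) by simp
      show ?thesis
        by (rule conjI[OF s3 conjI[OF s1 conjI[OF s2 conjI[OF dist]]]]) (intro allI impI ballI, rule bd; assumption)
    qed
    qed
  qed
qed simp

section \<open>Running time of the decomposition\<close>

lemma FC_row_sum: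
  assumes "FC P m" "FB P m" "FC P A" "FC P i" "FB P i"
  shows "FC P (\<lambda>x. row_sum (m x) (A x) (i x))"
proof -
  let ?Q = "\<lambda>a b z. P a b (fst z) \<and> snd z \<in> set [0..<m (fst z)]"
  have e: "FC ?Q (\<lambda>z. m (fst z))" "FC ?Q (\<lambda>z. A (fst z))" "FC ?Q (\<lambda>z. i (fst z))" "FB ?Q (\<lambda>z. m (fst z))" "FB ?Q (\<lambda>z. i (fst z))"
    by (rule FC_env[OF assms(1)] FC_env[OF assms(3)] FC_env[OF assms(4)] FB_env[OF assms(2)] FB_env[OF assms(5)], blast, (intro FC_fst FC_id)?)+
  have j: "FB ?Q (\<lambda>z. snd z)" by (rule FB_le[OF e(4)]) auto
  show ?thesis unfolding row_sum_def
    by (intro FC_sum_list FC_map FC_upt assms FC_nth_or FC_const_int FC_add_nat FC_mult_nat FB_add FB_mult e j FC_snd FC_id)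
      (simp_all add: assms)
qed

lemma FC_col_sum:
  assumes "FC P l" "FB P l" "FC P m" "FB P m" "FC P A" "FC P j" "FB P j"
  shows "FC P (\<lambda>x. col_sum (l x) (m x) (A x) (j x))"
proof -
  let ?Q = "\<lambda>a b z. P a b (fst z) \<and> snd z \<in> set [0..<l (fst z)]"
  have e: "FC ?Q (\<lambda>z. m (fst z))" "FC ?Q (\<lambda>z. A (fst z))" "FC ?Q (\<lambda>z. j (fst z))" "FB ?Q (\<lambda>z. m (fst z))" "FB ?Q (\<lambda>z. j (fst z))" "FB ?Q (\<lambda>z. l (fst z))"
    by (rule FC_env[OF assms(3)] FC_env[OF assms(5)] FC_env[OF assms(6)] FB_env[OF assms(4)] FB_env[OF assms(7)] FB_env[OF assms(2)], blast, (intro FC_fst FC_id)?)+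
  have i: "FB ?Q (\<lambda>z. snd z)" by (rule FB_le[OF e(6)]) auto
  show ?thesis unfolding col_sum_def
    by (intro FC_sum_list FC_map FC_upt assms FC_nth_or FC_const_int FC_add_nat FC_mult_nat FB_add FB_mult e i FC_snd FC_id)
      (simp_all add: assms)
qed

lemma row_sum_positive_part: "0 \<le> row_sum m (positive_part S) i \<and> row_sum m (positive_part S) i \<le> int m"
proof -
  have "\<forall>x\<in>set (positive_part S). 0 \<le> x \<and> x \<le> 1" by (auto simp: positive_part_def)
  then have b: "0 \<le> nth_or 0 (positive_part S) v \<and> nth_or 0 (positive_part S) v \<le> 1" for v
    by (auto simp: nth_or_def hd_drop_conv_nth)
  have "0 \<le> sum_list (map f xs) \<and> sum_list (map f xs) \<le> int (length xs)" if "\<And>v. 0 \<le> f v \<and> f v \<le> 1" for f :: "nat \<Rightarrow> int" and xs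
  proof (induction xs)
    case (Cons x xs)
    then show ?case using that[of x] by simp
  qed simp
  from this[of "\<lambda>j. nth_or 0 (positive_part S) (i * m + j)" "[0..<m]", OF b] show ?thesis by (simp add: row_sum_def)
qed

text \<open>The columns are the slices, of format \<open>l \<times> 2\<close>, so only
  \<open>l\<close> has to be a parameter. This allows the decomposition to be used when
  \<open>m\<close> is variable.\<close>

lemma FC_rounding_solutions:
  assumes l: "FC P l" "PB P l" and m: "FC P m" "FB P m" and n: "FC P n" and S: "FC P S" "FB P (\<lambda>x. length (S x))"
  shows "FC P (\<lambda>x. rounding_solutions (l x) (m x) (n x) (S x))"
proof -
  note l' = FB_of_PB[OF l(2)]
  have pp: "FC P (\<lambda>x. positive_part (S x))" unfolding positive_part_def
    by (intro FC_map S FC_If FC_less_int FC_const_int FC_snd FC_id)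
  let ?Q = "\<lambda>a b z. P a b (fst z) \<and> snd z \<in> set [0..<m (fst z)]"
  let ?W = "\<lambda>x. map (\<lambda>v. if v mod 2 = 0 then row_sum (m x) (S x) (v div 2) div n x
        else row_sum (m x) (positive_part (S x)) (v div 2) - row_sum (m x) (S x) (v div 2) div n x) [0..<l x * 2]"
  have e: "FC ?Q (\<lambda>z. m (fst z))" "FC ?Q (\<lambda>z. l (fst z))" "FC ?Q (\<lambda>z. n (fst z))" "FC ?Q (\<lambda>z. S (fst z))"
    "FC ?Q (\<lambda>z. positive_part (S (fst z)))" "FB ?Q (\<lambda>z. m (fst z))" "FB ?Q (\<lambda>z. l (fst z))"
    by (rule FC_env[OF m(1)] FC_env[OF l(1)] FC_env[OF n] FC_env[OF S(1)] FC_env[OF pp] FB_env[OF m(2)] FB_env[OF l'], blast, (intro FC_fst FC_id)?)+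
  have j: "FB ?Q (\<lambda>z. snd z)" by (rule FB_le[OF e(6)]) auto
  have c: "FC ?Q (\<lambda>z. col_sum (l (fst z)) (m (fst z)) (S (fst z)) (snd z))"
    "FC ?Q (\<lambda>z. col_sum (l (fst z)) (m (fst z)) (positive_part (S (fst z))) (snd z))"
    by (intro FC_col_sum e j FC_snd FC_id)+
  let ?T = "\<lambda>xs a b z. ?Q a b (fst z) \<and> snd z \<in> set (xs (fst z))"
  have f: "FC (?T xs) (\<lambda>z. m (fst (fst z)))" "FC (?T xs) (\<lambda>z. positive_part (S (fst (fst z))))" "FB (?T xs) (\<lambda>z. m (fst (fst z)))"
    "FB (?T xs) (\<lambda>z. snd (fst z))" "FB (?T xs) (\<lambda>z. l (fst (fst z)))" "FC (?T xs) (\<lambda>z. n (fst (fst z)))"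
    "FC (?T xs) (\<lambda>z. col_sum (l (fst (fst z))) (m (fst (fst z))) (S (fst (fst z))) (snd (fst z)))"
    "FC (?T xs) (\<lambda>z. col_sum (l (fst (fst z))) (m (fst (fst z))) (positive_part (S (fst (fst z)))) (snd (fst z)))" for xs :: "_ \<Rightarrow> nat list"
    by (rule FC_env[OF e(1)] FC_env[OF e(5)] FB_env[OF e(6)] FB_env[OF j] FB_env[OF e(7)] FC_env[OF e(3)] FC_env[OF c(1)] FC_env[OF c(2)], blast, (intro FC_fst FC_id)?)+
  have i: "FB (?T (\<lambda>z. [0..<l (fst z)])) (\<lambda>z. snd z)" by (rule FB_le[OF f(5)]) auto
  have row: "FC ?Q (\<lambda>z. map (\<lambda>i. nth_or 0 (positive_part (S (fst z))) (i * m (fst z) + snd z)) [0..<l (fst z)])"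
    by (intro FC_map FC_upt e FC_nth_or FC_const_int f FC_add_nat FC_mult_nat FB_add FB_mult i FC_fst FC_snd FC_id) (simp only: length_upt diff_zero e)
  have col: "FC ?Q (\<lambda>z. map (\<lambda>e. if e = 0 then col_sum (l (fst z)) (m (fst z)) (S (fst z)) (snd z) div n (fst z)
        else col_sum (l (fst z)) (m (fst z)) (positive_part (S (fst z))) (snd z) - col_sum (l (fst z)) (m (fst z)) (S (fst z)) (snd z) div n (fst z)) [0..<2])"
    by (intro FC_map FC_upt FC_const_nat FC_If FC_eq_nat FC_div_int FC_diff_int FC_mono[OF f(6)[of "\<lambda>_. [0..<2]"]] FC_mono[OF f(7)[of "\<lambda>_. [0..<2]"]] FC_mono[OF f(8)[of "\<lambda>_. [0..<2]"]] FC_snd FC_id FB_const)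
      (auto simp: FB_const)
  let ?U = "\<lambda>a b z. P a b (fst z) \<and> snd z \<in> set [0..<l (fst z) * 2]"
  have g: "FC ?U (\<lambda>z. m (fst z))" "FC ?U (\<lambda>z. n (fst z))" "FC ?U (\<lambda>z. S (fst z))"
    "FC ?U (\<lambda>z. positive_part (S (fst z)))" "FB ?U (\<lambda>z. m (fst z))" "FB ?U (\<lambda>z. l (fst z))"
    by (rule FC_env[OF m(1)] FC_env[OF n] FC_env[OF S(1)] FC_env[OF pp] FB_env[OF m(2)] FB_env[OF l'], blast, (intro FC_fst FC_id)?)+
  have v: "FB ?U (\<lambda>z. snd z div 2)" by (rule FB_le[OF g(6)]) auto
  have h: "FC ?U (\<lambda>z. row_sum (m (fst z)) (S (fst z)) (snd z div 2) div n (fst z))"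
    "FC ?U (\<lambda>z. row_sum (m (fst z)) (positive_part (S (fst z))) (snd z div 2) - row_sum (m (fst z)) (S (fst z)) (snd z div 2) div n (fst z))"
    by (intro FC_row_sum FC_div_int FC_diff_int FC_div_nat FC_const_nat g v FC_snd FC_id)+
  have W: "FC P ?W"
    by (intro FC_map FC_upt FC_mult_nat l FC_const_nat FB_const FB_mult FC_If FC_eq_nat FC_mod_nat FC_snd FC_id FC_mono[OF h(1)] FC_mono[OF h(2)])
      (auto intro!: FB_mult FB_const l')
  \<comment> \<open>The entries for the matrix and its complement add up to a row sum of the 0/1
    table, so the quotients by \<open>n\<close> cancel and the total is at most
    \<open>l * m\<close>.\<close>
  have sumW: "sum_list (?W x) = (\<Sum>i<l x. row_sum (m x) (positive_part (S x)) i)" for x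
  proof -
    have "sum_list (map w [0..<k * 2]) = (\<Sum>i<k. w (i * 2) + w (Suc (i * 2)))" for w :: "nat \<Rightarrow> int" and k
      by (induction k) auto
    moreover have "Suc (i * 2) mod 2 = 1" "Suc (i * 2) div 2 = i" for i :: nat by presburger+
    ultimately show ?thesis by simp
  qed
  show ?thesis unfolding rounding_solutions_def
  proof (rule FC_three_way[OF l FC_const_nat PB_const _ _ _ W])
    show "FC P (\<lambda>x. map (\<lambda>j. map (\<lambda>i. nth_or 0 (positive_part (S x)) (i * m x + j)) [0..<l x] @
        map (\<lambda>e. if e = 0 then col_sum (l x) (m x) (S x) j div n x else col_sum (l x) (m x) (positive_part (S x)) j - col_sum (l x) (m x) (S x) j div n x) [0..<2]) [0..<m x])"
      by (intro FC_map FC_upt m FC_append row col) (simp_all only: length_upt length_map diff_zero m e)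
    show "FB P (\<lambda>x. bit_length (sum_list (?W x)))"
    proof (rule FB_le[OF FB_Suc[OF FB_mult[OF l' m(2)]]])
      fix x
      have "0 \<le> sum_list (?W x)" unfolding sumW by (intro sum_nonneg) (use row_sum_positive_part in blast)
      moreover have "sum_list (?W x) \<le> int (l x * m x)" unfolding sumW
        using sum_bounded_above[of "{..<l x}" "\<lambda>i. row_sum (m x) (positive_part (S x)) i" "int (m x)"] row_sum_positive_part[of "m x" "S x"] by simp
      ultimately show "bit_length (sum_list (?W x)) \<le> Suc (l x * m x)"
        by (rule order_trans[OF bit_length_mono bit_length_nat_le])
    qed
  qed (use m in auto)
qed

lemma FC_rounding:
  assumes l: "FC P l" "PB P l" and m: "FC P m" "FB P m" and n: "FC P n" and S: "FC P S" "FB P (\<lambda>x. length (S x))"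
  shows "FC P (\<lambda>x. rounding (l x) (m x) (n x) (S x))"
proof -
  have s: "FC P (\<lambda>x. rounding_solutions (l x) (m x) (n x) (S x))" by (intro FC_rounding_solutions assms)
  let ?P = "\<lambda>a b x. P a b x \<and> rounding_solutions (l x) (m x) (n x) (S x) \<noteq> []"
  let ?Q = "\<lambda>a b z. ?P a b (fst z) \<and> snd z \<in> set [0..<l (fst z) * m (fst z)]"
  have h: "FC ?P (\<lambda>x. hd (rounding_solutions (l x) (m x) (n x) (S x)))"
    by (rule FC_hd[OF FC_mono[OF s]]) auto
  have e: "FC ?Q (\<lambda>z. hd (rounding_solutions (l (fst z)) (m (fst z)) (n (fst z)) (S (fst z))))"
    "FC ?Q (\<lambda>z. m (fst z))" "FB ?Q (\<lambda>z. m (fst z))" "FB ?Q (\<lambda>z. l (fst z))"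
    by (rule FC_env[OF h] FC_env[OF m(1)] FB_env[OF m(2)] FB_env[OF FB_of_PB[OF l(2)]], blast, (intro FC_fst FC_id)?)+
  have v: "FB ?Q (\<lambda>z. snd z mod m (fst z))" "FB ?Q (\<lambda>z. snd z div m (fst z) * 2)"
  proof -
    have lm: "FB ?Q (\<lambda>z. l (fst z) * m (fst z))" by (intro FB_mult e)
    show "FB ?Q (\<lambda>z. snd z mod m (fst z))" by (rule FB_le[OF lm]) (auto intro: order_trans[OF mod_less_eq_dividend])
    show "FB ?Q (\<lambda>z. snd z div m (fst z) * 2)"
      by (intro FB_mult FB_const, rule FB_le[OF lm]) (auto intro: order_trans[OF div_le_dividend])
  qed
  have lm: "FC ?P (\<lambda>x. l x * m x)" "FB ?P (\<lambda>x. l x * m x)"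
    by (intro FC_mult_nat FB_mult FC_mono[OF l(1)] FC_mono[OF m(1)] FB_le[OF m(2)] FB_env[OF m(2)] FB_env[OF FB_of_PB[OF l(2)]]; blast)+
  show ?thesis unfolding rounding_def
    by (intro FC_If FC_not_Nil s FC_Cons FC_Nil FC_map FC_upt lm FC_nth_or FC_const_int e v FC_mod_nat FC_mult_nat FC_div_nat FC_const_nat FB_const FC_snd FC_id)
      (simp add: lm)
qed

lemma FC_residues:
  assumes "FC P n" "FB P (\<lambda>x. bit_length (n x))" "FC P X" "FB P (\<lambda>x. length (X x))"
  shows "FC P (\<lambda>x. residues (n x) (X x))"
  unfolding residues_def
proof (intro FC_map assms FC_mod_int FC_snd FC_id)
  show "FC (\<lambda>a b z. P a b (fst z) \<and> snd z \<in> set (X (fst z))) (\<lambda>z. n (fst z))"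
    by (rule FC_env[OF assms(1)], blast) (intro FC_fst FC_id)
  show "FB (\<lambda>a b z. P a b (fst z) \<and> snd z \<in> set (X (fst z))) (\<lambda>z. bit_length (n (fst z)))"
    by (rule FB_env[OF assms(2)]) blast
qed

lemma length_residues [simp]: "length (residues n X) = length X"
  by (simp add: residues_def)

lemma FC_dec_layer:
  assumes "FC P n" "FC P X" "FB P (\<lambda>x. length (X x))" "FC P D"
  shows "FC P (\<lambda>x. dec_layer (n x) (X x) (D x))"
  unfolding dec_layer_def
proof (intro FC_map FC_zip assms FC_add_int FC_div_int FC_fst FC_snd FC_id)
  show "FB P (\<lambda>x. length (zip (X x) (D x)))" by (rule FB_le[OF assms(3)]) simp
  show "FC (\<lambda>a b z. P a b (fst z) \<and> snd z \<in> set (zip (X (fst z)) (D (fst z)))) (\<lambda>z. n (fst z))"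
    by (rule FC_env[OF assms(1)], blast) (intro FC_fst FC_id)
qed

lemma FC_dec_mult:
  assumes "FC P n" "FB P (\<lambda>x. bit_length (n x))" "FC P X" "FB P (\<lambda>x. length (X x))" "FC P D"
  shows "FC P (\<lambda>x. dec_mult (n x) (X x) (D x))"
  unfolding dec_mult_def
proof (rule FC_fold[where Q = "\<lambda>a b z. P a b (fst z)"])
  show "FC P (\<lambda>x. zip (residues (n x) (X x)) (D x))" using assms(4) by (intro FC_zip FC_residues assms) simp
  show "FB P (\<lambda>x. length (zip (residues (n x) (X x)) (D x)))" by (rule FB_le[OF assms(4)]) simp
  let ?Q = "\<lambda>a b z. P a b (fst z)"
  let ?g = "\<lambda>z :: 'a \<times> (int \<times> int) \<times> int. if snd (fst (snd z)) = 1 then fst (fst (snd z)) else n (fst z) - fst (fst (snd z))"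
  have "FC ?Q (\<lambda>z. n (fst z))" by (rule FC_env[OF assms(1)], blast) (intro FC_fst FC_id)
  note e = this FC_mono[OF this]
  have g: "FC ?Q ?g"
    by (intro FC_If FC_eq_int FC_const_int FC_diff_int FC_mono[OF e(1)] FC_fst FC_snd FC_id) auto
  show "FC ?Q (\<lambda>z. if ?g z < snd (snd z) then ?g z else snd (snd z))"
  proof (rule FC_If)
    show "FC ?Q (\<lambda>z. ?g z < snd (snd z))" by (rule FC_less_int[OF g]) (intro FC_snd FC_id)
  qed (rule FC_mono[OF g], blast, intro FC_snd FC_id)
qed (use assms in auto)

text \<open>Stated for an arbitrary \<open>D\<close>, because the running time is analysed on states
  of which only the sign and the length are known.\<close>

lemma dec_mult_bounds:
  assumes "0 < n"
  shows "0 \<le> dec_mult n X D \<and> dec_mult n X D \<le> n"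
proof -
  let ?f = "\<lambda>p. if snd p = 1 then fst p else n - fst p"
  note min = fold_min[where f = ?f and xs = "zip (residues n X) D" and n = n, folded dec_mult_def]
  have f: "0 \<le> ?f p" if "p \<in> set (zip (residues n X) D)" for p
  proof -
    have "fst p \<in> set (residues n X)" using set_zip_leftD[of "fst p" "snd p"] that by simp
    then show ?thesis using assms by (auto simp: residues_def intro: less_imp_le)
  qed
  have "0 \<le> dec_mult n X D"
    using min(3) by (rule disjE, use assms in simp, elim bexE) (erule ssubst, erule f)
  with min(1) show ?thesis by blast
qed

text \<open>One step of \<open>dec\<close> as a loop body, with the layers collected in reverse.
  When \<open>dec\<close> would stop, the state no longer changes, so the loop can always make the
  full number of iterations.\<close>

definition dec_next :: "nat \<Rightarrow> nat \<Rightarrow> int \<times> int list \<times> (int \<times> int list) list \<Rightarrow> int \<times> int list \<times> (int \<times> int list) list" where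
  "dec_next l m st = (if 0 < fst st \<and> rounding l m (fst st) (residues (fst st) (fst (snd st))) \<noteq> []
     then let D = hd (rounding l m (fst st) (residues (fst st) (fst (snd st))))
       in (fst st - dec_mult (fst st) (fst (snd st)) D, dec_rest (fst st) (fst (snd st)) D,
           (dec_mult (fst st) (fst (snd st)) D, dec_layer (fst st) (fst (snd st)) D) # snd (snd st))
     else st)"

lemma fold_dec_next: "rev (snd (snd (fold (\<lambda>_. dec_next l m) xs (n, X, acc)))) = rev acc @ dec l m (length xs) n X"
proof (induction xs arbitrary: n X acc)
  case (Cons y xs)
  show ?case
  proof (cases "0 < n \<and> rounding l m n (residues n X) \<noteq> []")
    case True
    then show ?thesis using Cons by (simp add: dec_next_def Let_def)
  next
    case False
    then have stop: "dec_next l m (n, X, acc) = (n, X, acc)" by (auto simp: dec_next_def)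
    then have "fold (\<lambda>_. dec_next l m) zs (n, X, acc) = (n, X, acc)" for zs :: "'a list" by (induction zs) simp_all
    then show ?thesis using False stop by auto
  qed
qed simp

lemma length_rounding: "rounding l m n S \<noteq> [] \<Longrightarrow> length (hd (rounding l m n S)) = l * m"
  by (auto simp: rounding_def split: if_splits)

lemma dec_next_invariant:
  assumes "0 \<le> fst st" "fst st \<le> n" "length (fst (snd st)) = l * m"
  shows "0 \<le> fst (dec_next l m st) \<and> fst (dec_next l m st) \<le> n \<and> length (fst (snd (dec_next l m st))) = l * m"
  using assms dec_mult_bounds[of "fst st" "fst (snd st)" "hd (rounding l m (fst st) (residues (fst st) (fst (snd st))))"]
  by (auto simp: dec_next_def Let_def dec_rest_def dec_layer_def length_rounding)

lemma FC_dec_next: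
  assumes l: "FC P l" "PB P l" and m: "FC P m" "FB P m"
    and st: "FC P st" "\<And>a b x. P a b x \<Longrightarrow> 0 \<le> fst (st x)" "FB P (\<lambda>x. bit_length (fst (st x)))"
      "\<And>a b x. P a b x \<Longrightarrow> length (fst (snd (st x))) = l x * m x"
  shows "FC P (\<lambda>x. dec_next (l x) (m x) (st x))"
proof -
  have n: "FC P (\<lambda>x. fst (st x))" and X: "FC P (\<lambda>x. fst (snd (st x)))" and acc: "FC P (\<lambda>x. snd (snd (st x)))"
    by (intro FC_fst FC_snd st)+
  have lX: "FB P (\<lambda>x. length (fst (snd (st x))))"
    by (rule FB_le[OF FB_mult[OF FB_of_PB[OF l(2)] m(2)]]) (simp add: st(4))
  let ?r = "\<lambda>x. rounding (l x) (m x) (fst (st x)) (residues (fst (st x)) (fst (snd (st x))))"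
  have r: "FC P ?r" by (intro FC_rounding l m n FC_residues st X lX) (simp add: lX)
  let ?P = "\<lambda>a b x. P a b x \<and> 0 < fst (st x) \<and> ?r x \<noteq> []"
  let ?Q = "\<lambda>a b z. ?P a b (fst z) \<and> snd z = hd (?r (fst z))"
  have rP: "FC ?P (\<lambda>x. hd (?r x))" by (rule FC_hd[OF FC_mono[OF r]]) auto
  have e: "FC ?Q (\<lambda>z. fst (st (fst z)))" "FC ?Q (\<lambda>z. fst (snd (st (fst z))))" "FC ?Q (\<lambda>z. snd (snd (st (fst z))))"
     "FB ?Q (\<lambda>z. bit_length (fst (st (fst z))))" "FB ?Q (\<lambda>z. length (fst (snd (st (fst z)))))"
    by (rule FC_env[OF n] FC_env[OF X] FC_env[OF acc] FB_env[OF st(3)] FB_env[OF lX], blast, (intro FC_fst FC_id)?)+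
  have k: "FC ?Q (\<lambda>z. dec_mult (fst (st (fst z))) (fst (snd (st (fst z)))) (snd z))"
    by (intro FC_dec_mult e FC_snd FC_id)
  have z: "FC ?Q (\<lambda>z. dec_layer (fst (st (fst z))) (fst (snd (st (fst z)))) (snd z))"
    by (intro FC_dec_layer e FC_snd FC_id)
  have kb: "FB ?Q (\<lambda>z. bit_length (dec_mult (fst (st (fst z))) (fst (snd (st (fst z)))) (snd z)))"
    by (rule FB_le[OF e(4)], rule bit_length_mono) (use dec_mult_bounds in blast)+
  have y: "FC ?Q (\<lambda>z. dec_rest (fst (st (fst z))) (fst (snd (st (fst z)))) (snd z))"
    unfolding dec_rest_def
  proof (intro FC_map FC_zip e z FC_diff_int FC_mult_int FC_fst FC_snd FC_id)
    let ?zs = "\<lambda>z. zip (fst (snd (st (fst z)))) (dec_layer (fst (st (fst z))) (fst (snd (st (fst z)))) (snd z))"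
    let ?T = "\<lambda>a b y. ?Q a b (fst y) \<and> snd y \<in> set (?zs (fst y))"
    show "FB ?Q (\<lambda>z. length (?zs z))" by (rule FB_le[OF e(5)]) simp
    show "FC ?T (\<lambda>y. dec_mult (fst (st (fst (fst y)))) (fst (snd (st (fst (fst y))))) (snd (fst y)))"
      by (rule FC_env[OF k], blast) (intro FC_fst FC_id)
    show "FB ?T (\<lambda>y. bit_length (dec_mult (fst (st (fst (fst y)))) (fst (snd (st (fst (fst y))))) (snd (fst y))))"
      by (rule FB_env[OF kb], blast)
  qed
  show ?thesis unfolding dec_next_def
    by (intro FC_If FC_conj FC_less_int FC_const_int FC_not_Nil n r FC_Let rP FC_Pair FC_diff_int FC_Cons e k z y FC_mono[OF st(1)]) simp
qed

lemma length_dec: "length (dec l m f n X) \<le> f"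
  by (induction f arbitrary: n X) (simp_all add: Let_def)

lemma FC_dec:
  assumes l: "FC P l" "PB P l" and m: "FC P m" "FB P m" and f: "FC P f" "FB P f"
    and n: "FC P n" "\<And>a b x. P a b x \<Longrightarrow> 0 \<le> n x" "FB P (\<lambda>x. bit_length (n x))"
    and X: "FC P X" "\<And>a b x. P a b x \<Longrightarrow> length (X x) = l x * m x"
  shows "FC P (\<lambda>x. dec (l x) (m x) (f x) (n x) (X x))"
proof -
  let ?s = "\<lambda>x ys. fold (\<lambda>_ :: nat. dec_next (l x) (m x)) ys (n x, X x, [])"
  have inv: "0 \<le> fst (?s x ys) \<and> fst (?s x ys) \<le> n x \<and> length (fst (snd (?s x ys))) = l x * m x" if "P a b x" for a b x ys
  proof (induction ys rule: rev_induct)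
    case (snoc y ys)
    then show ?case using dec_next_invariant[of "?s x ys" "n x" "l x" "m x"] by simp
  qed (use n(2)[OF that] X(2)[OF that] in simp)
  let ?Q = "\<lambda>a b z. P a b (fst z) \<and> 0 \<le> fst (snd (snd z)) \<and> fst (snd (snd z)) \<le> n (fst z) \<and>
    length (fst (snd (snd (snd z)))) = l (fst z) * m (fst z)"
  have "FC P (\<lambda>x. fold (\<lambda>_ :: nat. dec_next (l x) (m x)) [0..<f x] (n x, X x, []))"
  proof (rule FC_fold[where Q = ?Q])
    show "FC P (\<lambda>x. [0..<f x])" by (intro FC_upt f)
    show "FB P (\<lambda>x. length [0..<f x])" using f(2) by simp
    show "FC P (\<lambda>x. (n x, X x, []))" by (intro FC_Pair n X FC_Nil)
    have e: "FC ?Q (\<lambda>z. l (fst z))" "PB ?Q (\<lambda>z. l (fst z))" "FC ?Q (\<lambda>z. m (fst z))" "FB ?Q (\<lambda>z. m (fst z))" "FB ?Q (\<lambda>z. bit_length (n (fst z)))"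
      by (rule FC_env[OF l(1)] PB_env[OF l(2)] FC_env[OF m(1)] FB_env[OF m(2)] FB_env[OF n(3)], blast, (intro FC_fst FC_id)?)+
    show "FC ?Q (\<lambda>z. dec_next (l (fst z)) (m (fst z)) (snd (snd z)))"
      by (intro FC_dec_next e FC_snd FC_id FB_le[OF e(5)] bit_length_mono) blast+
    show "?Q a b (x, y, ?s x ys)" if "P a b x" for a b x y ys
      using inv[OF that] that by simp
  qed
  then have "FC P (\<lambda>x. rev (snd (snd (fold (\<lambda>_ :: nat. dec_next (l x) (m x)) [0..<f x] (n x, X x, [])))))"
  proof (intro FC_rev FC_snd)
    have "length (snd (snd (?s x [0..<f x]))) \<le> f x" for x
      using arg_cong[OF fold_dec_next[of "l x" "m x" "[0..<f x]" "n x" "X x" "[]"], of length] length_dec[of "l x" "m x" "f x"] by simp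
    then show "FB P (\<lambda>x. length (snd (snd (?s x [0..<f x]))))" by (rule FB_le[OF f(2)])
  qed
  then show ?thesis by (simp add: fold_dec_next)
qed

lemma FC_map_upt:
  assumes "FC P n" "FB P n" "FC (\<lambda>a b z. P a b (fst z) \<and> snd z < n (fst z)) (\<lambda>z. g (fst z) (snd z))"
  shows "FC P (\<lambda>x. map (g x) [0..<n x])"
  using assms by (intro FC_map FC_upt) auto

lemma FB_index: "FB P n \<Longrightarrow> FB (\<lambda>a b z. P a b (fst z) \<and> snd z < n (fst z)) (\<lambda>z. snd z)"
  by (erule FB_mono[where g = fst]) auto

lemma bit_length_sum_list:
  assumes "\<And>x. x \<in> set xs \<Longrightarrow> bit_length x \<le> \<beta>"
  shows "bit_length (sum_list xs) \<le> Suc (\<beta> + length xs)"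
  using assms
proof (induction xs)
  case Nil
  show ?case by (simp add: bit_length_def floorlog_def)
next
  case (Cons x xs)
  have "bit_length (sum_list xs) \<le> Suc (\<beta> + length xs)" "bit_length x \<le> \<beta>" using Cons by auto
  with bit_length_add[of x "sum_list xs"] show ?case by simp
qed


section \<open>Reading the instance\<close>

definition entry :: "nat list \<Rightarrow> nat \<Rightarrow> int" where
  "entry D i = int (nth_or 0 D i)"

text \<open>The offsets follow \<open>encode_data\<close>: \<open>t\<close> counts and the total
  number of layers take \<open>Suc t\<close> letters; then come \<open>t\<close> vectors of
  \<open>m\<close> column sums, \<open>t\<close> vectors of \<open>l\<close> row sums, and the line
  sums row by row.\<close>

definition col_entry :: "nat \<Rightarrow> nat \<Rightarrow> nat list \<Rightarrow> nat \<Rightarrow> nat \<Rightarrow> int" where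
  "col_entry m t D k j = entry D (Suc t + k * m + j)"

definition row_entry :: "nat \<Rightarrow> nat \<Rightarrow> nat \<Rightarrow> nat list \<Rightarrow> nat \<Rightarrow> nat \<Rightarrow> int" where
  "row_entry l m t D k i = entry D (Suc t + t * m + k * l + i)"

definition line_entry :: "nat \<Rightarrow> nat \<Rightarrow> nat \<Rightarrow> nat list \<Rightarrow> nat \<Rightarrow> int" where
  "line_entry l m t D v = entry D (Suc t + t * m + t * l + v)"

lemma FC_entry: "FC P D \<Longrightarrow> FC P i \<Longrightarrow> FB P i \<Longrightarrow> FC P (\<lambda>x. entry (D x) (i x))"
  unfolding entry_def by (intro FC_of_nat FC_nth_or FC_const_nat)

lemma FC_col_entry: "FC P m \<Longrightarrow> FB P m \<Longrightarrow> FC P t \<Longrightarrow> FB P t \<Longrightarrow> FC P D \<Longrightarrow> FC P k \<Longrightarrow> FB P k \<Longrightarrow> FC P j \<Longrightarrow> FB P j \<Longrightarrow>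
    FC P (\<lambda>x. col_entry (m x) (t x) (D x) (k x) (j x))"
  unfolding col_entry_def by (intro FC_entry FC_add_nat FC_Suc FC_mult_nat FB_add FB_mult FB_Suc)

lemma FC_row_entry: "FC P l \<Longrightarrow> FB P l \<Longrightarrow> FC P m \<Longrightarrow> FB P m \<Longrightarrow> FC P t \<Longrightarrow> FB P t \<Longrightarrow> FC P D \<Longrightarrow> FC P k \<Longrightarrow> FB P k \<Longrightarrow>
    FC P i \<Longrightarrow> FB P i \<Longrightarrow> FC P (\<lambda>x. row_entry (l x) (m x) (t x) (D x) (k x) (i x))"
  unfolding row_entry_def by (intro FC_entry FC_add_nat FC_Suc FC_mult_nat FB_add FB_mult FB_Suc)

lemma FC_line_entry: "FC P l \<Longrightarrow> FB P l \<Longrightarrow> FC P m \<Longrightarrow> FB P m \<Longrightarrow> FC P t \<Longrightarrow> FB P t \<Longrightarrow> FC P D \<Longrightarrow>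
    FC P v \<Longrightarrow> FB P v \<Longrightarrow> FC P (\<lambda>x. line_entry (l x) (m x) (t x) (D x) (v x))"
  unfolding line_entry_def by (intro FC_entry FC_add_nat FC_Suc FC_mult_nat FB_add FB_mult FB_Suc)

lemma entry_nonneg [simp]: "0 \<le> entry D i"
  by (simp add: entry_def)

lemma bit_length_entry: "bit_length (entry D i) \<le> Suc (encoding_length D)"
proof (cases "i < length D")
  case True
  then have "bit_length (int (D ! i)) \<le> encoding_length D"
    by (intro bit_length_le_encoding nth_mem)
  with True show ?thesis by (simp add: entry_def)
next
  case False
  then show ?thesis by (simp add: entry_def nth_or_def bit_length_def floorlog_def)
qed

lemma bit_length_row_entry: "bit_length (row_entry l m t D k i) \<le> Suc (encoding_length D)"
  unfolding row_entry_def by (rule bit_length_entry)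

lemma bit_length_col_entry: "bit_length (col_entry m t D k i) \<le> Suc (encoding_length D)"
  unfolding col_entry_def by (rule bit_length_entry)

lemma bit_length_line_entry: "bit_length (line_entry l m t D v) \<le> Suc (encoding_length D)"
  unfolding line_entry_def by (rule bit_length_entry)

section \<open>The tables of totals for all types, found by types or by columns\<close>

definition type_totals :: "nat \<Rightarrow> nat \<Rightarrow> nat \<Rightarrow> nat list \<Rightarrow> int list list \<Rightarrow> bool" where
  "type_totals l m t D X \<longleftrightarrow> length X = t \<and>
     (\<forall>k<t. has_margins l m (\<lambda>i. entry D k * row_entry l m t D k i) (\<lambda>j. entry D k * col_entry m t D k j) (X ! k)) \<and>
     (\<forall>v<l * m. (\<Sum>k<t. X ! k ! v) = line_entry l m t D v)"

text \<open>The slices are the types, so \<open>l\<close> and \<open>m\<close> are the bounded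
  dimensions and \<open>t\<close> is the variable one.\<close>

definition totals_by_types :: "nat \<Rightarrow> nat \<Rightarrow> nat \<Rightarrow> nat list \<Rightarrow> int list list list" where
  "totals_by_types l m t D = three_way l m
     (map (\<lambda>k. map (\<lambda>i. entry D k * row_entry l m t D k i) [0..<l] @ map (\<lambda>j. entry D k * col_entry m t D k j) [0..<m]) [0..<t])
     (map (line_entry l m t D) [0..<l * m])"

text \<open>Here slice \<open>j\<close> is the \<open>l \<times> t\<close> table formed by the columns \<open>j\<close> of all \<open>X\<^sup>k\<close>.\<close>

definition column_solutions :: "nat \<Rightarrow> nat \<Rightarrow> nat \<Rightarrow> nat list \<Rightarrow> int list list list" where
  "column_solutions l m t D = three_way l t
     (map (\<lambda>j. map (\<lambda>i. line_entry l m t D (i * m + j)) [0..<l] @ map (\<lambda>k. entry D k * col_entry m t D k j) [0..<t]) [0..<m])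
     (map (\<lambda>v. entry D (v mod t) * row_entry l m t D (v mod t) (v div t)) [0..<l * t])"

definition totals_by_columns :: "nat \<Rightarrow> nat \<Rightarrow> nat \<Rightarrow> nat list \<Rightarrow> int list list list" where
  "totals_by_columns l m t D = (if column_solutions l m t D \<noteq> []
     then [map (\<lambda>k. map (\<lambda>v. nth_or 0 (nth_or [] (hd (column_solutions l m t D)) (v mod m)) (v div m * t + k)) [0..<l * m]) [0..<t]]
     else [])"

lemma totals_by_types_sound:
  assumes "X \<in> set (totals_by_types l m t D)"
  shows "type_totals l m t D X"
proof -
  note X = three_way_sound[OF assms[unfolded totals_by_types_def]]
  have W: "length (map (line_entry l m t D) [0..<l * m]) = l * m" by simp
  show ?thesis unfolding type_totals_def has_margins_def
  proof (intro conjI allI impI)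
    show "length X = t" by (rule X(1)) simp
    show "nonneg (l * m) (X ! k)" if "k < t" for k by (rule X(2)) (use that in simp_all)
    show "(\<Sum>j<m. X ! k ! (i * m + j)) = entry D k * row_entry l m t D k i" if "k < t" "i < l" for k i
      by (rule X(3)) (use that in simp_all)
    show "(\<Sum>i<l. X ! k ! (i * m + j)) = entry D k * col_entry m t D k j" if "k < t" "j < m" for k j
      by (rule X(4)) (use that in simp_all)
    show "(\<Sum>k<t. X ! k ! v) = line_entry l m t D v" if "v < l * m" for v
      by (subst X(5)[OF W that]) (use that in simp)
  qed
qed

lemma totals_by_types_complete:
  assumes "type_totals l m t D X"
  shows "totals_by_types l m t D \<noteq> []"
  unfolding totals_by_types_def
proof (rule three_way_complete[where x = "\<lambda>k i j. X ! k ! (i * m + j)"])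
  show "0 \<le> X ! k ! (i * m + j)" if "k < t" "i < l" "j < m" for k i j
    using assms that grid_less[OF that(2,3)] by (auto simp: type_totals_def has_margins_def nonneg_def)
  show "(\<Sum>k<t. X ! k ! (i * m + j)) = map (line_entry l m t D) [0..<l * m] ! (i * m + j)" if "i < l" "j < m" for i j
    using assms grid_less[OF that] by (simp add: type_totals_def)
qed (use assms in \<open>auto simp: type_totals_def has_margins_def\<close>)

text \<open>A change of direction in one three-way table: entry \<open>(i, j)\<close> of the total
  for type \<open>k\<close> is entry \<open>(i, k)\<close> of slice \<open>j\<close>, so row sums of
  the totals become sums across slices and line sums become row sums of slices.\<close>

lemma totals_by_columns_sound:
  assumes "X \<in> set (totals_by_columns l m t D)"
  shows "type_totals l m t D X"
proof -
  let ?zs = "hd (column_solutions l m t D)"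
  have ne: "column_solutions l m t D \<noteq> []" and X: "X = map (\<lambda>k. map (\<lambda>v. nth_or 0 (nth_or [] ?zs (v mod m)) (v div m * t + k)) [0..<l * m]) [0..<t]"
    using assms by (auto simp: totals_by_columns_def split: if_splits)
  have "?zs \<in> set (column_solutions l m t D)" using ne by simp
  note zs = three_way_sound[OF this[unfolded column_solutions_def], folded column_solutions_def]
  let ?W = "map (\<lambda>v. entry D (v mod t) * row_entry l m t D (v mod t) (v div t)) [0..<l * t]"
  have W: "length ?W = l * t" by simp
  have zl: "length ?zs = m" by (rule zs) simp
  have znn: "nonneg (l * t) (?zs ! j)" if "j < m" for j by (rule zs) (use that in simp_all)
  have Xij: "X ! k ! (i * m + j) = ?zs ! j ! (i * t + k)" if "k < t" "i < l" "j < m" for k i j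
    using that grid_less[OF that(2,3)] grid_less[OF that(2,1)] zl znn[OF that(3)] by (simp add: X nonneg_def div_mult_self3)
  have Xv: "X ! k ! v = ?zs ! (v mod m) ! (v div m * t + k)" if "k < t" "v < l * m" for k v
    using Xij[of k "v div m" "v mod m"] grid_div_mod[OF that(2)] that by simp
  show ?thesis unfolding type_totals_def has_margins_def
  proof (intro conjI allI impI)
    show "length X = t" by (simp add: X)
    show "nonneg (l * m) (X ! k)" if k: "k < t" for k
      unfolding nonneg_def
    proof (intro conjI allI impI)
      show "length (X ! k) = l * m" using k by (simp add: X)
      fix v assume v: "v < l * m"
      note g = grid_div_mod[OF v]
      have "v div m * t + k < l * t" using g k by (intro grid_less) auto
      then show "0 \<le> X ! k ! v" unfolding Xv[OF k v] using znn[of "v mod m"] g by (simp add: nonneg_def)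
    qed
    show "(\<Sum>j<m. X ! k ! (i * m + j)) = entry D k * row_entry l m t D k i" if "k < t" "i < l" for k i
    proof -
      have "(\<Sum>j<m. X ! k ! (i * m + j)) = (\<Sum>j<m. ?zs ! j ! (i * t + k))"
        by (rule sum.cong[OF refl], rule Xij[OF that]) simp
      also have "\<dots> = ?W ! (i * t + k)" by (rule zs(5)[OF W grid_less[OF that(2,1)]])
      also have "\<dots> = entry D k * row_entry l m t D k i"
        using that grid_less[OF that(2,1)] by (simp add: div_mult_self3)
      finally show ?thesis .
    qed
    show "(\<Sum>i<l. X ! k ! (i * m + j)) = entry D k * col_entry m t D k j" if "k < t" "j < m" for k j
    proof -
      have "(\<Sum>i<l. X ! k ! (i * m + j)) = (\<Sum>i<l. ?zs ! j ! (i * t + k))"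
        by (rule sum.cong[OF refl], rule Xij[OF that(1) _ that(2)]) simp
      also have "\<dots> = entry D k * col_entry m t D k j" by (rule zs(4)[OF W that(2,1)])
      finally show ?thesis .
    qed
    show "(\<Sum>k<t. X ! k ! v) = line_entry l m t D v" if v: "v < l * m" for v
    proof -
      note g = grid_div_mod[OF v]
      have "(\<Sum>k<t. X ! k ! v) = (\<Sum>k<t. ?zs ! (v mod m) ! (v div m * t + k))"
        by (rule sum.cong[OF refl], rule Xv[OF _ v]) simp
      also have "\<dots> = line_entry l m t D (v div m * m + v mod m)" by (rule zs(3)[OF W]) (use g in auto)
      finally show ?thesis by simp
    qed
  qed
qed

lemma totals_by_columns_complete:
  assumes "type_totals l m t D X"
  shows "totals_by_columns l m t D \<noteq> []"
proof -
  have "column_solutions l m t D \<noteq> []"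
    unfolding column_solutions_def
  proof (rule three_way_complete[where x = "\<lambda>j i k. X ! k ! (i * m + j)"])
    show "0 \<le> X ! k ! (i * m + j)" if "j < m" "i < l" "k < t" for k i j
      using assms that grid_less[OF that(2,1)] by (auto simp: type_totals_def has_margins_def nonneg_def)
    show "(\<Sum>k<t. X ! k ! (i * m + j)) = line_entry l m t D (i * m + j)" if "j < m" "i < l" for i j
      using assms grid_less[OF that(2,1)] by (simp add: type_totals_def)
    show "(\<Sum>j<m. X ! k ! (i * m + j)) = map (\<lambda>v. entry D (v mod t) * row_entry l m t D (v mod t) (v div t)) [0..<l * t] ! (i * t + k)"
      if "i < l" "k < t" for i k
      using assms that grid_less[OF that] by (simp add: type_totals_def has_margins_def div_mult_self3)
  qed (use assms in \<open>auto simp: type_totals_def has_margins_def\<close>)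
  then show ?thesis by (simp add: totals_by_columns_def)
qed

section \<open>Running time of finding the totals\<close>

lemma FC_totals_by_types:
  assumes l: "FC P l" "PB P l" and m: "FC P m" "PB P m" and t: "FC P t" "FB P t"
    and D: "FC P D" "FB P (\<lambda>x. encoding_length (D x))"
  shows "FC P (\<lambda>x. totals_by_types (l x) (m x) (t x) (D x))"
proof -
  note l' = FB_of_PB[OF l(2)] and m' = FB_of_PB[OF m(2)]
  let ?Q = "\<lambda>a b z. P a b (fst z) \<and> snd z < t (fst z)"
  have e: "FC ?Q (\<lambda>z. l (fst z))" "FB ?Q (\<lambda>z. l (fst z))" "FC ?Q (\<lambda>z. m (fst z))" "FB ?Q (\<lambda>z. m (fst z))"
    "FC ?Q (\<lambda>z. t (fst z))" "FB ?Q (\<lambda>z. t (fst z))" "FC ?Q (\<lambda>z. D (fst z))"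
    by (rule FC_env[OF l(1)] FB_env[OF l'] FC_env[OF m(1)] FB_env[OF m'] FC_env[OF t(1)] FB_env[OF t(2)] FC_env[OF D(1)],
      blast, (intro FC_fst FC_id)?)+
  note k = FB_index[OF t(2)]
  have n: "FC ?Q (\<lambda>z. entry (D (fst z)) (snd z))" by (rule FC_entry[OF e(7) FC_snd[OF FC_id] k])
  let ?T = "\<lambda>N a b z. ?Q a b (fst z) \<and> snd z < N (fst z)"
  have f: "FC (?T N) (\<lambda>z. l (fst (fst z)))" "FB (?T N) (\<lambda>z. l (fst (fst z)))" "FC (?T N) (\<lambda>z. m (fst (fst z)))" "FB (?T N) (\<lambda>z. m (fst (fst z)))"
    "FC (?T N) (\<lambda>z. t (fst (fst z)))" "FB (?T N) (\<lambda>z. t (fst (fst z)))" "FC (?T N) (\<lambda>z. D (fst (fst z)))"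
    "FC (?T N) (\<lambda>z. entry (D (fst (fst z))) (snd (fst z)))" "FB (?T N) (\<lambda>z. snd (fst z))" for N
    by (rule FC_env[OF e(1)] FB_env[OF e(2)] FC_env[OF e(3)] FB_env[OF e(4)] FC_env[OF e(5)] FB_env[OF e(6)] FC_env[OF e(7)]
      FC_env[OF n] FB_env[OF k], blast, (intro FC_fst FC_id)?)+
  \<comment> \<open>The margins are products of two numbers of the input, so the second factors are
    no longer than the input.\<close>
  have row: "FB (?T N) (\<lambda>z. bit_length (row_entry (l (fst (fst z))) (m (fst (fst z))) (t (fst (fst z))) (D (fst (fst z))) (snd (fst z)) (snd z)))"
    and col: "FB (?T N) (\<lambda>z. bit_length (col_entry (m (fst (fst z))) (t (fst (fst z))) (D (fst (fst z))) (snd (fst z)) (snd z)))" for N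
    by (rule FB_mono[OF FB_Suc[OF D(2)], where g = "\<lambda>z. fst (fst z)"], use bit_length_row_entry bit_length_col_entry in blast)+
  show ?thesis unfolding totals_by_types_def
  proof (rule FC_three_way[OF l m])
    show "FC P (\<lambda>x. map (\<lambda>k. map (\<lambda>i. entry (D x) k * row_entry (l x) (m x) (t x) (D x) k i) [0..<l x] @
        map (\<lambda>j. entry (D x) k * col_entry (m x) (t x) (D x) k j) [0..<m x]) [0..<t x])"
      by (intro FC_map_upt t e FC_append FC_mult_int FC_row_entry FC_col_entry f row col FB_index FC_fst FC_snd FC_id)
        (simp only: length_map length_upt diff_zero e)
    show "FB P (\<lambda>x. length (map (\<lambda>k. map (\<lambda>i. entry (D x) k * row_entry (l x) (m x) (t x) (D x) k i) [0..<l x] @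
        map (\<lambda>j. entry (D x) k * col_entry (m x) (t x) (D x) k j) [0..<m x]) [0..<t x]))"
      using t(2) by simp
    let ?R = "\<lambda>a b z. P a b (fst z) \<and> snd z < l (fst z) * m (fst z)"
    have g: "FC ?R (\<lambda>z. l (fst z))" "FB ?R (\<lambda>z. l (fst z))" "FC ?R (\<lambda>z. m (fst z))" "FB ?R (\<lambda>z. m (fst z))"
      "FC ?R (\<lambda>z. t (fst z))" "FB ?R (\<lambda>z. t (fst z))" "FC ?R (\<lambda>z. D (fst z))"
      by (rule FC_env[OF l(1)] FB_env[OF l'] FC_env[OF m(1)] FB_env[OF m'] FC_env[OF t(1)] FB_env[OF t(2)] FC_env[OF D(1)],
        blast, (intro FC_fst FC_id)?)+
    show "FC P (\<lambda>x. map (line_entry (l x) (m x) (t x) (D x)) [0..<l x * m x])"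
      by (intro FC_map_upt FC_mult_nat l m FB_mult l' m' FC_line_entry g FB_index FC_snd FC_id)
    show "FB P (\<lambda>x. bit_length (sum_list (map (line_entry (l x) (m x) (t x) (D x)) [0..<l x * m x])))"
    proof (rule FB_le[OF FB_Suc[OF FB_add[OF FB_Suc[OF D(2)] FB_mult[OF l' m']]]])
      fix x
      have "bit_length (sum_list (map (line_entry (l x) (m x) (t x) (D x)) [0..<l x * m x]))
        \<le> Suc (Suc (encoding_length (D x)) + length (map (line_entry (l x) (m x) (t x) (D x)) [0..<l x * m x]))"
        by (rule bit_length_sum_list) (use bit_length_line_entry in auto)
      then show "bit_length (sum_list (map (line_entry (l x) (m x) (t x) (D x)) [0..<l x * m x])) \<le> Suc (Suc (encoding_length (D x)) + l x * m x)"
        by simp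
    qed
  qed auto
qed

lemma FC_column_solutions:
  assumes l: "FC P l" "PB P l" and m: "FC P m" "FB P m" and t: "FC P t" "PB P t"
    and D: "FC P D" "FB P (\<lambda>x. encoding_length (D x))"
  shows "FC P (\<lambda>x. column_solutions (l x) (m x) (t x) (D x))"
proof -
  note l' = FB_of_PB[OF l(2)] and t' = FB_of_PB[OF t(2)]
  let ?Q = "\<lambda>N a b z. P a b (fst z) \<and> snd z < N (fst z)"
  have e: "FC (?Q N) (\<lambda>z. l (fst z))" "FB (?Q N) (\<lambda>z. l (fst z))" "FC (?Q N) (\<lambda>z. m (fst z))" "FB (?Q N) (\<lambda>z. m (fst z))"
    "FC (?Q N) (\<lambda>z. t (fst z))" "FB (?Q N) (\<lambda>z. t (fst z))" "FC (?Q N) (\<lambda>z. D (fst z))" for N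
    by (rule FC_env[OF l(1)] FB_env[OF l'] FC_env[OF m(1)] FB_env[OF m(2)] FC_env[OF t(1)] FB_env[OF t'] FC_env[OF D(1)],
      blast, (intro FC_fst FC_id)?)+
  note j = FB_index[OF m(2)]
  let ?T = "\<lambda>N a b z. ?Q m a b (fst z) \<and> snd z < N (fst z)"
  have f: "FC (?T N) (\<lambda>z. l (fst (fst z)))" "FB (?T N) (\<lambda>z. l (fst (fst z)))" "FC (?T N) (\<lambda>z. m (fst (fst z)))" "FB (?T N) (\<lambda>z. m (fst (fst z)))"
    "FC (?T N) (\<lambda>z. t (fst (fst z)))" "FB (?T N) (\<lambda>z. t (fst (fst z)))" "FC (?T N) (\<lambda>z. D (fst (fst z)))" "FB (?T N) (\<lambda>z. snd (fst z))" for N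
    by (rule FC_env[OF e(1)[of m]] FB_env[OF e(2)[of m]] FC_env[OF e(3)[of m]] FB_env[OF e(4)[of m]] FC_env[OF e(5)[of m]] FB_env[OF e(6)[of m]]
      FC_env[OF e(7)[of m]] FB_env[OF j], blast, (intro FC_fst FC_id)?)+
  have col: "FB (?T N) (\<lambda>z. bit_length (col_entry (m (fst (fst z))) (t (fst (fst z))) (D (fst (fst z))) (snd z) (snd (fst z))))" for N
    by (rule FB_mono[OF FB_Suc[OF D(2)], where g = "\<lambda>z. fst (fst z)"], use bit_length_col_entry in blast)
  let ?R = "\<lambda>a b z. P a b (fst z) \<and> snd z < l (fst z) * t (fst z)"
  have v: "FB ?R (\<lambda>z. snd z mod t (fst z))" "FB ?R (\<lambda>z. snd z div t (fst z))"
    by (rule FB_le[OF FB_index[OF FB_mult[OF l' t']]], simp)+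
  have row: "FB ?R (\<lambda>z. bit_length (row_entry (l (fst z)) (m (fst z)) (t (fst z)) (D (fst z)) (snd z mod t (fst z)) (snd z div t (fst z))))"
    by (rule FB_mono[OF FB_Suc[OF D(2)], where g = fst], use bit_length_row_entry in blast)
  let ?W = "\<lambda>x. map (\<lambda>v. entry (D x) (v mod t x) * row_entry (l x) (m x) (t x) (D x) (v mod t x) (v div t x)) [0..<l x * t x]"
  show ?thesis unfolding column_solutions_def
  proof (rule FC_three_way[OF l t])
    show "FC P (\<lambda>x. map (\<lambda>j. map (\<lambda>i. line_entry (l x) (m x) (t x) (D x) (i * m x + j)) [0..<l x] @
        map (\<lambda>k. entry (D x) k * col_entry (m x) (t x) (D x) k j) [0..<t x]) [0..<m x])"
      by (intro FC_map_upt m e FC_append FC_mult_int FC_line_entry FC_col_entry FC_entry FC_add_nat FC_mult_nat FB_add FB_mult f col FB_index FC_fst FC_snd FC_id)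
        (simp only: length_map length_upt diff_zero e)
    show "FB P (\<lambda>x. length (map (\<lambda>j. map (\<lambda>i. line_entry (l x) (m x) (t x) (D x) (i * m x + j)) [0..<l x] @
        map (\<lambda>k. entry (D x) k * col_entry (m x) (t x) (D x) k j) [0..<t x]) [0..<m x]))"
      using m(2) by simp
    show "FC P ?W"
      by (intro FC_map_upt FC_mult_nat l t FB_mult l' t' FC_mult_int FC_row_entry FC_entry FC_mod_nat FC_div_nat e v row FC_snd FC_id)
    show "FB P (\<lambda>x. bit_length (sum_list (?W x)))"
    \<comment> \<open>The length of the input is counted twice because each entry of
      \<open>?W\<close> is a product of two input numbers; the last summand is for the number of
      terms.\<close>
    proof (rule FB_le[OF FB_Suc[OF FB_add[OF FB_add[OF FB_Suc[OF D(2)] FB_Suc[OF D(2)]] FB_mult[OF l' t']]]])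
      fix x
      have "bit_length (sum_list (?W x)) \<le> Suc (Suc (encoding_length (D x)) + Suc (encoding_length (D x)) + length (?W x))"
        by (rule bit_length_sum_list)
          (auto intro!: order_trans[OF bit_length_mult] add_mono[OF bit_length_entry bit_length_row_entry, simplified])
      then show "bit_length (sum_list (?W x)) \<le> Suc (Suc (encoding_length (D x)) + Suc (encoding_length (D x)) + l x * t x)"
        by simp
    qed
  qed auto
qed

lemma FC_totals_by_columns:
  assumes l: "FC P l" "PB P l" and m: "FC P m" "FB P m" and t: "FC P t" "PB P t"
    and D: "FC P D" "FB P (\<lambda>x. encoding_length (D x))"
  shows "FC P (\<lambda>x. totals_by_columns (l x) (m x) (t x) (D x))"
proof -
  note l' = FB_of_PB[OF l(2)] and t' = FB_of_PB[OF t(2)]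
  let ?sols = "\<lambda>x. column_solutions (l x) (m x) (t x) (D x)"
  have s: "FC P ?sols" by (intro FC_column_solutions assms)
  let ?P = "\<lambda>a b x. P a b x \<and> ?sols x \<noteq> []"
  have h: "FC ?P (\<lambda>x. hd (?sols x))" by (rule FC_hd[OF FC_mono[OF s]]) auto
  have p: "FC ?P t" "FB ?P t" by (rule FC_mono[OF t(1)] FB_env[OF t', where e = "\<lambda>x. x"], blast)+
  let ?Q = "\<lambda>a b z. ?P a b (fst z) \<and> snd z < t (fst z)"
  have e: "FC ?Q (\<lambda>z. l (fst z))" "FB ?Q (\<lambda>z. l (fst z))" "FC ?Q (\<lambda>z. m (fst z))" "FB ?Q (\<lambda>z. m (fst z))"
    "FC ?Q (\<lambda>z. t (fst z))" "FB ?Q (\<lambda>z. t (fst z))" "FC ?Q (\<lambda>z. hd (?sols (fst z)))" "FB ?Q (\<lambda>z. snd z)"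
    by (rule FC_env[OF l(1)] FB_env[OF l'] FC_env[OF m(1)] FB_env[OF m(2)] FC_env[OF t(1)] FB_env[OF t'] FC_env[OF h] FB_index[OF p(2)],
      (blast, (intro FC_fst FC_id)?)?)+
  let ?T = "\<lambda>a b z. ?Q a b (fst z) \<and> snd z < l (fst (fst z)) * m (fst (fst z))"
  have f: "FC ?T (\<lambda>z. m (fst (fst z)))" "FB ?T (\<lambda>z. m (fst (fst z)))" "FC ?T (\<lambda>z. t (fst (fst z)))" "FB ?T (\<lambda>z. t (fst (fst z)))"
    "FC ?T (\<lambda>z. hd (?sols (fst (fst z))))" "FB ?T (\<lambda>z. snd (fst z))"
    by (rule FC_env[OF e(3)] FB_env[OF e(4)] FC_env[OF e(5)] FB_env[OF e(6)] FC_env[OF e(7)] FB_env[OF e(8)], blast, (intro FC_fst FC_id)?)+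
  have v: "FB ?T (\<lambda>z. snd z mod m (fst (fst z)))" "FB ?T (\<lambda>z. snd z div m (fst (fst z)))"
    by (rule FB_le[OF FB_index[OF FB_mult[OF e(2) e(4)]]], simp)+
  show ?thesis unfolding totals_by_columns_def
    by (intro FC_If FC_not_Nil s FC_Cons FC_Nil FC_map_upt p FC_mult_nat FB_mult e FC_nth_or FC_const_int f FC_mod_nat FC_div_nat FC_add_nat FB_add v FC_fst FC_snd FC_id)
qed


section \<open>Correctness of the answer\<close>

lemma type_totals_dec:
  assumes "type_totals l m t D X" "k < t"
  defines "ps \<equiv> dec l m (Suc (l * m)) (entry D k) (X ! k)"
  shows "\<And>p. p \<in> set ps \<Longrightarrow> 1 \<le> fst p \<and> has_margins l m (row_entry l m t D k) (col_entry m t D k) (snd p)"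
    "sum_list (map fst ps) = entry D k"
    "\<And>v. v < l * m \<Longrightarrow> sum_list (map (\<lambda>p. fst p * snd p ! v) ps) = X ! k ! v"
    "distinct (map snd ps)"
proof -
  \<comment> \<open>There are only \<open>l * m\<close> entries, which is why
    \<open>Suc (l * m)\<close> steps suffice.\<close>
  have "card {v. v < l * m \<and> X ! k ! v mod entry D k \<noteq> 0} \<le> card {..<l * m}" by (intro card_mono) auto
  then have "card {v. v < l * m \<and> X ! k ! v mod entry D k \<noteq> 0} < Suc (l * m)" by simp
  note c = dec_correct[OF entry_nonneg _ this, of "row_entry l m t D k" "col_entry m t D k", folded ps_def]
  have h: "has_margins l m (\<lambda>i. entry D k * row_entry l m t D k i) (\<lambda>j. entry D k * col_entry m t D k j) (X ! k)"
    using assms by (simp add: type_totals_def)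
  show "\<And>p. p \<in> set ps \<Longrightarrow> 1 \<le> fst p \<and> has_margins l m (row_entry l m t D k) (col_entry m t D k) (snd p)"
    "sum_list (map fst ps) = entry D k"
    "\<And>v. v < l * m \<Longrightarrow> sum_list (map (\<lambda>p. fst p * snd p ! v) ps) = X ! k ! v"
    "distinct (map snd ps)" using c[OF h] by auto
qed

section \<open>Positions in concatenated lists and blocks of layers\<close>

lemma nth_concat_uniform:
  assumes "\<forall>ys\<in>set yss. length ys = m" "k < length yss" "j < m"
  shows "concat yss ! (k * m + j) = yss ! k ! j"
  using assms
proof (induction yss arbitrary: k)
  case (Cons ys yss)
  then show ?case by (cases k) (simp_all add: nth_append)
qed simp

lemma length_concat_uniform: "\<forall>ys\<in>set yss. length ys = m \<Longrightarrow> length (concat yss) = length yss * m"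
  by (induction yss) auto

lemma nth_concat_blocks:
  assumes "k < length yss" "r < length (yss ! k)"
  shows "concat yss ! (sum_list (take k (map length yss)) + r) = yss ! k ! r"
  using assms
proof (induction yss arbitrary: k)
  case (Cons ys yss)
  then show ?case by (cases k) (simp_all add: nth_append)
qed simp

lemma concat_map_grid: "concat (map (\<lambda>i. map (\<lambda>j. f (i * m + j)) [0..<m]) [0..<l]) = map f [0..<l * m]"
proof (induction l)
  case (Suc l)
  have "[0..<Suc l * m] = [0..<l * m] @ [l * m..<l * m + m]" using upt_add_eq_append[of 0 "l * m" m] by (simp add: add.commute)
  moreover have "[l * m..<l * m + m] = map (\<lambda>j. l * m + j) [0..<m]"
    by (rule nth_equalityI) auto
  ultimately show ?case using Suc by simp
qed simp

lemma sum_blocks: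
  fixes f :: "nat \<Rightarrow> 'a::comm_monoid_add"
  assumes "k \<le> length cs"
  shows "(\<Sum>i<k. \<Sum>h\<in>{sum_list (take i cs)..<sum_list (take (Suc i) cs)}. f h) = (\<Sum>h<sum_list (take k cs). f h)"
  using assms
proof (induction k)
  case (Suc k)
  have "sum_list (take k cs) \<le> sum_list (take (Suc k) cs)" using Suc.prems by (simp add: take_Suc_conv_app_nth)
  with Suc show ?case by (simp add: lessThan_atLeast0 sum.atLeastLessThan_concat)
qed simp

lemma card_block: "length (type_counts I) = num_types I \<Longrightarrow> k < num_types I \<Longrightarrow> card (block I k) = type_counts I ! k"
  by (simp add: block_def take_Suc_conv_app_nth)

text \<open>Here the layout of the input word is matched with the fields of the instance; the
  accessors then stand for the numbers of layers, the prescribed margins of a layer, and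
  \<open>w\<close>.\<close>

lemma huge_tables_entries:
  assumes "I \<in> huge_tables"
  defines "l \<equiv> num_rows I" and "m \<equiv> num_cols I" and "t \<equiv> num_types I" and "D \<equiv> encode_data I"
  shows "k < t \<Longrightarrow> entry D k = int (type_counts I ! k)"
    "k < t \<Longrightarrow> j < m \<Longrightarrow> col_entry m t D k j = int (column_sums I ! k $ j)"
    "k < t \<Longrightarrow> i < l \<Longrightarrow> row_entry l m t D k i = int (row_sums I ! k $ i)"
    "i < l \<Longrightarrow> j < m \<Longrightarrow> line_entry l m t D (i * m + j) = int (line_sums I $$ (i, j))"
proof -
  let ?U = "concat (map list_of_vec (column_sums I))" and ?V = "concat (map list_of_vec (row_sums I))"
    and ?M = "encode_mat (line_sums I)"
  have inst: "length (type_counts I) = t \<and> length (column_sums I) = t \<and> length (row_sums I) = t \<and>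
      set (column_sums I) \<subseteq> carrier_vec m \<and> set (row_sums I) \<subseteq> carrier_vec l \<and> line_sums I \<in> carrier_mat l m"
    using assms(1) unfolding huge_tables_def l_def m_def t_def by blast
  have I: "length (type_counts I) = t" "length (column_sums I) = t" "length (row_sums I) = t"
    "\<forall>u\<in>set (column_sums I). dim_vec u = m" "\<forall>v\<in>set (row_sums I). dim_vec v = l"
    "dim_row (line_sums I) = l" "dim_col (line_sums I) = m"
    using inst carrier_vecD by (blast, blast, blast, blast, blast, auto)
  have U: "\<forall>ys\<in>set (map list_of_vec (column_sums I)). length ys = m" using I(4) by auto
  have V: "\<forall>ys\<in>set (map list_of_vec (row_sums I)). length ys = l" using I(5) by auto
  have M: "\<forall>ys\<in>set (mat_to_list (line_sums I)). length ys = m" using I(7) by (auto simp: mat_to_list_def)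
  have lenU: "length ?U = t * m" and lenV: "length ?V = t * l" and lenM: "length ?M = l * m"
    using length_concat_uniform[OF U] length_concat_uniform[OF V] length_concat_uniform[OF M] I
    by (simp_all add: encode_mat_def mat_to_list_def)
  have D: "D = type_counts I @ [num_layers I] @ ?U @ ?V @ ?M" by (simp add: D_def encode_data_def)
  have lenD: "length D = Suc t + t * m + t * l + l * m" using lenU lenV lenM I(1) by (simp add: D)
  have entry: "entry D i = int (D ! i)" if "i < length D" for i using that by (simp add: entry_def)
  show "entry D k = int (type_counts I ! k)" if "k < t"
    using that I(1) lenD by (subst entry) (simp_all add: D nth_append)
  show "col_entry m t D k j = int (column_sums I ! k $ j)" if k: "k < t" and j: "j < m"
  proof -
    have g: "k * m + j < t * m" by (rule grid_less[OF k j])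
    have "D ! (Suc t + (k * m + j)) = ?U ! (k * m + j)" using g lenU I(1) by (simp add: D nth_append)
    also have "\<dots> = column_sums I ! k $ j"
      using nth_concat_uniform[OF U, of k j] k j I(2,4) by (simp add: list_of_vec_index)
    finally show ?thesis unfolding col_entry_def using g lenD by (subst entry) (simp_all add: add.assoc)
  qed
  show "row_entry l m t D k i = int (row_sums I ! k $ i)" if k: "k < t" and i: "i < l"
  proof -
    have g: "k * l + i < t * l" by (rule grid_less[OF k i])
    have "D ! (Suc t + t * m + (k * l + i)) = ?V ! (k * l + i)" using g lenU lenV I(1) by (simp add: D nth_append)
    also have "\<dots> = row_sums I ! k $ i"
      using nth_concat_uniform[OF V, of k i] k i I(3,5) by (simp add: list_of_vec_index)
    finally show ?thesis unfolding row_entry_def using g lenD by (subst entry) (simp_all add: add.assoc)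
  qed
  show "line_entry l m t D (i * m + j) = int (line_sums I $$ (i, j))" if i: "i < l" and j: "j < m"
  proof -
    have g: "i * m + j < l * m" by (rule grid_less[OF i j])
    have "D ! (Suc t + t * m + t * l + (i * m + j)) = ?M ! (i * m + j)" using g lenU lenV I(1) by (simp add: D nth_append)
    also have "\<dots> = line_sums I $$ (i, j)"
      using nth_concat_uniform[OF M, of i j] i j I(6,7) by (simp add: encode_mat_def mat_to_list_def)
    finally show ?thesis unfolding line_entry_def using g lenD by (subst entry) (simp_all add: add.assoc)
  qed
qed

text \<open>The total for type \<open>k\<close> is the sum of the layers in
  \<open>block I k\<close>, whose cardinality is the number of layers of that type. This is the
  direction that guarantees an answer whenever a feasible table exists.\<close>

lemma feasible_type_totals:
  assumes I: "I \<in> huge_tables" and x: "feasible I x"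
  shows "\<exists>X. type_totals (num_rows I) (num_cols I) (num_types I) (encode_data I) X"
proof -
  let ?l = "num_rows I" and ?m = "num_cols I" and ?t = "num_types I" and ?D = "encode_data I"
  note ent = huge_tables_entries[OF I]
  let ?x = "\<lambda>k i j. \<Sum>h\<in>block I k. int (x ! h $$ (i, j))"
  let ?X = "map (\<lambda>k. map (\<lambda>v. ?x k (v div ?m) (v mod ?m)) [0..<?l * ?m]) [0..<?t]"
  have counts: "length (type_counts I) = ?t" "sum_list (type_counts I) = num_layers I"
    using I by (auto simp: huge_tables_def)
  have X: "?X ! k ! (i * ?m + j) = ?x k i j" if "k < ?t" "i < ?l" "j < ?m" for k i j
    using that grid_less[OF that(2,3)] by (simp add: div_mult_self3)
  have layer: "layer_of_type I k (x ! h)" if "k < ?t" "h \<in> block I k" for k h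
    using x that by (simp add: feasible_def)
  have "type_totals ?l ?m ?t ?D ?X"
    unfolding type_totals_def has_margins_def
  proof (intro conjI allI impI)
    show "nonneg (?l * ?m) (?X ! k)" if "k < ?t" for k
      using that by (auto simp: nonneg_def intro!: sum_nonneg)
    show "(\<Sum>j<?m. ?X ! k ! (i * ?m + j)) = entry ?D k * row_entry ?l ?m ?t ?D k i" if "k < ?t" "i < ?l" for k i
    proof -
      have "(\<Sum>j<?m. ?X ! k ! (i * ?m + j)) = (\<Sum>j<?m. ?x k i j)"
        by (rule sum.cong[OF refl], rule X) (use that in auto)
      also have "\<dots> = (\<Sum>h\<in>block I k. \<Sum>j<?m. int (x ! h $$ (i, j)))" by (rule sum.swap)
      also have "\<dots> = (\<Sum>h\<in>block I k. int (row_sums I ! k $ i))"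
      proof (rule sum.cong[OF refl])
        fix h assume "h \<in> block I k"
        then have "(\<Sum>j<?m. x ! h $$ (i, j)) = row_sums I ! k $ i" using layer[OF that(1)] that by (simp add: layer_of_type_def)
        then show "(\<Sum>j<?m. int (x ! h $$ (i, j))) = int (row_sums I ! k $ i)" by (metis of_nat_sum)
      qed
      also have "\<dots> = entry ?D k * row_entry ?l ?m ?t ?D k i"
        using card_block[OF counts(1) that(1)] ent(1,3) that by simp
      finally show ?thesis .
    qed
    show "(\<Sum>i<?l. ?X ! k ! (i * ?m + j)) = entry ?D k * col_entry ?m ?t ?D k j" if "k < ?t" "j < ?m" for k j
    proof -
      have "(\<Sum>i<?l. ?X ! k ! (i * ?m + j)) = (\<Sum>i<?l. ?x k i j)"
        by (rule sum.cong[OF refl], rule X) (use that in auto)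
      also have "\<dots> = (\<Sum>h\<in>block I k. \<Sum>i<?l. int (x ! h $$ (i, j)))" by (rule sum.swap)
      also have "\<dots> = (\<Sum>h\<in>block I k. int (column_sums I ! k $ j))"
      proof (rule sum.cong[OF refl])
        fix h assume "h \<in> block I k"
        then have "(\<Sum>i<?l. x ! h $$ (i, j)) = column_sums I ! k $ j" using layer[OF that(1)] that by (simp add: layer_of_type_def)
        then show "(\<Sum>i<?l. int (x ! h $$ (i, j))) = int (column_sums I ! k $ j)" by (metis of_nat_sum)
      qed
      also have "\<dots> = entry ?D k * col_entry ?m ?t ?D k j"
        using card_block[OF counts(1) that(1)] ent(1,2) that by simp
      finally show ?thesis .
    qed
    show "(\<Sum>k<?t. ?X ! k ! v) = line_entry ?l ?m ?t ?D v" if v: "v < ?l * ?m" for v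
    proof -
      let ?i = "v div ?m" and ?j = "v mod ?m"
      note g = grid_div_mod[OF v]
      have "(\<Sum>k<?t. ?X ! k ! v) = (\<Sum>k<?t. ?x k ?i ?j)"
        by (rule sum.cong[OF refl]) (use v in simp)
      also have "\<dots> = (\<Sum>h<num_layers I. int (x ! h $$ (?i, ?j)))"
        unfolding block_def using sum_blocks[of ?t "type_counts I" "\<lambda>h. int (x ! h $$ (?i, ?j))"] counts by simp
      also have "\<dots> = int (\<Sum>h<num_layers I. x ! h $$ (?i, ?j))" by simp
      also have "\<dots> = int (line_sums I $$ (?i, ?j))" using x g unfolding feasible_def by metis
      also have "\<dots> = line_entry ?l ?m ?t ?D (?i * ?m + ?j)" using ent(4)[of ?i ?j] g by simp
      finally show ?thesis by simp
    qed
  qed simp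
  then show ?thesis by blast
qed

section \<open>From totals to a table and its compact representation\<close>

definition expand :: "(nat \<times> 'a) list \<Rightarrow> 'a list" where
  "expand ps = concat (map (\<lambda>(q, z). replicate q z) ps)"

lemma length_expand: "length (expand ps) = (\<Sum>(q, z)\<leftarrow>ps. q)"
  by (induction ps) (auto simp: expand_def)

lemma set_expand: "z \<in> set (expand ps) \<Longrightarrow> \<exists>q. (q, z) \<in> set ps"
  by (auto simp: expand_def)

lemma sum_list_expand: "sum_list (map f (expand ps)) = (\<Sum>(q, z)\<leftarrow>ps. q * f z)" for f :: "'a \<Rightarrow> nat"
  by (induction ps) (auto simp: expand_def sum_list_replicate)

text \<open>By distinctness no other pair of the list contributes copies of
  \<open>z\<close>.\<close>

lemma card_expand:
  assumes "distinct (map snd ps)" "(q, z) \<in> set ps"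
  shows "card {r. r < length (expand ps) \<and> expand ps ! r = z} = q"
proof -
  have "length (filter (\<lambda>y. y = z) (expand ps)) = (\<Sum>(p, y)\<leftarrow>ps. if y = z then p else 0)"
    by (induction ps) (auto simp: expand_def)
  also have "\<dots> = q" using assms
  proof (induction ps)
    case (Cons p ps)
    show ?case
    proof (cases "p = (q, z)")
      case True
      then have "\<forall>p\<in>set ps. snd p \<noteq> z" using Cons.prems(1) by auto
      then have "(\<Sum>(p, y)\<leftarrow>ps. if y = z then p else 0) = 0" by (induction ps) auto
      then show ?thesis using True by simp
    next
      case False
      then have "(q, z) \<in> set ps" using Cons.prems(2) by simp
      then have "snd p \<noteq> z" using Cons.prems(1) image_eqI[of z snd "(q, z)" "set ps"] by auto
      then show ?thesis using Cons.IH \<open>(q, z) \<in> set ps\<close> Cons.prems(1) by (auto split: prod.splits)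
    qed
  qed simp
  finally show ?thesis by (simp add: length_filter_conv_card)
qed

definition layer_mat :: "nat \<Rightarrow> nat \<Rightarrow> int list \<Rightarrow> nat mat" where
  "layer_mat l m z = mat l m (\<lambda>(i, j). nat (z ! (i * m + j)))"

lemma encode_layer_mat: "length z = l * m \<Longrightarrow> encode_mat (layer_mat l m z) = map nat z"
proof -
  assume len: "length z = l * m"
  have "mat_to_list (layer_mat l m z) = map (\<lambda>i. map (\<lambda>j. nat (z ! (i * m + j))) [0..<m]) [0..<l]"
    by (auto simp: mat_to_list_def layer_mat_def)
  then have "encode_mat (layer_mat l m z) = map (\<lambda>v. nat (z ! v)) [0..<l * m]"
    unfolding encode_mat_def using concat_map_grid[of "\<lambda>v. nat (z ! v)" m l] by simp
  also have "\<dots> = map nat z" using len by (intro nth_equalityI) auto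
  finally show ?thesis .
qed

lemma layer_of_type_layer_mat:
  assumes I: "I \<in> huge_tables" and k: "k < num_types I"
    and z: "has_margins (num_rows I) (num_cols I) (row_entry (num_rows I) (num_cols I) (num_types I) (encode_data I) k)
      (col_entry (num_cols I) (num_types I) (encode_data I) k) z"
  shows "layer_of_type I k (layer_mat (num_rows I) (num_cols I) z)"
proof -
  let ?l = "num_rows I" and ?m = "num_cols I"
  note ent = huge_tables_entries[OF I]
  have zij: "int (layer_mat ?l ?m z $$ (i, j)) = z ! (i * ?m + j)" if "i < ?l" "j < ?m" for i j
    using z that grid_less[OF that] by (simp add: layer_mat_def has_margins_def nonneg_def)
  show ?thesis unfolding layer_of_type_def
  proof (intro conjI allI impI)
    show "layer_mat ?l ?m z \<in> carrier_mat ?l ?m" by (simp add: layer_mat_def)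
    show "(\<Sum>i<?l. layer_mat ?l ?m z $$ (i, j)) = column_sums I ! k $ j" if j: "j < ?m" for j
    proof -
      have "int (\<Sum>i<?l. layer_mat ?l ?m z $$ (i, j)) = (\<Sum>i<?l. z ! (i * ?m + j))"
        unfolding of_nat_sum by (rule sum.cong[OF refl], rule zij) (use j in auto)
      also have "\<dots> = int (column_sums I ! k $ j)" using z j ent(2)[OF k j] by (simp add: has_margins_def)
      finally show ?thesis by (simp only: of_nat_eq_iff)
    qed
    show "(\<Sum>j<?m. layer_mat ?l ?m z $$ (i, j)) = row_sums I ! k $ i" if i: "i < ?l" for i
    proof -
      have "int (\<Sum>j<?m. layer_mat ?l ?m z $$ (i, j)) = (\<Sum>j<?m. z ! (i * ?m + j))"
        unfolding of_nat_sum by (rule sum.cong[OF refl], rule zij) (use i in auto)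
      also have "\<dots> = int (row_sums I ! k $ i)" using z i ent(3)[OF k i] by (simp add: has_margins_def)
      finally show ?thesis by (simp only: of_nat_eq_iff)
    qed
  qed
qed

definition layers_of_type :: "nat \<Rightarrow> nat \<Rightarrow> nat list \<Rightarrow> int list list \<Rightarrow> nat \<Rightarrow> (int \<times> int list) list" where
  "layers_of_type l m D X k = dec l m (Suc (l * m)) (entry D k) (nth_or [] X k)"

definition answer :: "nat \<Rightarrow> nat \<Rightarrow> nat \<Rightarrow> nat list \<Rightarrow> int list list list \<Rightarrow> int list" where
  "answer l m t D Xs = (if Xs \<noteq> [] then 1 # concat (map (\<lambda>k. int (length (layers_of_type l m D (hd Xs) k)) #
      concat (map (\<lambda>p. fst p # snd p) (layers_of_type l m D (hd Xs) k))) [0..<t]) else [0])"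

lemma layers_of_type:
  assumes "type_totals l m t D X" "k < t"
  shows "\<And>p. p \<in> set (layers_of_type l m D X k) \<Longrightarrow> 1 \<le> fst p \<and> has_margins l m (row_entry l m t D k) (col_entry m t D k) (snd p)"
    "sum_list (map fst (layers_of_type l m D X k)) = entry D k"
    "\<And>v. v < l * m \<Longrightarrow> sum_list (map (\<lambda>p. fst p * snd p ! v) (layers_of_type l m D X k)) = X ! k ! v"
    "distinct (map snd (layers_of_type l m D X k))"
proof -
  have "nth_or [] X k = X ! k" using assms by (simp add: type_totals_def)
  then have e: "layers_of_type l m D X k = dec l m (Suc (l * m)) (entry D k) (X ! k)" by (simp add: layers_of_type_def)
  show "\<And>p. p \<in> set (layers_of_type l m D X k) \<Longrightarrow> 1 \<le> fst p \<and> has_margins l m (row_entry l m t D k) (col_entry m t D k) (snd p)"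
    "sum_list (map fst (layers_of_type l m D X k)) = entry D k"
    "\<And>v. v < l * m \<Longrightarrow> sum_list (map (\<lambda>p. fst p * snd p ! v) (layers_of_type l m D X k)) = X ! k ! v"
    "distinct (map snd (layers_of_type l m D X k))"
    unfolding e by (rule type_totals_dec[OF assms]; assumption?)+
qed

text \<open>The table is the concatenation of the expanded lists of layers, one list for each type.
  The multiplicities for type \<open>k\<close> sum to its number of layers, so the expansion
  occupies exactly \<open>block I k\<close>, and the weighted sums of the layers return the totals
  and hence \<open>w\<close>.\<close>

lemma answer_represents:
  assumes I: "I \<in> huge_tables"
  defines "l \<equiv> num_rows I" and "m \<equiv> num_cols I" and "t \<equiv> num_types I" and "D \<equiv> encode_data I"
  assumes X: "type_totals l m t D X"
  shows "\<exists>x L. feasible I x \<and> represents I L x \<and>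
    map nat (1 # concat (map (\<lambda>k. int (length (layers_of_type l m D X k)) # concat (map (\<lambda>p. fst p # snd p) (layers_of_type l m D X k))) [0..<t])) =
    1 # encode_compact L"
proof -
  note ent = huge_tables_entries[OF I, folded l_def m_def t_def D_def]
  have counts: "length (type_counts I) = t" "sum_list (type_counts I) = num_layers I"
    using I unfolding huge_tables_def t_def by blast+
  let ?ps = "\<lambda>k. layers_of_type l m D X k"
  define L where "L = map (\<lambda>k. map (\<lambda>p. (nat (fst p), layer_mat l m (snd p))) (?ps k)) [0..<t]"
  define x where "x = concat (map expand L)"
  note ps = layers_of_type[OF X]
  have nn: "0 \<le> fst p" "nonneg (l * m) (snd p)" if "p \<in> set (?ps k)" "k < t" for p k
    using ps(1)[OF that(2,1)] by (auto simp: has_margins_def)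
  have Lk: "L ! k = map (\<lambda>p. (nat (fst p), layer_mat l m (snd p))) (?ps k)" if "k < t" for k using that by (simp add: L_def)
  have lenL: "length L = t" by (simp add: L_def)
  have tot: "(\<Sum>(q, z)\<leftarrow>L ! k. q) = type_counts I ! k" if k: "k < t" for k
  proof -
    have "int (\<Sum>(q, z)\<leftarrow>L ! k. q) = sum_list (map fst (?ps k))"
    proof -
      have "int (\<Sum>(q, z)\<leftarrow>map (\<lambda>p. (nat (fst p), layer_mat l m (snd p))) ys. q) = sum_list (map fst ys)"
        if "\<forall>p\<in>set ys. 0 \<le> fst p" for ys using that by (induction ys) auto
      then show ?thesis unfolding Lk[OF k] using nn(1)[OF _ k] by blast
    qed
    then show ?thesis using ps(2)[OF k] ent(1)[OF k] by simp
  qed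
  have lens: "map length (map expand L) = type_counts I"
    by (rule nth_equalityI) (use counts lenL tot in \<open>auto simp: length_expand\<close>)
  have xk: "x ! (sum_list (take k (type_counts I)) + r) = expand (L ! k) ! r" if "k < t" "r < type_counts I ! k" for k r
    using nth_concat_blocks[of k "map expand L" r] that lenL tot[OF that(1)] unfolding lens x_def by (simp add: length_expand)
  have lenx: "length x = num_layers I"
    unfolding x_def length_concat lens counts(2) by simp
  have blk: "block I k = (\<lambda>r. sum_list (take k (type_counts I)) + r) ` {..<type_counts I ! k}" if "k < t" for k
    unfolding block_def using that counts(1) by (simp add: take_Suc_conv_app_nth lessThan_atLeast0 add.commute)
  have layer: "layer_of_type I k z" if "k < t" "(q, z) \<in> set (L ! k)" for k q z
    using that(2) ps(1)[OF that(1)] layer_of_type_layer_mat[OF I, of k] that(1) unfolding Lk[OF that(1)]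
    by (auto simp: l_def m_def t_def D_def)
  have dist: "distinct (map snd (L ! k))" if k: "k < t" for k
  proof -
    \<comment> \<open>Turning integers into natural numbers is injective on nonnegative tables, so
      distinct layers stay distinct as matrices.\<close>
    have "inj_on (layer_mat l m) (snd ` set (?ps k))"
    proof (rule inj_onI, clarify)
      fix a y b z assume *: "(a, y) \<in> set (?ps k)" "(b, z) \<in> set (?ps k)" "layer_mat l m (snd (a, y)) = layer_mat l m (snd (b, z))"
      have n: "nonneg (l * m) y" "nonneg (l * m) z" using nn(2)[OF *(1) k] nn(2)[OF *(2) k] by simp_all
      have "map nat y = map nat z"
        using encode_layer_mat[of y l m] encode_layer_mat[of z l m] n *(3) by (simp add: nonneg_def)
      then have "map int (map nat y) = map int (map nat z)" by simp
      moreover have "map int (map nat w) = w" if "nonneg (l * m) w" for w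
        using that by (intro nth_equalityI) (auto simp: nonneg_def)
      ultimately show "snd (a, y) = snd (b, z)" using n by simp
    qed
    then have "distinct (map (layer_mat l m) (map snd (?ps k)))"
      using ps(4)[OF k] unfolding distinct_map[of "layer_mat l m"] by simp
    then show ?thesis unfolding Lk[OF k] by (simp add: o_def)
  qed
  have rep: "represents I L x"
    unfolding represents_def
  proof (intro conjI allI impI ballI)
    show "length L = num_types I" using lenL by (simp add: t_def)
    fix k assume "k < num_types I"
    then have k: "k < t" by (simp add: t_def)
    show "distinct (map snd (L ! k))" by (rule dist[OF k])
    show "(\<Sum>(q, z)\<leftarrow>L ! k. q) = type_counts I ! k" by (rule tot[OF k])
    fix p assume p: "p \<in> set (L ! k)"
    obtain q z where qz: "p = (q, z)" by (cases p)
    have "{h \<in> block I k. x ! h = z} = (\<lambda>r. sum_list (take k (type_counts I)) + r) ` {r. r < length (expand (L ! k)) \<and> expand (L ! k) ! r = z}"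
      unfolding blk[OF k] using xk[OF k] tot[OF k] by (auto simp: length_expand)
    then have "card {h \<in> block I k. x ! h = z} = card {r. r < length (expand (L ! k)) \<and> expand (L ! k) ! r = z}"
      by (simp add: card_image)
    also have "\<dots> = q" by (rule card_expand[OF dist[OF k]]) (use p qz in simp)
    finally show "case p of (q, z) \<Rightarrow> layer_of_type I k z \<and> q = card {h \<in> block I k. x ! h = z}"
      using layer[OF k] p qz by simp
  qed
  have feas: "feasible I x"
    unfolding feasible_def
  proof (intro conjI allI impI ballI)
    show "length x = num_layers I" by (rule lenx)
    show "layer_of_type I k (x ! h)" if k': "k < num_types I" and h: "h \<in> block I k" for k h
    proof -
      have k: "k < t" using k' by (simp add: t_def)
      obtain r where r: "h = sum_list (take k (type_counts I)) + r" "r < type_counts I ! k"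
        using h unfolding blk[OF k] by blast
      have "x ! h = expand (L ! k) ! r" unfolding r(1) by (rule xk[OF k r(2)])
      moreover have "expand (L ! k) ! r \<in> set (expand (L ! k))" using r(2) tot[OF k] by (intro nth_mem) (simp add: length_expand)
      ultimately have "x ! h \<in> set (expand (L ! k))" by simp
      from set_expand[OF this] obtain q where "(q, x ! h) \<in> set (L ! k)" ..
      then show ?thesis by (rule layer[OF k])
    qed
    show "(\<Sum>h<num_layers I. x ! h $$ (i, j)) = line_sums I $$ (i, j)" if "i < num_rows I" "j < num_cols I" for i j
    proof -
      have ij: "i < l" "j < m" using that by (simp_all add: l_def m_def)
      note g = grid_less[OF ij]
      let ?f = "\<lambda>z :: nat mat. z $$ (i, j)"
      have part: "int (\<Sum>(q, z)\<leftarrow>L ! k. q * ?f z) = X ! k ! (i * m + j)" if k: "k < t" for k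
      proof -
        have f: "int (nat (fst p) * ?f (layer_mat l m (snd p))) = fst p * snd p ! (i * m + j)" if "p \<in> set (?ps k)" for p
          using nn[OF that k] g ij by (simp add: layer_mat_def nonneg_def)
        have "int (\<Sum>(q, z)\<leftarrow>L ! k. q * ?f z) = sum_list (map (\<lambda>p. int (nat (fst p) * ?f (layer_mat l m (snd p)))) (?ps k))"
        proof -
          have "int (\<Sum>(q, z)\<leftarrow>map (\<lambda>p. (nat (fst p), layer_mat l m (snd p))) ys. q * ?f z) =
            sum_list (map (\<lambda>p. int (nat (fst p) * ?f (layer_mat l m (snd p)))) ys)" for ys
            by (induction ys) auto
          then show ?thesis unfolding Lk[OF k] by blast
        qed
        also have "\<dots> = sum_list (map (\<lambda>p. fst p * snd p ! (i * m + j)) (?ps k))"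
          by (rule arg_cong[where f = sum_list], rule map_cong[OF refl], rule f)
        also have "\<dots> = X ! k ! (i * m + j)" by (rule ps(3)[OF k g])
        finally show ?thesis .
      qed
      have "(\<Sum>h<num_layers I. ?f (x ! h)) = sum_list (map ?f x)"
        using lenx by (simp add: sum_list_sum_nth atLeast0LessThan)
      also have "\<dots> = sum_list (map (\<lambda>ps. \<Sum>(q, z)\<leftarrow>ps. q * ?f z) L)"
        unfolding x_def by (induction L) (simp_all add: sum_list_expand)
      also have "\<dots> = (\<Sum>k<t. \<Sum>(q, z)\<leftarrow>L ! k. q * ?f z)"
        using lenL by (simp add: sum_list_sum_nth atLeast0LessThan)
      finally have "int (\<Sum>h<num_layers I. ?f (x ! h)) = (\<Sum>k<t. int (\<Sum>(q, z)\<leftarrow>L ! k. q * ?f z))"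
        by (simp only: of_nat_sum)
      also have "\<dots> = (\<Sum>k<t. X ! k ! (i * m + j))"
        by (rule sum.cong[OF refl], rule part) simp
      also have "\<dots> = line_entry l m t D (i * m + j)" using X g by (simp add: type_totals_def)
      also have "\<dots> = int (line_sums I $$ (i, j))" by (rule ent(4)[OF ij])
      finally show ?thesis by (simp only: of_nat_eq_iff)
    qed
  qed
  have enc: "map nat (int (length (?ps k)) # concat (map (\<lambda>p. fst p # snd p) (?ps k))) =
      length (L ! k) # concat (map (\<lambda>(q, z). q # encode_mat z) (L ! k))" if k: "k < t" for k
  proof -
    have "map nat (concat (map (\<lambda>p. fst p # snd p) (?ps k))) = concat (map (\<lambda>p. nat (fst p) # map nat (snd p)) (?ps k))"
      by (simp add: map_concat o_def)
    also have "map (\<lambda>p. nat (fst p) # map nat (snd p)) (?ps k) = map (\<lambda>p. nat (fst p) # encode_mat (layer_mat l m (snd p))) (?ps k)"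
      using encode_layer_mat nn(2)[OF _ k] by (intro map_cong[OF refl]) (simp add: nonneg_def)
    finally show ?thesis by (simp add: Lk[OF k] o_def)
  qed
  have "map nat (1 # concat (map (\<lambda>k. int (length (?ps k)) # concat (map (\<lambda>p. fst p # snd p) (?ps k))) [0..<t])) =
      1 # concat (map (\<lambda>k. map nat (int (length (?ps k)) # concat (map (\<lambda>p. fst p # snd p) (?ps k)))) [0..<t])"
    by (simp add: map_concat o_def)
  also have "map (\<lambda>k. map nat (int (length (?ps k)) # concat (map (\<lambda>p. fst p # snd p) (?ps k)))) [0..<t] =
      map (\<lambda>k. length (L ! k) # concat (map (\<lambda>(q, z). q # encode_mat z) (L ! k))) [0..<t]"
    by (rule map_cong[OF refl], rule enc) simp
  also have "\<dots> = map (\<lambda>ps. length ps # concat (map (\<lambda>(q, z). q # encode_mat z) ps)) L"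
    by (rule nth_equalityI) (simp_all add: lenL)
  finally show ?thesis unfolding encode_compact_def by (intro exI conjI) (rule feas, rule rep)
qed

lemma solves_answer:
  assumes I: "I \<in> huge_tables"
    and sound: "\<forall>X\<in>set Xs. type_totals (num_rows I) (num_cols I) (num_types I) (encode_data I) X"
    and complete: "(\<exists>X. type_totals (num_rows I) (num_cols I) (num_types I) (encode_data I) X) \<longrightarrow> Xs \<noteq> []"
  shows "solves I (map nat (answer (num_rows I) (num_cols I) (num_types I) (encode_data I) Xs))"
proof (cases "Xs = []")
  case True
  then show ?thesis using feasible_type_totals[OF I] complete by (auto simp: solves_def answer_def)
next
  case False
  then have "type_totals (num_rows I) (num_cols I) (num_types I) (encode_data I) (hd Xs)" using sound by simp
  from answer_represents[OF I this] obtain x L where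
    x: "feasible I x" "represents I L x" "map nat (answer (num_rows I) (num_cols I) (num_types I) (encode_data I) Xs) = 1 # encode_compact L"
    using False by (auto simp: answer_def)
  then show ?thesis unfolding solves_def by auto
qed

lemma answer_nonneg:
  assumes "\<forall>X\<in>set Xs. type_totals l m t D X"
  shows "\<forall>y\<in>set (answer l m t D Xs). 0 \<le> y"
proof (cases "Xs = []")
  case False
  then have X: "type_totals l m t D (hd Xs)" using assms by simp
  have "0 \<le> y" if "k < t" "p \<in> set (layers_of_type l m D (hd Xs) k)" "y \<in> set (snd p)" for k p y
    using layers_of_type(1)[OF X that(1,2)] that(3) by (auto simp: has_margins_def nonneg_def in_set_conv_nth)
  moreover have "0 \<le> fst p" if "k < t" "p \<in> set (layers_of_type l m D (hd Xs) k)" for k p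
    using layers_of_type(1)[OF X that] by simp
  ultimately show ?thesis using False by (auto simp: answer_def)
qed (simp add: answer_def)

lemma length_layers:
  assumes "type_totals l m t D X" "k < t"
  shows "length (int (length (layers_of_type l m D X k)) # concat (map (\<lambda>p. fst p # snd p) (layers_of_type l m D X k)))
    \<le> Suc (Suc (l * m) * Suc (l * m))"
proof -
  have "\<forall>ys\<in>set (map (\<lambda>p. fst p # snd p) (layers_of_type l m D X k)). length ys = Suc (l * m)"
    using layers_of_type(1)[OF assms] by (auto simp: has_margins_def nonneg_def)
  from length_concat_uniform[OF this]
  have "length (concat (map (\<lambda>p. fst p # snd p) (layers_of_type l m D X k))) = length (layers_of_type l m D X k) * Suc (l * m)" by simp
  also have "\<dots> \<le> Suc (l * m) * Suc (l * m)"
    by (rule mult_le_mono1) (simp only: layers_of_type_def length_dec)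
  finally show ?thesis by simp
qed

lemma length_answer:
  assumes "\<forall>X\<in>set Xs. type_totals l m t D X"
  shows "length (answer l m t D Xs) \<le> Suc (t * Suc (Suc (l * m) * Suc (l * m)))"
proof (cases "Xs = []")
  case False
  then have X: "type_totals l m t D (hd Xs)" using assms by simp
  have "length (concat (map f [0..<t])) \<le> t * N" if "\<And>k. k < t \<Longrightarrow> length (f k) \<le> N" for f :: "nat \<Rightarrow> int list" and N
    using that
  proof (induction t)
    case (Suc t)
    then have "length (concat (map f [0..<t])) \<le> t * N" "length (f t) \<le> N" by simp_all
    then show ?case by simp
  qed simp
  from this[OF length_layers[OF X]] False show ?thesis by (simp add: answer_def)
qed (simp add: answer_def)

text \<open>That the candidates are tables of totals is assumed for all admissible inputs, because
  the lengths of the layers, and with them the size of the output, are derived from it.\<close>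

lemma FC_answer:
  assumes l: "FC P l" "PB P l" and m: "FC P m" "FB P m" and t: "FC P t" "FB P t"
    and D: "FC P D" "FB P (\<lambda>x. encoding_length (D x))"
    and Xs: "FC P Xs" "\<And>a b x. P a b x \<Longrightarrow> \<forall>X\<in>set (Xs x). type_totals (l x) (m x) (t x) (D x) X"
  shows "FC P (\<lambda>x. answer (l x) (m x) (t x) (D x) (Xs x))"
proof -
  note l' = FB_of_PB[OF l(2)]
  let ?P = "\<lambda>a b x. P a b x \<and> Xs x \<noteq> []"
  have p: "FC ?P t" "FB ?P t" by (rule FC_mono[OF t(1)] FB_env[OF t(2), where e = "\<lambda>x. x"], blast)+
  have X: "type_totals (l x) (m x) (t x) (D x) (hd (Xs x))" if "?P a b x" for a b x
    using Xs(2)[of a b x] that by simp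
  have h: "FC ?P (\<lambda>x. hd (Xs x))" by (rule FC_hd[OF FC_mono[OF Xs(1)]]) auto
  let ?Q = "\<lambda>a b z. ?P a b (fst z) \<and> snd z < t (fst z)"
  let ?ps = "\<lambda>z. layers_of_type (l (fst z)) (m (fst z)) (D (fst z)) (hd (Xs (fst z))) (snd z)"
  have e: "FC ?Q (\<lambda>z. l (fst z))" "PB ?Q (\<lambda>z. l (fst z))" "FC ?Q (\<lambda>z. m (fst z))" "FB ?Q (\<lambda>z. m (fst z))"
    "FC ?Q (\<lambda>z. D (fst z))" "FC ?Q (\<lambda>z. hd (Xs (fst z)))" "FB ?Q (\<lambda>z. encoding_length (D (fst z)))"
    by (rule FC_env[OF l(1)] PB_env[OF l(2)] FC_env[OF m(1)] FB_env[OF m(2)] FC_env[OF D(1)] FC_env[OF h] FB_env[OF D(2)], blast, (intro FC_fst FC_id)?)+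
  note k = FB_index[OF p(2)]
  have ps: "FC ?Q ?ps" unfolding layers_of_type_def
  proof (intro FC_dec e FC_Suc FC_mult_nat FB_Suc FB_mult FB_of_PB[OF e(2)] FC_entry FC_nth_or FC_Nil k FC_snd FC_id)
    show "0 \<le> entry (D (fst z)) (snd z)" for z by simp
    show "FB ?Q (\<lambda>z. bit_length (entry (D (fst z)) (snd z)))"
      by (rule FB_le[OF FB_Suc[OF e(7)] bit_length_entry])
    show "length (nth_or [] (hd (Xs (fst z))) (snd z)) = l (fst z) * m (fst z)" if "?Q a b z" for a b z
      using X[of a b "fst z"] that by (simp add: type_totals_def has_margins_def nonneg_def)
  qed
  have lps: "FB ?Q (\<lambda>z. length (?ps z))"
  proof (rule FB_le[OF FB_Suc[OF FB_mult[OF FB_of_PB[OF e(2)] e(4)]]])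
    show "length (?ps z) \<le> Suc (l (fst z) * m (fst z))" for z by (simp only: layers_of_type_def length_dec)
  qed
  have c: "FC ?Q (\<lambda>z. concat (map (\<lambda>p. fst p # snd p) (?ps z)))"
  proof (rule FC_concat)
    show "FC ?Q (\<lambda>z. map (\<lambda>p. fst p # snd p) (?ps z))" by (intro FC_map ps lps FC_Cons FC_fst FC_snd FC_id)
    show "FB ?Q (\<lambda>z. length (map (\<lambda>p. fst p # snd p) (?ps z)))" using lps by simp
    show "FB (\<lambda>a b y. ?Q a b (fst y) \<and> snd y \<in> set (map (\<lambda>p. fst p # snd p) (?ps (fst y)))) (\<lambda>y. length (snd y))"
    proof (rule FB_mono[OF FB_Suc[OF FB_mult[OF l' m(2)]], where g = "\<lambda>y. fst (fst y)"], rule conjI, blast)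
      fix a b y assume y: "?Q a b (fst y) \<and> snd y \<in> set (map (\<lambda>p. fst p # snd p) (?ps (fst y)))"
      then have "\<And>p. p \<in> set (?ps (fst y)) \<Longrightarrow> length (snd p) = l (fst (fst y)) * m (fst (fst y))"
        using layers_of_type(1)[OF X[of a b "fst (fst y)"]] by (auto simp: has_margins_def nonneg_def)
      then show "length (snd y) \<le> Suc (l (fst (fst y)) * m (fst (fst y)))" using y by auto
    qed
  qed
  have body: "FC ?P (\<lambda>x. 1 # concat (map (\<lambda>k. int (length (layers_of_type (l x) (m x) (D x) (hd (Xs x)) k)) #
      concat (map (\<lambda>p. fst p # snd p) (layers_of_type (l x) (m x) (D x) (hd (Xs x)) k))) [0..<t x]))"
    (is "FC ?P (\<lambda>x. 1 # concat (?ys x))")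
  proof (rule FC_Cons[OF FC_const_int FC_concat])
    show "FC ?P ?ys" by (intro FC_map_upt p FC_Cons FC_of_nat FC_length ps lps c)
    show "FB ?P (\<lambda>x. length (?ys x))" using p(2) by simp
    show "FB (\<lambda>a b y. ?P a b (fst y) \<and> snd y \<in> set (?ys (fst y))) (\<lambda>y. length (snd y))"
    proof (rule FB_mono[OF FB_Suc[OF FB_mult[OF FB_Suc[OF FB_mult[OF l' m(2)]] FB_Suc[OF FB_mult[OF l' m(2)]]]], where g = fst], rule conjI, blast)
      fix a b y assume y: "?P a b (fst y) \<and> snd y \<in> set (?ys (fst y))"
      then show "length (snd y) \<le> Suc (Suc (l (fst y) * m (fst y)) * Suc (l (fst y) * m (fst y)))"
        using length_layers[OF X[of a b "fst y"]] by auto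
    qed
  qed
  show ?thesis unfolding answer_def
    by (rule FC_If[OF FC_not_Nil[OF Xs(1)] body]) (intro FC_Cons FC_const_int FC_Nil)
qed


section \<open>The two algorithms\<close>

text \<open>As \<open>nth_or\<close> yields 0 beyond the end of the word, the filtered list is never empty.\<close>

definition unary_value :: "nat list \<Rightarrow> nat" where
  "unary_value xs = hd (filter (\<lambda>i. nth_or 0 xs (2 + i) = 0) [0..<Suc (length xs)])"

text \<open>The 3 stands for the two leading numbers and the end marker of the unary number.\<close>

definition payload :: "nat list \<Rightarrow> nat list" where
  "payload xs = drop (3 + unary_value xs) xs"

definition solve_unary_types :: "nat list \<Rightarrow> nat list" where
  "solve_unary_types xs = map nat (answer (nth_or 0 xs 0) (nth_or 0 xs 1) (unary_value xs) (payload xs)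
     (totals_by_types (nth_or 0 xs 0) (nth_or 0 xs 1) (unary_value xs) (payload xs)))"

definition solve_unary_cols :: "nat list \<Rightarrow> nat list" where
  "solve_unary_cols xs = map nat (answer (nth_or 0 xs 0) (unary_value xs) (nth_or 0 xs 1) (payload xs)
     (totals_by_columns (nth_or 0 xs 0) (unary_value xs) (nth_or 0 xs 1) (payload xs)))"

text \<open>The common shape of both encodings: two binary parameters, whose sum is bounded by
  \<open>a\<close>, and a unary number, whose value is bounded by the length of the word and thus by
  \<open>b\<close>.\<close>

definition sized_input :: "nat \<Rightarrow> nat \<Rightarrow> nat list \<Rightarrow> bool" where
  "sized_input a b xs \<longleftrightarrow> (\<exists>p q k D. xs = [p, q] @ unary k @ D \<and> p + q \<le> a) \<and> encoding_length xs \<le> b"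

lemma parse:
  assumes "xs = [p, q] @ unary k @ D"
  shows "nth_or 0 xs 0 = p" "nth_or 0 xs 1 = q" "unary_value xs = k" "payload xs = D"
proof -
  have len: "length xs = 3 + k + length D" by (simp add: assms unary_def)
  show "nth_or 0 xs 0 = p" "nth_or 0 xs 1 = q" by (simp_all add: assms)
  have "nth_or 0 xs (2 + i) = 1" if "i < k" for i using that by (simp add: assms unary_def nth_append)
  moreover have "nth_or 0 xs (2 + k) = 0" by (simp add: assms unary_def nth_append)
  moreover have "[0..<Suc (length xs)] = [0..<k] @ k # [Suc k..<Suc (length xs)]"
    using upt_add_eq_append[of 0 k "Suc (length xs) - k"] upt_conv_Cons[of k "Suc (length xs)"] len by (simp add: add.left_commute)
  ultimately show k: "unary_value xs = k" by (simp add: unary_value_def)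
  show "payload xs = D" unfolding payload_def k by (simp add: assms unary_def numeral_3_eq_3)
qed

lemma encoding_length_drop: "encoding_length (drop n xs) \<le> encoding_length xs"
  unfolding encoding_length_def by (subst (2) append_take_drop_id[symmetric, of xs n], unfold map_append sum_list_append) simp

lemma FC_parse:
  defines "P \<equiv> sized_input"
  shows "FC P (\<lambda>xs. nth_or 0 xs 0)" "PB P (\<lambda>xs. nth_or 0 xs 0)" "FC P (\<lambda>xs. nth_or 0 xs 1)" "PB P (\<lambda>xs. nth_or 0 xs 1)"
    "FC P unary_value" "FB P unary_value" "FC P payload" "FB P (\<lambda>xs. encoding_length (payload xs))" "FB P encoding_length"
proof -
  show "FC P (\<lambda>xs. nth_or 0 xs 0)" "FC P (\<lambda>xs. nth_or 0 xs 1)"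
    by (intro FC_nth_or FC_const_nat FC_id FB_const)+
  have "nth_or 0 xs 0 \<le> a \<and> nth_or 0 xs 1 \<le> a" if xs: "P a b xs" for a b xs
  proof -
    obtain p q k D where e: "xs = [p, q] @ unary k @ D" "p + q \<le> a"
      using xs unfolding P_def sized_input_def by blast
    from e(2) show ?thesis unfolding parse(1,2)[OF e(1)] by simp
  qed
  then show "PB P (\<lambda>xs. nth_or 0 xs 0)" "PB P (\<lambda>xs. nth_or 0 xs 1)" by (auto intro: PB_param)
  show e: "FB P encoding_length" by (rule FB_size) (simp add: P_def sized_input_def)
  have len: "FB P length" by (rule FB_le[OF e length_le_encoding])
  have "unary_value xs < Suc (length xs)" for xs
  proof -
    let ?f = "filter (\<lambda>i. nth_or 0 xs (2 + i) = 0) [0..<Suc (length xs)]"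
    have "length xs \<in> set ?f" by (auto simp: nth_or_def)
    then have "hd ?f \<in> set ?f" by (cases ?f) auto
    then show ?thesis by (auto simp: unary_value_def)
  qed
  then have u: "unary_value xs \<le> length xs" for xs by (simp add: less_Suc_eq_le)
  show k: "FB P unary_value" by (rule FB_le[OF len u])
  let ?Q = "\<lambda>a b z. P a b (fst z) \<and> snd z \<in> set [0..<Suc (length (fst z))]"
  have i: "FB ?Q (\<lambda>z. 2 + snd z)"
    by (rule FB_mono[OF FB_add[OF FB_const[of _ 2] FB_Suc[OF len]], where g = fst]) auto
  show k': "FC P unary_value"
    unfolding unary_value_def
  proof (rule FC_hd)
    show "FC P (\<lambda>xs. filter (\<lambda>i. nth_or 0 xs (2 + i) = 0) [0..<Suc (length xs)])"
    proof (rule FC_filter)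
      show "FC P (\<lambda>xs. [0..<Suc (length xs)])" by (intro FC_upt FC_Suc FB_Suc FC_length FC_id len)
      show "FB P (\<lambda>xs. length [0..<Suc (length xs)])" using FB_Suc[OF len] by simp
      show "FC ?Q (\<lambda>z. nth_or 0 (fst z) (2 + snd z) = 0)"
        by (intro FC_eq_nat FC_nth_or FC_const_nat FC_add_nat i FC_fst FC_snd FC_id)
    qed
    show "filter (\<lambda>i. nth_or 0 xs (2 + i) = 0) [0..<Suc (length xs)] \<noteq> []" for xs :: "nat list"
      by (auto simp: filter_empty_conv nth_or_def)
  qed
  show "FC P payload"
    unfolding payload_def by (intro FC_drop FC_add_nat FC_const_nat k k' FB_add FB_const FC_id)
  show "FB P (\<lambda>xs. encoding_length (payload xs))"
    unfolding payload_def by (rule FB_le[OF e encoding_length_drop])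
qed

text \<open>A nonnegative integer and the corresponding natural number have the same encoding, so
  the conversion requires no computation.\<close>

lemma FC_map_nat:
  assumes "FC P f" "\<And>a b x. P a b x \<Longrightarrow> \<forall>y\<in>set (f x). 0 \<le> y"
  shows "FC P (\<lambda>x. map nat (f x))"
proof (rule FC_enc_cong[OF assms(1)])
  fix a b x assume "P a b x"
  have "enc ys = enc (map nat ys)" if "\<forall>y\<in>set ys. 0 \<le> y" for ys
    using that by (induction ys) (simp_all add: enc_nat_def enc_int_def)
  from this[OF assms(2)[OF \<open>P a b x\<close>]] show "enc (f x) = enc (map nat (f x))" .
qed

lemma unary_types_tractable:
  "fixed_parameter_tractable huge_tables encode_unary_types (\<lambda>I. [num_rows I, num_cols I]) solves"
proof (rule fixed_parameter_tractable_FC[where P = sized_input and f = solve_unary_types])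
  note p = FC_parse
  note sound = totals_by_types_sound
  show "FC sized_input solve_unary_types"
    unfolding solve_unary_types_def
    by (intro FC_map_nat FC_answer FC_totals_by_types p FB_of_PB[OF p(4)] answer_nonneg ballI) (rule sound, assumption)+
  show "FB sized_input (\<lambda>x. length (solve_unary_types x))"
  proof (rule FB_le)
    let ?l = "\<lambda>xs. nth_or 0 xs 0" and ?m = "\<lambda>xs. nth_or 0 xs 1"
    show "FB sized_input (\<lambda>xs. Suc (unary_value xs * Suc (Suc (?l xs * ?m xs) * Suc (?l xs * ?m xs))))"
      by (intro FB_Suc FB_mult p FB_of_PB[OF p(2)] FB_of_PB[OF p(4)])
    show "length (solve_unary_types xs) \<le> Suc (unary_value xs * Suc (Suc (?l xs * ?m xs) * Suc (?l xs * ?m xs)))" for xs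
      unfolding solve_unary_types_def length_map by (rule length_answer) (use sound in blast)
  qed
  fix I assume I: "I \<in> huge_tables"
  have e: "encode_unary_types I = [num_rows I, num_cols I] @ unary (num_types I) @ encode_data I"
    by (simp add: encode_unary_types_def)
  show "sized_input (sum_list [num_rows I, num_cols I]) (encoding_length (encode_unary_types I)) (encode_unary_types I)"
    unfolding sized_input_def using e by force
  show "encode_unary_types I \<noteq> []" by (simp add: e)
  show "solves I (solve_unary_types (encode_unary_types I))"
    unfolding solve_unary_types_def parse[OF e]
    by (rule solves_answer[OF I]) (use sound totals_by_types_complete in blast)+
qed (rule FC_parse)

lemma unary_cols_tractable:
  "fixed_parameter_tractable huge_tables encode_unary_cols (\<lambda>I. [num_rows I, num_types I]) solves"
proof (rule fixed_parameter_tractable_FC[where P = sized_input and f = solve_unary_cols])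
  note p = FC_parse
  note sound = totals_by_columns_sound
  show "FC sized_input solve_unary_cols"
    unfolding solve_unary_cols_def
    by (intro FC_map_nat FC_answer FC_totals_by_columns p FB_of_PB[OF p(4)] answer_nonneg ballI) (rule sound, assumption)+
  show "FB sized_input (\<lambda>x. length (solve_unary_cols x))"
  proof (rule FB_le)
    let ?l = "\<lambda>xs. nth_or 0 xs 0" and ?t = "\<lambda>xs. nth_or 0 xs 1"
    show "FB sized_input (\<lambda>xs. Suc (?t xs * Suc (Suc (?l xs * unary_value xs) * Suc (?l xs * unary_value xs))))"
      by (intro FB_Suc FB_mult p FB_of_PB[OF p(2)] FB_of_PB[OF p(4)])
    show "length (solve_unary_cols xs) \<le> Suc (?t xs * Suc (Suc (?l xs * unary_value xs) * Suc (?l xs * unary_value xs)))" for xs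
      unfolding solve_unary_cols_def length_map by (rule length_answer) (use sound in blast)
  qed
  fix I assume I: "I \<in> huge_tables"
  have e: "encode_unary_cols I = [num_rows I, num_types I] @ unary (num_cols I) @ encode_data I"
    by (simp add: encode_unary_cols_def)
  show "sized_input (sum_list [num_rows I, num_types I]) (encoding_length (encode_unary_cols I)) (encode_unary_cols I)"
    unfolding sized_input_def using e by force
  show "encode_unary_cols I \<noteq> []" by (simp add: e)
  show "solves I (solve_unary_cols (encode_unary_cols I))"
    unfolding solve_unary_cols_def parse[OF e]
    by (rule solves_answer[OF I]) (use sound totals_by_columns_complete in blast)+
qed (rule FC_parse)

theorem theorem3p1:
  shows "fixed_parameter_tractable huge_tables encode_unary_types
           (\<lambda>I. [num_rows I, num_cols I]) solves
       \<and> fixed_parameter_tractable huge_tables encode_unary_cols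
           (\<lambda>I. [num_rows I, num_types I]) solves"
  by (intro conjI unary_types_tractable unary_cols_tractable)

end
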